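(* Let $Q$ be a Dynkin quiver, let $P$ be a projective and $I$ an injective finite-dimensional representation of $Q$ over $\mathbb{C}$, and let $$G=\begin{bmatrix}\mathrm{Aut}_Q(P)&0\\ \mathrm{Hom}_Q(P,I)&\mathrm{Aut}_Q(I)\end{bmatrix}\subset \mathrm{Aut}_Q(P\oplus I).$$ Then $G$ acts on $\mathrm{Gr}_{\mathbf{dim}\,P}(P\oplus I)$ with finitely many orbits, parametrized by the pairs of isomorphism classes $([Q_P],[N_I])$ such that $Q_P$ is a quotient of $P$, $N_I$ is a subrepresentation of $I$, and $\mathbf{dim}\,Q_P=\mathbf{dim}\,N_I$. Moreover, if $Q$ is equioriented of type $A_n$, then the orbits are cells parametrized by torus fixed points.
   Context: A Dynkin quiver is a quiver whose underlying graph is a simply laced Dynkin diagram. A representation $M$ of $Q$ consists of finite-dimensional complex vector spaces $M_i$, one for each vertex $i$, and linear maps $M_\alpha:M_i\to M_j$ for arrows $\alpha:i\to j$; its dimension vector is $\mathbf{dim}\,M=(\dim M_i)_i$. The quiver Grassmannian $\mathrm{Gr}_{\mathbf{e}}(M)\subset\prod_i\mathrm{Gr}_{e_i}(M_i)$ parametrizes subrepresentations of $M$ of dimension vector $\mathbf{e}$; the group $\mathrm{Aut}_Q(M)$ of automorphisms of the representation $M$ acts on it. The pair attached to a point $N\in\mathrm{Gr}_{\mathbf{dim}\,P}(P\oplus I)$ is given by $N_I=N\cap I$ and $Q_P=P/\pi(N)$, where $\pi:P\oplus I\to P$ is the projection. The equioriented quiver of type $A_n$ has vertices $1,\dots,n$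 and arrows $i\to i+1$. For this quiver every indecomposable direct summand of $P\oplus I$ has at most one-dimensional spaces at every vertex; fixing a decomposition of $P$ and of $I$ into indecomposables and choosing a nonzero vector in each nonzero such space gives a basis $\mathbf{B}$ of $P\oplus I$. The torus is $\mathbb{C}^*$ acting on $P\oplus I$ by scaling the indecomposable summands with pairwise distinct weights, and hence acting on $\mathrm{Gr}_{\mathbf{dim}\,P}(P\oplus I)$; the torus fixed points are exactly the subrepresentations of dimension vector $\mathbf{dim}\,P$ spanned by subsets of $\mathbf{B}$. A cell is a subvariety isomorphic to a complex affine space.
   Formalization: For equioriented A_n, "orbits are cells" and the bijection with torus fixed points are stated only when the indecomposable summands of P are pairwise non-isomorphic and likewise those of I (false otherwise: A_1, P=C^2, I=C has an orbit P^1); in general only: every orbit has a fixed point. *)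

theory Defs
  imports
    "HOL-Analysis.Analysis"
    "HOL-Algebra.Group_Action"
    "HOL-Library.Function_Algebras"
    "Graph_Theory.Digraph"
begin

section \<open>Complex vector spaces\<close>

class scaleC =
  fixes scaleC :: "complex \<Rightarrow> 'a \<Rightarrow> 'a" (infixr "*\<^sub>C" 75)

class complex_vector = scaleC + ab_group_add +
  assumes scaleC_add_right: "a *\<^sub>C (x + y) = a *\<^sub>C x + a *\<^sub>C y"
    and scaleC_add_left: "(a + b) *\<^sub>C x = a *\<^sub>C x + b *\<^sub>C x"
    and scaleC_scaleC: "a *\<^sub>C (b *\<^sub>C x) = (a * b) *\<^sub>C x"
    and scaleC_one: "1 *\<^sub>C x = x"

global_interpretation cvec: vector_space "scaleC :: complex \<Rightarrow> 'a \<Rightarrow> 'a::complex_vector"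
  by unfold_locales (rule scaleC_add_right scaleC_add_left scaleC_scaleC scaleC_one)+

global_interpretation cvec_pair: vector_space_pair
  "scaleC :: complex \<Rightarrow> 'a \<Rightarrow> 'a::complex_vector" "scaleC :: complex \<Rightarrow> 'b \<Rightarrow> 'b::complex_vector"
  by unfold_locales

instantiation complex :: complex_vector
begin
definition scaleC_complex :: "complex \<Rightarrow> complex \<Rightarrow> complex" where
  "scaleC_complex c z = c * z"
instance by standard (simp_all add: scaleC_complex_def algebra_simps)
end

instantiation prod :: (complex_vector, complex_vector) complex_vector
begin
definition scaleC_prod :: "complex \<Rightarrow> 'a \<times> 'b \<Rightarrow> 'a \<times> 'b" where
  "scaleC_prod c p = (c *\<^sub>C fst p, c *\<^sub>C snd p)"
instance
  by standard
    (simp_all add: scaleC_prod_def scaleC_add_right scaleC_add_left scaleC_scaleC scaleC_one)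
end

instantiation "fun" :: (type, complex_vector) complex_vector
begin
definition scaleC_fun :: "complex \<Rightarrow> ('a \<Rightarrow> 'b) \<Rightarrow> 'a \<Rightarrow> 'b" where
  "scaleC_fun c f = (\<lambda>x. c *\<^sub>C f x)"
instance
  by standard
    (simp_all add: scaleC_fun_def fun_eq_iff scaleC_add_right scaleC_add_left scaleC_scaleC scaleC_one)
end

definition clinear_on :: "'a::complex_vector set \<Rightarrow> ('a \<Rightarrow> 'b::complex_vector) \<Rightarrow> bool" where
  "clinear_on V f \<longleftrightarrow>
     (\<forall>x\<in>V. \<forall>y\<in>V. f (x + y) = f x + f y) \<and> (\<forall>c. \<forall>x\<in>V. f (c *\<^sub>C x) = c *\<^sub>C f x)"

definition fin_dim_subspace :: "'a::complex_vector set \<Rightarrow> bool" where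
  "fin_dim_subspace V \<longleftrightarrow> (\<exists>B. finite B \<and> cvec.span B = V)"


section \<open>Dynkin quivers\<close>

text \<open>
  A quiver is a digraph in the sense of \<^theory>\<open>Graph_Theory.Digraph\<close>.  The Dynkin diagrams below
  are connected; their vertices are numbered from 1.
\<close>

definition A_edges :: "nat \<Rightarrow> nat set set" where
  "A_edges n = {{k, k + 1} | k. 1 \<le> k \<and> k < n}"

definition D_edges :: "nat \<Rightarrow> nat set set" where
  "D_edges n = insert {n - 2, n} (A_edges (n - 1))"

text \<open>In the numbering used for type E, the chain is \<open>1, \<dots>, n - 1\<close> and \<open>n\<close> hangs off its third vertex.\<close>

definition E_edges :: "nat \<Rightarrow> nat set set" where
  "E_edges n = insert {3, n} (A_edges (n - 1))"

definition simply_laced_dynkin :: "nat \<Rightarrow> nat set set \<Rightarrow> bool" where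
  "simply_laced_dynkin n E \<longleftrightarrow>
     (n \<ge> 1 \<and> E = A_edges n) \<or> (n \<ge> 4 \<and> E = D_edges n) \<or> (n \<in> {6, 7, 8} \<and> E = E_edges n)"

definition dynkin_quiver :: "('v, 'e) pre_digraph \<Rightarrow> bool" where
  "dynkin_quiver Q \<longleftrightarrow> fin_digraph Q \<and>
     (\<exists>n E f. simply_laced_dynkin n E \<and> bij_betw f (verts Q) {1..n} \<and>
        bij_betw (\<lambda>a. {f (tail Q a), f (head Q a)}) (arcs Q) E)"

definition equioriented_A :: "('v, 'e) pre_digraph \<Rightarrow> bool" where
  "equioriented_A Q \<longleftrightarrow> fin_digraph Q \<and>
     (\<exists>n\<ge>1. \<exists>f :: 'v \<Rightarrow> nat. bij_betw f (verts Q) {1..n} \<and>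
        bij_betw (\<lambda>a. (f (tail Q a), f (head Q a))) (arcs Q) {(k, k + 1) | k. 1 \<le> k \<and> k < n})"


section \<open>Representations\<close>

text \<open>
  The spaces of a representation are finite-dimensional subspaces of one ambient space.  The values
  of \<open>rep_space\<close> off the vertex set, and of \<open>rep_map\<close> off the arcs or off the source spaces, carry no
  meaning.  Families indexed by vertices (subrepresentations, homomorphisms) are extensional, so
  that equality of families is equality at the vertices.
\<close>

record ('v, 'e, 'a) rep =
  rep_space :: "'v \<Rightarrow> 'a set"
  rep_map :: "'e \<Rightarrow> 'a \<Rightarrow> 'a"

definition is_rep :: "('v, 'e) pre_digraph \<Rightarrow> ('v, 'e, 'a::complex_vector) rep \<Rightarrow> bool" where
  "is_rep Q M \<longleftrightarrow>
     (\<forall>i\<in>verts Q. fin_dim_subspace (rep_space M i)) \<and>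
     (\<forall>a\<in>arcs Q. clinear_on (rep_space M (tail Q a)) (rep_map M a) \<and>
        rep_map M a ` rep_space M (tail Q a) \<subseteq> rep_space M (head Q a))"

definition dim_vec_of :: "('v, 'e, 'a::complex_vector) rep \<Rightarrow> 'v \<Rightarrow> nat" where
  "dim_vec_of M = (\<lambda>i. cvec.dim (rep_space M i))"

definition rep_Hom :: "('v, 'e) pre_digraph \<Rightarrow> ('v, 'e, 'a::complex_vector) rep \<Rightarrow>
    ('v, 'e, 'b::complex_vector) rep \<Rightarrow> ('v \<Rightarrow> 'a \<Rightarrow> 'b) set" where
  "rep_Hom Q M N =
     {f \<in> (\<Pi>\<^sub>E i\<in>verts Q. rep_space M i \<rightarrow>\<^sub>E rep_space N i).
        (\<forall>i\<in>verts Q. clinear_on (rep_space M i) (f i)) \<and>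
        (\<forall>a\<in>arcs Q. \<forall>x\<in>rep_space M (tail Q a).
           f (head Q a) (rep_map M a x) = rep_map N a (f (tail Q a) x))}"

definition rep_comp :: "('v, 'e) pre_digraph \<Rightarrow> ('v, 'e, 'a) rep \<Rightarrow>
    ('v \<Rightarrow> 'b \<Rightarrow> 'c) \<Rightarrow> ('v \<Rightarrow> 'a \<Rightarrow> 'b) \<Rightarrow> 'v \<Rightarrow> 'a \<Rightarrow> 'c" where
  "rep_comp Q M g f = (\<lambda>i\<in>verts Q. compose (rep_space M i) (g i) (f i))"

definition rep_epi :: "('v, 'e) pre_digraph \<Rightarrow> ('v, 'e, 'a::complex_vector) rep \<Rightarrow>
    ('v, 'e, 'b::complex_vector) rep \<Rightarrow> ('v \<Rightarrow> 'a \<Rightarrow> 'b) set" where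
  "rep_epi Q M N = {f \<in> rep_Hom Q M N. \<forall>i\<in>verts Q. f i ` rep_space M i = rep_space N i}"

definition rep_mono :: "('v, 'e) pre_digraph \<Rightarrow> ('v, 'e, 'a::complex_vector) rep \<Rightarrow>
    ('v, 'e, 'b::complex_vector) rep \<Rightarrow> ('v \<Rightarrow> 'a \<Rightarrow> 'b) set" where
  "rep_mono Q M N = {f \<in> rep_Hom Q M N. \<forall>i\<in>verts Q. inj_on (f i) (rep_space M i)}"

definition rep_iso :: "('v, 'e) pre_digraph \<Rightarrow> ('v, 'e, 'a::complex_vector) rep \<Rightarrow>
    ('v, 'e, 'b::complex_vector) rep \<Rightarrow> ('v \<Rightarrow> 'a \<Rightarrow> 'b) set" where
  "rep_iso Q M N =
     {f \<in> rep_Hom Q M N. \<forall>i\<in>verts Q. bij_betw (f i) (rep_space M i) (rep_space N i)}"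

definition rep_isomorphic :: "('v, 'e) pre_digraph \<Rightarrow> ('v, 'e, 'a::complex_vector) rep \<Rightarrow>
    ('v, 'e, 'b::complex_vector) rep \<Rightarrow> bool" where
  "rep_isomorphic Q M N \<longleftrightarrow> rep_iso Q M N \<noteq> {}"

text \<open>
  HOL cannot quantify over all ambient types inside a definition.  The test representations below
  live in \<open>nat \<Rightarrow> complex\<close>; every finite-dimensional representation is isomorphic to such a one.
\<close>

definition projective_rep :: "('v, 'e) pre_digraph \<Rightarrow> ('v, 'e, 'a::complex_vector) rep \<Rightarrow> bool" where
  "projective_rep Q P \<longleftrightarrow> is_rep Q P \<and>
     (\<forall>(M :: ('v, 'e, nat \<Rightarrow> complex) rep) (N :: ('v, 'e, nat \<Rightarrow> complex) rep).
        is_rep Q M \<longrightarrow> is_rep Q N \<longrightarrow>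
        (\<forall>f\<in>rep_epi Q M N. \<forall>g\<in>rep_Hom Q P N. \<exists>h\<in>rep_Hom Q P M. rep_comp Q P f h = g))"

definition injective_rep :: "('v, 'e) pre_digraph \<Rightarrow> ('v, 'e, 'a::complex_vector) rep \<Rightarrow> bool" where
  "injective_rep Q I \<longleftrightarrow> is_rep Q I \<and>
     (\<forall>(M :: ('v, 'e, nat \<Rightarrow> complex) rep) (N :: ('v, 'e, nat \<Rightarrow> complex) rep).
        is_rep Q M \<longrightarrow> is_rep Q N \<longrightarrow>
        (\<forall>f\<in>rep_mono Q M N. \<forall>g\<in>rep_Hom Q M I. \<exists>h\<in>rep_Hom Q N I. rep_comp Q M h f = g))"

definition rep_sum :: "('v, 'e, 'a) rep \<Rightarrow> ('v, 'e, 'b) rep \<Rightarrow> ('v, 'e, 'a \<times> 'b) rep" where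
  "rep_sum M N = \<lparr>rep_space = (\<lambda>i. rep_space M i \<times> rep_space N i),
                  rep_map = (\<lambda>a. map_prod (rep_map M a) (rep_map N a))\<rparr>"

definition is_subrep :: "('v, 'e) pre_digraph \<Rightarrow> ('v, 'e, 'a::complex_vector) rep \<Rightarrow>
    ('v \<Rightarrow> 'a set) \<Rightarrow> bool" where
  "is_subrep Q M U \<longleftrightarrow> U \<in> extensional (verts Q) \<and>
     (\<forall>i\<in>verts Q. cvec.subspace (U i) \<and> U i \<subseteq> rep_space M i) \<and>
     (\<forall>a\<in>arcs Q. rep_map M a ` U (tail Q a) \<subseteq> U (head Q a))"

definition subrep :: "('v, 'e, 'a) rep \<Rightarrow> ('v \<Rightarrow> 'a set) \<Rightarrow> ('v, 'e, 'a) rep" where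
  "subrep M U = M\<lparr>rep_space := U\<rparr>"

definition iso_class :: "('v, 'e) pre_digraph \<Rightarrow> ('v, 'e, 'a::complex_vector) rep \<Rightarrow>
    ('v, 'e, 'a) rep set" where
  "iso_class Q M = {M'. is_rep Q M' \<and> rep_isomorphic Q M M'}"

text \<open>
  The isomorphism class of the quotient \<open>M / U\<close>: the targets of epimorphisms from \<open>M\<close> with kernel
  \<open>U\<close>, taken in the ambient space of \<open>M\<close>.  It is a single nonempty isomorphism class, see
  \<open>quotient_class_eq_iso_class\<close> and \<open>quotient_class_nonempty\<close>.
\<close>

definition quotient_class :: "('v, 'e) pre_digraph \<Rightarrow> ('v, 'e, 'a::complex_vector) rep \<Rightarrow>
    ('v \<Rightarrow> 'a set) \<Rightarrow> ('v, 'e, 'a) rep set" where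
  "quotient_class Q M U =
     {R. is_rep Q R \<and>
        (\<exists>f\<in>rep_epi Q M R. \<forall>i\<in>verts Q. {x \<in> rep_space M i. f i x = 0} = U i)}"


lemma fin_dim_subspace_imp_subspace: "fin_dim_subspace V \<Longrightarrow> cvec.subspace V"
  unfolding fin_dim_subspace_def using cvec.subspace_span by blast

lemma clinear_on_0:
  assumes "clinear_on V f" "cvec.subspace V"
  shows "f 0 = 0"
proof -
  have "f (0 *\<^sub>C 0) = 0 *\<^sub>C f 0"
    using assms cvec.subspace_0 unfolding clinear_on_def by blast
  then show ?thesis by simp
qed

lemma clinear_on_diff:
  assumes "clinear_on V f" "cvec.subspace V" "x \<in> V" "y \<in> V"
  shows "f (x - y) = f x - f y"
proof -
  have "x - y \<in> V"
    using assms cvec.subspace_diff by blast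
  then have "f ((x - y) + y) = f (x - y) + f y"
    using assms unfolding clinear_on_def by blast
  then show ?thesis by simp
qed

lemma rep_HomD:
  assumes "f \<in> rep_Hom Q M N"
  shows "i \<in> verts Q \<Longrightarrow> x \<in> rep_space M i \<Longrightarrow> f i x \<in> rep_space N i"
    and "i \<in> verts Q \<Longrightarrow> clinear_on (rep_space M i) (f i)"
    and "a \<in> arcs Q \<Longrightarrow> x \<in> rep_space M (tail Q a) \<Longrightarrow>
           f (head Q a) (rep_map M a x) = rep_map N a (f (tail Q a) x)"
  using assms unfolding rep_Hom_def by (auto simp: PiE_iff)

lemma rep_HomI:
  assumes "\<And>i x. i \<in> verts Q \<Longrightarrow> x \<in> rep_space M i \<Longrightarrow> f i x \<in> rep_space N i"
    and "\<And>i. i \<in> verts Q \<Longrightarrow> clinear_on (rep_space M i) (f i)"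
    and "\<And>a x. a \<in> arcs Q \<Longrightarrow> x \<in> rep_space M (tail Q a) \<Longrightarrow>
           f (head Q a) (rep_map M a x) = rep_map N a (f (tail Q a) x)"
    and Q: "wf_digraph Q" and M: "is_rep Q M"
  shows "(\<lambda>i\<in>verts Q. \<lambda>x\<in>rep_space M i. f i x) \<in> rep_Hom Q M N"
proof -
  have sub: "cvec.subspace (rep_space M i)" if "i \<in> verts Q" for i
    using M that fin_dim_subspace_imp_subspace unfolding is_rep_def by blast
  have "clinear_on (rep_space M i) (\<lambda>x\<in>rep_space M i. f i x)" if i: "i \<in> verts Q" for i
    using assms(2)[OF i] cvec.subspace_add[OF sub[OF i]] cvec.subspace_scale[OF sub[OF i]]
    unfolding clinear_on_def by simp
  moreover have "rep_map M a x \<in> rep_space M (head Q a)"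
    if "a \<in> arcs Q" "x \<in> rep_space M (tail Q a)" for a x
    using M that unfolding is_rep_def by blast
  ultimately show ?thesis
    using assms(1,3) wf_digraph.tail_in_verts[OF Q] wf_digraph.head_in_verts[OF Q]
    unfolding rep_Hom_def by (auto simp: PiE_iff)
qed

lemma quotient_classE:
  assumes "R \<in> quotient_class Q M U"
  obtains f where "is_rep Q R" "f \<in> rep_Hom Q M R"
    "\<forall>i\<in>verts Q. f i ` rep_space M i = rep_space R i"
    "\<forall>i\<in>verts Q. {x \<in> rep_space M i. f i x = 0} = U i"
  using assms unfolding quotient_class_def rep_epi_def mem_Collect_eq by (elim conjE bexE CollectE)

lemma quotient_class_eq_iso_class:
  assumes Q: "wf_digraph Q" and M: "is_rep Q M" and R: "R \<in> quotient_class Q M U"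
  shows "quotient_class Q M U = iso_class Q R"
proof -
  obtain f where rR: "is_rep Q R" and fH: "f \<in> rep_Hom Q M R"
    and fs0: "\<forall>i\<in>verts Q. f i ` rep_space M i = rep_space R i"
    and fk0: "\<forall>i\<in>verts Q. {x \<in> rep_space M i. f i x = 0} = U i"
    by (rule quotient_classE[OF R])
  note fs = bspec[OF fs0] and fk = bspec[OF fk0]
  have subM: "cvec.subspace (rep_space M i)" if "i \<in> verts Q" for i
    using M that fin_dim_subspace_imp_subspace unfolding is_rep_def by blast
  have subR: "cvec.subspace (rep_space R i)" if "i \<in> verts Q" for i
    using rR that fin_dim_subspace_imp_subspace unfolding is_rep_def by blast
  have mapM: "rep_map M a x \<in> rep_space M (head Q a)"
    if "a \<in> arcs Q" "x \<in> rep_space M (tail Q a)" for a x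
    using M that unfolding is_rep_def by blast
  note ends = wf_digraph.tail_in_verts[OF Q] wf_digraph.head_in_verts[OF Q]
  show ?thesis
  proof (intro equalityI subsetI)
    fix R' assume R': "R' \<in> quotient_class Q M U"
    obtain g where rR': "is_rep Q R'" and gH: "g \<in> rep_Hom Q M R'"
      and gs0: "\<forall>i\<in>verts Q. g i ` rep_space M i = rep_space R' i"
      and gk0: "\<forall>i\<in>verts Q. {x \<in> rep_space M i. g i x = 0} = U i"
      by (rule quotient_classE[OF R'])
    note gs = bspec[OF gs0] and gk = bspec[OF gk0]
    have eq: "f i x = f i y \<longleftrightarrow> g i x = g i y"
      if i: "i \<in> verts Q" and x: "x \<in> rep_space M i" and y: "y \<in> rep_space M i" for i x y
    proof -
      have d: "x - y \<in> rep_space M i"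
        using cvec.subspace_diff[OF subM[OF i] x y] .
      have "f i x = f i y \<longleftrightarrow> x - y \<in> U i"
        unfolding fk[OF i, symmetric] mem_Collect_eq
        by (simp only: clinear_on_diff[OF rep_HomD(2)[OF fH i] subM[OF i] x y] d right_minus_eq simp_thms)
      moreover have "g i x = g i y \<longleftrightarrow> x - y \<in> U i"
        unfolding gk[OF i, symmetric] mem_Collect_eq
        by (simp only: clinear_on_diff[OF rep_HomD(2)[OF gH i] subM[OF i] x y] d right_minus_eq simp_thms)
      ultimately show ?thesis by simp
    qed
    define s where "s i = inv_into (rep_space M i) (f i)" for i
    have s_in: "s i y \<in> rep_space M i" and fs_y: "f i (s i y) = y"
      if "i \<in> verts Q" "y \<in> rep_space R i" for i y
    proof -
      have "y \<in> f i ` rep_space M i"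
        using that(2) unfolding fs[OF that(1)] .
      then show "s i y \<in> rep_space M i" "f i (s i y) = y"
        unfolding s_def by (rule inv_into_into, rule f_inv_into_f)
    qed
    define h where "h i y = g i (s i y)" for i y
    have h_f: "h i (f i x) = g i x" if "i \<in> verts Q" "x \<in> rep_space M i" for i x
    proof -
      have fx: "f i x \<in> rep_space R i"
        using rep_HomD(1)[OF fH that] .
      show ?thesis
        unfolding h_def
        using eq[OF that(1) s_in[OF that(1) fx] that(2)] fs_y[OF that(1) fx] by simp
    qed
    have ex: "\<exists>x\<in>rep_space M i. y = f i x" if "i \<in> verts Q" "y \<in> rep_space R i" for i y
      using s_in[OF that] fs_y[OF that] by (intro bexI[of _ "s i y"]) simp_all
    let ?h = "\<lambda>i\<in>verts Q. \<lambda>x\<in>rep_space R i. h i x"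
    have "?h \<in> rep_Hom Q R R'"
    proof (rule rep_HomI[OF _ _ _ Q rR])
      fix i y assume "i \<in> verts Q" "y \<in> rep_space R i"
      then show "h i y \<in> rep_space R' i"
        unfolding h_def using s_in rep_HomD(1)[OF gH] by blast
    next
      fix i assume i: "i \<in> verts Q"
      have "h i (y + z) = h i y + h i z" if yz: "y \<in> rep_space R i" "z \<in> rep_space R i" for y z
      proof -
        obtain u v where u: "u \<in> rep_space M i" "y = f i u" and v: "v \<in> rep_space M i" "z = f i v"
          using ex[OF i] yz by blast
        have "u + v \<in> rep_space M i"
          using cvec.subspace_add[OF subM[OF i]] u v by blast
        moreover have "f i (u + v) = y + z" "g i (u + v) = g i u + g i v"
          using rep_HomD(2)[OF fH i] rep_HomD(2)[OF gH i] u v unfolding clinear_on_def by auto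
        ultimately show ?thesis
          using h_f[OF i] u v by metis
      qed
      moreover have "h i (c *\<^sub>C y) = c *\<^sub>C h i y" if y: "y \<in> rep_space R i" for c y
      proof -
        obtain u where u: "u \<in> rep_space M i" "y = f i u"
          using ex[OF i y] by blast
        have "c *\<^sub>C u \<in> rep_space M i"
          using cvec.subspace_scale[OF subM[OF i]] u by blast
        moreover have "f i (c *\<^sub>C u) = c *\<^sub>C y" "g i (c *\<^sub>C u) = c *\<^sub>C g i u"
          using rep_HomD(2)[OF fH i] rep_HomD(2)[OF gH i] u unfolding clinear_on_def by auto
        ultimately show ?thesis
          using h_f[OF i] u by metis
      qed
      ultimately show "clinear_on (rep_space R i) (h i)"
        unfolding clinear_on_def by blast
    next
      fix a y assume a: "a \<in> arcs Q" and y: "y \<in> rep_space R (tail Q a)"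
      obtain x where x: "x \<in> rep_space M (tail Q a)" "y = f (tail Q a) x"
        using ex[OF ends(1)[OF a] y] by blast
      have "h (head Q a) (rep_map R a y) = h (head Q a) (f (head Q a) (rep_map M a x))"
        using rep_HomD(3)[OF fH a x(1)] x(2) by simp
      also have "\<dots> = g (head Q a) (rep_map M a x)"
        using h_f[OF ends(2)[OF a] mapM[OF a x(1)]] .
      also have "\<dots> = rep_map R' a (h (tail Q a) y)"
        using rep_HomD(3)[OF gH a x(1)] h_f[OF ends(1)[OF a] x(1)] x(2) by simp
      finally show "h (head Q a) (rep_map R a y) = rep_map R' a (h (tail Q a) y)" .
    qed
    moreover have "bij_betw (?h i) (rep_space R i) (rep_space R' i)" if i: "i \<in> verts Q" for i
    proof -
      have "inj_on (h i) (rep_space R i)"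
      proof (rule inj_onI)
        fix y z assume y: "y \<in> rep_space R i" and z: "z \<in> rep_space R i" and e: "h i y = h i z"
        show "y = z"
          using e eq[OF i s_in[OF i y] s_in[OF i z]] fs_y[OF i y] fs_y[OF i z]
          unfolding h_def by simp
      qed
      moreover have "h i ` rep_space R i = rep_space R' i"
        unfolding fs[OF i, symmetric] gs[OF i, symmetric] image_image
        using h_f[OF i] by (intro image_cong) auto
      ultimately show ?thesis
        using i by (simp add: bij_betw_def)
    qed
    ultimately show "R' \<in> iso_class Q R"
      unfolding iso_class_def rep_isomorphic_def rep_iso_def using rR' by blast
  next
    fix R' assume "R' \<in> iso_class Q R"
    then obtain \<phi> where rR': "is_rep Q R'" and pH: "\<phi> \<in> rep_Hom Q R R'"
      and pb: "\<And>i. i \<in> verts Q \<Longrightarrow> bij_betw (\<phi> i) (rep_space R i) (rep_space R' i)"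
      unfolding iso_class_def rep_isomorphic_def rep_iso_def by blast
    let ?g = "\<lambda>i\<in>verts Q. \<lambda>x\<in>rep_space M i. \<phi> i (f i x)"
    have "?g \<in> rep_Hom Q M R'"
    proof (rule rep_HomI[OF _ _ _ Q M])
      fix i x assume "i \<in> verts Q" "x \<in> rep_space M i"
      then show "\<phi> i (f i x) \<in> rep_space R' i"
        using rep_HomD(1)[OF fH] rep_HomD(1)[OF pH] by blast
    next
      fix i assume i: "i \<in> verts Q"
      show "clinear_on (rep_space M i) (\<lambda>x. \<phi> i (f i x))"
        using rep_HomD(2)[OF fH i] rep_HomD(2)[OF pH i] rep_HomD(1)[OF fH i]
        unfolding clinear_on_def by simp
    next
      fix a x assume a: "a \<in> arcs Q" and x: "x \<in> rep_space M (tail Q a)"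
      show "\<phi> (head Q a) (f (head Q a) (rep_map M a x)) = rep_map R' a (\<phi> (tail Q a) (f (tail Q a) x))"
        using rep_HomD(3)[OF fH a x] rep_HomD(3)[OF pH a rep_HomD(1)[OF fH ends(1)[OF a] x]] by simp
    qed
    moreover have "?g i ` rep_space M i = rep_space R' i" if i: "i \<in> verts Q" for i
    proof -
      have "?g i ` rep_space M i = \<phi> i ` f i ` rep_space M i"
        using i by (simp add: image_image)
      then show ?thesis
        using fs[OF i] pb[OF i] by (simp add: bij_betw_def)
    qed
    moreover have "{x \<in> rep_space M i. ?g i x = 0} = U i" if i: "i \<in> verts Q" for i
    proof -
      have "\<phi> i (f i x) = 0 \<longleftrightarrow> f i x = 0" if x: "x \<in> rep_space M i" for x
        using clinear_on_0[OF rep_HomD(2)[OF pH i] subR[OF i]] pb[OF i] cvec.subspace_0[OF subR[OF i]]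
          rep_HomD(1)[OF fH i x] unfolding bij_betw_def inj_on_def by metis
      then show ?thesis
        unfolding fk[OF i, symmetric] using i by auto
    qed
    ultimately show "R' \<in> quotient_class Q M U"
      unfolding quotient_class_def rep_epi_def using rR' by blast
  qed
qed

lemma quotient_space_exists:
  fixes V :: "'a::complex_vector set"
  assumes V: "fin_dim_subspace V" and U: "cvec.subspace U" "U \<subseteq> V"
  shows "\<exists>p. fin_dim_subspace (p ` V) \<and> Vector_Spaces.linear scaleC scaleC p \<and>
    p ` V \<subseteq> V \<and> {x \<in> V. p x = 0} = U \<and> (\<forall>x\<in>V. p (p x) = p x)"
proof -
  obtain B0 where B0: "finite B0" "cvec.span B0 = V"
    using V unfolding fin_dim_subspace_def by blast
  obtain B where B: "B \<subseteq> U" "cvec.independent B" "U \<subseteq> cvec.span B"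
    using cvec.maximal_independent_subset[of U] by blast
  have spanB: "cvec.span B = U"
    using B U(1) cvec.span_minimal by blast
  obtain C where C: "B \<subseteq> C" "C \<subseteq> V" "cvec.independent C" "V \<subseteq> cvec.span C"
    using cvec.maximal_independent_subset_extend[of B V] B U(2) by blast
  have subV: "cvec.subspace V"
    using fin_dim_subspace_imp_subspace[OF V] .
  have spanC: "cvec.span C = V"
    using C cvec.span_minimal[OF C(2) subV] by blast
  have finC: "finite C"
    using cvec.independent_span_bound[OF B0(1) C(3)] C(2) B0(2) by blast
  obtain p where p: "Vector_Spaces.linear scaleC scaleC p"
    and pC: "\<And>b. b \<in> C \<Longrightarrow> p b = (if b \<in> B then 0 else b)"
    using cvec_pair.linear_independent_extend[OF C(3), of "\<lambda>b. if b \<in> B then 0 else b"] by blast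
  interpret p: Vector_Spaces.linear scaleC scaleC p by (rule p)
  have pV: "p ` V = cvec.span (p ` C)"
    unfolding spanC[symmetric] by (rule p.span_image[symmetric])
  have "p ` C \<subseteq> V"
    using pC C(2) cvec.subspace_0[OF subV] by auto
  then have WV: "p ` V \<subseteq> V"
    unfolding pV by (rule cvec.span_minimal[OF _ subV])
  have fin: "fin_dim_subspace (p ` V)"
    unfolding fin_dim_subspace_def pV using finC by blast
  have d: "x - p x \<in> U" if "x \<in> V" for x
  proof -
    have "cvec.subspace {x. x - p x \<in> U}"
    proof (rule cvec.subspaceI)
      show "0 \<in> {x. x - p x \<in> U}"
        using cvec.subspace_0[OF U(1)] by (simp add: p.zero)
    next
      fix x y assume "x \<in> {x. x - p x \<in> U}" "y \<in> {x. x - p x \<in> U}"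
      then have "(x - p x) + (y - p y) \<in> U"
        using cvec.subspace_add[OF U(1)] by blast
      then show "x + y \<in> {x. x - p x \<in> U}"
        by (simp add: p.add algebra_simps)
    next
      fix c x assume "x \<in> {x. x - p x \<in> U}"
      then have "c *\<^sub>C (x - p x) \<in> U"
        using cvec.subspace_scale[OF U(1)] by blast
      then show "c *\<^sub>C x \<in> {x. x - p x \<in> U}"
        by (simp add: p.scale cvec.scale_right_diff_distrib)
    qed
    moreover have "C \<subseteq> {x. x - p x \<in> U}"
      using pC B(1) cvec.subspace_0[OF U(1)] by auto
    ultimately have "cvec.span C \<subseteq> {x. x - p x \<in> U}"
      by (rule cvec.span_minimal[rotated])
    then show ?thesis
      using that spanC by blast
  qed
  have pU: "p x = 0" if "x \<in> U" for x
  proof (rule p.eq_0_on_span)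
    show "x \<in> cvec.span B" using that spanB by simp
    show "p b = 0" if "b \<in> B" for b using that pC C(1) by auto
  qed
  have ker: "{x \<in> V. p x = 0} = U"
    using d pU U(2) by force
  have idem: "p (p x) = p x" if "x \<in> V" for x
    using pU[OF d[OF that]] by (simp add: p.diff)
  show ?thesis
    using fin p WV ker idem by blast
qed

lemma quotient_class_nonempty:
  assumes Q: "wf_digraph Q" and M: "is_rep Q M" and U: "is_subrep Q M U"
  shows "quotient_class Q M U \<noteq> {}"
proof -
  note ends = wf_digraph.tail_in_verts[OF Q] wf_digraph.head_in_verts[OF Q]
  have "\<forall>i\<in>verts Q. \<exists>p. fin_dim_subspace (p ` rep_space M i) \<and>
      Vector_Spaces.linear scaleC scaleC p \<and> p ` rep_space M i \<subseteq> rep_space M i \<and>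
      {x \<in> rep_space M i. p x = 0} = U i \<and> (\<forall>x\<in>rep_space M i. p (p x) = p x)"
  proof
    fix i assume "i \<in> verts Q"
    then have "fin_dim_subspace (rep_space M i)" "cvec.subspace (U i)" "U i \<subseteq> rep_space M i"
      using M U unfolding is_rep_def is_subrep_def by blast+
    then show "\<exists>p. fin_dim_subspace (p ` rep_space M i) \<and>
      Vector_Spaces.linear scaleC scaleC p \<and> p ` rep_space M i \<subseteq> rep_space M i \<and>
      {x \<in> rep_space M i. p x = 0} = U i \<and> (\<forall>x\<in>rep_space M i. p (p x) = p x)"
      by (rule quotient_space_exists)
  qed
  from bchoice[OF this] obtain p where p0: "\<forall>i\<in>verts Q. fin_dim_subspace (p i ` rep_space M i) \<and>
      Vector_Spaces.linear scaleC scaleC (p i) \<and> p i ` rep_space M i \<subseteq> rep_space M i \<and>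
      {x \<in> rep_space M i. p i x = 0} = U i \<and> (\<forall>x\<in>rep_space M i. p i (p i x) = p i x)"
    by (rule exE)
  have p: "fin_dim_subspace (p i ` rep_space M i)" "Vector_Spaces.linear scaleC scaleC (p i)"
    "p i ` rep_space M i \<subseteq> rep_space M i" "{x \<in> rep_space M i. p i x = 0} = U i"
    "\<And>x. x \<in> rep_space M i \<Longrightarrow> p i (p i x) = p i x" if "i \<in> verts Q" for i
    using bspec[OF p0 that] by simp_all
  have subM: "cvec.subspace (rep_space M i)" if "i \<in> verts Q" for i
    using M that fin_dim_subspace_imp_subspace unfolding is_rep_def by blast
  have mapM: "rep_map M a x \<in> rep_space M (head Q a)" "clinear_on (rep_space M (tail Q a)) (rep_map M a)"
    if "a \<in> arcs Q" "x \<in> rep_space M (tail Q a)" for a x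
    using M that unfolding is_rep_def by blast+
  have add: "p i (x + y) = p i x + p i y" and scale: "p i (c *\<^sub>C x) = c *\<^sub>C p i x"
    and diff: "p i (x - y) = p i x - p i y" if "i \<in> verts Q" for i x y c
    using p(2)[OF that] cvec_pair.linear_add cvec_pair.linear_scale cvec_pair.linear_diff by blast+
  define R where "R = \<lparr>rep_space = (\<lambda>i. p i ` rep_space M i),
    rep_map = (\<lambda>a x. p (head Q a) (rep_map M a x))\<rparr>"
  have lin: "clinear_on (rep_space M i) (p i)" if "i \<in> verts Q" for i
    using add[OF that] scale[OF that] unfolding clinear_on_def by blast
  have rR: "is_rep Q R"
    unfolding is_rep_def
  proof (intro conjI ballI)
    fix i assume "i \<in> verts Q"
    then show "fin_dim_subspace (rep_space R i)"
      using p(1) unfolding R_def by simp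
  next
    fix a assume a: "a \<in> arcs Q"
    have sub: "p (tail Q a) x \<in> rep_space M (tail Q a)" if "x \<in> rep_space M (tail Q a)" for x
      using p(3)[OF ends(1)[OF a]] that by blast
    have "clinear_on (rep_space M (tail Q a)) (rep_map M a)"
      using M a unfolding is_rep_def by blast
    then have "clinear_on (p (tail Q a) ` rep_space M (tail Q a)) (rep_map M a)"
      using p(3)[OF ends(1)[OF a]] unfolding clinear_on_def by (meson subsetD)
    then show "clinear_on (rep_space R (tail Q a)) (rep_map R a)"
      using add[OF ends(2)[OF a]] scale[OF ends(2)[OF a]] unfolding R_def clinear_on_def by simp
    show "rep_map R a ` rep_space R (tail Q a) \<subseteq> rep_space R (head Q a)"
      using sub mapM(1)[OF a] unfolding R_def by auto
  qed
  let ?f = "\<lambda>i\<in>verts Q. \<lambda>x\<in>rep_space M i. p i x"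
  have "?f \<in> rep_Hom Q M R"
  proof (rule rep_HomI[OF _ _ _ Q M])
    fix i x assume "i \<in> verts Q" "x \<in> rep_space M i"
    then show "p i x \<in> rep_space R i" unfolding R_def by simp
  next
    fix i assume "i \<in> verts Q"
    then show "clinear_on (rep_space M i) (p i)" by (rule lin)
  next
    fix a x assume a: "a \<in> arcs Q" and x: "x \<in> rep_space M (tail Q a)"
    let ?t = "tail Q a" and ?h = "head Q a"
    have px: "p ?t x \<in> rep_space M ?t"
      using p(3)[OF ends(1)[OF a]] x by blast
    have "p ?t (x - p ?t x) = 0"
      using diff[OF ends(1)[OF a]] p(5)[OF ends(1)[OF a] x] by simp
    then have "x - p ?t x \<in> U ?t"
      using p(4)[OF ends(1)[OF a]] cvec.subspace_diff[OF subM[OF ends(1)[OF a]] x px] by blast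
    then have "rep_map M a (x - p ?t x) \<in> U ?h"
      using U a unfolding is_subrep_def by blast
    then have "p ?h (rep_map M a (x - p ?t x)) = 0"
      using p(4)[OF ends(2)[OF a]] by blast
    then have "p ?h (rep_map M a x) = p ?h (rep_map M a (p ?t x))"
      using clinear_on_diff[OF mapM(2)[OF a x] subM[OF ends(1)[OF a]] x px] diff[OF ends(2)[OF a]]
      by simp
    then show "p ?h (rep_map M a x) = rep_map R a (p ?t x)"
      unfolding R_def by simp
  qed
  moreover have "?f i ` rep_space M i = rep_space R i" if "i \<in> verts Q" for i
    using that unfolding R_def by simp
  moreover have "{x \<in> rep_space M i. ?f i x = 0} = U i" if "i \<in> verts Q" for i
    unfolding p(4)[OF that, symmetric] using that by auto
  ultimately have "R \<in> quotient_class Q M U"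
    unfolding quotient_class_def rep_epi_def using rR by blast
  then show ?thesis by blast
qed


section \<open>The quiver Grassmannian, the group and its action\<close>

definition quiver_grass :: "('v, 'e) pre_digraph \<Rightarrow> ('v, 'e, 'a::complex_vector) rep \<Rightarrow>
    ('v \<Rightarrow> nat) \<Rightarrow> ('v \<Rightarrow> 'a set) set" where
  "quiver_grass Q M e = {N. is_subrep Q M N \<and> (\<forall>i\<in>verts Q. cvec.dim (N i) = e i)}"

definition Aut_group :: "('v, 'e) pre_digraph \<Rightarrow> ('v, 'e, 'a::complex_vector) rep \<Rightarrow>
    ('v \<Rightarrow> 'a \<Rightarrow> 'a) monoid" where
  "Aut_group Q M = \<lparr>carrier = rep_iso Q M M, mult = rep_comp Q M,
                    one = (\<lambda>i\<in>verts Q. \<lambda>x\<in>rep_space M i. x)\<rparr>"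

definition block_map :: "('v, 'e) pre_digraph \<Rightarrow> ('v, 'e, 'a) rep \<Rightarrow> ('v, 'e, 'b::plus) rep \<Rightarrow>
    ('v \<Rightarrow> 'a \<Rightarrow> 'a) \<Rightarrow> ('v \<Rightarrow> 'a \<Rightarrow> 'b) \<Rightarrow> ('v \<Rightarrow> 'b \<Rightarrow> 'b) \<Rightarrow> 'v \<Rightarrow> 'a \<times> 'b \<Rightarrow> 'a \<times> 'b" where
  "block_map Q P I a h b =
     (\<lambda>i\<in>verts Q. \<lambda>z\<in>rep_space (rep_sum P I) i. (a i (fst z), h i (fst z) + b i (snd z)))"

definition block_subgroup :: "('v, 'e) pre_digraph \<Rightarrow> ('v, 'e, 'a::complex_vector) rep \<Rightarrow>
    ('v, 'e, 'b::complex_vector) rep \<Rightarrow> ('v \<Rightarrow> 'a \<times> 'b \<Rightarrow> 'a \<times> 'b) set" where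
  "block_subgroup Q P I =
     {block_map Q P I a h b | a h b. a \<in> rep_iso Q P P \<and> h \<in> rep_Hom Q P I \<and> b \<in> rep_iso Q I I}"

definition block_group :: "('v, 'e) pre_digraph \<Rightarrow> ('v, 'e, 'a::complex_vector) rep \<Rightarrow>
    ('v, 'e, 'b::complex_vector) rep \<Rightarrow> ('v \<Rightarrow> 'a \<times> 'b \<Rightarrow> 'a \<times> 'b) monoid" where
  "block_group Q P I = (Aut_group Q (rep_sum P I))\<lparr>carrier := block_subgroup Q P I\<rparr>"

definition grass_act :: "('v, 'e) pre_digraph \<Rightarrow> ('v \<Rightarrow> 'a set) set \<Rightarrow> ('v \<Rightarrow> 'a \<Rightarrow> 'a) \<Rightarrow>
    ('v \<Rightarrow> 'a set) \<Rightarrow> 'v \<Rightarrow> 'a set" where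
  "grass_act Q X g = (\<lambda>N\<in>X. \<lambda>i\<in>verts Q. g i ` N i)"

definition part_I :: "('v, 'e) pre_digraph \<Rightarrow> ('v \<Rightarrow> ('a::zero \<times> 'b) set) \<Rightarrow> 'v \<Rightarrow> 'b set" where
  "part_I Q N = (\<lambda>i\<in>verts Q. {x. (0, x) \<in> N i})"

definition part_P :: "('v, 'e) pre_digraph \<Rightarrow> ('v \<Rightarrow> ('a \<times> 'b) set) \<Rightarrow> 'v \<Rightarrow> 'a set" where
  "part_P Q N = (\<lambda>i\<in>verts Q. fst ` N i)"

definition class_pair :: "('v, 'e) pre_digraph \<Rightarrow> ('v, 'e, 'a::complex_vector) rep \<Rightarrow>
    ('v, 'e, 'b::complex_vector) rep \<Rightarrow> ('v \<Rightarrow> ('a \<times> 'b) set) \<Rightarrow>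
    ('v, 'e, 'a) rep set \<times> ('v, 'e, 'b) rep set" where
  "class_pair Q P I N = (quotient_class Q P (part_P Q N), iso_class Q (subrep I (part_I Q N)))"

definition admissible_pairs :: "('v, 'e) pre_digraph \<Rightarrow> ('v, 'e, 'a::complex_vector) rep \<Rightarrow>
    ('v, 'e, 'b::complex_vector) rep \<Rightarrow> (('v, 'e, 'a) rep set \<times> ('v, 'e, 'b) rep set) set" where
  "admissible_pairs Q P I =
     {(iso_class Q R, iso_class Q (subrep I V)) | R V.
        is_rep Q R \<and> rep_epi Q P R \<noteq> {} \<and> is_subrep Q I V \<and>
        (\<forall>i\<in>verts Q. dim_vec_of R i = dim_vec_of (subrep I V) i)}"


section \<open>Decompositions into indecomposables and the torus\<close>

definition indecomposable_rep :: "('v, 'e) pre_digraph \<Rightarrow> ('v, 'e, 'a::complex_vector) rep \<Rightarrow> bool" where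
  "indecomposable_rep Q M \<longleftrightarrow> is_rep Q M \<and> (\<exists>i\<in>verts Q. rep_space M i \<noteq> {0}) \<and>
     (\<forall>U W. is_subrep Q M U \<longrightarrow> is_subrep Q M W \<longrightarrow>
        (\<forall>i\<in>verts Q. U i \<inter> W i = {0} \<and> rep_space M i = {u + w | u w. u \<in> U i \<and> w \<in> W i}) \<longrightarrow>
        (\<forall>i\<in>verts Q. U i = {0}) \<or> (\<forall>i\<in>verts Q. W i = {0}))"

definition indec_decomposition :: "('v, 'e) pre_digraph \<Rightarrow> ('v, 'e, 'a::complex_vector) rep \<Rightarrow>
    'k set \<Rightarrow> ('k \<Rightarrow> 'v \<Rightarrow> 'a set) \<Rightarrow> bool" where
  "indec_decomposition Q M K S \<longleftrightarrow> finite K \<and>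
     (\<forall>k\<in>K. is_subrep Q M (S k) \<and> indecomposable_rep Q (subrep M (S k))) \<and>
     (\<forall>i\<in>verts Q. \<forall>x\<in>rep_space M i. \<exists>!y. y \<in> (\<Pi>\<^sub>E k\<in>K. S k i) \<and> x = (\<Sum>k\<in>K. y k))"

definition sum_summands :: "('v, 'e) pre_digraph \<Rightarrow> ('k \<Rightarrow> 'v \<Rightarrow> 'a::zero set) \<Rightarrow>
    ('l \<Rightarrow> 'v \<Rightarrow> 'b::zero set) \<Rightarrow> 'k + 'l \<Rightarrow> 'v \<Rightarrow> ('a \<times> 'b) set" where
  "sum_summands Q S T =
     case_sum (\<lambda>k. \<lambda>i\<in>verts Q. S k i \<times> {0}) (\<lambda>l. \<lambda>i\<in>verts Q. {0} \<times> T l i)"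

text \<open>
  The image of \<open>N\<close> under the automorphism that scales the summand \<open>S k\<close> by \<open>t\<close> to the power \<open>w k\<close>.
\<close>

definition torus_act :: "('v, 'e) pre_digraph \<Rightarrow> 'k set \<Rightarrow> ('k \<Rightarrow> 'v \<Rightarrow> 'a::complex_vector set) \<Rightarrow>
    ('k \<Rightarrow> int) \<Rightarrow> complex \<Rightarrow> ('v \<Rightarrow> 'a set) \<Rightarrow> 'v \<Rightarrow> 'a set" where
  "torus_act Q K S w t N =
     (\<lambda>i\<in>verts Q. {(\<Sum>k\<in>K. (t powi w k) *\<^sub>C x k) | x. (\<forall>k\<in>K. x k \<in> S k i) \<and> (\<Sum>k\<in>K. x k) \<in> N i})"

definition torus_fixed :: "('v, 'e) pre_digraph \<Rightarrow> 'k set \<Rightarrow> ('k \<Rightarrow> 'v \<Rightarrow> 'a::complex_vector set) \<Rightarrow>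
    ('k \<Rightarrow> int) \<Rightarrow> ('v \<Rightarrow> 'a set) set \<Rightarrow> ('v \<Rightarrow> 'a set) set" where
  "torus_fixed Q K S w X = {N \<in> X. \<forall>t. t \<noteq> 0 \<longrightarrow> torus_act Q K S w t N = N}"

text \<open>
  With repeated summands the orbits of the block group need not be cells: for one vertex, \<open>P\<close> of
  dimension 2 and \<open>I\<close> of dimension 1, one of the two orbits is a projective line containing two torus
  fixed points.
\<close>

definition multiplicity_free :: "('v, 'e) pre_digraph \<Rightarrow> ('v, 'e, 'a::complex_vector) rep \<Rightarrow>
    'k set \<Rightarrow> ('k \<Rightarrow> 'v \<Rightarrow> 'a set) \<Rightarrow> bool" where
  "multiplicity_free Q M K S \<longleftrightarrow>
     (\<forall>k\<in>K. \<forall>l\<in>K. rep_isomorphic Q (subrep M (S k)) (subrep M (S l)) \<longrightarrow> k = l)"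


section \<open>Varieties as spaces with functions, and cells\<close>

text \<open>
  A complex variety is treated as a space with functions: a topological space with, for each open
  set \<open>U\<close>, the predicate telling which functions are regular on \<open>U\<close> (only the values on \<open>U\<close> matter).
\<close>

record 'x fspace =
  ftop :: "'x topology"
  fregular :: "'x set \<Rightarrow> ('x \<Rightarrow> complex) \<Rightarrow> bool"

definition fspace_isomorphic :: "'x fspace \<Rightarrow> 'y fspace \<Rightarrow> bool" where
  "fspace_isomorphic X Y \<longleftrightarrow>
     (\<exists>\<phi>. homeomorphic_map (ftop X) (ftop Y) \<phi> \<and>
        (\<forall>U f. openin (ftop X) U \<longrightarrow> (fregular Y (\<phi> ` U) f \<longleftrightarrow> fregular X U (f \<circ> \<phi>))))"

text \<open>The structure induced on a subset: a function is regular if it extends locally.\<close>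

definition fsubspace :: "'x fspace \<Rightarrow> 'x set \<Rightarrow> 'x fspace" where
  "fsubspace X Z =
     \<lparr>ftop = subtopology (ftop X) Z,
      fregular = (\<lambda>W f. openin (subtopology (ftop X) Z) W \<and>
        (\<forall>x\<in>W. \<exists>U g. x \<in> U \<and> openin (ftop X) U \<and> fregular X U g \<and> (\<forall>y\<in>U \<inter> W. f y = g y)))\<rparr>"

definition quotient_topology :: "'x topology \<Rightarrow> ('x \<Rightarrow> 'y) \<Rightarrow> 'y topology" where
  "quotient_topology T p =
     topology (\<lambda>U. U \<subseteq> p ` topspace T \<and> openin T {x \<in> topspace T. p x \<in> U})"

lemma openin_quotient_topology:
  "openin (quotient_topology T p) U \<longleftrightarrow>
     U \<subseteq> p ` topspace T \<and> openin T {x \<in> topspace T. p x \<in> U}"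
proof -
  have "istopology (\<lambda>U. U \<subseteq> p ` topspace T \<and> openin T {x \<in> topspace T. p x \<in> U})"
    unfolding istopology_def
  proof (intro conjI allI impI)
    fix A B
    assume A: "A \<subseteq> p ` topspace T \<and> openin T {x \<in> topspace T. p x \<in> A}"
      and B: "B \<subseteq> p ` topspace T \<and> openin T {x \<in> topspace T. p x \<in> B}"
    have "{x \<in> topspace T. p x \<in> A \<inter> B} = {x \<in> topspace T. p x \<in> A} \<inter> {x \<in> topspace T. p x \<in> B}"
      by blast
    then show "openin T {x \<in> topspace T. p x \<in> A \<inter> B}"
      using A B by (simp add: openin_Int)
    show "A \<inter> B \<subseteq> p ` topspace T"
      using A by blast
  next
    fix \<K>
    assume K: "\<forall>K\<in>\<K>. K \<subseteq> p ` topspace T \<and> openin T {x \<in> topspace T. p x \<in> K}"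
    have "{x \<in> topspace T. p x \<in> \<Union> \<K>} = (\<Union>K\<in>\<K>. {x \<in> topspace T. p x \<in> K})"
      by blast
    then show "openin T {x \<in> topspace T. p x \<in> \<Union> \<K>}"
      using K by auto
    show "\<Union> \<K> \<subseteq> p ` topspace T"
      using K by blast
  qed
  then show ?thesis
    unfolding quotient_topology_def by (simp add: topology_inverse')
qed

definition fquotient :: "'x fspace \<Rightarrow> ('x \<Rightarrow> 'y) \<Rightarrow> 'y fspace" where
  "fquotient X p =
     \<lparr>ftop = quotient_topology (ftop X) p,
      fregular = (\<lambda>U f. openin (quotient_topology (ftop X) p) U \<and>
        fregular X {x \<in> topspace (ftop X). p x \<in> U} (f \<circ> p))\<rparr>"

inductive_set poly_algebra :: "('x \<Rightarrow> complex) set \<Rightarrow> ('x \<Rightarrow> complex) set"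
  for L :: "('x \<Rightarrow> complex) set" where
  const: "(\<lambda>x. c) \<in> poly_algebra L"
| gen: "l \<in> L \<Longrightarrow> l \<in> poly_algebra L"
| add: "f \<in> poly_algebra L \<Longrightarrow> g \<in> poly_algebra L \<Longrightarrow> (\<lambda>x. f x + g x) \<in> poly_algebra L"
| mult: "f \<in> poly_algebra L \<Longrightarrow> g \<in> poly_algebra L \<Longrightarrow> (\<lambda>x. f x * g x) \<in> poly_algebra L"

text \<open>The Zariski topology on \<open>X\<close> with coordinate functions \<open>L\<close>.\<close>

definition zariski_topology :: "'x set \<Rightarrow> ('x \<Rightarrow> complex) set \<Rightarrow> 'x topology" where
  "zariski_topology X L =
     topology (\<lambda>U. \<exists>F\<subseteq>poly_algebra L. U = {x \<in> X. \<exists>p\<in>F. p x \<noteq> 0})"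

lemma openin_zariski_topology:
  "openin (zariski_topology X L) U \<longleftrightarrow> (\<exists>F\<subseteq>poly_algebra L. U = {x \<in> X. \<exists>p\<in>F. p x \<noteq> 0})"
proof -
  have "istopology (\<lambda>U. \<exists>F\<subseteq>poly_algebra L. U = {x \<in> X. \<exists>p\<in>F. p x \<noteq> 0})"
    unfolding istopology_def
  proof (intro conjI allI impI)
    fix A B
    assume "\<exists>F\<subseteq>poly_algebra L. A = {x \<in> X. \<exists>p\<in>F. p x \<noteq> 0}"
      and "\<exists>F\<subseteq>poly_algebra L. B = {x \<in> X. \<exists>p\<in>F. p x \<noteq> 0}"
    then obtain F G where F: "F \<subseteq> poly_algebra L" "A = {x \<in> X. \<exists>p\<in>F. p x \<noteq> 0}"
      and G: "G \<subseteq> poly_algebra L" "B = {x \<in> X. \<exists>p\<in>G. p x \<noteq> 0}"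
      by blast
    let ?H = "{\<lambda>x. f x * g x | f g. f \<in> F \<and> g \<in> G}"
    have "?H \<subseteq> poly_algebra L"
      using F(1) G(1) by (auto intro!: poly_algebra.mult)
    moreover have "A \<inter> B = {x \<in> X. \<exists>p\<in>?H. p x \<noteq> 0}"
    proof (intro equalityI subsetI)
      fix x assume "x \<in> A \<inter> B"
      then obtain f g where "x \<in> X" "f \<in> F" "g \<in> G" "f x \<noteq> 0" "g x \<noteq> 0"
        unfolding F(2) G(2) by blast
      then show "x \<in> {x \<in> X. \<exists>p\<in>?H. p x \<noteq> 0}"
        by (intro CollectI conjI bexI[of _ "\<lambda>x. f x * g x"]) auto
    next
      fix x assume "x \<in> {x \<in> X. \<exists>p\<in>?H. p x \<noteq> 0}"
      then obtain f g where "x \<in> X" "f \<in> F" "g \<in> G" "f x * g x \<noteq> 0"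
        by blast
      then show "x \<in> A \<inter> B"
        unfolding F(2) G(2) by auto
    qed
    ultimately show "\<exists>F\<subseteq>poly_algebra L. A \<inter> B = {x \<in> X. \<exists>p\<in>F. p x \<noteq> 0}"
      by blast
  next
    fix \<K>
    assume "\<forall>K\<in>\<K>. \<exists>F\<subseteq>poly_algebra L. K = {x \<in> X. \<exists>p\<in>F. p x \<noteq> 0}"
    from bchoice[OF this] obtain F where
      F: "\<forall>K\<in>\<K>. F K \<subseteq> poly_algebra L \<and> K = {x \<in> X. \<exists>p\<in>F K. p x \<noteq> 0}"
      by blast
    have "(\<Union>K\<in>\<K>. K) = (\<Union>K\<in>\<K>. {x \<in> X. \<exists>p\<in>F K. p x \<noteq> 0})"
      by (rule SUP_cong) (use F in blast)+
    also have "\<dots> = {x \<in> X. \<exists>p\<in>\<Union> (F ` \<K>). p x \<noteq> 0}"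
      by blast
    finally have "\<Union> \<K> = {x \<in> X. \<exists>p\<in>\<Union> (F ` \<K>). p x \<noteq> 0}"
      by simp
    moreover have "\<Union> (F ` \<K>) \<subseteq> poly_algebra L"
      using F by blast
    ultimately show "\<exists>F\<subseteq>poly_algebra L. \<Union> \<K> = {x \<in> X. \<exists>p\<in>F. p x \<noteq> 0}"
      by blast
  qed
  then show ?thesis
    unfolding zariski_topology_def by (simp add: topology_inverse')
qed

definition zariski_space :: "'x set \<Rightarrow> ('x \<Rightarrow> complex) set \<Rightarrow> 'x fspace" where
  "zariski_space X L =
     \<lparr>ftop = zariski_topology X L,
      fregular = (\<lambda>U f. openin (zariski_topology X L) U \<and>
        (\<forall>x\<in>U. \<exists>W p q. x \<in> W \<and> W \<subseteq> U \<and> openin (zariski_topology X L) W \<and>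
           p \<in> poly_algebra L \<and> q \<in> poly_algebra L \<and> (\<forall>y\<in>W. q y \<noteq> 0 \<and> f y = p y / q y)))\<rparr>"

definition affine_space :: "nat \<Rightarrow> (nat \<Rightarrow> complex) fspace" where
  "affine_space m = zariski_space ({..<m} \<rightarrow>\<^sub>E UNIV) {\<lambda>x. x j | j. j < m}"

text \<open>
  The product of the Grassmannians of \<open>e i\<close>-dimensional subspaces of the spaces of \<open>M\<close> carries its
  usual structure as the quotient of the variety of tuples of frames by the product of the groups
  \<open>GL\<close> of the \<open>e i\<close>; here the frame variety is open in an affine space whose coordinates are the
  linear coordinates of the frame vectors.
\<close>

definition frames :: "('v, 'e) pre_digraph \<Rightarrow> ('v, 'e, 'a::complex_vector) rep \<Rightarrow> ('v \<Rightarrow> nat) \<Rightarrow>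
    ('v \<Rightarrow> nat \<Rightarrow> 'a) set" where
  "frames Q M e =
     {u \<in> (\<Pi>\<^sub>E i\<in>verts Q. {..<e i} \<rightarrow>\<^sub>E rep_space M i).
        \<forall>i\<in>verts Q. inj_on (u i) {..<e i} \<and> cvec.independent (u i ` {..<e i})}"

definition frame_coordinates :: "('v, 'e) pre_digraph \<Rightarrow> ('v, 'e, 'a::complex_vector) rep \<Rightarrow>
    ('v \<Rightarrow> nat) \<Rightarrow> (('v \<Rightarrow> nat \<Rightarrow> 'a) \<Rightarrow> complex) set" where
  "frame_coordinates Q M e =
     {\<lambda>u. \<xi> (u i k) | \<xi> i k. i \<in> verts Q \<and> k < e i \<and> clinear_on (rep_space M i) \<xi>}"

definition frame_span :: "('v, 'e) pre_digraph \<Rightarrow> ('v \<Rightarrow> nat) \<Rightarrow> ('v \<Rightarrow> nat \<Rightarrow> 'a::complex_vector) \<Rightarrow>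
    'v \<Rightarrow> 'a set" where
  "frame_span Q e u = (\<lambda>i\<in>verts Q. cvec.span (u i ` {..<e i}))"

definition grass_product :: "('v, 'e) pre_digraph \<Rightarrow> ('v, 'e, 'a::complex_vector) rep \<Rightarrow>
    ('v \<Rightarrow> nat) \<Rightarrow> ('v \<Rightarrow> 'a set) fspace" where
  "grass_product Q M e =
     fquotient (zariski_space (frames Q M e) (frame_coordinates Q M e)) (frame_span Q e)"

definition quiver_grass_variety :: "('v, 'e) pre_digraph \<Rightarrow> ('v, 'e, 'a::complex_vector) rep \<Rightarrow>
    ('v \<Rightarrow> nat) \<Rightarrow> ('v \<Rightarrow> 'a set) fspace" where
  "quiver_grass_variety Q M e = fsubspace (grass_product Q M e) (quiver_grass Q M e)"

definition is_subvariety :: "'x fspace \<Rightarrow> 'x set \<Rightarrow> bool" where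
  "is_subvariety X Z \<longleftrightarrow> (\<exists>U C. openin (ftop X) U \<and> closedin (ftop X) C \<and> Z = U \<inter> C)"

definition is_cell :: "'x fspace \<Rightarrow> 'x set \<Rightarrow> bool" where
  "is_cell X Z \<longleftrightarrow>
     is_subvariety X Z \<and> (\<exists>m. fspace_isomorphic (affine_space m) (fsubspace X Z))"

end

theory Submission imports Defs "Jordan_Normal_Form.Determinant" begin

text \<open>
  The arcs into a vertex inject \<open>P\<close> jointly and the arcs out of a vertex surject \<open>I\<close> jointly. These
  conditions let homomorphisms be built vertex by vertex along the orientation: every \<open>N\<close> is the
  image of \<open>\<pi>(N) + (N \<inter> I)\<close> under some \<open>(x, y) \<mapsto> (x, h x + y)\<close> with \<open>h : P \<rightarrow> I\<close>, and isomorphisms between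
  quotients of \<open>P\<close> or between subrepresentations of \<open>I\<close> lift to automorphisms. So the orbit of \<open>N\<close> is
  determined by the two isomorphism classes. They are finite in number because, by reflection
  functors, an indecomposable is determined by its dimension vector.

  Over the equioriented quiver the summands of \<open>P\<close> are strings ending at \<open>n\<close> and those of \<open>I\<close> strings
  starting at \<open>1\<close>. Ordered by their other ends, with those of \<open>I\<close> first, every unitriangular matrix
  gives an automorphism in the group, so Gaussian elimination moves each \<open>N\<close> to the coordinate
  subrepresentation of its pivots. Without multiplicities the group is itself triangular, and the orbit
  is a Schubert-like cell: it is cut out of the chart where the pivot minors do not vanish by equations
  between the entries of the reduced echelon form, and its coordinates are the remaining entries at
  the vertices where pivots first appear.
\<close>

subsection \<open>Linear maps on finite-dimensional subspaces\<close>

text \<open>Each lifting property is tested against one map built at a vertex, which yields the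
  local arc condition; injectivity also extends a shear from \<open>\<pi>(N)\<close> to
  \<open>P\<close>. The finiteness rests on a certificate: a positive integer vector
  \<open>u\<close> whose image under the Cartan matrix is strictly positive. By a weighted
  arithmetic-geometric inequality it bounds all vectors of given Tits form, and paired with a
  nonnegative vector fixed by all reflections it forces that vector to be 0; so repeated rounds of
  reflections must produce a negative entry. A reflected representation contains a kernel inside a
  space of arc-indexed families, which has to be embedded again in the ambient type; hence this part
  works in \<open>nat => complex\<close> and is transported afterwards. For the cells the obstacle
  is that the Grassmannian carries the quotient structure from frames: pivot minors are functions of
  frames only, while their nonvanishing depends on the span. Regular functions are therefore
  compared on frames after clearing powers of the product of the pivot minors, with a polynomial
  frame as section over the cell.\<close>

lemma clinear_onI:
 assumes "!!x y. x : V ==> y : V ==> f (x + y) = f x + f y"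
  and "!!c x. x : V ==> f (c *\<^sub>C x) = c *\<^sub>C f x"
 shows "clinear_on V f"
 using assms unfolding clinear_on_def by blast

lemma clinear_on_add: "clinear_on V f ==> x : V ==> y : V ==> f (x + y) = f x + f y"
 unfolding clinear_on_def by blast

lemma clinear_on_scale: "clinear_on V f ==> x : V ==> f (c *\<^sub>C x) = c *\<^sub>C f x"
 unfolding clinear_on_def by blast

lemma clinear_on_subset: "clinear_on V f ==> U <= V ==> clinear_on U f"
 unfolding clinear_on_def by blast

lemma clinear_on_compose:
 "clinear_on V f ==> f ` V <= W ==> clinear_on W g ==> clinear_on V (%x. g (f x))"
 unfolding clinear_on_def by (simp add: image_subset_iff)

lemma clinear_on_plus:
 "clinear_on V f ==> clinear_on V g ==> clinear_on V (%x. f x + g x)"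
 unfolding clinear_on_def by (simp add: cvec.scale_right_distrib algebra_simps)

lemma clinear_on_minus:
 "clinear_on V f ==> clinear_on V g ==> clinear_on V (%x. f x - g x)"
 unfolding clinear_on_def by (simp add: cvec.scale_right_diff_distrib algebra_simps)

lemma clinear_on_zero: "clinear_on V (%x. 0)"
 unfolding clinear_on_def by simp

lemma clinear_on_id: "clinear_on V (%x. x)"
 unfolding clinear_on_def by simp

lemma clinear_on_sum:
 assumes "clinear_on V f" "cvec.subspace V" "!!k. k : K ==> x k : V"
 shows "f (SUM k:K. x k) = (SUM k:K. f (x k))"
 using assms(3)
proof (induction K rule: infinite_finite_induct)
 case (insert a K)
 then show ?case
  using clinear_on_add[OF assms(1)] cvec.subspace_sum[OF assms(2), of K x] by simp
qed (auto simp: clinear_on_0[OF assms(1,2)])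

lemma clinear_on_sum_fun:
 assumes "!!k. k : K ==> clinear_on V (f k)"
 shows "clinear_on V (%x. SUM k:K. f k x)"
 using assms unfolding clinear_on_def by (simp add: sum.distrib cvec.scale_sum_right)

lemma linear_iff_clinear_on: "Vector_Spaces.linear scaleC scaleC f \<longleftrightarrow> clinear_on UNIV f"
 unfolding Vector_Spaces.linear_iff clinear_on_def
 by (simp add: cvec.vector_space_axioms)

lemma clinear_on_kernel_subspace:
 assumes "clinear_on V f" "cvec.subspace V"
 shows "cvec.subspace {x : V. f x = 0}"
 using assms clinear_on_0[OF assms] unfolding cvec.subspace_def clinear_on_def by auto

lemma clinear_on_vimage_subspace:
 assumes "clinear_on V f" "cvec.subspace V" "cvec.subspace W"
 shows "cvec.subspace {x : V. f x : W}"
 using assms clinear_on_0[OF assms(1,2)] unfolding cvec.subspace_def clinear_on_def by auto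

lemma clinear_on_image_subspace:
 assumes f: "clinear_on V f" and V: "cvec.subspace V"
 shows "cvec.subspace (f ` V)"
proof (rule cvec.subspaceI)
 show "0 : f ` V"
  using clinear_on_0[OF f V] cvec.subspace_0[OF V] by force
next
 fix x y assume "x : f ` V" "y : f ` V"
 then obtain u v where "u : V" "v : V" "x = f u" "y = f v" by blast
 then show "x + y : f ` V"
  using clinear_on_add[OF f] cvec.subspace_add[OF V] by (metis image_eqI)
next
 fix c x assume "x : f ` V"
 then obtain u where "u : V" "x = f u" by blast
 then show "c *\<^sub>C x : f ` V"
  using clinear_on_scale[OF f] cvec.subspace_scale[OF V] by (metis image_eqI)
qed

lemma clinear_on_inj_iff:
 assumes f: "clinear_on V f" and V: "cvec.subspace V"
 shows "inj_on f V \<longleftrightarrow> (ALL x:V. f x = 0 --> x = 0)"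
proof
 assume "inj_on f V"
 then show "ALL x:V. f x = 0 --> x = 0"
  using clinear_on_0[OF f V] cvec.subspace_0[OF V] by (metis inj_onD)
next
 assume *: "ALL x:V. f x = 0 --> x = 0"
 show "inj_on f V"
 proof (rule inj_onI)
  fix x y assume "x : V" "y : V" "f x = f y"
  then show "x = y"
   using clinear_on_diff[OF f V] cvec.subspace_diff[OF V] * by (metis right_minus_eq)
 qed
qed

lemma clinear_on_inv_into:
 assumes f: "clinear_on V f" and V: "cvec.subspace V" and b: "bij_betw f V W"
 shows "clinear_on W (inv_into V f)"
proof (rule clinear_onI)
 note i = bij_betw_inv_into_right[OF b] inv_into_into[of _ f V, unfolded bij_betw_imp_surj_on[OF b]]
 fix x y assume "x : W" "y : W"
 then show "inv_into V f (x + y) = inv_into V f x + inv_into V f y"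
  using clinear_on_add[OF f] cvec.subspace_add[OF V] i bij_betw_inv_into_left[OF b]
  by metis
next
 note i = bij_betw_inv_into_right[OF b] inv_into_into[of _ f V, unfolded bij_betw_imp_surj_on[OF b]]
 fix c x assume "x : W"
 then show "inv_into V f (c *\<^sub>C x) = c *\<^sub>C inv_into V f x"
  using clinear_on_scale[OF f] cvec.subspace_scale[OF V] i bij_betw_inv_into_left[OF b]
  by metis
qed

lemma clinear_on_span_eq:
 assumes "clinear_on (cvec.span B) f" "clinear_on (cvec.span B) g" "!!b. b : B ==> f b = g b"
  "x : cvec.span B"
 shows "f x = g x"
proof -
 have s: "cvec.subspace (cvec.span B)" by simp
 have "cvec.span B <= {x : cvec.span B. f x - g x = 0}"
  using assms(3) cvec.span_base
  by (intro cvec.span_minimal clinear_on_kernel_subspace clinear_on_minus assms(1,2) s) auto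
 then show ?thesis using assms(4) by auto
qed

lemma clinear_on_image_span:
 assumes "clinear_on (cvec.span B) f"
 shows "f ` cvec.span B = cvec.span (f ` B)"
proof
 have s: "cvec.subspace (cvec.span B)" by simp
 have "cvec.span B <= {x : cvec.span B. f x : cvec.span (f ` B)}"
  by (intro cvec.span_minimal clinear_on_vimage_subspace assms s) (auto intro: cvec.span_base)
 then show "f ` cvec.span B <= cvec.span (f ` B)" by blast
 show "cvec.span (f ` B) <= f ` cvec.span B"
  by (intro cvec.span_minimal clinear_on_image_subspace assms s) (auto intro: cvec.span_base)
qed

section \<open>Bases, dimension and rank-nullity inside an ambient space\<close>

lemma fin_dim_subspace_basis:
 assumes "fin_dim_subspace V"
 obtains B where "finite B" "cvec.independent B" "B <= V" "cvec.span B = V" "card B = cvec.dim V"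
proof -
 obtain B0 where B0: "finite B0" "cvec.span B0 = V"
  using assms unfolding fin_dim_subspace_def by blast
 obtain B where B: "B <= V" "cvec.independent B" "V <= cvec.span B" "card B = cvec.dim V"
  using cvec.basis_exists by blast
 show ?thesis
 proof (rule that)
  show "finite B" using cvec.independent_span_bound[OF B0(1) B(2)] B(1) B0(2) by blast
  show "cvec.span B = V"
   using B(1,3) B0(2) cvec.span_minimal[OF B(1)] fin_dim_subspace_imp_subspace[OF assms] by blast
 qed (use B in auto)
qed

lemma fin_dim_subspace_extend_basis:
 assumes V: "fin_dim_subspace V" and B: "cvec.independent B" "B <= V"
 obtains C where "B <= C" "C <= V" "finite C" "cvec.independent C" "cvec.span C = V"
proof -
 obtain B0 where B0: "finite B0" "cvec.span B0 = V"
  using assms unfolding fin_dim_subspace_def by blast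
 obtain C where C: "B <= C" "C <= V" "cvec.independent C" "V <= cvec.span C"
  using cvec.maximal_independent_subset_extend[of B V] B by blast
 show ?thesis
 proof (rule that[OF C(1,2) _ C(3)])
  show "finite C" using cvec.independent_span_bound[OF B0(1) C(3)] C(2) B0(2) by blast
  show "cvec.span C = V"
   using C(4) cvec.span_minimal[OF C(2) fin_dim_subspace_imp_subspace[OF V]] by blast
 qed
qed

lemma fin_dim_subspace_subset:
 assumes V: "fin_dim_subspace V" and U: "cvec.subspace U" "U <= V"
 shows "fin_dim_subspace U"
proof -
 obtain B where B: "B <= U" "cvec.independent B" "U <= cvec.span B"
  using cvec.maximal_independent_subset[of U] by blast
 obtain C where "B <= C" "C <= V" "finite C" "cvec.independent C" "cvec.span C = V"
  by (rule fin_dim_subspace_extend_basis[OF V B(2)]) (use B(1) U(2) in auto)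
 then have "finite B" using finite_subset by blast
 moreover have "cvec.span B = U" using B cvec.span_minimal[OF B(1) U(1)] by blast
 ultimately show ?thesis unfolding fin_dim_subspace_def by blast
qed

lemma fin_dim_subspace_span: "finite B ==> fin_dim_subspace (cvec.span B)"
 unfolding fin_dim_subspace_def by blast

lemma fin_dim_subspace_zero: "fin_dim_subspace {0}"
 using fin_dim_subspace_span[of "{}"] by simp

lemma cvec_dim_zero: "cvec.dim {0} = 0"
 using cvec.dim_span_eq_card_independent[OF cvec.independent_empty] by simp

lemma cvec_dim_mono:
 assumes V: "fin_dim_subspace V" and U: "cvec.subspace U" "U <= V"
 shows "cvec.dim U <= cvec.dim V"
proof -
 obtain B where B: "finite B" "cvec.independent B" "B <= U" "cvec.span B = U" "card B = cvec.dim U"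
  by (rule fin_dim_subspace_basis[OF fin_dim_subspace_subset[OF V U]])
 obtain C where C: "finite C" "cvec.independent C" "C <= V" "cvec.span C = V" "card C = cvec.dim V"
  by (rule fin_dim_subspace_basis[OF V])
 show ?thesis
  using cvec.independent_span_bound[OF C(1) B(2)] B C U(2) by auto
qed

lemma cvec_dim_eq_imp_eq:
 assumes V: "fin_dim_subspace V" and U: "cvec.subspace U" "U <= V"
  and d: "cvec.dim V <= cvec.dim U"
 shows "U = V"
proof -
 obtain B where B: "finite B" "cvec.independent B" "B <= U" "cvec.span B = U" "card B = cvec.dim U"
  by (rule fin_dim_subspace_basis[OF fin_dim_subspace_subset[OF V U]])
 obtain C where C: "B <= C" "C <= V" "finite C" "cvec.independent C" "cvec.span C = V"
  by (rule fin_dim_subspace_extend_basis[OF V B(2)]) (use B(3) U(2) in auto)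
 have "card C = cvec.dim V"
  using cvec.dim_span_eq_card_independent[OF C(4)] C(5) by simp
 then have "B = C" using card_seteq[OF C(3,1)] B(5) d by simp
 then show ?thesis using B(4) C(5) by simp
qed

lemma cvec_dim_pos:
 assumes "fin_dim_subspace V"
 shows "cvec.dim V = 0 \<longleftrightarrow> V = {0}"
proof
 assume "cvec.dim V = 0"
 then show "V = {0}"
  using cvec_dim_eq_imp_eq[OF assms cvec.subspace_single_0]
   cvec.subspace_0[OF fin_dim_subspace_imp_subspace[OF assms]] by auto
qed (simp add: cvec_dim_zero)

lemma clinear_on_exists_on_basis:
 assumes "cvec.independent B"
 obtains g where "clinear_on UNIV g" "!!b. b : B ==> g b = f b"
 using cvec_pair.linear_independent_extend[OF assms, of f] linear_iff_clinear_on by blast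

lemma clinear_on_extend:
 assumes V: "cvec.subspace V" and f: "clinear_on V f"
 obtains g where "clinear_on UNIV g" "!!x. x : V ==> g x = f x"
proof -
 obtain B where B: "B <= V" "cvec.independent B" "V <= cvec.span B"
  using cvec.maximal_independent_subset[of V] by blast
 have sp: "cvec.span B = V" using B cvec.span_minimal[OF B(1) V] by blast
 obtain g where g: "clinear_on UNIV g" "!!b. b : B ==> g b = f b"
  using clinear_on_exists_on_basis[OF B(2)] by metis
 have "g x = f x" if "x : V" for x
  by (rule clinear_on_span_eq[of B]) (use f g that sp clinear_on_subset[OF g(1)] in auto)
 then show ?thesis using that g(1) by blast
qed

lemma fin_dim_subspace_image:
 assumes "fin_dim_subspace V" "clinear_on V f"
 shows "fin_dim_subspace (f ` V)"
 using assms clinear_on_image_span unfolding fin_dim_subspace_def by (metis finite_imageI)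

lemma fin_dim_subspace_complement:
 assumes V: "fin_dim_subspace V" and U: "cvec.subspace U" "U <= V"
 obtains W where "cvec.subspace W" "W <= V" "U Int W = {0}"
  "!!x. x : V ==> EX u:U. EX w:W. x = u + w"
proof -
 obtain p where p: "Vector_Spaces.linear scaleC scaleC p" "p ` V <= V"
  "{x : V. p x = 0} = U" "ALL x:V. p (p x) = p x"
  using quotient_space_exists[OF V U] by blast
 have pl: "clinear_on V p"
  using p(1) linear_iff_clinear_on clinear_on_subset by blast
 note sV = fin_dim_subspace_imp_subspace[OF V]
 show ?thesis
 proof (rule that)
  show "cvec.subspace (p ` V)" using clinear_on_image_subspace[OF pl sV] .
  show "p ` V <= V" by fact
  show "U Int p ` V = {0}"
  proof
   show "U Int p ` V <= {0}" using p(3,4) by auto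
   show "{0} <= U Int p ` V"
    using cvec.subspace_0[OF U(1)] cvec.subspace_0[OF sV] clinear_on_0[OF pl sV]
    by (auto intro!: image_eqI[of _ _ 0])
  qed
  fix x assume x: "x : V"
  then have "p x : V" using p(2) by blast
  then have "x - p x : V" "p (x - p x) = 0"
   using x cvec.subspace_diff[OF sV] clinear_on_diff[OF pl sV] p(4) by auto
  then have "x - p x : U" using p(3) by blast
  then show "EX u:U. EX w:p ` V. x = u + w"
   using x by (intro bexI[of _ "x - p x"] bexI[of _ "p x"]) auto
 qed
qed

lemma clinear_on_rank_nullity:
 assumes V: "fin_dim_subspace V" and f: "clinear_on V f"
 shows "cvec.dim V = cvec.dim {x : V. f x = 0} + cvec.dim (f ` V)"
proof -
 note sV = fin_dim_subspace_imp_subspace[OF V]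
 let ?K = "{x : V. f x = 0}"
 have K: "cvec.subspace ?K" "?K <= V" using clinear_on_kernel_subspace[OF f sV] by auto
 obtain B where B: "finite B" "cvec.independent B" "B <= ?K" "cvec.span B = ?K" "card B = cvec.dim ?K"
  by (rule fin_dim_subspace_basis[OF fin_dim_subspace_subset[OF V K]])
 obtain C where C: "B <= C" "C <= V" "finite C" "cvec.independent C" "cvec.span C = V"
  by (rule fin_dim_subspace_extend_basis[OF V B(2)]) (use B(3) in auto)
 obtain F where F: "clinear_on UNIV F" "!!x. x : V ==> F x = f x"
  using clinear_on_extend[OF sV f] by blast
 have L: "Vector_Spaces.linear scaleC scaleC F" using F(1) linear_iff_clinear_on by blast
 let ?D = "C - B"
 have spD: "cvec.span ?D <= V" using C by (metis Diff_subset cvec.span_mono)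
 have indD: "cvec.independent ?D" using C(4) cvec.independent_mono by blast
 have "inj_on F (cvec.span ?D)"
 proof -
  have "x = 0" if x: "x : cvec.span ?D" "F x = 0" for x
  proof -
   have "x : cvec.span B" using x spD F(2) B(4) by auto
   moreover have "cvec.span B Int cvec.span ?D = {0}"
   proof -
    have "y = 0" if y: "y : cvec.span B" "y : cvec.span ?D" for y
    proof -
     \<comment> \<open>Coordinates in the basis \<open>C\<close> of a vector in both spans are
       supported in \<open>B\<close> and in \<open>C - B\<close>, hence nowhere.\<close>
     have "cvec.representation C y = cvec.representation B y"
      "cvec.representation C y = cvec.representation ?D y"
      using cvec.representation_extend[OF C(4) y(1) C(1)]
       cvec.representation_extend[OF C(4) y(2)] by auto
     then have "cvec.representation C y b = 0" for b
      using cvec.representation_ne_zero[of B y b] cvec.representation_ne_zero[of ?D y b] by auto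
     moreover have "y = (\<Sum>b | cvec.representation C y b ~= 0. cvec.representation C y b *\<^sub>C b)"
      using cvec.sum_nonzero_representation_eq[OF C(4)] y C(5) spD by auto
     ultimately show "y = 0" by simp
    qed
    then show ?thesis using cvec.span_zero by auto
   qed
   ultimately show "x = 0" using x by blast
  qed
  then show ?thesis
   using clinear_on_inj_iff[OF clinear_on_subset[OF F(1)]] by auto
 qed
 then have indF: "cvec.independent (F ` ?D)" "inj_on F ?D"
  using cvec_pair.linear_independent_injective_image[OF L indD]
   inj_on_subset[OF _ cvec.span_superset] by auto
 have "cvec.span (F ` ?D) = f ` V"
 proof -
  have "f ` V = F ` V" using F(2) by force
  also have "... = cvec.span (F ` C)"
   using C(5) clinear_on_image_span[of C F] clinear_on_subset[OF F(1)] by auto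
  also have "... = cvec.span (F ` ?D)"
  proof
   have "F b = 0" if "b : B" for b using that B(3) F(2) by auto
   then have "F ` C <= cvec.span (F ` ?D)"
    by (metis (no_types, lifting) Diff_iff cvec.span_base cvec.span_zero image_eqI image_subsetI)
   then show "cvec.span (F ` C) <= cvec.span (F ` ?D)"
    by (intro cvec.span_minimal) auto
   show "cvec.span (F ` ?D) <= cvec.span (F ` C)" by (intro cvec.span_mono) auto
  qed
  finally show ?thesis by simp
 qed
 then have "cvec.dim (f ` V) = card ?D"
  using cvec.dim_span_eq_card_independent[OF indF(1)] card_image[OF indF(2)] by simp
 moreover have "cvec.dim V = card C" using cvec.dim_span_eq_card_independent[OF C(4)] C(5) by simp
 ultimately show ?thesis using B(5) card_Diff_subset[OF B(1) C(1)] card_mono[OF C(3,1)] by simp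
qed

lemma cvec_dim_inj_image:
 assumes V: "fin_dim_subspace V" and f: "clinear_on V f" "inj_on f V"
 shows "cvec.dim (f ` V) = cvec.dim V"
proof -
 note sV = fin_dim_subspace_imp_subspace[OF V]
 have "{x : V. f x = 0} = {0}"
  using f clinear_on_inj_iff[OF f(1) sV] clinear_on_0[OF f(1) sV] cvec.subspace_0[OF sV] by auto
 then show ?thesis using clinear_on_rank_nullity[OF V f(1)] cvec_dim_zero by simp
qed

lemma clinear_on_inj_imp_bij:
 assumes V: "fin_dim_subspace V" and W: "fin_dim_subspace W" and f: "clinear_on V f" "inj_on f V"
  "f ` V <= W" and d: "cvec.dim W <= cvec.dim V"
 shows "bij_betw f V W"
proof -
 have "f ` V = W"
  using cvec_dim_eq_imp_eq[OF W clinear_on_image_subspace[OF f(1)]] f(3) d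
   cvec_dim_inj_image[OF V f(1,2)] fin_dim_subspace_imp_subspace[OF V] by auto
 then show ?thesis using f(2) by (simp add: bij_betw_def)
qed

lemma clinear_on_surj_imp_bij:
 assumes V: "fin_dim_subspace V" and f: "clinear_on V f"
  "f ` V = W" and d: "cvec.dim V <= cvec.dim W"
 shows "bij_betw f V W"
proof -
 note sV = fin_dim_subspace_imp_subspace[OF V]
 have "cvec.dim {x : V. f x = 0} = 0"
  using clinear_on_rank_nullity[OF V f(1)] f(2) d by simp
 then have "{x : V. f x = 0} = {0}"
  using cvec_dim_pos fin_dim_subspace_subset[OF V clinear_on_kernel_subspace[OF f(1) sV]] by auto
 then have "inj_on f V" using clinear_on_inj_iff[OF f(1) sV] by auto
 then show ?thesis using f(2) by (simp add: bij_betw_def)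
qed

lemma clinear_bij_exists:
 fixes V :: "'a::complex_vector set" and W :: "'b::complex_vector set"
 assumes V: "fin_dim_subspace V" and W: "fin_dim_subspace W" and d: "cvec.dim V = cvec.dim W"
 obtains f where "clinear_on UNIV f" "bij_betw f V W"
proof -
 obtain B where B: "finite B" "cvec.independent B" "B <= V" "cvec.span B = V" "card B = cvec.dim V"
  by (rule fin_dim_subspace_basis[OF V])
 obtain C where C: "finite C" "cvec.independent C" "C <= W" "cvec.span C = W" "card C = cvec.dim W"
  by (rule fin_dim_subspace_basis[OF W])
 have "EX f. Vector_Spaces.linear scaleC scaleC f & f ` B = C & f ` V = W & inj_on f V"
  by (rule cvec_pair.finite_basis_to_basis_subspace_isomorphism)
   (use B C d fin_dim_subspace_imp_subspace[OF V] fin_dim_subspace_imp_subspace[OF W] in auto)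
 then show ?thesis
  using that by (auto simp: linear_iff_clinear_on bij_betw_def)
qed

lemma sum_fun_apply: "(SUM k:A. f k) x = (SUM k:A. f k x)"
 by (induction A rule: infinite_finite_induct) auto

lemma fin_dim_subspace_of_dim:
 "EX W :: (nat => complex) set. fin_dim_subspace W & cvec.dim W = n"
proof -
 define e :: "nat => nat => complex" where "e j = (%k. if k = j then 1 else 0)" for j
 have inj: "inj_on e A" for A
  by (auto simp: inj_on_def e_def fun_eq_iff split: if_splits)
 have "cvec.independent (e ` {..<n})"
 proof (rule cvec.independent_if_scalars_zero)
  fix f x assume s: "(SUM x:e ` {..<n}. f x *\<^sub>C x) = 0" and x: "x : e ` {..<n}"
  obtain j where j: "x = e j" "j < n" using x by auto
  have "0 = (\<Sum>k<n. f (e k) *\<^sub>C e k) j"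
   using s by (simp add: sum.reindex[OF inj])
  also have "... = (\<Sum>k<n. f (e k) * (if j = k then 1 else 0))"
   by (simp add: sum_fun_apply scaleC_fun_def scaleC_complex_def e_def)
  also have "... = f x" using j by (simp add: if_distrib cong: if_cong)
  finally show "f x = 0" by simp
 qed simp
 then have "cvec.dim (cvec.span (e ` {..<n})) = n"
  using cvec.dim_span_eq_card_independent card_image[OF inj] by (metis card_lessThan)
 then show ?thesis using fin_dim_subspace_span by blast
qed

text \<open>The test representations in the definitions of projectivity and injectivity, and the
  reflected representations constructed later, live in \<open>nat => complex\<close>; this moves any
  finite-dimensional space there.\<close>

lemma clinear_embed:
 fixes V :: "'a::complex_vector set"
 assumes V: "fin_dim_subspace V"
 obtains f :: "'a => nat => complex" where "clinear_on UNIV f" "inj_on f V"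
proof -
 obtain W :: "(nat => complex) set" where W: "fin_dim_subspace W" "cvec.dim V = cvec.dim W"
  using fin_dim_subspace_of_dim by metis
 show ?thesis using clinear_bij_exists[OF V W] that bij_betw_imp_inj_on by metis
qed

lemma clinear_on_fst: "clinear_on V fst" and clinear_on_snd: "clinear_on V snd"
 unfolding clinear_on_def by (simp_all add: scaleC_prod_def)

lemma clinear_on_Pair: "clinear_on V f ==> clinear_on V g ==> clinear_on V (%x. (f x, g x))"
 unfolding clinear_on_def by (simp add: scaleC_prod_def)

lemma cvec_subspace_Times:
 "cvec.subspace V ==> cvec.subspace W ==> cvec.subspace (V \<times> W)"
 unfolding cvec.subspace_def by (auto simp: scaleC_prod_def zero_prod_def)

lemma fin_dim_subspace_Times:
 assumes V: "fin_dim_subspace V" and W: "fin_dim_subspace W"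
 shows "fin_dim_subspace (V \<times> W)"
proof -
 obtain B C where B: "finite B" "cvec.span B = V" and C: "finite C" "cvec.span C = W"
  using V W unfolding fin_dim_subspace_def by blast
 note sV = fin_dim_subspace_imp_subspace[OF V] and sW = fin_dim_subspace_imp_subspace[OF W]
 let ?X = "(%x. (x, 0)) ` B Un (%y. (0, y)) ` C"
 have l: "clinear_on V (%x. (x, 0))" "clinear_on W (%y. (0, y))"
  by (intro clinear_on_Pair clinear_on_id clinear_on_zero)+
 have "V \<times> W <= cvec.span ?X"
 proof safe
  fix x y assume "x : V" "y : W"
  then have "(x, 0) : cvec.span ((%x. (x, 0)) ` B)" "(0, y) : cvec.span ((%y. (0, y)) ` C)"
   using clinear_on_image_span[of B "%x. (x, 0)"] clinear_on_image_span[of C "%y. (0, y)"] l B C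
   by auto
  then have "(x, 0) + (0, y) : cvec.span ?X"
   using cvec.span_mono[of "(%x. (x, 0)) ` B" ?X] cvec.span_mono[of "(%y. (0, y)) ` C" ?X]
   by (intro cvec.span_add) blast+
  then show "(x, y) : cvec.span ?X" by simp
 qed
 moreover have "?X <= V \<times> W"
  using B C cvec.span_superset[of B] cvec.span_superset[of C]
   cvec.subspace_0[OF sV] cvec.subspace_0[OF sW] by auto
 ultimately have "cvec.span ?X = V \<times> W"
  using cvec.span_minimal[OF _ cvec_subspace_Times[OF sV sW]] by blast
 then show ?thesis using fin_dim_subspace_span[of ?X] B(1) C(1) by simp
qed

lemma cvec_dim_fst_snd:
 fixes N :: "('a::complex_vector \<times> 'b::complex_vector) set"
 assumes N: "fin_dim_subspace N"
 shows "cvec.dim N = cvec.dim {y. (0, y) : N} + cvec.dim (fst ` N)"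
proof -
 note sN = fin_dim_subspace_imp_subspace[OF N]
 let ?K = "{x : N. fst x = 0}"
 have K: "fin_dim_subspace ?K"
  by (intro fin_dim_subspace_subset[OF N] clinear_on_kernel_subspace clinear_on_fst sN) auto
 have "snd ` ?K = {y. (0, y) : N}" by force
 moreover have "inj_on snd ?K" by (auto simp: inj_on_def)
 ultimately have "cvec.dim ?K = cvec.dim {y. (0, y) : N}"
  using cvec_dim_inj_image[OF K clinear_on_snd] by simp
 then show ?thesis using clinear_on_rank_nullity[OF N clinear_on_fst] by simp
qed

lemma cvec_dim_Times:
 assumes V: "fin_dim_subspace V" and W: "fin_dim_subspace W"
 shows "cvec.dim (V \<times> W) = cvec.dim V + cvec.dim W"
proof -
 have "fst ` (V \<times> W) = V" "{y. (0, y) : V \<times> W} = W"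
  using cvec.subspace_0[OF fin_dim_subspace_imp_subspace[OF V]]
   cvec.subspace_0[OF fin_dim_subspace_imp_subspace[OF W]] by auto
 then show ?thesis using cvec_dim_fst_snd[OF fin_dim_subspace_Times[OF V W]] by simp
qed

section \<open>Factoring, gluing and lifting linear maps\<close>

lemma clinear_factor:
 assumes W: "cvec.subspace W" and p: "clinear_on W p" and d: "clinear_on W d"
  and k: "!!x. x : W ==> p x = 0 ==> d x = 0"
 obtains D where "clinear_on UNIV D" "!!x. x : W ==> D (p x) = d x"
proof -
 have e: "d x = d y" if "x : W" "y : W" "p x = p y" for x y
  using k[of "x - y"] that cvec.subspace_diff[OF W] clinear_on_diff[OF p W] clinear_on_diff[OF d W]
  by simp
 define D where "D y = d (inv_into W p y)" for y
 have D: "D (p x) = d x" if "x : W" for x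
  unfolding D_def using that by (intro e) (auto intro: inv_into_into f_inv_into_f)
 have "clinear_on (p ` W) D"
 proof (rule clinear_onI)
  fix x y assume "x : p ` W" "y : p ` W"
  then obtain u v where "u : W" "v : W" "x = p u" "y = p v" by blast
  then show "D (x + y) = D x + D y"
   using D clinear_on_add[OF p] clinear_on_add[OF d] cvec.subspace_add[OF W] by metis
 next
  fix c x assume "x : p ` W"
  then obtain u where "u : W" "x = p u" by blast
  then show "D (c *\<^sub>C x) = c *\<^sub>C D x"
   using D clinear_on_scale[OF p] clinear_on_scale[OF d] cvec.subspace_scale[OF W] by metis
 qed
 from clinear_on_extend[OF clinear_on_image_subspace[OF p W] this] obtain G
  where "clinear_on UNIV G" "!!x. x : p ` W ==> G x = D x" by blast
 then show ?thesis using that D by auto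
qed

text \<open>With \<open>F\<close> extending \<open>f\<close> and \<open>p\<close> a linear map whose
  kernel in \<open>U + W\<close> is \<open>U\<close>, the defect \<open>g - F\<close> on
  \<open>W\<close> vanishes on the kernel of \<open>p\<close>, so it factors as
  \<open>D o p\<close>. The map \<open>F + D o p\<close> is unchanged on \<open>U\<close> and
  corrected on \<open>W\<close>.\<close>

lemma clinear_glue:
 fixes U W :: "'a::complex_vector set"
 assumes U: "fin_dim_subspace U" and W: "fin_dim_subspace W"
  and f: "clinear_on U f" and g: "clinear_on W g" and fg: "!!x. x : U ==> x : W ==> f x = g x"
 obtains h where "clinear_on UNIV h" "!!x. x : U ==> h x = f x" "!!x. x : W ==> h x = g x"
proof -
 note sU = fin_dim_subspace_imp_subspace[OF U] and sW = fin_dim_subspace_imp_subspace[OF W]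
 obtain F where F: "clinear_on UNIV F" "!!x. x : U ==> F x = f x"
  using clinear_on_extend[OF sU f] by blast
 obtain BU BW where B: "finite BU" "cvec.span BU = U" "finite BW" "cvec.span BW = W"
  using U W unfolding fin_dim_subspace_def by blast
 let ?V = "cvec.span (BU Un BW)"
 have V: "fin_dim_subspace ?V" "U <= ?V" "W <= ?V"
  unfolding B(2,4)[symmetric] using B(1,3) by (auto intro!: fin_dim_subspace_span cvec.span_mono)
 obtain p :: "'a => 'a" where p: "Vector_Spaces.linear scaleC scaleC p" "{x : ?V. p x = 0} = U"
  using quotient_space_exists[OF V(1) sU V(2)] by blast
 have pl: "clinear_on S p" for S using p(1) linear_iff_clinear_on clinear_on_subset by blast
 obtain D where D: "clinear_on UNIV D" "!!x. x : W ==> D (p x) = g x - F x"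
 proof (rule clinear_factor[OF sW pl clinear_on_minus[OF g clinear_on_subset[OF F(1)]]])
  fix x assume x: "x : W" "p x = 0"
  then have "x : U" using p(2) V(3) by blast
  then show "g x - F x = 0" using fg x F(2) by simp
 qed auto
 show ?thesis
 proof (rule that[of "%x. F x + D (p x)"])
  show "clinear_on UNIV (%x. F x + D (p x))"
   by (intro clinear_on_plus F(1) clinear_on_compose[OF pl _ D(1)]) auto
  show "F x + D (p x) = f x" if "x : U" for x
  proof -
   have "p x = 0" using that p(2) by blast
   then show ?thesis using F(2)[OF that] clinear_on_0[OF D(1)] by simp
  qed
  show "F x + D (p x) = g x" if "x : W" for x using D(2)[OF that] by simp
 qed
qed

text \<open>The one-vertex step of the later constructions. Values are free on a basis of
  \<open>W\<close> extending one of \<open>V\<close>: \<open>ph\<close> on the old basis vectors,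
  and any preimage under \<open>Ph'\<close> of the required value on the new ones.\<close>

lemma clinear_lift_extend:
 assumes W: "fin_dim_subspace W" and V: "cvec.subspace V" "V <= W" and W': "cvec.subspace W'"
  and ph: "clinear_on V ph" "ph ` V <= W'" and Ph: "clinear_on W Ph" and Ph': "clinear_on W' Ph'"
  and im: "Ph ` W <= Ph' ` W'" and eq: "!!v. v : V ==> Ph' (ph v) = Ph v"
 obtains b where "clinear_on UNIV b" "b ` W <= W'" "!!v. v : V ==> b v = ph v"
  "!!w. w : W ==> Ph' (b w) = Ph w"
proof -
 obtain B where B: "finite B" "cvec.independent B" "B <= V" "cvec.span B = V" "card B = cvec.dim V"
  by (rule fin_dim_subspace_basis[OF fin_dim_subspace_subset[OF W V]])
 obtain C where C: "B <= C" "C <= W" "finite C" "cvec.independent C" "cvec.span C = W"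
  by (rule fin_dim_subspace_extend_basis[OF W B(2)]) (use B(3) V(2) in auto)
 define s where "s c = (if c : B then ph c else (SOME y. y : W' & Ph' y = Ph c))" for c
 have s: "s c : W' & Ph' (s c) = Ph c" if "c : C" for c
 proof (cases "c : B")
  case True
  then show ?thesis using ph(2) B(3) eq unfolding s_def by auto
 next
  case False
  have "EX y. y : W' & Ph' y = Ph c" using im that C(2) by (metis image_iff subset_iff)
  then show ?thesis using False unfolding s_def by (simp add: someI_ex[where P="%y. y : W' & Ph' y = Ph c"])
 qed
 obtain b where b: "clinear_on UNIV b" "!!c. c : C ==> b c = s c"
  using clinear_on_exists_on_basis[OF C(4)] by metis
 have bl: "clinear_on S b" for S using clinear_on_subset[OF b(1)] by blast
 have bW: "b ` W <= W'"
  unfolding C(5)[symmetric] clinear_on_image_span[OF bl]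
  by (rule cvec.span_minimal) (use b(2) s W' in auto)
 show ?thesis
 proof (rule that[OF b(1) bW])
  show "b v = ph v" if "v : V" for v
   by (rule clinear_on_span_eq[of B]) (use that B ph b(2) C(1) bl in \<open>auto simp: s_def\<close>)
  show "Ph' (b w) = Ph w" if "w : W" for w
   by (rule clinear_on_span_eq[of C "%w. Ph' (b w)"])
    (use that C(5) Ph b(2) s bW clinear_on_compose[OF bl[of W] bW Ph'] in auto)
 qed
qed

text \<open>An arbitrary lift may fail to be injective on the kernel of \<open>Ph\<close>. So the
  kernels are matched first, by an isomorphism \<open>kp\<close> agreeing with \<open>ph\<close> on
  \<open>V\<close>; \<open>ph\<close> and \<open>kp\<close> are glued on \<open>V\<close> plus the
  kernel and only then lifted. A vector killed by the lift lies in the kernel of \<open>Ph\<close>,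
  where the lift is \<open>kp\<close>.\<close>

lemma clinear_lift_extend_bij:
 fixes W :: "'a::complex_vector set" and W' :: "'b::complex_vector set"
 assumes W: "fin_dim_subspace W" and V: "cvec.subspace V" "V <= W" and W': "fin_dim_subspace W'"
  and ph: "clinear_on V ph" "ph ` V <= W'" "inj_on ph V"
  and Ph: "clinear_on W Ph" and Ph': "clinear_on W' Ph'"
  and im: "Ph ` W <= Ph' ` W'" and eq: "!!v. v : V ==> Ph' (ph v) = Ph v"
  and dK: "cvec.dim {x : W. Ph x = 0} = cvec.dim {x : W'. Ph' x = 0}"
  and dW: "cvec.dim W = cvec.dim W'"
 obtains b where "clinear_on UNIV b" "bij_betw b W W'" "!!v. v : V ==> b v = ph v"
  "!!w. w : W ==> Ph' (b w) = Ph w"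
proof -
 note sW = fin_dim_subspace_imp_subspace[OF W] and sW' = fin_dim_subspace_imp_subspace[OF W']
 let ?K = "{x : W. Ph x = 0}" and ?K' = "{x : W'. Ph' x = 0}"
 have K: "fin_dim_subspace ?K" and K': "fin_dim_subspace ?K'"
  using W W' clinear_on_kernel_subspace[OF Ph sW] clinear_on_kernel_subspace[OF Ph' sW']
  by (auto intro: fin_dim_subspace_subset)
 note sK = fin_dim_subspace_imp_subspace[OF K] and sK' = fin_dim_subspace_imp_subspace[OF K']
 have VK: "cvec.subspace (V Int ?K)" "V Int ?K <= ?K"
  using cvec.subspace_inter[OF V(1) sK] by auto
 have "EX kp. clinear_on UNIV kp & bij_betw kp ?K ?K' & (ALL x:V Int ?K. kp x = ph x)"
 proof -
  let ?A = "V Int ?K" and ?A' = "ph ` (V Int ?K)"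
  have phA: "clinear_on ?A ph" using clinear_on_subset[OF ph(1)] by blast
  have A': "cvec.subspace ?A'" "?A' <= ?K'"
   using clinear_on_image_subspace[OF phA VK(1)] eq ph(2) by auto
  have fA: "fin_dim_subspace ?A" using fin_dim_subspace_subset[OF K VK] .
  have dA: "cvec.dim ?A' = cvec.dim ?A"
   by (rule cvec_dim_inj_image[OF fA phA]) (rule inj_on_subset[OF ph(3)], blast)
  have inA: "inj_on ph ?A" by (rule inj_on_subset[OF ph(3)]) blast
  obtain p :: "'a => 'a" where p: "Vector_Spaces.linear scaleC scaleC p" "{x : ?K. p x = 0} = ?A"
   "fin_dim_subspace (p ` ?K)"
   using quotient_space_exists[OF K VK] by blast
  obtain p' :: "'b => 'b" where p': "Vector_Spaces.linear scaleC scaleC p'" "{x : ?K'. p' x = 0} = ?A'"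
   "fin_dim_subspace (p' ` ?K')"
   using quotient_space_exists[OF K' A'] by blast
  have pl: "clinear_on S p" for S using p(1) linear_iff_clinear_on clinear_on_subset by blast
  have pl': "clinear_on S p'" for S using p'(1) linear_iff_clinear_on clinear_on_subset by blast
  \<comment> \<open>Since \<open>ph\<close> is injective, the quotients of the two kernels by
    \<open>V Int ?K\<close> and by its image have equal dimension; an isomorphism \<open>t\<close>
    between them is then lifted to \<open>kp\<close>.\<close>
  have "cvec.dim (p ` ?K) = cvec.dim (p' ` ?K')"
   using clinear_on_rank_nullity[OF K pl] clinear_on_rank_nullity[OF K' pl'] dA dK p(2) p'(2) by simp
  then obtain t where t: "clinear_on UNIV t" "bij_betw t (p ` ?K) (p' ` ?K')"
   using clinear_bij_exists[OF p(3) p'(3)] by metis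
  have tl: "clinear_on S t" for S using clinear_on_subset[OF t(1)] by blast
  have tp: "clinear_on S (%x. t (p x))" for S
   by (rule clinear_on_compose[OF pl _ t(1)]) auto
  obtain kp where kp: "clinear_on UNIV kp" "kp ` ?K <= ?K'" "!!v. v : ?A ==> kp v = ph v"
   "!!w. w : ?K ==> p' (kp w) = t (p w)"
  proof (rule clinear_lift_extend[OF K VK sK' phA A'(2) tp pl'])
   show "(%x. t (p x)) ` ?K <= p' ` ?K'" using t(2) unfolding bij_betw_def by blast
   fix v assume "v : ?A"
   then have "p v = 0" "p' (ph v) = 0" using p(2) p'(2) by blast+
   then show "p' (ph v) = t (p v)" using clinear_on_0[OF t(1)] by simp
  qed blast
  have kpl: "clinear_on S kp" for S using clinear_on_subset[OF kp(1)] by blast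
  have "inj_on kp ?K"
   unfolding clinear_on_inj_iff[OF kpl sK]
  proof (intro ballI impI)
   fix x assume x: "x : ?K" "kp x = 0"
   then have "t (p x) = 0" using kp(4) clinear_on_0[OF pl'[of UNIV]] by force
   then have "p x = 0"
    using t(2) x(1) clinear_on_inj_iff[OF tl clinear_on_image_subspace[OF pl sK]]
    unfolding bij_betw_def by blast
   then have "x : ?A" using x(1) p(2) by blast
   then show "x = 0" using kp(3) x(2) inA clinear_on_inj_iff[OF phA VK(1)] by auto
  qed
  then have "bij_betw kp ?K ?K'"
   using clinear_on_inj_imp_bij[OF K K' kpl _ kp(2)] dK by simp
  then show ?thesis using kp(1,3) by blast
 qed
 then obtain kp where kp: "clinear_on UNIV kp" "bij_betw kp ?K ?K'" "!!x. x : V ==> x : ?K ==> kp x = ph x"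
  by blast
 have kpl: "clinear_on S kp" for S using clinear_on_subset[OF kp(1)] by blast
 obtain h where h: "clinear_on UNIV h" "!!x. x : V ==> h x = ph x" "!!x. x : ?K ==> h x = kp x"
  by (rule clinear_glue[OF fin_dim_subspace_subset[OF W V] K ph(1) kpl[of ?K]]) (use kp(3) in auto)
 have hl: "clinear_on S h" for S using clinear_on_subset[OF h(1)] by blast
 let ?S = "{x + y | x y. x : V & y : ?K}"
 have S: "cvec.subspace ?S" "?S <= W"
  using cvec.subspace_sums[OF V(1) sK] V(2) cvec.subspace_add[OF sW] by auto
 have kpK: "kp y : ?K'" if "y : ?K" for y using kp(2) that unfolding bij_betw_def by blast
 have hS: "h z : W' & Ph' (h z) = Ph z" if zS: "z : ?S" for z
 proof -
  obtain x y where z: "z = x + y" "x : V" "y : ?K" using zS by blast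
  have hz: "h z = ph x + kp y" using z h(2,3) clinear_on_add[OF h(1)] by simp
  have "ph x : W'" "kp y : W'" using z ph(2) kpK by blast+
  moreover have "Ph z = Ph x" using z clinear_on_add[OF Ph] V(2) by auto
  moreover have "Ph' (kp y) = 0" using kpK[OF z(3)] by blast
  ultimately show ?thesis
   using hz clinear_on_add[OF Ph'] cvec.subspace_add[OF sW'] eq[OF z(2)] by simp
 qed
 obtain b where b: "clinear_on UNIV b" "b ` W <= W'" "!!v. v : ?S ==> b v = h v"
  "!!w. w : W ==> Ph' (b w) = Ph w"
  by (rule clinear_lift_extend[OF W S sW' hl[of ?S] _ Ph Ph' im]) (use hS in blast)+
 have bl: "clinear_on S b" for S using clinear_on_subset[OF b(1)] by blast
 have VS: "V <= ?S" "?K <= ?S"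
  using cvec.subspace_0[OF V(1)] cvec.subspace_0[OF sK]
  by (blast intro: add.right_neutral[symmetric] add.left_neutral[symmetric])+
 have "inj_on b W"
  unfolding clinear_on_inj_iff[OF bl sW]
 proof (intro ballI impI)
  fix x assume x: "x : W" "b x = 0"
  then have "x : ?K" using b(4) clinear_on_0[OF Ph' sW'] by force
  then have "kp x = 0" using b(3) h(3) x VS by (metis (no_types, lifting) subsetD)
  then show "x = 0"
   using \<open>x : ?K\<close> kp(2) clinear_on_inj_iff[OF kpl sK] unfolding bij_betw_def by blast
 qed
 then have "bij_betw b W W'"
  using clinear_on_inj_imp_bij[OF W W' bl _ b(2)] dW by simp
 moreover have "b v = ph v" if "v : V" for v
  using b(3) h(2) VS that by (metis (no_types, lifting) subsetD)
 ultimately show ?thesis using that b(1,4) by blast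
qed

subsection \<open>Representations and homomorphisms\<close>

lemma rep_fin_dim: "is_rep Q M ==> i : verts Q ==> fin_dim_subspace (rep_space M i)"
 by (simp add: is_rep_def)

lemma rep_subspace: "is_rep Q M ==> i : verts Q ==> cvec.subspace (rep_space M i)"
 by (rule fin_dim_subspace_imp_subspace[OF rep_fin_dim])

lemma rep_map_clinear: "is_rep Q M ==> a : arcs Q ==> clinear_on (rep_space M (tail Q a)) (rep_map M a)"
 by (simp add: is_rep_def)

lemma rep_map_in:
 "is_rep Q M ==> a : arcs Q ==> x : rep_space M (tail Q a) ==> rep_map M a x : rep_space M (head Q a)"
 by (simp add: is_rep_def image_subset_iff)

lemma is_repI:
 assumes "!!i. i : verts Q ==> fin_dim_subspace (rep_space M i)"
  and "!!a. a : arcs Q ==> clinear_on (rep_space M (tail Q a)) (rep_map M a)"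
  and "!!a x. a : arcs Q ==> x : rep_space M (tail Q a) ==> rep_map M a x : rep_space M (head Q a)"
 shows "is_rep Q M"
 using assms by (simp add: is_rep_def image_subset_iff)

lemma is_subrepD:
 assumes "is_subrep Q M U"
 shows "U : extensional (verts Q)"
  and "i : verts Q ==> cvec.subspace (U i)"
  and "i : verts Q ==> U i <= rep_space M i"
  and "a : arcs Q ==> x : U (tail Q a) ==> rep_map M a x : U (head Q a)"
 using assms by (simp_all add: is_subrep_def image_subset_iff)

lemma is_subrepI:
 assumes "U : extensional (verts Q)" and "!!i. i : verts Q ==> cvec.subspace (U i)"
  and "!!i. i : verts Q ==> U i <= rep_space M i"
  and "!!a x. a : arcs Q ==> x : U (tail Q a) ==> rep_map M a x : U (head Q a)"
 shows "is_subrep Q M U"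
 using assms by (simp add: is_subrep_def image_subset_iff)

lemma subrep_simps [simp]: "rep_space (subrep M U) = U" "rep_map (subrep M U) = rep_map M"
 unfolding subrep_def by simp_all

lemma is_rep_subrep:
 assumes Q: "wf_digraph Q" and M: "is_rep Q M" and U: "is_subrep Q M U"
 shows "is_rep Q (subrep M U)"
proof (rule is_repI)
 note U' = is_subrepD[OF U] and t = wf_digraph.tail_in_verts[OF Q]
 fix i assume i: "i : verts Q"
 then show "fin_dim_subspace (rep_space (subrep M U) i)"
  using fin_dim_subspace_subset[OF rep_fin_dim[OF M i] U'(2,3)] by simp
next
 fix a assume a: "a : arcs Q"
 show "clinear_on (rep_space (subrep M U) (tail Q a)) (rep_map (subrep M U) a)"
  using clinear_on_subset[OF rep_map_clinear[OF M a] is_subrepD(3)[OF U wf_digraph.tail_in_verts[OF Q a]]]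
  by simp
qed (use is_subrepD(4)[OF U] in auto)

lemma rep_Hom_eqI:
 assumes "f : rep_Hom Q M N" "g : rep_Hom Q M N"
  and "!!i x. i : verts Q ==> x : rep_space M i ==> f i x = g i x"
 shows "f = g"
proof
 fix i
 show "f i = g i"
 proof (cases "i : verts Q")
  case True
  then have "f i : rep_space M i \<rightarrow>\<^sub>E rep_space N i" "g i : rep_space M i \<rightarrow>\<^sub>E rep_space N i"
   using assms(1,2) unfolding rep_Hom_def by auto
  then show ?thesis using assms(3)[OF True] by (intro PiE_ext) auto
 next
  case False
  then show ?thesis using assms(1,2) unfolding rep_Hom_def by (auto simp: PiE_def extensional_def)
 qed
qed

lemma rep_comp_apply [simp]:
 "i : verts Q ==> x : rep_space M i ==> rep_comp Q M g f i x = g i (f i x)"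
 unfolding rep_comp_def by (simp add: compose_eq)

lemma rep_comp_eq_restrict:
 "rep_comp Q M g f = (\<lambda>i\<in>verts Q. \<lambda>x\<in>rep_space M i. g i (f i x))"
 unfolding rep_comp_def compose_def by auto

lemma rep_Hom_comp:
 assumes Q: "wf_digraph Q" and M: "is_rep Q M" and f: "f : rep_Hom Q M N" and g: "g : rep_Hom Q N K"
 shows "rep_comp Q M g f : rep_Hom Q M K"
 unfolding rep_comp_eq_restrict
proof (rule rep_HomI[OF _ _ _ Q M])
 fix i assume i: "i : verts Q"
 show "clinear_on (rep_space M i) (%x. g i (f i x))"
  using clinear_on_compose[OF rep_HomD(2)[OF f i] _ rep_HomD(2)[OF g i]] rep_HomD(1)[OF f i] by blast
next
 fix i x assume "i : verts Q" "x : rep_space M i"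
 then show "g i (f i x) : rep_space K i" using rep_HomD(1)[OF f] rep_HomD(1)[OF g] by blast
next
 fix a x assume a: "a : arcs Q" and x: "x : rep_space M (tail Q a)"
 show "g (head Q a) (f (head Q a) (rep_map M a x)) = rep_map K a (g (tail Q a) (f (tail Q a) x))"
  using rep_HomD(3)[OF f a x]
   rep_HomD(3)[OF g a rep_HomD(1)[OF f wf_digraph.tail_in_verts[OF Q a] x]] by simp
qed

lemma rep_iso_Hom: "f : rep_iso Q M N ==> f : rep_Hom Q M N"
 unfolding rep_iso_def by blast

lemma rep_iso_bij: "f : rep_iso Q M N ==> i : verts Q ==> bij_betw (f i) (rep_space M i) (rep_space N i)"
 unfolding rep_iso_def by blast

lemma rep_isoI:
 "f : rep_Hom Q M N ==> (!!i. i : verts Q ==> bij_betw (f i) (rep_space M i) (rep_space N i)) ==>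
  f : rep_iso Q M N"
 unfolding rep_iso_def by blast

lemma rep_iso_comp:
 assumes Q: "wf_digraph Q" and M: "is_rep Q M" and f: "f : rep_iso Q M N" and g: "g : rep_iso Q N K"
 shows "rep_comp Q M g f : rep_iso Q M K"
proof (rule rep_isoI[OF rep_Hom_comp[OF Q M rep_iso_Hom[OF f] rep_iso_Hom[OF g]]])
 fix i assume i: "i : verts Q"
 have "bij_betw (g i o f i) (rep_space M i) (rep_space K i)"
  using bij_betw_trans[OF rep_iso_bij[OF f i] rep_iso_bij[OF g i]] .
 then show "bij_betw (rep_comp Q M g f i) (rep_space M i) (rep_space K i)"
  using i by (subst bij_betw_cong[where g="g i o f i"]) auto
qed

definition rep_id :: "('v, 'e) pre_digraph => ('v, 'e, 'a) rep => 'v => 'a => 'a" where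
 "rep_id Q M = (\<lambda>i\<in>verts Q. \<lambda>x\<in>rep_space M i. x)"

lemma rep_id_apply [simp]: "i : verts Q ==> x : rep_space M i ==> rep_id Q M i x = x"
 unfolding rep_id_def by simp

lemma rep_id_iso:
 assumes Q: "wf_digraph Q" and M: "is_rep Q M"
 shows "rep_id Q M : rep_iso Q M M"
proof (rule rep_isoI)
 show "rep_id Q M : rep_Hom Q M M"
  unfolding rep_id_def by (rule rep_HomI[OF _ _ _ Q M]) (auto intro: clinear_on_id)
 fix i assume i: "i : verts Q"
 show "bij_betw (rep_id Q M i) (rep_space M i) (rep_space M i)"
  using i by (subst bij_betw_cong[where g="%x. x"]) (auto simp: bij_betw_def)
qed

definition rep_inv :: "('v, 'e) pre_digraph => ('v, 'e, 'a) rep => ('v, 'e, 'b) rep =>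
  ('v => 'a => 'b) => 'v => 'b => 'a" where
 "rep_inv Q M N f = (\<lambda>i\<in>verts Q. \<lambda>x\<in>rep_space N i. inv_into (rep_space M i) (f i) x)"

lemma rep_inv_apply:
 assumes "f : rep_iso Q M N" "i : verts Q"
 shows "x : rep_space M i ==> rep_inv Q M N f i (f i x) = x"
  and "y : rep_space N i ==> f i (rep_inv Q M N f i y) = y"
  and "y : rep_space N i ==> rep_inv Q M N f i y : rep_space M i"
 using rep_iso_bij[OF assms] assms(2) unfolding rep_inv_def
 by (auto simp: bij_betw_inv_into_left bij_betw_inv_into_right bij_betw_def intro: inv_into_into)

lemma rep_inv_iso:
 assumes Q: "wf_digraph Q" and M: "is_rep Q M" and N: "is_rep Q N" and f: "f : rep_iso Q M N"
 shows "rep_inv Q M N f : rep_iso Q N M"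
proof (rule rep_isoI)
 note fH = rep_iso_Hom[OF f]
 show "rep_inv Q M N f : rep_Hom Q N M"
  unfolding rep_inv_def
 proof (rule rep_HomI[OF _ _ _ Q N])
  fix i x assume i: "i : verts Q" and x: "x : rep_space N i"
  then show "inv_into (rep_space M i) (f i) x : rep_space M i"
   using rep_inv_apply(3)[OF f i x] unfolding rep_inv_def by simp
 next
  fix i assume i: "i : verts Q"
  show "clinear_on (rep_space N i) (inv_into (rep_space M i) (f i))"
   by (rule clinear_on_inv_into[OF rep_HomD(2)[OF fH i] rep_subspace[OF M i] rep_iso_bij[OF f i]])
 next
  fix a y assume a: "a : arcs Q" and y: "y : rep_space N (tail Q a)"
  note t = wf_digraph.tail_in_verts[OF Q a] and h = wf_digraph.head_in_verts[OF Q a]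
  define x where "x = rep_inv Q M N f (tail Q a) y"
  have x: "x : rep_space M (tail Q a)" "f (tail Q a) x = y"
   using rep_inv_apply(2,3)[OF f t y] unfolding x_def by auto
  have "rep_inv Q M N f (head Q a) (rep_map N a y) = rep_map M a x"
   using rep_HomD(3)[OF fH a x(1)] x(2) rep_inv_apply(1)[OF f h rep_map_in[OF M a x(1)]] by simp
  then show "inv_into (rep_space M (head Q a)) (f (head Q a)) (rep_map N a y) =
    rep_map M a (inv_into (rep_space M (tail Q a)) (f (tail Q a)) y)"
   using t h y rep_map_in[OF N a y] unfolding x_def rep_inv_def by simp
 qed
 fix i assume i: "i : verts Q"
 have "bij_betw (inv_into (rep_space M i) (f i)) (rep_space N i) (rep_space M i)"
  using bij_betw_inv_into[OF rep_iso_bij[OF f i]] .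
 then show "bij_betw (rep_inv Q M N f i) (rep_space N i) (rep_space M i)"
  using i unfolding rep_inv_def by (subst bij_betw_cong[where g="inv_into (rep_space M i) (f i)"]) auto
qed

lemma rep_isomorphic_refl: "wf_digraph Q ==> is_rep Q M ==> rep_isomorphic Q M M"
 unfolding rep_isomorphic_def using rep_id_iso by blast

lemma rep_isomorphic_sym:
 "wf_digraph Q ==> is_rep Q M ==> is_rep Q N ==> rep_isomorphic Q M N ==> rep_isomorphic Q N M"
 unfolding rep_isomorphic_def using rep_inv_iso by blast

lemma rep_isomorphic_trans:
 "wf_digraph Q ==> is_rep Q M ==> rep_isomorphic Q M N ==> rep_isomorphic Q N K ==> rep_isomorphic Q M K"
 unfolding rep_isomorphic_def using rep_iso_comp by blast

lemma iso_class_eq_iff: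
 assumes Q: "wf_digraph Q" and M: "is_rep Q M" and N: "is_rep Q N"
 shows "iso_class Q M = iso_class Q N \<longleftrightarrow> rep_isomorphic Q M N"
proof
 assume "iso_class Q M = iso_class Q N"
 moreover have "N : iso_class Q N"
  unfolding iso_class_def using N rep_isomorphic_refl[OF Q N] by blast
 ultimately show "rep_isomorphic Q M N" unfolding iso_class_def by blast
next
 assume "rep_isomorphic Q M N"
 then show "iso_class Q M = iso_class Q N"
  unfolding iso_class_def using rep_isomorphic_trans[OF Q] rep_isomorphic_sym[OF Q] M N by blast
qed

lemma rep_isomorphic_dim:
 assumes M: "is_rep Q M" and iso: "rep_isomorphic Q M N" and i: "i : verts Q"
 shows "cvec.dim (rep_space N i) = cvec.dim (rep_space M i)"
proof -
 obtain f where f: "f : rep_iso Q M N" using iso unfolding rep_isomorphic_def by blast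
 show ?thesis
  using cvec_dim_inj_image[OF rep_fin_dim[OF M i] rep_HomD(2)[OF rep_iso_Hom[OF f] i]]
   rep_iso_bij[OF f i] unfolding bij_betw_def by simp
qed

section \<open>Change of the ambient space\<close>

lemma rep_transport:
 fixes M :: "('v, 'e, 'a::complex_vector) rep"
 assumes Q: "wf_digraph Q" and M: "is_rep Q M"
  and ph: "!!i. i : verts Q ==> clinear_on (rep_space M i) (ph i)"
  and inj: "!!i. i : verts Q ==> inj_on (ph i) (rep_space M i)"
 defines "M' == \<lparr>rep_space = (%i. ph i ` rep_space M i),
  rep_map = (%a y. ph (head Q a) (rep_map M a (inv_into (rep_space M (tail Q a)) (ph (tail Q a)) y)))\<rparr>"
 shows "is_rep Q M'" "(\<lambda>i\<in>verts Q. \<lambda>x\<in>rep_space M i. ph i x) : rep_iso Q M M'"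
proof -
 note t = wf_digraph.tail_in_verts[OF Q] and h = wf_digraph.head_in_verts[OF Q]
 have bij: "bij_betw (ph i) (rep_space M i) (rep_space M' i)" if "i : verts Q" for i
  using inj[OF that] unfolding M'_def bij_betw_def by simp
 show "is_rep Q M'"
 proof (rule is_repI)
  fix i assume i: "i : verts Q"
  then show "fin_dim_subspace (rep_space M' i)"
   unfolding M'_def using fin_dim_subspace_image[OF rep_fin_dim[OF M i] ph[OF i]] by simp
 next
  fix a assume a: "a : arcs Q"
  let ?t = "tail Q a" and ?h = "head Q a"
  note iv = clinear_on_inv_into[OF ph[OF t[OF a]] rep_subspace[OF M t[OF a]] bij[OF t[OF a]]]
  have im: "inv_into (rep_space M ?t) (ph ?t) ` rep_space M' ?t <= rep_space M ?t"
   using bij_betw_inv_into[OF bij[OF t[OF a]]] unfolding bij_betw_def by simp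
  show "clinear_on (rep_space M' ?t) (rep_map M' a)"
   using clinear_on_compose[OF clinear_on_compose[OF iv im rep_map_clinear[OF M a]] _ ph[OF h[OF a]]]
    im rep_map_in[OF M a] unfolding M'_def by auto
  fix y assume "y : rep_space M' ?t"
  then show "rep_map M' a y : rep_space M' ?h"
   using im rep_map_in[OF M a] unfolding M'_def by auto
 qed
 show "(\<lambda>i\<in>verts Q. \<lambda>x\<in>rep_space M i. ph i x) : rep_iso Q M M'"
 proof (rule rep_isoI)
  show "(\<lambda>i\<in>verts Q. \<lambda>x\<in>rep_space M i. ph i x) : rep_Hom Q M M'"
  proof (rule rep_HomI[OF _ ph _ Q M])
   fix i x assume "i : verts Q" "x : rep_space M i"
   then show "ph i x : rep_space M' i" unfolding M'_def by simp
  next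
   fix a x assume a: "a : arcs Q" and x: "x : rep_space M (tail Q a)"
   then show "ph (head Q a) (rep_map M a x) = rep_map M' a (ph (tail Q a) x)"
    unfolding M'_def using inj[OF t[OF a]] by simp
  qed
  fix i assume i: "i : verts Q"
  show "bij_betw ((\<lambda>i\<in>verts Q. \<lambda>x\<in>rep_space M i. ph i x) i) (rep_space M i) (rep_space M' i)"
   using bij[OF i] i by (subst bij_betw_cong[where g="ph i"]) auto
 qed
qed

lemma rep_embed:
 fixes M :: "('v, 'e, 'a::complex_vector) rep"
 assumes Q: "wf_digraph Q" and M: "is_rep Q M"
 obtains M' :: "('v, 'e, nat => complex) rep" and ph where "is_rep Q M'" "ph : rep_iso Q M M'"
proof -
 have "ALL i:verts Q. EX f :: 'a => nat => complex. clinear_on (rep_space M i) f & inj_on f (rep_space M i)"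
 proof
  fix i assume i: "i : verts Q"
  obtain f :: "'a => nat => complex" where "clinear_on UNIV f" "inj_on f (rep_space M i)"
   by (rule clinear_embed[OF rep_fin_dim[OF M i]])
  then show "EX f :: 'a => nat => complex. clinear_on (rep_space M i) f & inj_on f (rep_space M i)"
   using clinear_on_subset by blast
 qed
 from bchoice[OF this] obtain ph :: "'v => 'a => nat => complex" where
  "ALL i:verts Q. clinear_on (rep_space M i) (ph i) & inj_on (ph i) (rep_space M i)" by blast
 then show ?thesis
  using rep_transport[OF Q M, of ph] that by blast
qed

text \<open>The definition quantifies over test objects in \<open>nat => complex\<close> only;
  embedding \<open>M\<close> and \<open>N\<close> there and conjugating \<open>f\<close> and
  \<open>g\<close> removes the restriction on ambient types.\<close>

lemma projective_rep_lift:
 fixes P :: "('v, 'e, 'a::complex_vector) rep" and M :: "('v, 'e, 'b::complex_vector) rep"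
  and N :: "('v, 'e, 'c::complex_vector) rep"
 assumes Q: "wf_digraph Q" and P: "projective_rep Q P" and M: "is_rep Q M" and N: "is_rep Q N"
  and f: "f : rep_epi Q M N" and g: "g : rep_Hom Q P N"
 obtains h where "h : rep_Hom Q P M"
  "!!i x. i : verts Q ==> x : rep_space P i ==> f i (h i x) = g i x"
proof -
 have rP: "is_rep Q P" using P unfolding projective_rep_def by blast
 obtain M' :: "('v, 'e, nat => complex) rep" and ph where M': "is_rep Q M'" "ph : rep_iso Q M M'"
  by (rule rep_embed[OF Q M])
 obtain N' :: "('v, 'e, nat => complex) rep" and ps where N': "is_rep Q N'" "ps : rep_iso Q N N'"
  by (rule rep_embed[OF Q N])
 define ph' where "ph' = rep_inv Q M M' ph"
 have ph': "ph' : rep_iso Q M' M" unfolding ph'_def by (rule rep_inv_iso[OF Q M M'])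
 have fH: "f : rep_Hom Q M N" and fs: "!!i. i : verts Q ==> f i ` rep_space M i = rep_space N i"
  using f unfolding rep_epi_def by auto
 let ?f' = "rep_comp Q M' ps (rep_comp Q M' f ph')"
 have f'H: "?f' : rep_Hom Q M' N'"
  by (rule rep_Hom_comp[OF Q M'(1) rep_Hom_comp[OF Q M'(1) rep_iso_Hom[OF ph'] fH] rep_iso_Hom[OF N'(2)]])
 have "?f' i ` rep_space M' i = rep_space N' i" if i: "i : verts Q" for i
 proof -
  have "?f' i ` rep_space M' i = (%x. ps i (f i (ph' i x))) ` rep_space M' i"
   using i by (intro image_cong) auto
  also have "... = ps i ` (f i ` (ph' i ` rep_space M' i))" by (simp add: image_image)
  also have "... = rep_space N' i"
   using rep_iso_bij[OF ph' i] rep_iso_bij[OF N'(2) i] fs[OF i] unfolding bij_betw_def by simp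
  finally show ?thesis .
 qed
 then have f'E: "?f' : rep_epi Q M' N'" using f'H unfolding rep_epi_def by blast
 have "rep_comp Q P ps g : rep_Hom Q P N'"
  by (rule rep_Hom_comp[OF Q rP g rep_iso_Hom[OF N'(2)]])
 then obtain h where h: "h : rep_Hom Q P M'" "rep_comp Q P ?f' h = rep_comp Q P ps g"
  using P M'(1) N'(1) f'E unfolding projective_rep_def by blast
 show ?thesis
 proof (rule that)
  show "rep_comp Q P ph' h : rep_Hom Q P M"
   by (rule rep_Hom_comp[OF Q rP h(1) rep_iso_Hom[OF ph']])
  fix i x assume i: "i : verts Q" and x: "x : rep_space P i"
  have hx: "h i x : rep_space M' i" using rep_HomD(1)[OF h(1) i x] .
  have in_N: "f i (ph' i (h i x)) : rep_space N i"
   using rep_HomD(1)[OF fH i rep_HomD(1)[OF rep_iso_Hom[OF ph'] i hx]] .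
  have "rep_comp Q P ?f' h i x = rep_comp Q P ps g i x" using h(2) by simp
  then have "ps i (f i (ph' i (h i x))) = ps i (g i x)" using i x hx by simp
  then have "f i (ph' i (h i x)) = g i x"
   using rep_iso_bij[OF N'(2) i] in_N rep_HomD(1)[OF g i x] unfolding bij_betw_def inj_on_def by blast
  then show "f i (rep_comp Q P ph' h i x) = g i x" using i x by simp
 qed
qed

lemma injective_rep_extend:
 fixes I :: "('v, 'e, 'a::complex_vector) rep" and M :: "('v, 'e, 'b::complex_vector) rep"
  and N :: "('v, 'e, 'c::complex_vector) rep"
 assumes Q: "wf_digraph Q" and I: "injective_rep Q I" and M: "is_rep Q M" and N: "is_rep Q N"
  and f: "f : rep_mono Q M N" and g: "g : rep_Hom Q M I"
 obtains h where "h : rep_Hom Q N I"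
  "!!i x. i : verts Q ==> x : rep_space M i ==> h i (f i x) = g i x"
proof -
 obtain M' :: "('v, 'e, nat => complex) rep" and ph where M': "is_rep Q M'" "ph : rep_iso Q M M'"
  by (rule rep_embed[OF Q M])
 obtain N' :: "('v, 'e, nat => complex) rep" and ps where N': "is_rep Q N'" "ps : rep_iso Q N N'"
  by (rule rep_embed[OF Q N])
 define ph' where "ph' = rep_inv Q M M' ph"
 have ph': "ph' : rep_iso Q M' M" unfolding ph'_def by (rule rep_inv_iso[OF Q M M'])
 have fH: "f : rep_Hom Q M N" and fi: "!!i. i : verts Q ==> inj_on (f i) (rep_space M i)"
  using f unfolding rep_mono_def by auto
 let ?f' = "rep_comp Q M' ps (rep_comp Q M' f ph')"
 have f'H: "?f' : rep_Hom Q M' N'"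
  by (rule rep_Hom_comp[OF Q M'(1) rep_Hom_comp[OF Q M'(1) rep_iso_Hom[OF ph'] fH] rep_iso_Hom[OF N'(2)]])
 have "inj_on (?f' i) (rep_space M' i)" if i: "i : verts Q" for i
 proof -
  have "inj_on (ps i o (f i o ph' i)) (rep_space M' i)"
   using rep_iso_bij[OF ph' i] rep_iso_bij[OF N'(2) i] fi[OF i] rep_HomD(1)[OF fH i]
   by (intro comp_inj_on) (auto simp: bij_betw_def image_image intro: inj_on_subset)
  then show ?thesis using i by (subst inj_on_cong[where g="ps i o (f i o ph' i)"]) auto
 qed
 then have f'M: "?f' : rep_mono Q M' N'" using f'H unfolding rep_mono_def by blast
 have "rep_comp Q M' g ph' : rep_Hom Q M' I"
  by (rule rep_Hom_comp[OF Q M'(1) rep_iso_Hom[OF ph'] g])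
 then obtain h where h: "h : rep_Hom Q N' I" "rep_comp Q M' h ?f' = rep_comp Q M' g ph'"
  using I M'(1) N'(1) f'M unfolding injective_rep_def by blast
 show ?thesis
 proof (rule that)
  show "rep_comp Q N h ps : rep_Hom Q N I"
   by (rule rep_Hom_comp[OF Q N rep_iso_Hom[OF N'(2)] h(1)])
  fix i x assume i: "i : verts Q" and x: "x : rep_space M i"
  define y where "y = ph i x"
  have y: "y : rep_space M' i" "ph' i y = x"
   using rep_HomD(1)[OF rep_iso_Hom[OF M'(2)] i x] rep_inv_apply(1)[OF M'(2) i x]
   unfolding y_def ph'_def by auto
  have "rep_comp Q M' h ?f' i y = rep_comp Q M' g ph' i y" using h(2) by simp
  then have "h i (ps i (f i x)) = g i x" using i y by simp
  then show "rep_comp Q N h ps i (f i x) = g i x" using i x rep_HomD(1)[OF fH i x] by simp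
 qed
qed

subsection \<open>Local characterizations of projectives and injectives\<close>

text \<open>An external direct sum whose summands share one ambient type. Families are 0 off
  \<open>A\<close>, which makes it a subspace of a function type and reduces equality of families to
  equality on \<open>A\<close>.\<close>

definition dsum :: "'e set => ('e => 'a::complex_vector set) => ('e => 'a) set" where
 "dsum A V = {x. (ALL a:A. x a : V a) & (ALL a. a ~: A --> x a = 0)}"

lemma dsum_subspace: "(!!a. a : A ==> cvec.subspace (V a)) ==> cvec.subspace (dsum A V)"
 unfolding dsum_def cvec.subspace_def by (auto simp: scaleC_fun_def)

lemma dsum_fin_dim:
 assumes "finite A" "!!a. a : A ==> fin_dim_subspace (V a)"
 shows "fin_dim_subspace (dsum A V) & cvec.dim (dsum A V) = (SUM a:A. cvec.dim (V a))"
 using assms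
proof (induction A rule: finite_induct)
 case empty
 have "dsum {} V = {0}" unfolding dsum_def by (auto simp: fun_eq_iff)
 then show ?case using fin_dim_subspace_zero cvec_dim_zero by simp
next
 case (insert a A)
 let ?f = "%(v, x). (%b. if b = a then v else x b)"
 have IH: "fin_dim_subspace (dsum A V)" "cvec.dim (dsum A V) = (SUM a:A. cvec.dim (V a))"
  using insert by auto
 have Va: "fin_dim_subspace (V a)" using insert by simp
 have lin: "clinear_on (V a \<times> dsum A V) ?f"
  unfolding clinear_on_def by (auto simp: scaleC_prod_def scaleC_fun_def fun_eq_iff)
 have fin: "fin_dim_subspace (V a \<times> dsum A V)" by (rule fin_dim_subspace_Times[OF Va IH(1)])
 have inj: "inj_on ?f (V a \<times> dsum A V)"
  using insert(2) by (auto simp: inj_on_def dsum_def fun_eq_iff)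
 have im: "?f ` (V a \<times> dsum A V) = dsum (insert a A) V"
 proof
  show "?f ` (V a \<times> dsum A V) <= dsum (insert a A) V" unfolding dsum_def by auto
  show "dsum (insert a A) V <= ?f ` (V a \<times> dsum A V)"
  proof
   fix x assume x: "x : dsum (insert a A) V"
   have "(x a, x(a := 0)) : V a \<times> dsum A V"
    using x insert(2) unfolding dsum_def by auto
   moreover have "x = ?f (x a, x(a := 0))" by (auto simp: fun_eq_iff)
   ultimately show "x : ?f ` (V a \<times> dsum A V)" by blast
  qed
 qed
 show ?case
  using fin_dim_subspace_image[OF fin lin] cvec_dim_inj_image[OF fin lin inj]
   cvec_dim_Times[OF Va IH(1)] IH(2) insert(1,2) im by simp
qed

definition in_arcs_injective :: "('v, 'e) pre_digraph => ('v, 'e, 'a::complex_vector) rep => bool" where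
 "in_arcs_injective Q M \<longleftrightarrow> (ALL i:verts Q. ALL x. (ALL a:in_arcs Q i. x a : rep_space M (tail Q a)) -->
  (SUM a:in_arcs Q i. rep_map M a (x a)) = 0 --> (ALL a:in_arcs Q i. x a = 0))"

definition out_arcs_surjective :: "('v, 'e) pre_digraph => ('v, 'e, 'a::complex_vector) rep => bool" where
 "out_arcs_surjective Q M \<longleftrightarrow> (ALL i:verts Q. ALL y. (ALL a:out_arcs Q i. y a : rep_space M (head Q a)) -->
  (EX x:rep_space M i. ALL a:out_arcs Q i. rep_map M a x = y a))"

lemma in_arcs_injective_subrep:
 assumes Q: "wf_digraph Q" and U: "is_subrep Q M U" and M: "in_arcs_injective Q M"
 shows "in_arcs_injective Q (subrep M U)"
proof -
 have "U (tail Q a) <= rep_space M (tail Q a)" if "a : in_arcs Q i" for a i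
  using that is_subrepD(3)[OF U] wf_digraph.tail_in_verts[OF Q] by (auto simp: in_arcs_def)
 then show ?thesis using M unfolding in_arcs_injective_def by (simp add: subset_iff)
qed

lemma in_arcs_sum_clinear:
 assumes M: "is_rep Q M"
 shows "clinear_on (dsum (in_arcs Q i) (%a. rep_space M (tail Q a)))
  (%x. SUM a:in_arcs Q i. rep_map M a (x a))"
proof (rule clinear_on_sum_fun)
 fix a assume a: "a : in_arcs Q i"
 have "clinear_on (dsum (in_arcs Q i) (%a. rep_space M (tail Q a))) (%x. x a)"
  unfolding clinear_on_def by (simp add: scaleC_fun_def)
 moreover have "a : arcs Q" using a by (simp add: in_arcs_def)
 ultimately show "clinear_on (dsum (in_arcs Q i) (%a. rep_space M (tail Q a))) (%x. rep_map M a (x a))"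
  using a by (intro clinear_on_compose[OF _ _ rep_map_clinear[OF M]]) (auto simp: dsum_def)
qed

lemma in_arcs_sum_in:
 assumes M: "is_rep Q M" and i: "i : verts Q" and x: "!!a. a : in_arcs Q i ==> x a : rep_space M (tail Q a)"
 shows "(SUM a:in_arcs Q i. rep_map M a (x a)) : rep_space M i"
 using rep_map_in[OF M] x by (intro cvec.subspace_sum[OF rep_subspace[OF M i]]) (auto simp: in_arcs_def)

text \<open>The test map is an epimorphism \<open>f : M -> P\<close> in which \<open>M\<close> has
  an extra summand \<open>D\<close> at \<open>i\<close>, the direct sum of the spaces at the tails
  of the arcs into \<open>i\<close>. In \<open>M\<close> such an arc stores its argument in its own
  slot of \<open>D\<close>, and \<open>f\<close> adds up the slots by the maps of \<open>P\<close>.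
  A section of \<open>f\<close> therefore reads every \<open>x a\<close> off the sum of the images,
  so a zero sum has zero terms.\<close>

lemma projective_in_arcs_injective:
 fixes P :: "('v, 'e, 'a::complex_vector) rep"
 assumes Q: "fin_digraph Q" and nl: "!!a. a : arcs Q ==> tail Q a ~= head Q a" and P: "projective_rep Q P"
 shows "in_arcs_injective Q P"
 unfolding in_arcs_injective_def
proof (intro ballI allI impI)
 interpret fin_digraph Q by (rule Q)
 note wf = wf_digraph_axioms
 have rP: "is_rep Q P" using P unfolding projective_rep_def by blast
 fix i x a0 assume i: "i : verts Q" and x: "ALL a:in_arcs Q i. x a : rep_space P (tail Q a)"
  and s0: "(SUM a:in_arcs Q i. rep_map P a (x a)) = 0" and a0: "a0 : in_arcs Q i"
 let ?A = "in_arcs Q i"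
 define D where "D = dsum ?A (%a. rep_space P (tail Q a))"
 have finA: "finite ?A" using finite_arcs by (simp add: in_arcs_def)
 have fD: "fin_dim_subspace D"
  unfolding D_def using dsum_fin_dim[OF finA, of "%a. rep_space P (tail Q a)"] rep_fin_dim[OF rP] by simp
 define f where "f j z = (if j = i then (SUM a:?A. rep_map P a (fst z a)) else 0) + snd z"
  for j and z :: "('e => 'a) \<times> 'a"
 \<comment> \<open>An arc into \<open>i\<close> moves the \<open>P\<close>-component of its argument
   to a slot of \<open>D\<close>. All other arcs apply \<open>f\<close> first, so that those leaving
   \<open>i\<close> also see the sum of the slots. Since there are no loops, an arc into
   \<open>i\<close> starts where \<open>D\<close> is absent.\<close>
 define M where "M = \<lparr>rep_space = (%j. (if j = i then D else {0}) \<times> rep_space P j),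
  rep_map = (%b z. if head Q b = i then ((%c. if c = b then snd z else 0), 0)
   else (0, rep_map P b (f (tail Q b) z)))\<rparr>"
 have sumD: "(SUM a:?A. rep_map P a (y a)) : rep_space P i" if "y : D" for y
  by (rule in_arcs_sum_in[OF rP i]) (use that in \<open>auto simp: D_def dsum_def\<close>)
 have fM: "f j z : rep_space P j" if "j : verts Q" "z : rep_space M j" for j z
  using that sumD cvec.subspace_add[OF rep_subspace[OF rP]] unfolding f_def M_def
  by (auto split: if_splits)
 have fl: "clinear_on (rep_space M j) (f j)" if "j : verts Q" for j
 proof -
  have "clinear_on (rep_space M i) (%z. SUM a:?A. rep_map P a (fst z a))"
   by (rule clinear_on_compose[OF clinear_on_fst _ in_arcs_sum_clinear[OF rP]])
    (auto simp: M_def D_def)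
  then show ?thesis
   unfolding f_def by (cases "j = i") (auto intro!: clinear_on_plus clinear_on_snd clinear_on_zero)
 qed
 have rM: "is_rep Q M"
 proof (rule is_repI)
  fix j assume "j : verts Q"
  then show "fin_dim_subspace (rep_space M j)"
   unfolding M_def using fD fin_dim_subspace_zero
   by (auto intro!: fin_dim_subspace_Times rep_fin_dim[OF rP])
 next
  fix b assume b: "b : arcs Q"
  have "clinear_on (rep_space M (tail Q b)) (%z. rep_map P b (f (tail Q b) z))"
   by (rule clinear_on_compose[OF fl _ rep_map_clinear[OF rP b]]) (use b fM in auto)
  then have "clinear_on (rep_space M (tail Q b)) (%z. (0 :: 'e => 'a, rep_map P b (f (tail Q b) z)))"
   by (intro clinear_on_Pair clinear_on_zero)
  moreover have "clinear_on S (%z :: ('e => 'a) \<times> 'a. ((%c. if c = b then snd z else 0), 0 :: 'a))" for S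
   unfolding clinear_on_def by (auto simp: scaleC_prod_def scaleC_fun_def fun_eq_iff)
  ultimately show "clinear_on (rep_space M (tail Q b)) (rep_map M b)"
   unfolding M_def by (cases "head Q b = i") auto
  fix z assume z: "z : rep_space M (tail Q b)"
  show "rep_map M b z : rep_space M (head Q b)"
  proof (cases "head Q b = i")
   case True
   then have "snd z : rep_space P (tail Q b)" using z unfolding M_def by auto
   then show ?thesis
    using True b cvec.subspace_0[OF rep_subspace[OF rP i]] cvec.subspace_0[OF rep_subspace[OF rP tail_in_verts]]
    unfolding M_def D_def dsum_def by (auto simp: in_arcs_def)
  next
   case False
   then show ?thesis
    using rep_map_in[OF rP b fM[OF _ z]] b unfolding M_def by auto
  qed
 qed
 let ?f = "\<lambda>j\<in>verts Q. \<lambda>z\<in>rep_space M j. f j z"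
 have fz: "f (tail Q b) z = snd z" if "b : arcs Q" "head Q b = i" "z : rep_space M (tail Q b)" for b z
  using that nl[OF that(1)] unfolding f_def by auto
 have fH: "?f : rep_Hom Q M P"
 proof (rule rep_HomI[OF fM fl _ wf rM])
  fix b z assume b: "b : arcs Q" and z: "z : rep_space M (tail Q b)"
  show "f (head Q b) (rep_map M b z) = rep_map P b (f (tail Q b) z)"
  proof (cases "head Q b = i")
   case True
   have "(SUM a:?A. rep_map P a (if a = b then snd z else 0)) = (SUM a:?A. if a = b then rep_map P b (snd z) else 0)"
    using clinear_on_0[OF rep_map_clinear[OF rP] rep_subspace[OF rP]] by (intro sum.cong) (auto simp: in_arcs_def)
   then show ?thesis
    using True b fz[OF b True z] by (simp add: f_def M_def in_arcs_def)
  next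
   case False
   then show ?thesis by (simp add: f_def M_def)
  qed
 qed
 have zD: "0 : D" using cvec.subspace_0[OF fin_dim_subspace_imp_subspace[OF fD]] .
 have "?f j ` rep_space M j = rep_space P j" if j: "j : verts Q" for j
 proof -
  have "y : ?f j ` rep_space M j" if y: "y : rep_space P j" for y
  proof (rule image_eqI)
   show "(0, y) : rep_space M j" using y zD unfolding M_def by simp
   have "(SUM a:?A. rep_map P a (0 :: 'a)) = 0"
    using clinear_on_0[OF rep_map_clinear[OF rP] rep_subspace[OF rP]]
    by (intro sum.neutral) (auto simp: in_arcs_def)
   then show "y = ?f j (0, y)" using j \<open>(0, y) : rep_space M j\<close> by (simp add: f_def)
  qed
  then show ?thesis using fM[OF j] j by auto
 qed
 then have "?f : rep_epi Q M P" using fH unfolding rep_epi_def by blast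
 then obtain h where h: "h : rep_Hom Q P M"
  and fh: "!!j y. j : verts Q ==> y : rep_space P j ==> ?f j (h j y) = rep_id Q P j y"
  by (rule projective_rep_lift[OF wf P rM rP _ rep_iso_Hom[OF rep_id_iso[OF wf rP]]]) (rule that)
 \<comment> \<open>Naturality of the section along \<open>a\<close>, combined with the section
   property at the tail.\<close>
 have key: "fst (h i (rep_map P a v)) = (%c. if c = a then v else 0)"
  if a: "a : ?A" and v: "v : rep_space P (tail Q a)" for a v
 proof -
  have a': "a : arcs Q" "head Q a = i" using a by (auto simp: in_arcs_def)
  have t: "tail Q a : verts Q" using a' by simp
  have hv: "h (tail Q a) v : rep_space M (tail Q a)" using rep_HomD(1)[OF h t v] .
  have "snd (h (tail Q a) v) = v" using fh[OF t v] fz[OF a' hv] t v hv by simp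
  then show ?thesis using rep_HomD(3)[OF h a'(1) v] a'(2) unfolding M_def by (simp add: fun_eq_iff)
 qed
 have sP: "cvec.subspace (rep_space P i)" using rep_subspace[OF rP i] .
 have hl: "clinear_on (rep_space P i) (%y. fst (h i y))"
  by (rule clinear_on_compose[OF rep_HomD(2)[OF h i] _ clinear_on_fst]) (rule order_refl)
 have "0 = fst (h i (SUM a:?A. rep_map P a (x a)))"
  using s0 clinear_on_0[OF hl sP] by simp
 also have "... = (SUM a:?A. fst (h i (rep_map P a (x a))))"
  by (rule clinear_on_sum[OF hl sP]) (use x rep_map_in[OF rP] in \<open>auto simp: in_arcs_def\<close>)
 also have "... = (SUM a:?A. (%c. if c = a then x a else 0))"
  using key x by (intro sum.cong) auto
 finally have "0 = (SUM a:?A. (%c. if c = a then x a else 0)) a0" by simp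
 then show "x a0 = 0" using a0 finA by (simp add: sum_fun_apply cong: if_cong)
qed

text \<open>Dual test map: \<open>I\<close> is embedded in \<open>N\<close>, which at
  \<open>i\<close> has an extra factor recording one prescribed value for each arc out of
  \<open>i\<close>. In \<open>N\<close> these arcs return the recorded value, so a retraction
  applied to \<open>(0, y)\<close> gives a vector whose images under the arcs are the
  \<open>y a\<close>.\<close>

lemma injective_out_arcs_surjective:
 fixes I :: "('v, 'e, 'a::complex_vector) rep"
 assumes Q: "fin_digraph Q" and nl: "!!a. a : arcs Q ==> tail Q a ~= head Q a" and I: "injective_rep Q I"
 shows "out_arcs_surjective Q I"
 unfolding out_arcs_surjective_def
proof (intro ballI allI impI)
 interpret fin_digraph Q by (rule Q)
 note wf = wf_digraph_axioms
 have rI: "is_rep Q I" using I unfolding injective_rep_def by blast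
 fix i y assume i: "i : verts Q" and y: "ALL a:out_arcs Q i. y a : rep_space I (head Q a)"
 let ?A = "out_arcs Q i"
 have finA: "finite ?A" using finite_arcs by (simp add: out_arcs_def)
 define D where "D = dsum ?A (%a. rep_space I (head Q a))"
 have fD: "fin_dim_subspace D"
  unfolding D_def using dsum_fin_dim[OF finA, of "%a. rep_space I (head Q a)"] rep_fin_dim[OF rI] by simp
 define f where "f j x = (x, %a. if j = i & a : ?A then rep_map I a x else 0)" for j x
 define N where "N = \<lparr>rep_space = (%j. rep_space I j \<times> (if j = i then D else {0})),
  rep_map = (%b z. f (head Q b) (if tail Q b = i then snd z b else rep_map I b (fst z)))\<rparr>"
 have zD: "0 : D" using cvec.subspace_0[OF fin_dim_subspace_imp_subspace[OF fD]] .
 have fN: "f j x : rep_space N j" if "j : verts Q" "x : rep_space I j" for j x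
  using that rep_map_in[OF rI] unfolding f_def N_def D_def dsum_def
  by (auto simp: out_arcs_def fun_eq_iff)
 have fl: "clinear_on (rep_space I j) (f j)" if "j : verts Q" for j
  using rep_map_clinear[OF rI] unfolding f_def
  by (intro clinear_on_Pair clinear_on_id)
   (auto simp: clinear_on_def out_arcs_def fun_eq_iff scaleC_fun_def)
 have Nin: "(if tail Q b = i then snd z b else rep_map I b (fst z)) : rep_space I (head Q b)"
  if b: "b : arcs Q" and z: "z : rep_space N (tail Q b)" for b z
  using z b rep_map_in[OF rI b] unfolding N_def D_def dsum_def by (auto simp: out_arcs_def)
 have rN: "is_rep Q N"
 proof (rule is_repI)
  fix j assume "j : verts Q"
  then show "fin_dim_subspace (rep_space N j)"
   unfolding N_def using fD fin_dim_subspace_zero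
   by (auto intro!: fin_dim_subspace_Times rep_fin_dim[OF rI])
 next
  fix b assume b: "b : arcs Q"
  have "clinear_on (rep_space N (tail Q b)) (%z. rep_map I b (fst z))"
   by (rule clinear_on_compose[OF clinear_on_fst _ rep_map_clinear[OF rI b]]) (auto simp: N_def)
  moreover have "clinear_on (rep_space N (tail Q b)) (%z. snd z b)"
   unfolding clinear_on_def by (simp add: scaleC_prod_def scaleC_fun_def)
  ultimately have l: "clinear_on (rep_space N (tail Q b))
    (%z. if tail Q b = i then snd z b else rep_map I b (fst z))"
   by (cases "tail Q b = i") auto
  show "clinear_on (rep_space N (tail Q b)) (rep_map N b)"
   using clinear_on_compose[OF l image_subsetI[OF Nin[OF b]] fl[OF head_in_verts[OF b]]]
   unfolding N_def by simp
  fix z assume "z : rep_space N (tail Q b)"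
  then show "rep_map N b z : rep_space N (head Q b)"
   using fN[OF _ Nin[OF b]] b unfolding N_def by auto
 qed
 let ?f = "\<lambda>j\<in>verts Q. \<lambda>x\<in>rep_space I j. f j x"
 have fH: "?f : rep_Hom Q I N"
 proof (rule rep_HomI[OF fN fl _ wf rI])
  fix b x assume b: "b : arcs Q" and x: "x : rep_space I (tail Q b)"
  show "f (head Q b) (rep_map I b x) = rep_map N b (f (tail Q b) x)"
   using b by (cases "tail Q b = i") (simp_all add: f_def N_def out_arcs_def fun_eq_iff)
 qed
 have "?f : rep_mono Q I N"
  using fH unfolding rep_mono_def by (auto simp: inj_on_def f_def)
 then obtain h where h: "h : rep_Hom Q N I"
  and hf: "!!j x. j : verts Q ==> x : rep_space I j ==> h j (?f j x) = rep_id Q I j x"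
  by (rule injective_rep_extend[OF wf I rI rN _ rep_iso_Hom[OF rep_id_iso[OF wf rI]]]) (rule that)
 let ?z = "(0, %a. if a : ?A then y a else 0)"
 have z: "?z : rep_space N i"
  using y cvec.subspace_0[OF rep_subspace[OF rI i]] unfolding N_def D_def dsum_def by simp
 show "EX x:rep_space I i. ALL a:?A. rep_map I a x = y a"
 proof (intro bexI ballI)
  show "h i ?z : rep_space I i" using rep_HomD(1)[OF h i z] .
  fix a assume a: "a : ?A"
  have a': "a : arcs Q" "tail Q a = i" using a by (auto simp: out_arcs_def)
  have ya: "y a : rep_space I (head Q a)" using y a by blast
  have "rep_map I a (h i ?z) = h (head Q a) (rep_map N a ?z)"
   using rep_HomD(3)[OF h a'(1)] z a'(2) by auto
  also have "rep_map N a ?z = f (head Q a) (y a)" using a a'(2) unfolding N_def by simp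
  also have "h (head Q a) (f (head Q a) (y a)) = y a" using hf[of "head Q a" "y a"] ya a' by simp
  finally show "rep_map I a (h i ?z) = y a" .
 qed
qed

subsection \<open>Constructions along an acyclic orientation\<close>

text \<open>Recursion along an acyclic orientation. By \<open>loc\<close> the condition at
  \<open>i\<close> reads only the values at \<open>i\<close> and at vertices of smaller rank, so
  later choices cannot spoil earlier ones.\<close>

lemma rank_choice:
 fixes r :: "'v => nat" and G :: "'v => ('v => 'c) => bool"
 assumes step: "!!i b. i : V ==> (!!j. j : V ==> r j < r i ==> G j b) ==> EX y. G i (b(i := y))"
  and loc: "!!i b b'. i : V ==> b i = b' i ==> (!!j. j : V ==> r j < r i ==> b j = b' j) ==> G i b ==> G i b'"
  and fin: "finite V"
 obtains b where "!!i. i : V ==> G i b"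
proof -
 have *: "EX b. ALL i:V. r i < n --> G i b" for n
 proof (induction n)
  case 0
  then show ?case by simp
 next
  case (Suc n)
  then obtain b where b: "!!i. i : V ==> r i < n ==> G i b" by blast
  \<comment> \<open>All vertices of rank \<open>n\<close> are chosen at once; \<open>G i\<close>
    does not read the other vertices of that rank.\<close>
  define b' where "b' i = (if r i = n then SOME y. G i (b(i := y)) else b i)" for i
  have "G i b'" if i: "i : V" "r i < Suc n" for i
  proof (cases "r i = n")
   case True
   then have "EX y. G i (b(i := y))" using b i by (intro step) auto
   from someI_ex[OF this] have g: "G i (b(i := SOME y. G i (b(i := y))))" .
   show ?thesis
    by (rule loc[OF i(1) _ _ g]) (use True in \<open>auto simp: b'_def\<close>)
  next
   case False
   then have "G i b" using b i by simp
   then show ?thesis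
    by (rule loc[OF i(1), rotated 2]) (use False i in \<open>auto simp: b'_def\<close>)
  qed
  then show ?case by blast
 qed
 obtain b where "ALL i:V. r i < Suc (Max (r ` V)) --> G i b" using * by blast
 moreover have "r i < Suc (Max (r ` V))" if "i : V" for i
  using that fin by (simp add: le_imp_less_Suc)
 ultimately show ?thesis using that by blast
qed

definition sink_rank :: "('v, 'e) pre_digraph => ('v => nat) => bool" where
 "sink_rank Q r \<longleftrightarrow> (ALL a:arcs Q. r (head Q a) < r (tail Q a))"

lemma sink_rank_reverse:
 assumes Q: "fin_digraph Q" and r: "sink_rank Q r"
 obtains r' :: "'v => nat" where "!!a. a : arcs Q ==> r' (tail Q a) < r' (head Q a)"
proof
 interpret fin_digraph Q by (rule Q)
 fix a assume a: "a : arcs Q"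
 have "r (tail Q a) <= Max (r ` verts Q)" using a by simp
 then show "Max (r ` verts Q) - r (tail Q a) < Max (r ` verts Q) - r (head Q a)"
  using bspec[OF r[unfolded sink_rank_def] a] by linarith
qed

lemma in_arcs_injectiveD:
 assumes "in_arcs_injective Q M" "i : verts Q" "!!a. a : in_arcs Q i ==> x a : rep_space M (tail Q a)"
  "(SUM a:in_arcs Q i. rep_map M a (x a)) = 0" "a : in_arcs Q i"
 shows "x a = 0"
 using assms unfolding in_arcs_injective_def by blast

text \<open>Vertices are treated with tails before heads. On the image of the incoming arcs
  \<open>h i\<close> is forced by naturality, and it is well defined because these arcs are jointly
  injective on \<open>U\<close>; beyond that image it is any lift of \<open>g i\<close> through
  \<open>f i\<close>. The switch \<open>B\<close> adds the isomorphism version: \<open>False\<close>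
  serves to split \<open>N -> \<pi>(N)\<close>, \<open>True\<close> to lift isomorphisms of
  quotients of \<open>P\<close>.\<close>

lemma in_arcs_injective_lift:
 fixes U :: "('v, 'e, 'a::complex_vector) rep" and M :: "('v, 'e, 'b::complex_vector) rep"
  and R :: "('v, 'e, 'c::complex_vector) rep"
 assumes Q: "fin_digraph Q" and r: "sink_rank Q r"
  and U: "is_rep Q U" and M: "is_rep Q M" and R: "is_rep Q R" and inj: "in_arcs_injective Q U"
  and f: "f : rep_Hom Q M R" and g: "g : rep_Hom Q U R"
  and im: "!!i. i : verts Q ==> g i ` rep_space U i <= f i ` rep_space M i"
  and bij: "B ==> in_arcs_injective Q M"
   "!!i. B ==> i : verts Q ==> cvec.dim (rep_space U i) = cvec.dim (rep_space M i)"
   "!!i. B ==> i : verts Q ==> f i ` rep_space M i <= g i ` rep_space U i"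
 obtains h where "h : rep_Hom Q U M" "!!i x. i : verts Q ==> x : rep_space U i ==> f i (h i x) = g i x"
  "B ==> h : rep_iso Q U M"
proof -
 interpret fin_digraph Q by (rule Q)
 note wf = wf_digraph_axioms
 obtain r' :: "'v => nat" where r': "!!a. a : arcs Q ==> r' (tail Q a) < r' (head Q a)"
  by (rule sink_rank_reverse[OF Q r]) (rule that)
 define G where "G i h \<longleftrightarrow> clinear_on (rep_space U i) (h i) & h i ` rep_space U i <= rep_space M i &
  (ALL x:rep_space U i. f i (h i x) = g i x) &
  (ALL a:in_arcs Q i. ALL x:rep_space U (tail Q a). h i (rep_map U a x) = rep_map M a (h (tail Q a) x)) &
  (B --> bij_betw (h i) (rep_space U i) (rep_space M i))"
  for i and h :: "'v => 'a => 'b"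
 obtain h where h: "!!i. i : verts Q ==> G i h"
 proof (rule rank_choice[of "verts Q" r' G])
  fix i :: 'v and h h' :: "'v => 'a => 'b"
  assume "i : verts Q" and hi: "h i = h' i" and lo: "!!j. j : verts Q ==> r' j < r' i ==> h j = h' j"
   and gi: "G i h"
  have "h (tail Q a) = h' (tail Q a)" if "a : in_arcs Q i" for a
   using that r' by (intro lo) (auto simp: in_arcs_def)
  then show "G i h'" using gi hi unfolding G_def by simp
 next
  fix i :: 'v and h :: "'v => 'a => 'b"
  assume i: "i : verts Q" and lo: "!!j. j : verts Q ==> r' j < r' i ==> G j h"
  let ?A = "in_arcs Q i"
  have A: "a : arcs Q" "head Q a = i" "tail Q a : verts Q" "tail Q a ~= i" "G (tail Q a) h"
   if "a : ?A" for a
   using that r' lo by (force simp: in_arcs_def)+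
  have finA: "finite ?A" using finite_arcs by (simp add: in_arcs_def)
  define D where "D = dsum ?A (%a. rep_space U (tail Q a))"
  have fD: "fin_dim_subspace D"
   unfolding D_def using dsum_fin_dim[OF finA, of "%a. rep_space U (tail Q a)"] rep_fin_dim[OF U] by simp
  note sD = fin_dim_subspace_imp_subspace[OF fD]
  note Ui = rep_fin_dim[OF U i] and Mi = rep_fin_dim[OF M i]
  \<comment> \<open>\<open>Ps\<close> is the sum map into \<open>U i\<close> and \<open>d\<close>
    the value that naturality prescribes on it; the forced map is \<open>ph\<close> with
    \<open>ph (Ps x) = d x\<close>.\<close>
  define Ps where "Ps x = (SUM a:?A. rep_map U a (x a))" for x
  define d where "d x = (SUM a:?A. rep_map M a (h (tail Q a) (x a)))" for x
  have Psl: "clinear_on D Ps" unfolding Ps_def D_def by (rule in_arcs_sum_clinear[OF U])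
  have hin: "h (tail Q a) x : rep_space M (tail Q a)" if "a : ?A" "x : rep_space U (tail Q a)" for a x
   using A(5)[OF that(1)] that(2) unfolding G_def by blast
  have dl: "clinear_on D d"
   unfolding d_def
  proof (rule clinear_on_sum_fun)
   fix a assume a: "a : ?A"
   have 1: "clinear_on D (%x. x a)" unfolding clinear_on_def by (simp add: scaleC_fun_def)
   have 2: "(%x. x a) ` D <= rep_space U (tail Q a)" using a unfolding D_def dsum_def by auto
   have 3: "clinear_on (rep_space U (tail Q a)) (h (tail Q a))" using A(5)[OF a] unfolding G_def by simp
   have 4: "clinear_on (rep_space U (tail Q a)) (%x. rep_map M a (h (tail Q a) x))"
    by (rule clinear_on_compose[OF 3 _ rep_map_clinear[OF M A(1)[OF a]]]) (use hin[OF a] in auto)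
   show "clinear_on D (%x. rep_map M a (h (tail Q a) (x a)))"
    by (rule clinear_on_compose[OF 1 2 4])
  qed
  have xD: "x a : rep_space U (tail Q a)" if "x : D" "a : ?A" for x a
   using that unfolding D_def dsum_def by auto
  have Ps0: "x = 0" if x: "x : D" "Ps x = 0" for x
  proof
   fix a
   show "x a = 0 a"
    using inj i xD[OF x(1)] x unfolding in_arcs_injective_def Ps_def
    by (cases "a : ?A") (auto simp: D_def dsum_def)
  qed
  obtain ph where ph: "clinear_on UNIV ph" "!!x. x : D ==> ph (Ps x) = d x"
   by (rule clinear_factor[OF sD Psl dl]) (use Ps0 clinear_on_0[OF dl sD] in auto)
  let ?V = "Ps ` D"
  have V: "cvec.subspace ?V" "?V <= rep_space U i"
   using clinear_on_image_subspace[OF Psl sD] in_arcs_sum_in[OF U i] xD unfolding Ps_def by auto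
  have phV: "clinear_on ?V ph" "ph ` ?V <= rep_space M i"
   using clinear_on_subset[OF ph(1)] ph(2) in_arcs_sum_in[OF M i] xD hin unfolding d_def by auto
  have eq: "f i (ph v) = g i v" if v: "v : ?V" for v
  proof -
   obtain x where x: "x : D" "v = Ps x" using v by blast
   have "f i (d x) = (SUM a:?A. f i (rep_map M a (h (tail Q a) (x a))))"
    unfolding d_def
    using rep_map_in[OF M A(1)] A(2) hin xD[OF x(1)]
    by (intro clinear_on_sum[OF rep_HomD(2)[OF f i] rep_subspace[OF M i]]) force
   also have "... = (SUM a:?A. rep_map R a (f (tail Q a) (h (tail Q a) (x a))))"
    using rep_HomD(3)[OF f A(1)] A(2) hin xD[OF x(1)] by (intro sum.cong) force+
   also have "... = (SUM a:?A. rep_map R a (g (tail Q a) (x a)))"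
    using A(5) xD[OF x(1)] unfolding G_def by (intro sum.cong) auto
   also have "... = (SUM a:?A. g i (rep_map U a (x a)))"
    using rep_HomD(3)[OF g A(1)] A(2) xD[OF x(1)] by (intro sum.cong) force+
   also have "... = g i (Ps x)"
    unfolding Ps_def using rep_map_in[OF U A(1)] A(2) xD[OF x(1)]
    by (intro clinear_on_sum[OF rep_HomD(2)[OF g i] rep_subspace[OF U i], symmetric]) force
   finally show ?thesis using ph(2) x by simp
  qed
  note gl = rep_HomD(2)[OF g i] and fl = rep_HomD(2)[OF f i]
  have "EX b. clinear_on UNIV b & b ` rep_space U i <= rep_space M i & (ALL v:?V. b v = ph v) &
   (ALL w:rep_space U i. f i (b w) = g i w) & (B --> bij_betw b (rep_space U i) (rep_space M i))"
  proof (cases B)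
   case False
   obtain b where "clinear_on UNIV b" "b ` rep_space U i <= rep_space M i" "!!v. v : ?V ==> b v = ph v"
    "!!w. w : rep_space U i ==> f i (b w) = g i w"
    by (rule clinear_lift_extend[OF Ui V fin_dim_subspace_imp_subspace[OF Mi] phV gl fl im[OF i] eq])
     (assumption, rule that)
   then show ?thesis using False by blast
  next
   case True
   \<comment> \<open>Joint injectivity of the arcs of \<open>M\<close> and injectivity of
     \<open>h\<close> at the tails enter here.\<close>
   have injph: "inj_on ph ?V"
    unfolding clinear_on_inj_iff[OF phV(1) V(1)]
   proof (intro ballI impI)
    fix v assume v: "v : ?V" "ph v = 0"
    then obtain x where x: "x : D" "v = Ps x" by blast
    then have "d x = 0" using v ph(2) by simp
    then have "ALL a:?A. h (tail Q a) (x a) = 0"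
     using in_arcs_injectiveD[OF bij(1)[OF True] i, of "%a. h (tail Q a) (x a)"] hin xD[OF x(1)]
     unfolding d_def by simp
    then have "x a = 0" if "a : ?A" for a
     using A(5)[OF that] xD[OF x(1) that] True that
      clinear_on_inj_iff[of "rep_space U (tail Q a)" "h (tail Q a)"] rep_subspace[OF U A(3)[OF that]]
     unfolding G_def bij_betw_def by blast
    then have "x = 0" using x(1) unfolding D_def dsum_def by (auto simp: fun_eq_iff)
    then show "v = 0" using x clinear_on_0[OF Psl sD] by simp
   qed
   have dK: "cvec.dim {x : rep_space U i. g i x = 0} = cvec.dim {x : rep_space M i. f i x = 0}"
   proof -
    have "g i ` rep_space U i = f i ` rep_space M i" using im[OF i] bij(3)[OF True i] by blast
    then show ?thesis
     using clinear_on_rank_nullity[OF Ui gl] clinear_on_rank_nullity[OF Mi fl] bij(2)[OF True i] by simp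
   qed
   obtain b where "clinear_on UNIV b" "bij_betw b (rep_space U i) (rep_space M i)"
    "!!v. v : ?V ==> b v = ph v" "!!w. w : rep_space U i ==> f i (b w) = g i w"
    by (rule clinear_lift_extend_bij[OF Ui V Mi phV injph gl fl im[OF i] eq dK bij(2)[OF True i]])
     (assumption, rule that)
   then show ?thesis unfolding bij_betw_def by blast
  qed
  then obtain b where b: "clinear_on UNIV b" "b ` rep_space U i <= rep_space M i"
   "ALL v:?V. b v = ph v" "ALL w:rep_space U i. f i (b w) = g i w"
   "B --> bij_betw b (rep_space U i) (rep_space M i)"
   by blast
  have "b (rep_map U a x) = rep_map M a (h (tail Q a) x)" if a: "a : ?A" and x: "x : rep_space U (tail Q a)" for a x
  proof -
   let ?s = "%c. if c = a then x else 0"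
   have s: "?s : D"
    using a x cvec.subspace_0[OF rep_subspace[OF U A(3)]] unfolding D_def dsum_def by auto
   have "Ps ?s = (SUM c:?A. if c = a then rep_map U a x else 0)"
    unfolding Ps_def using clinear_on_0[OF rep_map_clinear[OF U A(1)] rep_subspace[OF U A(3)]]
    by (intro sum.cong) auto
   then have 1: "Ps ?s = rep_map U a x" using a finA by simp
   have "d ?s = (SUM c:?A. if c = a then rep_map M a (h (tail Q a) x) else 0)"
    unfolding d_def
   proof (intro sum.cong refl)
    fix c assume c: "c : ?A"
    have "h (tail Q c) 0 = 0"
     using A(5)[OF c] clinear_on_0[of "rep_space U (tail Q c)" "h (tail Q c)"] rep_subspace[OF U A(3)[OF c]]
     unfolding G_def by simp
    then show "rep_map M c (h (tail Q c) (if c = a then x else 0)) =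
      (if c = a then rep_map M a (h (tail Q a) x) else 0)"
     using clinear_on_0[OF rep_map_clinear[OF M A(1)] rep_subspace[OF M A(3)], OF c c] by simp
   qed
   then have "d ?s = rep_map M a (h (tail Q a) x)" using a finA by simp
   then show ?thesis using b(3) ph(2)[OF s] s 1 by (metis image_eqI)
  qed
  then have "G i (h(i := b))"
   unfolding G_def using b A(4) clinear_on_subset[OF b(1) subset_UNIV] by simp
  then show "EX y. G i (h(i := y))" by (rule exI[of _ b])
 qed (auto intro: that)
 let ?h = "\<lambda>i\<in>verts Q. \<lambda>x\<in>rep_space U i. h i x"
 have hH: "?h : rep_Hom Q U M"
 proof (rule rep_HomI[OF _ _ _ wf U])
  fix a x assume a: "a : arcs Q" "x : rep_space U (tail Q a)"
  then show "h (head Q a) (rep_map U a x) = rep_map M a (h (tail Q a) x)"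
   using h[OF head_in_verts[OF a(1)]] unfolding G_def in_arcs_def by blast
 qed (use h in \<open>auto simp: G_def image_subset_iff\<close>)
 show ?thesis
 proof (rule that[OF hH])
  show "f i (?h i x) = g i x" if "i : verts Q" "x : rep_space U i" for i x
   using h[OF that(1)] that unfolding G_def by simp
  assume B
  show "?h : rep_iso Q U M"
  proof (rule rep_isoI[OF hH])
   fix i assume i: "i : verts Q"
   show "bij_betw (?h i) (rep_space U i) (rep_space M i)"
    using h[OF i] i \<open>B\<close> unfolding G_def by (subst bij_betw_cong[where g="h i"]) auto
  qed
 qed
qed

text \<open>Vertices are treated with heads before tails. At \<open>i\<close> the new map
  \<open>c\<close> has to satisfy \<open>rep_map I a (c x) = b (head Q a) (rep_map I a x)\<close>
  for all outgoing \<open>a\<close> and to extend \<open>ph i\<close>. Joint surjectivity makes the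
  equations solvable, and the bijections at the heads make the two kernels coincide, so a bijective
  solution exists.\<close>

lemma out_arcs_surjective_extend_iso:
 fixes I :: "('v, 'e, 'a::complex_vector) rep"
 assumes Q: "fin_digraph Q" and r: "sink_rank Q r"
  and I: "is_rep Q I" and surj: "out_arcs_surjective Q I"
  and V: "is_subrep Q I V" and V': "is_subrep Q I V'"
  and ph: "ph : rep_iso Q (subrep I V) (subrep I V')"
 obtains b where "b : rep_iso Q I I" "!!i x. i : verts Q ==> x : V i ==> b i x = ph i x"
proof -
 interpret fin_digraph Q by (rule Q)
 note wf = wf_digraph_axioms
 note phH = rep_iso_Hom[OF ph]
 define G where "G i b \<longleftrightarrow> clinear_on (rep_space I i) (b i) & bij_betw (b i) (rep_space I i) (rep_space I i) &
  (ALL x:V i. b i x = ph i x) &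
  (ALL a:out_arcs Q i. ALL x:rep_space I i. b (head Q a) (rep_map I a x) = rep_map I a (b i x))"
  for i and b :: "'v => 'a => 'a"
 obtain b where b: "!!i. i : verts Q ==> G i b"
 proof (rule rank_choice[of "verts Q" r G])
  fix i :: 'v and h h' :: "'v => 'a => 'a"
  assume "i : verts Q" and hi: "h i = h' i" and lo: "!!j. j : verts Q ==> r j < r i ==> h j = h' j"
   and gi: "G i h"
  have "h (head Q a) = h' (head Q a)" if "a : out_arcs Q i" for a
   using that r by (intro lo) (auto simp: out_arcs_def sink_rank_def)
  then show "G i h'" using gi hi unfolding G_def by simp
 next
  fix i :: 'v and b :: "'v => 'a => 'a"
  assume i: "i : verts Q" and lo: "!!j. j : verts Q ==> r j < r i ==> G j b"
  let ?A = "out_arcs Q i"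
  have A: "a : arcs Q" "tail Q a = i" "head Q a : verts Q" "head Q a ~= i" "G (head Q a) b"
   if "a : ?A" for a
   using that r lo by (force simp: out_arcs_def sink_rank_def)+
  note Ii = rep_fin_dim[OF I i] and sI = rep_subspace[OF I]
  \<comment> \<open>\<open>Ph\<close> collects the required values over all outgoing arcs and
    \<open>Ph'\<close> the images under the arcs themselves; the conditions on \<open>c\<close>
    become \<open>Ph' (c x) = Ph x\<close>.\<close>
  define Ph where "Ph x = (%a. if a : ?A then b (head Q a) (rep_map I a x) else 0)" for x
  define Ph' where "Ph' x = (%a. if a : ?A then rep_map I a x else 0)" for x
  have blin: "clinear_on (rep_space I (head Q a)) (b (head Q a))"
   and bbij: "bij_betw (b (head Q a)) (rep_space I (head Q a)) (rep_space I (head Q a))" if "a : ?A" for a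
   using A(5)[OF that] unfolding G_def by auto
  have mlin: "clinear_on (rep_space I i) (rep_map I a)" if "a : ?A" for a
   using rep_map_clinear[OF I A(1)[OF that]] A(2)[OF that] by simp
  have min: "rep_map I a x : rep_space I (head Q a)" if "a : ?A" "x : rep_space I i" for a x
   using rep_map_in[OF I A(1)[OF that(1)]] A(2)[OF that(1)] that(2) by simp
  have bmlin: "clinear_on (rep_space I i) (%x. b (head Q a) (rep_map I a x))" if "a : ?A" for a
   by (rule clinear_on_compose[OF mlin[OF that] _ blin[OF that]]) (use min[OF that] in auto)
  have Phl: "clinear_on (rep_space I i) Ph"
   using bmlin unfolding Ph_def clinear_on_def by (auto simp: fun_eq_iff scaleC_fun_def)
  have Ph'l: "clinear_on (rep_space I i) Ph'"
   using mlin unfolding Ph'_def clinear_on_def by (auto simp: fun_eq_iff scaleC_fun_def)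
  have im: "Ph ` rep_space I i <= Ph' ` rep_space I i"
  proof
   fix y assume "y : Ph ` rep_space I i"
   then obtain x where x: "x : rep_space I i" "y = Ph x" by blast
   have "ALL a:?A. y a : rep_space I (head Q a)"
    using x min bij_betw_apply[OF bbij] unfolding Ph_def by auto
   then obtain x' where x': "x' : rep_space I i" "ALL a:?A. rep_map I a x' = y a"
    using surj i unfolding out_arcs_surjective_def by blast
   have "y = Ph' x'" using x' x(2) unfolding Ph'_def Ph_def by (auto simp: fun_eq_iff)
   then show "y : Ph' ` rep_space I i" using x' by blast
  qed
  have ker: "{x : rep_space I i. Ph x = 0} = {x : rep_space I i. Ph' x = 0}"
  proof -
   have "b (head Q a) (rep_map I a x) = 0 \<longleftrightarrow> rep_map I a x = 0" if a: "a : ?A" and "x : rep_space I i" for a x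
    using bbij[OF a] min[OF that] clinear_on_inj_iff[OF blin[OF a] sI[OF A(3)[OF a]]]
     clinear_on_0[OF blin[OF a] sI[OF A(3)[OF a]]] unfolding bij_betw_def by auto
   then show ?thesis unfolding Ph_def Ph'_def by (auto simp: fun_eq_iff)
  qed
  have Vi: "cvec.subspace (V i)" "V i <= rep_space I i" using is_subrepD(2,3)[OF V i] .
  have V'i: "V' i <= rep_space I i" using is_subrepD(3)[OF V' i] .
  have phb: "bij_betw (ph i) (V i) (V' i)" using rep_iso_bij[OF ph i] by simp
  have phV: "clinear_on (V i) (ph i)" "ph i ` V i <= rep_space I i" "inj_on (ph i) (V i)"
   using rep_HomD(2)[OF phH i] phb V'i unfolding bij_betw_def by auto
  have eq: "Ph' (ph i v) = Ph v" if v: "v : V i" for v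
  proof
   fix a
   show "Ph' (ph i v) a = Ph v a"
   proof (cases "a : ?A")
    case True
    have "b (head Q a) (rep_map I a v) = ph (head Q a) (rep_map I a v)"
     using A(5)[OF True] is_subrepD(4)[OF V A(1)[OF True]] A(2)[OF True] v unfolding G_def by simp
    then show ?thesis
     using rep_HomD(3)[OF phH A(1)[OF True]] A(2)[OF True] v True unfolding Ph_def Ph'_def by simp
   next
    case False
    then show ?thesis by (auto simp: Ph_def Ph'_def)
   qed
  qed
  obtain c where c: "clinear_on UNIV c" "bij_betw c (rep_space I i) (rep_space I i)"
   "!!v. v : V i ==> c v = ph i v" "!!w. w : rep_space I i ==> Ph' (c w) = Ph w"
   by (rule clinear_lift_extend_bij[OF Ii Vi Ii phV Phl Ph'l im eq _ refl])
    (assumption, use ker in simp, rule that)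
  have "b (head Q a) (rep_map I a x) = rep_map I a (c x)" if "a : ?A" "x : rep_space I i" for a x
   using c(4)[OF that(2)] that(1) unfolding Ph_def Ph'_def fun_eq_iff by (auto dest: spec[of _ a])
  then have "G i (b(i := c))"
   unfolding G_def using c A(4) clinear_on_subset[OF c(1) subset_UNIV] by simp
  then show "EX y. G i (b(i := y))" by (rule exI[of _ c])
 qed (auto intro: that)
 let ?b = "\<lambda>i\<in>verts Q. \<lambda>x\<in>rep_space I i. b i x"
 have hH: "?b : rep_Hom Q I I"
 proof (rule rep_HomI[OF _ _ _ wf I])
  fix a x assume a: "a : arcs Q" "x : rep_space I (tail Q a)"
  then show "b (head Q a) (rep_map I a x) = rep_map I a (b (tail Q a) x)"
   using b[OF tail_in_verts[OF a(1)]] unfolding G_def out_arcs_def by blast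
 next
  fix i x assume i: "i : verts Q" "x : rep_space I i"
  then have "bij_betw (b i) (rep_space I i) (rep_space I i)" using b unfolding G_def by simp
  then show "b i x : rep_space I i" using i(2) by (rule bij_betw_apply)
 qed (use b in \<open>auto simp: G_def\<close>)
 show ?thesis
 proof (rule that)
  show "?b : rep_iso Q I I"
  proof (rule rep_isoI[OF hH])
   fix i assume i: "i : verts Q"
   show "bij_betw (?b i) (rep_space I i) (rep_space I i)"
    using b[OF i] i unfolding G_def by (subst bij_betw_cong[where g="b i"]) auto
  qed
  show "?b i x = ph i x" if "i : verts Q" "x : V i" for i x
   using b[OF that(1)] that is_subrepD(3)[OF V that(1)] unfolding G_def by auto
 qed
qed

subsection \<open>Automorphism groups acting on quiver Grassmannians\<close>

lemma rep_comp_assoc: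
 assumes Q: "wf_digraph Q" and M: "is_rep Q M" and f: "f : rep_Hom Q M N" and g: "g : rep_Hom Q N K"
  and h: "h : rep_Hom Q K L"
 shows "rep_comp Q M (rep_comp Q N h g) f = rep_comp Q M h (rep_comp Q M g f)"
 using rep_HomD(1)[OF f] unfolding rep_comp_eq_restrict by (auto simp: fun_eq_iff restrict_def)

lemma Aut_group_simps [simp]:
 "carrier (Aut_group Q M) = rep_iso Q M M" "mult (Aut_group Q M) = rep_comp Q M"
 "one (Aut_group Q M) = rep_id Q M"
 unfolding Aut_group_def rep_id_def by simp_all

lemma Aut_group_inv_aux:
 assumes Q: "wf_digraph Q" and M: "is_rep Q M" and f: "f : rep_iso Q M M"
 shows "rep_comp Q M (rep_inv Q M M f) f = rep_id Q M"
 by (rule rep_Hom_eqI[OF rep_Hom_comp[OF Q M rep_iso_Hom[OF f] rep_iso_Hom[OF rep_inv_iso[OF Q M M f]]]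
   rep_iso_Hom[OF rep_id_iso[OF Q M]]])
  (use rep_inv_apply[OF f] in auto)

lemma group_Aut_group:
 assumes Q: "wf_digraph Q" and M: "is_rep Q M"
 shows "group (Aut_group Q M)"
proof (rule groupI)
 fix f assume f: "f : carrier (Aut_group Q M)"
 then have f': "f : rep_iso Q M M" by simp
 show "\<one>\<^bsub>Aut_group Q M\<^esub> \<otimes>\<^bsub>Aut_group Q M\<^esub> f = f"
  unfolding Aut_group_simps
  by (rule rep_Hom_eqI[OF rep_iso_Hom[OF rep_iso_comp[OF Q M f' rep_id_iso[OF Q M]]] rep_iso_Hom[OF f']])
   (use rep_HomD(1)[OF rep_iso_Hom[OF f']] in auto)
 show "EX g:carrier (Aut_group Q M). g \<otimes>\<^bsub>Aut_group Q M\<^esub> f = \<one>\<^bsub>Aut_group Q M\<^esub>"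
  using Aut_group_inv_aux[OF Q M] rep_inv_iso[OF Q M M] f by auto
next
 fix f g h assume "f : carrier (Aut_group Q M)" "g : carrier (Aut_group Q M)" "h : carrier (Aut_group Q M)"
 then show "f \<otimes>\<^bsub>Aut_group Q M\<^esub> g \<otimes>\<^bsub>Aut_group Q M\<^esub> h = f \<otimes>\<^bsub>Aut_group Q M\<^esub> (g \<otimes>\<^bsub>Aut_group Q M\<^esub> h)"
  unfolding Aut_group_simps
  by (intro rep_comp_assoc[OF Q M rep_iso_Hom rep_iso_Hom rep_iso_Hom])
qed (use rep_iso_comp[OF Q M] rep_id_iso[OF Q M] in auto)

lemma inv_Aut_group:
 assumes Q: "wf_digraph Q" and M: "is_rep Q M" and f: "f : rep_iso Q M M"
 shows "inv\<^bsub>Aut_group Q M\<^esub> f = rep_inv Q M M f"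
 by (rule group.inv_equality[OF group_Aut_group[OF Q M]])
  (use f rep_inv_iso[OF Q M M f] Aut_group_inv_aux[OF Q M f] in auto)

lemma grass_image:
 assumes Q: "wf_digraph Q" and M: "is_rep Q M" and g: "g : rep_iso Q M M'" and N: "N : quiver_grass Q M e"
 shows "(\<lambda>i\<in>verts Q. g i ` N i) : quiver_grass Q M' e"
proof -
 note gH = rep_iso_Hom[OF g]
 have N': "is_subrep Q M N" and d: "!!i. i : verts Q ==> cvec.dim (N i) = e i"
  using N unfolding quiver_grass_def by auto
 note sN = is_subrepD[OF N']
 have gN: "clinear_on (N i) (g i)" if "i : verts Q" for i
  using clinear_on_subset[OF rep_HomD(2)[OF gH that] sN(3)[OF that]] .
 have "is_subrep Q M' (\<lambda>i\<in>verts Q. g i ` N i)"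
 proof (rule is_subrepI)
  fix i assume i: "i : verts Q"
  show "cvec.subspace ((\<lambda>i\<in>verts Q. g i ` N i) i)"
   using clinear_on_image_subspace[OF gN[OF i] sN(2)[OF i]] i by simp
  show "(\<lambda>i\<in>verts Q. g i ` N i) i <= rep_space M' i"
   using rep_HomD(1)[OF gH i] sN(3)[OF i] i by auto
 next
  fix a x assume a: "a : arcs Q" and x: "x : (\<lambda>i\<in>verts Q. g i ` N i) (tail Q a)"
  note t = wf_digraph.tail_in_verts[OF Q a] and h = wf_digraph.head_in_verts[OF Q a]
  obtain y where y: "y : N (tail Q a)" "x = g (tail Q a) y" using x t by auto
  have "rep_map M' a x = g (head Q a) (rep_map M a y)"
   using rep_HomD(3)[OF gH a] sN(3)[OF t] y by auto
  then show "rep_map M' a x : (\<lambda>i\<in>verts Q. g i ` N i) (head Q a)"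
   using sN(4)[OF a y(1)] h by auto
 qed auto
 moreover have "cvec.dim (g i ` N i) = e i" if i: "i : verts Q" for i
 proof -
  have "inj_on (g i) (N i)"
   using rep_iso_bij[OF g i] sN(3)[OF i] unfolding bij_betw_def by (auto intro: inj_on_subset)
  then show ?thesis
   using cvec_dim_inj_image[OF fin_dim_subspace_subset[OF rep_fin_dim[OF M i] sN(2,3)[OF i]] gN[OF i]]
    d[OF i] i by simp
 qed
 ultimately show ?thesis unfolding quiver_grass_def by simp
qed

lemma group_action_grass:
 fixes M :: "('v, 'e, 'a::complex_vector) rep" and e :: "'v => nat"
 assumes Q: "wf_digraph Q" and M: "is_rep Q M" and H: "subgroup H (Aut_group Q M)"
 defines "Gr == quiver_grass Q M e"
 shows "group_action (Aut_group Q M\<lparr>carrier := H\<rparr>) Gr (grass_act Q Gr)"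
proof -
 interpret A: group "Aut_group Q M" by (rule group_Aut_group[OF Q M])
 let ?G = "Aut_group Q M\<lparr>carrier := H\<rparr>"
 let ?act = "grass_act Q Gr"
 have HI: "g : rep_iso Q M M" if "g : H" for g using subgroup.subset[OF H] that by auto
 have in_M: "N i <= rep_space M i" "N : extensional (verts Q)" if "N : Gr" "i : verts Q" for N i
 proof -
  have "is_subrep Q M N" using that(1) unfolding Gr_def quiver_grass_def by blast
  then show "N i <= rep_space M i" "N : extensional (verts Q)"
   using is_subrepD(1,3) that(2) by fast+
 qed
 have closed: "?act g N : Gr" if "g : rep_iso Q M M" "N : Gr" for g N
  using grass_image[OF Q M that(1)] that(2) unfolding Gr_def grass_act_def by auto
 have comp: "?act (rep_comp Q M g h) N = ?act g (?act h N)"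
  if g: "g : rep_iso Q M M" and h: "h : rep_iso Q M M" and N: "N : Gr" for g h N
 proof
  fix i
  show "?act (rep_comp Q M g h) N i = ?act g (?act h N) i"
  proof (cases "i : verts Q")
   case True
   then have "rep_comp Q M g h i ` N i = g i ` h i ` N i"
    using in_M(1)[OF N True] by (auto simp: image_image subset_iff intro!: image_cong)
   then show ?thesis using True N closed[OF h N] by (simp add: grass_act_def)
  next
   case False
   then show ?thesis using N closed[OF h N] by (simp add: grass_act_def)
  qed
 qed
 have one: "?act (rep_id Q M) N = N" if N: "N : Gr" for N
 proof
  fix i
  show "?act (rep_id Q M) N i = N i"
  proof (cases "i : verts Q")
   case True
   then have "rep_id Q M i ` N i = (%x. x) ` N i"
    using in_M(1)[OF N True] by (intro image_cong) auto
   then show ?thesis using True N by (simp add: grass_act_def)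
  next
   case False
   have "N : extensional (verts Q)"
    using N is_subrepD(1) unfolding Gr_def quiver_grass_def by auto
   then show ?thesis using False N by (simp add: grass_act_def extensional_def)
  qed
 qed
 have bij: "?act g : Bij Gr" if g: "g : H" for g
 proof -
  note gi = HI[OF g] and gv = rep_inv_iso[OF Q M M HI[OF g]]
  have l: "rep_comp Q M (rep_inv Q M M g) g = rep_id Q M" by (rule Aut_group_inv_aux[OF Q M gi])
  have r: "rep_comp Q M g (rep_inv Q M M g) = rep_id Q M"
   using A.r_inv[of g] inv_Aut_group[OF Q M gi] gi by simp
  have "bij_betw (?act g) Gr Gr"
   by (rule bij_betw_byWitness[of _ "?act (rep_inv Q M M g)"])
    (use comp[OF gv gi] comp[OF gi gv] l r one closed gi gv in auto)
  then show ?thesis unfolding Bij_def grass_act_def by auto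
 qed
 have "group_hom ?G (BijGroup Gr) ?act"
 proof (rule group_hom.intro)
  show "group ?G" using A.subgroup_imp_group[OF H] .
  show "group (BijGroup Gr)" by (rule group_BijGroup)
  show "group_hom_axioms ?G (BijGroup Gr) ?act"
  proof (rule group_hom_axioms.intro, rule homI)
   fix g assume "g : carrier ?G"
   then show "?act g : carrier (BijGroup Gr)" using bij by (simp add: BijGroup_def)
  next
   fix g h assume "g : carrier ?G" "h : carrier ?G"
   then have g: "g : H" and h: "h : H" by auto
   have "?act (rep_comp Q M g h) = compose Gr (?act g) (?act h)"
   proof
    fix N
    show "?act (rep_comp Q M g h) N = compose Gr (?act g) (?act h) N"
     using comp[OF HI[OF g] HI[OF h]]
     by (cases "N : Gr") (auto simp: compose_def grass_act_def)
   qed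
   then show "?act (g \<otimes>\<^bsub>?G\<^esub> h) = ?act g \<otimes>\<^bsub>BijGroup Gr\<^esub> ?act h"
    using bij[OF g] bij[OF h] by (simp add: BijGroup_def)
  qed
 qed
 then show ?thesis by (rule group_action.intro)
qed

subsection \<open>The block group\<close>

lemma rep_sum_simps [simp]:
 "rep_space (rep_sum P I) i = rep_space P i \<times> rep_space I i"
 "rep_map (rep_sum P I) a = map_prod (rep_map P a) (rep_map I a)"
 unfolding rep_sum_def by simp_all

lemma is_rep_sum:
 fixes P :: "('v, 'e, 'a::complex_vector) rep" and I :: "('v, 'e, 'b::complex_vector) rep"
 assumes P: "is_rep Q P" and I: "is_rep Q I"
 shows "is_rep Q (rep_sum P I)"
proof (rule is_repI)
 fix i assume "i : verts Q"
 then show "fin_dim_subspace (rep_space (rep_sum P I) i)"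
  using fin_dim_subspace_Times[OF rep_fin_dim[OF P] rep_fin_dim[OF I]] by simp
next
 fix a assume a: "a : arcs Q"
 have "clinear_on (rep_space P (tail Q a) \<times> rep_space I (tail Q a)) (%z. (rep_map P a (fst z), rep_map I a (snd z)))"
  by (intro clinear_on_Pair clinear_on_compose[OF clinear_on_fst _ rep_map_clinear[OF P a]]
    clinear_on_compose[OF clinear_on_snd _ rep_map_clinear[OF I a]]) auto
 then show "clinear_on (rep_space (rep_sum P I) (tail Q a)) (rep_map (rep_sum P I) a)"
  by (simp add: map_prod_def case_prod_unfold)
qed (use rep_map_in[OF P] rep_map_in[OF I] in auto)

lemma block_map_apply:
 "i : verts Q ==> x : rep_space P i ==> y : rep_space I i ==>
  block_map Q P I a h b i (x, y) = (a i x, h i x + b i y)"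
 unfolding block_map_def by simp

lemma block_map_iso:
 fixes P :: "('v, 'e, 'a::complex_vector) rep" and I :: "('v, 'e, 'b::complex_vector) rep"
 assumes Q: "wf_digraph Q" and P: "is_rep Q P" and I: "is_rep Q I"
  and a: "a : rep_iso Q P P" and h: "h : rep_Hom Q P I" and b: "b : rep_iso Q I I"
 shows "block_map Q P I a h b : rep_iso Q (rep_sum P I) (rep_sum P I)"
proof -
 note aH = rep_iso_Hom[OF a] and bH = rep_iso_Hom[OF b] and S = is_rep_sum[OF P I]
 let ?g = "%i z. (a i (fst z), h i (fst z) + b i (snd z))"
 have lin: "clinear_on (rep_space P i \<times> rep_space I i) (?g i)" if i: "i : verts Q" for i
  by (intro clinear_on_Pair clinear_on_plus clinear_on_compose[OF clinear_on_fst _ rep_HomD(2)[OF aH i]]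
    clinear_on_compose[OF clinear_on_fst _ rep_HomD(2)[OF h i]]
    clinear_on_compose[OF clinear_on_snd _ rep_HomD(2)[OF bH i]]) auto
 have gin: "?g i z : rep_space P i \<times> rep_space I i" if i: "i : verts Q" "z : rep_space P i \<times> rep_space I i" for i z
  using that rep_HomD(1)[OF aH] rep_HomD(1)[OF h] rep_HomD(1)[OF bH] cvec.subspace_add[OF rep_subspace[OF I i(1)]]
  by auto
 have gH: "block_map Q P I a h b : rep_Hom Q (rep_sum P I) (rep_sum P I)"
  unfolding block_map_def
 proof (rule rep_HomI[OF _ _ _ Q S])
  fix c z assume c: "c : arcs Q" and z: "z : rep_space (rep_sum P I) (tail Q c)"
  note t = wf_digraph.tail_in_verts[OF Q c]
  have "rep_map I c (h (tail Q c) (fst z) + b (tail Q c) (snd z)) =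
    rep_map I c (h (tail Q c) (fst z)) + rep_map I c (b (tail Q c) (snd z))"
   using z rep_HomD(1)[OF h t] rep_HomD(1)[OF bH t] by (intro clinear_on_add[OF rep_map_clinear[OF I c]]) auto
  then show "?g (head Q c) (rep_map (rep_sum P I) c z) = rep_map (rep_sum P I) c (?g (tail Q c) z)"
   using z rep_HomD(3)[OF aH c] rep_HomD(3)[OF h c] rep_HomD(3)[OF bH c] by auto
 qed (use lin gin in auto)
 show ?thesis
 proof (rule rep_isoI[OF gH])
  fix i assume i: "i : verts Q"
  let ?S = "rep_space P i \<times> rep_space I i"
  note fS = fin_dim_subspace_Times[OF rep_fin_dim[OF P i] rep_fin_dim[OF I i]]
  have a0: "x = 0" if "x : rep_space P i" "a i x = 0" for x
   using rep_iso_bij[OF a i] clinear_on_inj_iff[OF rep_HomD(2)[OF aH i] rep_subspace[OF P i]] that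
   unfolding bij_betw_def by simp
  have b0: "x = 0" if "x : rep_space I i" "b i x = 0" for x
   using rep_iso_bij[OF b i] clinear_on_inj_iff[OF rep_HomD(2)[OF bH i] rep_subspace[OF I i]] that
   unfolding bij_betw_def by simp
  have "inj_on (?g i) ?S"
   unfolding clinear_on_inj_iff[OF lin[OF i] fin_dim_subspace_imp_subspace[OF fS]]
  proof safe
   fix x y assume "x : rep_space P i" "y : rep_space I i"
    and 0: "(a i (fst (x, y)), h i (fst (x, y)) + b i (snd (x, y))) = 0"
   moreover have "x = 0" using a0[OF \<open>x : _\<close>] 0 by (simp add: zero_prod_def)
   moreover have "h i 0 = 0" by (rule clinear_on_0[OF rep_HomD(2)[OF h i] rep_subspace[OF P i]])
   ultimately have "x = 0" "b i y = 0" by (simp_all add: zero_prod_def)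
   then show "(x, y) = 0" using b0[OF \<open>y : _\<close>] by (simp add: zero_prod_def)
  qed
  then have "bij_betw (?g i) ?S ?S"
   by (rule clinear_on_inj_imp_bij[OF fS fS lin[OF i]]) (use gin[OF i] in auto)
  then show "bij_betw (block_map Q P I a h b i) (rep_space (rep_sum P I) i) (rep_space (rep_sum P I) i)"
   using i unfolding block_map_def by (subst bij_betw_cong[where g="?g i"]) auto
 qed
qed

text \<open>Block triangular form means that \<open>0 \<times> I\<close> is preserved, a condition
  for which closure under products and inverses is easy. To recover the blocks, finite dimension is
  used: the block on \<open>P\<close> is bijective because \<open>g\<close> is onto, the block on
  \<open>I\<close> because \<open>g\<close> is injective.\<close>

lemma block_subgroup_iff:
 fixes P :: "('v, 'e, 'a::complex_vector) rep" and I :: "('v, 'e, 'b::complex_vector) rep"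
 assumes Q: "wf_digraph Q" and P: "is_rep Q P" and I: "is_rep Q I"
 shows "g : block_subgroup Q P I \<longleftrightarrow>
  g : rep_iso Q (rep_sum P I) (rep_sum P I) & (ALL i:verts Q. ALL y:rep_space I i. fst (g i (0, y)) = 0)"
proof safe
 assume "g : block_subgroup Q P I"
 then obtain a h b where g: "g = block_map Q P I a h b" "a : rep_iso Q P P" "h : rep_Hom Q P I" "b : rep_iso Q I I"
  unfolding block_subgroup_def by blast
 then show "g : rep_iso Q (rep_sum P I) (rep_sum P I)" using block_map_iso[OF Q P I] by simp
 fix i y assume i: "i : verts Q" and y: "y : rep_space I i"
 show "fst (g i (0, y)) = 0"
  using i y g(1) cvec.subspace_0[OF rep_subspace[OF P i]]
   clinear_on_0[OF rep_HomD(2)[OF rep_iso_Hom[OF g(2)] i] rep_subspace[OF P i]]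
  by (simp add: block_map_apply)
next
 assume g: "g : rep_iso Q (rep_sum P I) (rep_sum P I)"
  and g0: "ALL i:verts Q. ALL y:rep_space I i. fst (g i (0, y)) = 0"
 note gH = rep_iso_Hom[OF g] and S = is_rep_sum[OF P I]
 note t = wf_digraph.tail_in_verts[OF Q] and hd = wf_digraph.head_in_verts[OF Q]
 have P0: "0 : rep_space P i" and I0: "0 : rep_space I i" if "i : verts Q" for i
  using cvec.subspace_0[OF rep_subspace[OF P that]] cvec.subspace_0[OF rep_subspace[OF I that]] by auto
 have glin: "clinear_on (rep_space P i \<times> rep_space I i) (g i)" if "i : verts Q" for i
  using rep_HomD(2)[OF gH that] by simp
 have gin: "g i (x, y) : rep_space P i \<times> rep_space I i"
  if "i : verts Q" "x : rep_space P i" "y : rep_space I i" for i x y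
  using rep_HomD(1)[OF gH that(1), of "(x, y)"] that by simp
 have lP: "clinear_on (rep_space P i) (%x. g i (x, 0))" if i: "i : verts Q" for i
  by (rule clinear_on_compose[OF clinear_on_Pair[OF clinear_on_id clinear_on_zero] _ glin[OF i]])
   (use I0[OF i] in auto)
 have lI: "clinear_on (rep_space I i) (%y. g i (0, y))" if i: "i : verts Q" for i
  by (rule clinear_on_compose[OF clinear_on_Pair[OF clinear_on_zero clinear_on_id] _ glin[OF i]])
   (use P0[OF i] in auto)
 have split: "g i (x, y) = g i (x, 0) + g i (0, y)"
  if "i : verts Q" "x : rep_space P i" "y : rep_space I i" for i x y
  using clinear_on_add[OF glin[OF that(1)], of "(x, 0)" "(0, y)"] that P0 I0 by simp
 have m0: "rep_map P c 0 = 0" "rep_map I c 0 = 0" if "c : arcs Q" for c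
  using clinear_on_0[OF rep_map_clinear[OF P that] rep_subspace[OF P t[OF that]]]
   clinear_on_0[OF rep_map_clinear[OF I that] rep_subspace[OF I t[OF that]]] by auto
 have nat: "g (head Q c) (rep_map P c x, rep_map I c y) = map_prod (rep_map P c) (rep_map I c) (g (tail Q c) (x, y))"
  if "c : arcs Q" "x : rep_space P (tail Q c)" "y : rep_space I (tail Q c)" for c x y
  using rep_HomD(3)[OF gH that(1), of "(x, y)"] that by simp
 define a where "a = (\<lambda>i\<in>verts Q. \<lambda>x\<in>rep_space P i. fst (g i (x, 0)))"
 define h where "h = (\<lambda>i\<in>verts Q. \<lambda>x\<in>rep_space P i. snd (g i (x, 0)))"
 define b where "b = (\<lambda>i\<in>verts Q. \<lambda>y\<in>rep_space I i. snd (g i (0, y)))"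
 have aH: "a : rep_Hom Q P P"
  unfolding a_def
 proof (rule rep_HomI[OF _ _ _ Q P])
  show "fst (g i (x, 0)) : rep_space P i" if "i : verts Q" "x : rep_space P i" for i x
   using gin[OF that I0[OF that(1)]] by auto
  show "clinear_on (rep_space P i) (%x. fst (g i (x, 0)))" if "i : verts Q" for i
   by (rule clinear_on_compose[OF lP[OF that] subset_UNIV clinear_on_fst])
  fix c x assume c: "c : arcs Q" and x: "x : rep_space P (tail Q c)"
  show "fst (g (head Q c) (rep_map P c x, 0)) = rep_map P c (fst (g (tail Q c) (x, 0)))"
   using nat[OF c x I0[OF t[OF c]]] m0[OF c] by (simp add: fst_map_prod)
 qed
 have hH: "h : rep_Hom Q P I"
  unfolding h_def
 proof (rule rep_HomI[OF _ _ _ Q P])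
  show "snd (g i (x, 0)) : rep_space I i" if "i : verts Q" "x : rep_space P i" for i x
   using gin[OF that I0[OF that(1)]] by auto
  show "clinear_on (rep_space P i) (%x. snd (g i (x, 0)))" if "i : verts Q" for i
   by (rule clinear_on_compose[OF lP[OF that] subset_UNIV clinear_on_snd])
  fix c x assume c: "c : arcs Q" and x: "x : rep_space P (tail Q c)"
  show "snd (g (head Q c) (rep_map P c x, 0)) = rep_map I c (snd (g (tail Q c) (x, 0)))"
   using nat[OF c x I0[OF t[OF c]]] m0[OF c] by (simp add: snd_map_prod)
 qed
 have bH: "b : rep_Hom Q I I"
  unfolding b_def
 proof (rule rep_HomI[OF _ _ _ Q I])
  show "snd (g i (0, y)) : rep_space I i" if "i : verts Q" "y : rep_space I i" for i y
   using gin[OF that(1) P0[OF that(1)] that(2)] by auto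
  show "clinear_on (rep_space I i) (%y. snd (g i (0, y)))" if "i : verts Q" for i
   by (rule clinear_on_compose[OF lI[OF that] subset_UNIV clinear_on_snd])
  fix c y assume c: "c : arcs Q" and y: "y : rep_space I (tail Q c)"
  show "snd (g (head Q c) (0, rep_map I c y)) = rep_map I c (snd (g (tail Q c) (0, y)))"
   using nat[OF c P0[OF t[OF c]] y] m0[OF c] by (simp add: snd_map_prod)
 qed
 have "a : rep_iso Q P P"
 proof (rule rep_isoI[OF aH])
  fix i assume i: "i : verts Q"
  have "a i ` rep_space P i = rep_space P i"
  proof
   show "a i ` rep_space P i <= rep_space P i" using rep_HomD(1)[OF aH i] by auto
   show "rep_space P i <= a i ` rep_space P i"
   proof
    fix x' assume "x' : rep_space P i"
    then have "(x', 0) : g i ` (rep_space P i \<times> rep_space I i)"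
     using rep_iso_bij[OF g i] I0[OF i] unfolding bij_betw_def by simp
    then obtain x y where xy: "x : rep_space P i" "y : rep_space I i" "g i (x, y) = (x', 0)" by auto
    then have "a i x = x'"
     using split[OF i xy(1,2)] g0 i unfolding a_def by (simp add: prod_eq_iff)
    then show "x' : a i ` rep_space P i" using xy by blast
   qed
  qed
  then show "bij_betw (a i) (rep_space P i) (rep_space P i)"
   by (intro clinear_on_surj_imp_bij[OF rep_fin_dim[OF P i] rep_HomD(2)[OF aH i]]) auto
 qed
 moreover have "b : rep_iso Q I I"
 proof (rule rep_isoI[OF bH])
  fix i assume i: "i : verts Q"
  have "inj_on (b i) (rep_space I i)"
   unfolding clinear_on_inj_iff[OF rep_HomD(2)[OF bH i] rep_subspace[OF I i]]
  proof (intro ballI impI)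
   fix y assume y: "y : rep_space I i" "b i y = 0"
   then have "g i (0, y) = 0" using g0 i unfolding b_def by (simp add: prod_eq_iff)
   then have "(0 :: 'a, y) = 0"
    using rep_iso_bij[OF g i] clinear_on_inj_iff[OF glin[OF i] rep_subspace[OF S i, simplified]] y P0[OF i]
    unfolding bij_betw_def by auto
   then show "y = 0" by (simp add: zero_prod_def)
  qed
  then show "bij_betw (b i) (rep_space I i) (rep_space I i)"
   using rep_HomD(1)[OF bH i]
   by (intro clinear_on_inj_imp_bij[OF rep_fin_dim[OF I i] rep_fin_dim[OF I i] rep_HomD(2)[OF bH i]]) auto
 qed
 moreover have "g = block_map Q P I a h b"
 proof (rule rep_Hom_eqI[OF gH rep_iso_Hom[OF block_map_iso[OF Q P I calculation(1) hH calculation(2)]]])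
  fix i z assume i: "i : verts Q" and z: "z : rep_space (rep_sum P I) i"
  obtain x y where xy: "z = (x, y)" "x : rep_space P i" "y : rep_space I i" using z by auto
  show "g i z = block_map Q P I a h b i z"
   using split[OF i xy(2,3)] g0 i xy(2,3)
   unfolding xy(1) block_map_apply[OF i xy(2,3)] by (simp add: a_def h_def b_def prod_eq_iff)
 qed
 ultimately show "g : block_subgroup Q P I" using hH unfolding block_subgroup_def by blast
qed

lemma subgroup_block_subgroup:
 fixes P :: "('v, 'e, 'a::complex_vector) rep" and I :: "('v, 'e, 'b::complex_vector) rep"
 assumes Q: "wf_digraph Q" and P: "is_rep Q P" and I: "is_rep Q I"
 shows "subgroup (block_subgroup Q P I) (Aut_group Q (rep_sum P I))"
proof -
 note S = is_rep_sum[OF P I] and iff = block_subgroup_iff[OF Q P I]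
 have P0: "0 : rep_space P i" if "i : verts Q" for i
  using cvec.subspace_0[OF rep_subspace[OF P that]] .
 show ?thesis
 proof (rule subgroup.intro)
  show "block_subgroup Q P I <= carrier (Aut_group Q (rep_sum P I))" using iff by auto
  show "\<one>\<^bsub>Aut_group Q (rep_sum P I)\<^esub> : block_subgroup Q P I"
   using rep_id_iso[OF Q S] P0 by (simp add: iff)
 next
  fix g h assume g: "g : block_subgroup Q P I" and h: "h : block_subgroup Q P I"
  have "fst (g i (h i (0, y))) = 0" if i: "i : verts Q" and y: "y : rep_space I i" for i y
  proof -
   have "h i (0, y) : rep_space (rep_sum P I) i"
    using h iff rep_HomD(1)[OF rep_iso_Hom] P0[OF i] i y by fastforce
   moreover have "fst (h i (0, y)) = 0" using h iff i y by blast
   ultimately obtain y' where "h i (0, y) = (0, y')" "y' : rep_space I i" by (cases "h i (0, y)") auto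
   then show ?thesis using g iff i by auto
  qed
  then show "g \<otimes>\<^bsub>Aut_group Q (rep_sum P I)\<^esub> h : block_subgroup Q P I"
   using rep_iso_comp[OF Q S, of h "rep_sum P I" g "rep_sum P I"] g h P0 by (simp add: iff)
 next
  fix g assume g: "g : block_subgroup Q P I"
  obtain a h b where abh: "g = block_map Q P I a h b" "a : rep_iso Q P P" "h : rep_Hom Q P I" "b : rep_iso Q I I"
   using g unfolding block_subgroup_def by blast
  have gi: "g : rep_iso Q (rep_sum P I) (rep_sum P I)" using g iff by blast
  have "fst (rep_inv Q (rep_sum P I) (rep_sum P I) g i (0, y)) = 0"
   if i: "i : verts Q" and y: "y : rep_space I i" for i y
  proof -
   obtain y' where y': "y' : rep_space I i" "y = b i y'"
    using rep_iso_bij[OF abh(4) i] y unfolding bij_betw_def by blast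
   have "g i (0, y') = (0, y)"
    using abh(1) y' P0[OF i] i clinear_on_0[OF rep_HomD(2)[OF rep_iso_Hom[OF abh(2)] i] rep_subspace[OF P i]]
     clinear_on_0[OF rep_HomD(2)[OF abh(3) i] rep_subspace[OF P i]]
    by (simp add: block_map_apply)
   then show ?thesis using rep_inv_apply(1)[OF gi i, of "(0, y')"] P0[OF i] y' by simp
  qed
  then show "inv\<^bsub>Aut_group Q (rep_sum P I)\<^esub> g : block_subgroup Q P I"
   using rep_inv_iso[OF Q S S gi] by (simp add: inv_Aut_group[OF Q S gi] iff)
 qed
qed

subsection \<open>Orbits of the block group\<close>

lemma subrep_eqI:
 assumes "U : extensional V" "U' : extensional V" "!!i. i : V ==> U i = U' i"
 shows "U = U'"
 using assms by (intro extensionalityI)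

lemma part_I_apply [simp]: "i : verts Q ==> part_I Q N i = {x. (0, x) : N i}"
 unfolding part_I_def by simp

lemma part_P_apply [simp]: "i : verts Q ==> part_P Q N i = fst ` N i"
 unfolding part_P_def by simp

lemma is_subrep_part_I:
 assumes Q: "wf_digraph Q" and P: "is_rep Q P" and N: "is_subrep Q (rep_sum P I) N"
 shows "is_subrep Q I (part_I Q N)"
proof (rule is_subrepI)
 note sN = is_subrepD[OF N]
 show "part_I Q N : extensional (verts Q)" unfolding part_I_def by simp
 fix i assume i: "i : verts Q"
 show "part_I Q N i <= rep_space I i" using sN(3)[OF i] i by auto
 show "cvec.subspace (part_I Q N i)"
 proof (rule cvec.subspaceI)
  show "0 : part_I Q N i" using cvec.subspace_0[OF sN(2)[OF i]] i by (simp add: zero_prod_def)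
 next
  fix x y assume "x : part_I Q N i" "y : part_I Q N i"
  then show "x + y : part_I Q N i" using cvec.subspace_add[OF sN(2)[OF i], of "(0, x)" "(0, y)"] i by simp
 next
  fix c x assume "x : part_I Q N i"
  then show "c *\<^sub>C x : part_I Q N i"
   using cvec.subspace_scale[OF sN(2)[OF i], of "(0, x)" c] i by (simp add: scaleC_prod_def)
 qed
next
 fix a x assume a: "a : arcs Q" and x: "x : part_I Q N (tail Q a)"
 note t = wf_digraph.tail_in_verts[OF Q a] and h = wf_digraph.head_in_verts[OF Q a]
 show "rep_map I a x : part_I Q N (head Q a)"
  using is_subrepD(4)[OF N a, of "(0, x)"] x t h
   clinear_on_0[OF rep_map_clinear[OF P a] rep_subspace[OF P t]] by simp
qed

lemma is_subrep_part_P: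
 assumes Q: "wf_digraph Q" and N: "is_subrep Q (rep_sum P I) N"
 shows "is_subrep Q P (part_P Q N)"
proof (rule is_subrepI)
 note sN = is_subrepD[OF N]
 show "part_P Q N : extensional (verts Q)" unfolding part_P_def by simp
 fix i assume i: "i : verts Q"
 show "part_P Q N i <= rep_space P i" using sN(3)[OF i] i by auto
 show "cvec.subspace (part_P Q N i)"
  using clinear_on_image_subspace[OF clinear_on_fst sN(2)[OF i]] i by simp
next
 fix a x assume a: "a : arcs Q" and x: "x : part_P Q N (tail Q a)"
 note t = wf_digraph.tail_in_verts[OF Q a] and h = wf_digraph.head_in_verts[OF Q a]
 obtain y where y: "(x, y) : N (tail Q a)" using x t by force
 have "fst (rep_map P a x, rep_map I a y) : fst ` N (head Q a)"
  by (rule imageI) (use is_subrepD(4)[OF N a y] in simp)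
 then show "rep_map P a x : part_P Q N (head Q a)" using h by simp
qed

lemma image_subrep_iso:
 assumes Q: "wf_digraph Q" and I: "is_rep Q I" and V: "is_subrep Q I V" and b: "b : rep_iso Q I I"
 shows "rep_isomorphic Q (subrep I V) (subrep I (\<lambda>i\<in>verts Q. b i ` V i))"
proof -
 note bH = rep_iso_Hom[OF b]
 have "(\<lambda>i\<in>verts Q. \<lambda>x\<in>rep_space (subrep I V) i. b i x) : rep_iso Q (subrep I V) (subrep I (\<lambda>i\<in>verts Q. b i ` V i))"
 proof (rule rep_isoI)
  show "(\<lambda>i\<in>verts Q. \<lambda>x\<in>rep_space (subrep I V) i. b i x) : rep_Hom Q (subrep I V) (subrep I (\<lambda>i\<in>verts Q. b i ` V i))"
  proof (rule rep_HomI[OF _ _ _ Q is_rep_subrep[OF Q I V]])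
   show "clinear_on (rep_space (subrep I V) i) (b i)" if "i : verts Q" for i
    using clinear_on_subset[OF rep_HomD(2)[OF bH that] is_subrepD(3)[OF V that]] by simp
   show "b (head Q a) (rep_map (subrep I V) a x) = rep_map (subrep I (\<lambda>i\<in>verts Q. b i ` V i)) a (b (tail Q a) x)"
    if a: "a : arcs Q" and "x : rep_space (subrep I V) (tail Q a)" for a x
    using rep_HomD(3)[OF bH a] is_subrepD(3)[OF V wf_digraph.tail_in_verts[OF Q a]] that by auto
  qed auto
  fix i assume i: "i : verts Q"
  have "inj_on (b i) (V i)"
   using rep_iso_bij[OF b i] is_subrepD(3)[OF V i] unfolding bij_betw_def by (auto intro: inj_on_subset)
  then have "bij_betw (b i) (V i) (b i ` V i)" by (simp add: bij_betw_def)
  then show "bij_betw ((\<lambda>i\<in>verts Q. \<lambda>x\<in>rep_space (subrep I V) i. b i x) i) (rep_space (subrep I V) i)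
    (rep_space (subrep I (\<lambda>i\<in>verts Q. b i ` V i)) i)"
   using i by (subst bij_betw_cong[where g="b i"]) auto
 qed
 then show ?thesis unfolding rep_isomorphic_def by blast
qed

text \<open>If \<open>f\<close> has kernel \<open>U\<close>, then \<open>f\<close> composed with the
  inverse of \<open>a\<close> has the image of \<open>U\<close> as kernel and the same target; so
  the two quotient classes share a member.\<close>

lemma quotient_class_image:
 assumes Q: "wf_digraph Q" and P: "is_rep Q P" and U: "is_subrep Q P U" and a: "a : rep_iso Q P P"
 shows "quotient_class Q P U = quotient_class Q P (\<lambda>i\<in>verts Q. a i ` U i)"
proof -
 obtain R where R: "R : quotient_class Q P U" using quotient_class_nonempty[OF Q P U] by blast
 obtain f where rR: "is_rep Q R" and fH: "f : rep_Hom Q P R"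
  and fs: "ALL i:verts Q. f i ` rep_space P i = rep_space R i"
  and fk: "ALL i:verts Q. {x : rep_space P i. f i x = 0} = U i"
  by (rule quotient_classE[OF R])
 let ?a' = "rep_inv Q P P a"
 have a': "?a' : rep_iso Q P P" by (rule rep_inv_iso[OF Q P P a])
 let ?g = "rep_comp Q P f ?a'"
 have gH: "?g : rep_Hom Q P R" by (rule rep_Hom_comp[OF Q P rep_iso_Hom[OF a'] fH])
 have "?g i ` rep_space P i = rep_space R i" if i: "i : verts Q" for i
 proof -
  have "?g i ` rep_space P i = f i ` ?a' i ` rep_space P i" using i by (auto simp: image_image intro!: image_cong)
  then show ?thesis using rep_iso_bij[OF a' i] fs i unfolding bij_betw_def by simp
 qed
 moreover have "{x : rep_space P i. ?g i x = 0} = (\<lambda>i\<in>verts Q. a i ` U i) i" if i: "i : verts Q" for i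
 proof
  have fU: "x : U i \<longleftrightarrow> x : rep_space P i & f i x = 0" for x using fk i by blast
  show "{x : rep_space P i. ?g i x = 0} <= (\<lambda>i\<in>verts Q. a i ` U i) i"
  proof
   fix x assume x: "x : {x : rep_space P i. ?g i x = 0}"
   then have "?a' i x : U i" "a i (?a' i x) = x"
    using i rep_inv_apply(2,3)[OF a i] fU by auto
   then show "x : (\<lambda>i\<in>verts Q. a i ` U i) i" using i by (metis image_eqI restrict_apply')
  qed
  show "(\<lambda>i\<in>verts Q. a i ` U i) i <= {x : rep_space P i. ?g i x = 0}"
   using i fU rep_HomD(1)[OF rep_iso_Hom[OF a] i] rep_inv_apply(1)[OF a i] by auto
 qed
 ultimately have "R : quotient_class Q P (\<lambda>i\<in>verts Q. a i ` U i)"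
  unfolding quotient_class_def rep_epi_def using rR gH by blast
 then show ?thesis
  using quotient_class_eq_iso_class[OF Q P R] quotient_class_eq_iso_class[OF Q P] by simp
qed

lemma graph_set_eq_image: "{(x, f x + y) | x y. x : A & y : B} = (%(x, y). (x, f x + y)) ` (A \<times> B)"
 by auto

locale block_action = fin_digraph Q
 for Q :: "('v, 'e) pre_digraph" +
 fixes P :: "('v, 'e, 'a::complex_vector) rep" and I :: "('v, 'e, 'b::complex_vector) rep"
  and r :: "'v => nat"
 assumes r: "sink_rank Q r" and projective: "projective_rep Q P" and injective: "injective_rep Q I"
begin

abbreviation Gr :: "('v => ('a \<times> 'b) set) set" where
 "Gr == quiver_grass Q (rep_sum P I) (dim_vec_of P)"

abbreviation act :: "('v => 'a \<times> 'b => 'a \<times> 'b) => ('v => ('a \<times> 'b) set) => 'v => ('a \<times> 'b) set" where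
 "act == grass_act Q Gr"

abbreviation G :: "('v => 'a \<times> 'b => 'a \<times> 'b) monoid" where
 "G == block_group Q P I"

lemma wf: "wf_digraph Q" by (rule wf_digraph_axioms)

lemma fd: "fin_digraph Q" by (rule fin_digraph_axioms)

lemma repP: "is_rep Q P" using projective unfolding projective_rep_def by (rule conjunct1)

lemma repI: "is_rep Q I" using injective unfolding injective_rep_def by (rule conjunct1)

lemma repS: "is_rep Q (rep_sum P I)" by (rule is_rep_sum[OF repP repI])

lemma no_loops: "a : arcs Q ==> tail Q a ~= head Q a"
 using r unfolding sink_rank_def by fastforce

lemma injP: "in_arcs_injective Q P"
 by (rule projective_in_arcs_injective[OF fd no_loops projective])

lemma surjI: "out_arcs_surjective Q I"
 by (rule injective_out_arcs_surjective[OF fd no_loops injective])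

lemma carrier_G [simp]: "carrier G = block_subgroup Q P I"
 unfolding block_group_def by simp

lemma group_action_G: "group_action G Gr act"
 unfolding block_group_def
 by (rule group_action_grass[OF wf repS subgroup_block_subgroup[OF wf repP repI]])

lemma GrD:
 assumes "N : Gr"
 shows "is_subrep Q (rep_sum P I) N" "i : verts Q ==> cvec.dim (N i) = cvec.dim (rep_space P i)"
 using assms unfolding quiver_grass_def dim_vec_of_def by auto

lemma Gr_finite_dim: "N : Gr ==> i : verts Q ==> fin_dim_subspace (N i)"
 by (rule fin_dim_subspace_subset[OF rep_fin_dim[OF repS] is_subrepD(2)[OF GrD(1)] is_subrepD(3)[OF GrD(1)]])

text \<open>The projection \<open>N -> \<pi>(N)\<close> splits, since subrepresentations of
  \<open>P\<close> inherit joint injectivity of the incoming arcs. The second component of the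
  splitting is a homomorphism from \<open>\<pi>(N)\<close> to \<open>I\<close>, and injectivity of
  \<open>I\<close> extends it to \<open>P\<close>.\<close>

lemma Gr_graph:
 assumes N: "N : Gr"
 obtains h where "h : rep_Hom Q P I"
  "!!i. i : verts Q ==> N i = {(x, h i x + y) | x y. x : part_P Q N i & y : part_I Q N i}"
proof -
 note sN = GrD(1)[OF N]
 note sP = is_subrep_part_P[OF wf sN] and sI = is_subrep_part_I[OF wf repP sN]
 let ?NP = "subrep P (part_P Q N)" and ?N = "subrep (rep_sum P I) N"
 have rNP: "is_rep Q ?NP" and rN: "is_rep Q ?N"
  using is_rep_subrep[OF wf repP sP] is_rep_subrep[OF wf repS sN] .
 have fH: "(\<lambda>i\<in>verts Q. \<lambda>z\<in>rep_space ?N i. fst z) : rep_Hom Q ?N ?NP"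
  by (rule rep_HomI[OF _ _ _ wf rN]) (auto intro: clinear_on_fst simp: fst_map_prod)
 obtain s where s: "s : rep_Hom Q ?NP ?N"
  "!!i x. i : verts Q ==> x : rep_space ?NP i ==>
   (\<lambda>i\<in>verts Q. \<lambda>z\<in>rep_space ?N i. fst z) i (s i x) = rep_id Q ?NP i x"
 proof (rule in_arcs_injective_lift[OF fd r rNP rN rNP in_arcs_injective_subrep[OF wf sP injP] fH
    rep_iso_Hom[OF rep_id_iso[OF wf rNP]], where B=False])
  fix i assume i: "i : verts Q"
  have "rep_id Q ?NP i ` rep_space ?NP i = fst ` N i" using i by (force intro: image_eqI)
  moreover have "(\<lambda>i\<in>verts Q. \<lambda>z\<in>rep_space ?N i. fst z) i ` rep_space ?N i = fst ` N i" using i by simp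
  ultimately show "rep_id Q ?NP i ` rep_space ?NP i <= (\<lambda>i\<in>verts Q. \<lambda>z\<in>rep_space ?N i. fst z) i ` rep_space ?N i"
   by simp
 qed (auto intro: that)
 have sin: "s i x : N i" "fst (s i x) = x" if i: "i : verts Q" "x : part_P Q N i" for i x
  using rep_HomD(1)[OF s(1) i(1)] s(2)[of i x] i by auto
 have h0: "(\<lambda>i\<in>verts Q. \<lambda>x\<in>rep_space ?NP i. snd (s i x)) : rep_Hom Q ?NP I"
 proof (rule rep_HomI[OF _ _ _ wf rNP])
  fix i x assume i: "i : verts Q" "x : rep_space ?NP i"
  then show "snd (s i x) : rep_space I i" using sin(1)[of i x] is_subrepD(3)[OF sN i(1)] by auto
 next
  fix i assume i: "i : verts Q"
  show "clinear_on (rep_space ?NP i) (%x. snd (s i x))"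
   by (rule clinear_on_compose[OF rep_HomD(2)[OF s(1) i] subset_UNIV clinear_on_snd])
 next
  fix a x assume a: "a : arcs Q" and x: "x : rep_space ?NP (tail Q a)"
  show "snd (s (head Q a) (rep_map ?NP a x)) = rep_map I a (snd (s (tail Q a) x))"
   using rep_HomD(3)[OF s(1) a x] by (simp add: snd_map_prod)
 qed
 have incl: "(\<lambda>i\<in>verts Q. \<lambda>x\<in>rep_space ?NP i. x) : rep_mono Q ?NP P"
  unfolding rep_mono_def
 proof (intro CollectI conjI ballI)
  show "(\<lambda>i\<in>verts Q. \<lambda>x\<in>rep_space ?NP i. x) : rep_Hom Q ?NP P"
   by (rule rep_HomI[OF _ _ _ wf rNP]) (use is_subrepD(3)[OF sP] in \<open>auto intro: clinear_on_id\<close>)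
 qed (auto simp: inj_on_def)
 obtain h where h: "h : rep_Hom Q P I" "!!i x. i : verts Q ==> x : rep_space ?NP i ==>
   h i ((\<lambda>i\<in>verts Q. \<lambda>x\<in>rep_space ?NP i. x) i x) = (\<lambda>i\<in>verts Q. \<lambda>x\<in>rep_space ?NP i. snd (s i x)) i x"
  by (rule injective_rep_extend[OF wf injective rNP repP incl h0]) (rule that)
 have hs: "s i x = (x, h i x)" if "i : verts Q" "x : part_P Q N i" for i x
  using h(2)[of i x] sin[OF that] that by (simp add: prod_eq_iff)
 have "N i = {(x, h i x + y) | x y. x : part_P Q N i & y : part_I Q N i}" if i: "i : verts Q" for i
 proof (intro equalityI subsetI)
  fix z assume z: "z : N i"
  obtain x w where xw: "z = (x, w)" by (cases z)
  have "fst z : fst ` N i" using z by (rule imageI)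
  then have x: "x : part_P Q N i" using i xw by simp
  have "z - s i x : N i" by (rule cvec.subspace_diff[OF is_subrepD(2)[OF sN i] z sin(1)[OF i x]])
  then have "w - h i x : part_I Q N i" using i xw hs[OF i x] by simp
  then show "z : {(x, h i x + y) | x y. x : part_P Q N i & y : part_I Q N i}"
   using x xw by (intro CollectI exI[of _ x] exI[of _ "w - h i x"]) auto
 next
  fix z assume "z : {(x, h i x + y) | x y. x : part_P Q N i & y : part_I Q N i}"
  then obtain x y where xy: "z = (x, h i x + y)" "x : part_P Q N i" "y : part_I Q N i" by blast
  have "s i x + (0, y) : N i"
   using cvec.subspace_add[OF is_subrepD(2)[OF sN i] sin(1)[OF i xy(2)]] xy(3) i by simp
  then show "z : N i" using xy hs[OF i xy(2)] by simp
 qed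
 then show ?thesis using that h(1) by blast
qed

text \<open>An isomorphism of the parts in \<open>I\<close> extends to \<open>b\<close>. For
  \<open>P\<close> one common quotient \<open>R\<close> is used: lifting its identity gives
  \<open>a\<close> with \<open>f' a = f\<close>, which carries the kernel of \<open>f\<close> onto
  that of \<open>f'\<close>.\<close>

lemma class_pair_eq_imp_orbit:
 assumes N: "N : Gr" and N': "N' : Gr" and eq: "class_pair Q P I N = class_pair Q P I N'"
 shows "N' : orbit G act N"
proof -
 note sP = is_subrep_part_P[OF wf GrD(1)[OF N]] and sP' = is_subrep_part_P[OF wf GrD(1)[OF N']]
 note sI = is_subrep_part_I[OF wf repP GrD(1)[OF N]] and sI' = is_subrep_part_I[OF wf repP GrD(1)[OF N']]
 have eqP: "quotient_class Q P (part_P Q N) = quotient_class Q P (part_P Q N')"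
  and eqI: "iso_class Q (subrep I (part_I Q N)) = iso_class Q (subrep I (part_I Q N'))"
  using eq unfolding class_pair_def by auto
 obtain h where h: "h : rep_Hom Q P I"
  "!!i. i : verts Q ==> N i = {(x, h i x + y) | x y. x : part_P Q N i & y : part_I Q N i}"
  using Gr_graph[OF N] by blast
 obtain h' where h': "h' : rep_Hom Q P I"
  "!!i. i : verts Q ==> N' i = {(x, h' i x + y) | x y. x : part_P Q N' i & y : part_I Q N' i}"
  using Gr_graph[OF N'] by blast
 have "rep_isomorphic Q (subrep I (part_I Q N)) (subrep I (part_I Q N'))"
  using eqI iso_class_eq_iff[OF wf is_rep_subrep[OF wf repI sI] is_rep_subrep[OF wf repI sI']] by simp
 then obtain ph where ph: "ph : rep_iso Q (subrep I (part_I Q N)) (subrep I (part_I Q N'))"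
  unfolding rep_isomorphic_def by blast
 obtain b where b: "b : rep_iso Q I I" "!!i x. i : verts Q ==> x : part_I Q N i ==> b i x = ph i x"
  by (rule out_arcs_surjective_extend_iso[OF fd r repI surjI sI sI' ph]) (rule that)
 have bI: "b i ` part_I Q N i = part_I Q N' i" if "i : verts Q" for i
  using rep_iso_bij[OF ph that] b(2)[OF that] unfolding bij_betw_def by simp
 obtain R where R: "R : quotient_class Q P (part_P Q N)" using quotient_class_nonempty[OF wf repP sP] by blast
 then have R': "R : quotient_class Q P (part_P Q N')" using eqP by simp
 obtain f where rR: "is_rep Q R" and f: "f : rep_Hom Q P R"
  "ALL i:verts Q. f i ` rep_space P i = rep_space R i"
  "ALL i:verts Q. {x : rep_space P i. f i x = 0} = part_P Q N i"
  by (rule quotient_classE[OF R])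
 obtain f' where f': "f' : rep_Hom Q P R"
  "ALL i:verts Q. f' i ` rep_space P i = rep_space R i"
  "ALL i:verts Q. {x : rep_space P i. f' i x = 0} = part_P Q N' i"
  by (rule quotient_classE[OF R'])
 obtain a where a: "a : rep_Hom Q P P" "!!i x. i : verts Q ==> x : rep_space P i ==> f' i (a i x) = f i x"
  "True ==> a : rep_iso Q P P"
  by (rule in_arcs_injective_lift[OF fd r repP repP rR injP f'(1) f(1), where B=True])
   (use f f' injP in \<open>auto intro: that\<close>)
 then have ai: "a : rep_iso Q P P" by simp
 have aP: "a i ` part_P Q N i = part_P Q N' i" if i: "i : verts Q" for i
 proof
  have k: "x : part_P Q N i \<longleftrightarrow> x : rep_space P i & f i x = 0"
   "x : part_P Q N' i \<longleftrightarrow> x : rep_space P i & f' i x = 0" for x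
   using f(3) f'(3) i by blast+
  show "a i ` part_P Q N i <= part_P Q N' i"
  proof (rule image_subsetI)
   fix x assume "x : part_P Q N i"
   then have x: "x : rep_space P i" "f i x = 0" using k(1)[of x] by auto
   show "a i x : part_P Q N' i"
    unfolding k(2) using a(2)[OF i x(1)] x(2) rep_HomD(1)[OF a(1) i x(1)] by simp
  qed
  show "part_P Q N' i <= a i ` part_P Q N i"
  proof
   fix x assume x: "x : part_P Q N' i"
   then have x': "x : rep_space P i" "f' i x = 0" using k(2)[of x] by auto
   then obtain y where y: "y : rep_space P i" "x = a i y"
    using rep_iso_bij[OF ai i] unfolding bij_betw_def by blast
   have "y : part_P Q N i" unfolding k(1) using x' y a(2)[OF i y(1)] by simp
   then show "x : a i ` part_P Q N i" using y by blast
  qed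
 qed
 \<comment> \<open>Chosen so that over \<open>a i x\<close> the second component
   \<open>h i x + y\<close> is sent to \<open>h' i (a i x) + b i y\<close>, which matches the graph
   descriptions of \<open>N\<close> and \<open>N'\<close>.\<close>
 define k where "k = (\<lambda>i\<in>verts Q. \<lambda>x\<in>rep_space P i. h' i (a i x) - b i (h i x))"
 note bH = rep_iso_Hom[OF b(1)]
 have kH: "k : rep_Hom Q P I"
  unfolding k_def
 proof (rule rep_HomI[OF _ _ _ wf repP])
  fix i assume i: "i : verts Q"
  show "h' i (a i x) - b i (h i x) : rep_space I i" if "x : rep_space P i" for x
   using cvec.subspace_diff[OF rep_subspace[OF repI i]] rep_HomD(1)[OF h'(1) i] rep_HomD(1)[OF a(1) i]
    rep_HomD(1)[OF bH i] rep_HomD(1)[OF h(1) i] that by blast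
  show "clinear_on (rep_space P i) (%x. h' i (a i x) - b i (h i x))"
   by (intro clinear_on_minus clinear_on_compose[OF rep_HomD(2)[OF a(1) i] _ rep_HomD(2)[OF h'(1) i]]
     clinear_on_compose[OF rep_HomD(2)[OF h(1) i] _ rep_HomD(2)[OF bH i]])
    (use rep_HomD(1)[OF a(1) i] rep_HomD(1)[OF h(1) i] in auto)
 next
  fix c x assume c: "c : arcs Q" and x: "x : rep_space P (tail Q c)"
  note t = tail_in_verts[OF c]
  have ax: "a (tail Q c) x : rep_space P (tail Q c)" and hx: "h (tail Q c) x : rep_space I (tail Q c)"
   using rep_HomD(1)[OF a(1) t x] rep_HomD(1)[OF h(1) t x] .
  show "h' (head Q c) (a (head Q c) (rep_map P c x)) - b (head Q c) (h (head Q c) (rep_map P c x)) =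
    rep_map I c (h' (tail Q c) (a (tail Q c) x) - b (tail Q c) (h (tail Q c) x))"
   using rep_HomD(3)[OF a(1) c x] rep_HomD(3)[OF h(1) c x] rep_HomD(3)[OF h'(1) c ax] rep_HomD(3)[OF bH c hx]
    clinear_on_diff[OF rep_map_clinear[OF repI c] rep_subspace[OF repI t]
     rep_HomD(1)[OF h'(1) t ax] rep_HomD(1)[OF bH t hx]] by simp
 qed
 let ?g = "block_map Q P I a k b"
 have g: "?g : carrier G" using ai kH b(1) unfolding carrier_G block_subgroup_def by blast
 have gz: "?g i (x, h i x + y) = (a i x, h' i (a i x) + b i y)"
  if i: "i : verts Q" and x: "x : part_P Q N i" and y: "y : part_I Q N i" for i x y
 proof -
  have x': "x : rep_space P i" and y': "y : rep_space I i"
   using is_subrepD(3)[OF sP i] is_subrepD(3)[OF sI i] x y by auto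
  note hx = rep_HomD(1)[OF h(1) i x']
  have "b i (h i x + y) = b i (h i x) + b i y" by (rule clinear_on_add[OF rep_HomD(2)[OF bH i] hx y'])
  then show ?thesis
   using block_map_apply[OF i x' cvec.subspace_add[OF rep_subspace[OF repI i] hx y']] x' i
   by (simp add: k_def)
 qed
 have "act ?g N = N'"
 proof (rule subrep_eqI)
  show "act ?g N : extensional (verts Q)" using N by (simp add: grass_act_def)
  show "N' : extensional (verts Q)" using is_subrepD(1)[OF GrD(1)[OF N']] .
  fix i assume i: "i : verts Q"
  let ?A = "part_P Q N i" and ?B = "part_I Q N i"
  have "?g i ` N i = ?g i ` (%(x, y). (x, h i x + y)) ` (?A \<times> ?B)"
   using h(2)[OF i] unfolding graph_set_eq_image by (rule arg_cong[of _ _ "image (?g i)"])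
  also have "... = (%(x, y). (a i x, h' i (a i x) + b i y)) ` (?A \<times> ?B)"
   unfolding image_image by (rule image_cong[OF refl]) (use gz[OF i] in auto)
  also have "... = (%(x, y). (x, h' i x + y)) ` ((a i ` ?A) \<times> (b i ` ?B))"
   by (force simp: image_def)
  also have "... = N' i" unfolding aP[OF i] bI[OF i] using h'(2)[OF i] unfolding graph_set_eq_image by (rule sym)
  finally show "act ?g N i = N' i" using i N by (simp add: grass_act_def)
 qed
 then show ?thesis using g unfolding orbit_def by blast
qed

lemma orbit_imp_class_pair_eq:
 assumes N: "N : Gr" and N': "N' : orbit G act N"
 shows "class_pair Q P I N' = class_pair Q P I N"
proof -
 note sN = GrD(1)[OF N]
 note sP = is_subrep_part_P[OF wf sN] and sI = is_subrep_part_I[OF wf repP sN]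
 obtain a h b where a: "a : rep_iso Q P P" and h: "h : rep_Hom Q P I" and b: "b : rep_iso Q I I"
  and N'_eq: "N' = act (block_map Q P I a h b) N"
  using N' unfolding orbit_def carrier_G block_subgroup_def by blast
 have N'i: "N' i = block_map Q P I a h b i ` N i" if "i : verts Q" for i
  using N'_eq N that by (simp add: grass_act_def)
 have Ni: "x : rep_space P i" "y : rep_space I i" if "i : verts Q" "(x, y) : N i" for i x y
  using is_subrepD(3)[OF sN that(1)] that(2) by auto
 have a0: "x = 0" if "i : verts Q" "x : rep_space P i" "a i x = 0" for i x
  using rep_iso_bij[OF a that(1)]
   clinear_on_inj_iff[OF rep_HomD(2)[OF rep_iso_Hom[OF a] that(1)] rep_subspace[OF repP that(1)]] that
  unfolding bij_betw_def by simp
 have a00: "a i 0 = 0" "h i 0 = 0" if "i : verts Q" for i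
  using clinear_on_0[OF rep_HomD(2)[OF rep_iso_Hom[OF a] that] rep_subspace[OF repP that]]
   clinear_on_0[OF rep_HomD(2)[OF h that] rep_subspace[OF repP that]] by auto
 have P': "part_P Q N' = (\<lambda>i\<in>verts Q. a i ` part_P Q N i)"
 proof (rule subrep_eqI[of _ "verts Q"])
  fix i assume i: "i : verts Q"
  have "fst ` N' i = (%z. a i (fst z)) ` N i"
   unfolding N'i[OF i] image_image
  proof (intro image_cong refl)
   fix z assume z: "z : N i"
   obtain x y where xy: "z = (x, y)" by (cases z)
   show "fst (block_map Q P I a h b i z) = a i (fst z)"
    using block_map_apply[OF i Ni[OF i z[unfolded xy]]] xy by simp
  qed
  then show "part_P Q N' i = (\<lambda>i\<in>verts Q. a i ` part_P Q N i) i" using i by (simp add: image_image)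
 qed (auto simp: part_P_def)
 \<comment> \<open>A vector of \<open>N'\<close> with zero first component comes from one with
   \<open>a i x = 0\<close>, hence with \<open>x = 0\<close>.\<close>
 have I': "part_I Q N' = (\<lambda>i\<in>verts Q. b i ` part_I Q N i)"
 proof (rule subrep_eqI[of _ "verts Q"])
  fix i assume i: "i : verts Q"
  have "{y. (0, y) : N' i} = b i ` {y. (0, y) : N i}"
  proof (intro equalityI subsetI)
   fix y' assume "y' : {y. (0, y) : N' i}"
   then obtain x y where xy: "(x, y) : N i" "(0, y') = block_map Q P I a h b i (x, y)"
    unfolding N'i[OF i] by auto
   then have "a i x = 0" "y' = h i x + b i y" using block_map_apply[OF i Ni[OF i xy(1)]] by auto
   then have "x = 0" using a0[OF i Ni(1)[OF i xy(1)]] by simp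
   then show "y' : b i ` {y. (0, y) : N i}" using xy(1) \<open>y' = _\<close> a00[OF i] by auto
  next
   fix y' assume "y' : b i ` {y. (0, y) : N i}"
   then obtain y where y: "(0, y) : N i" "y' = b i y" by blast
   then have "(0, y') = block_map Q P I a h b i (0, y)"
    using block_map_apply[OF i Ni[OF i y(1)]] a00[OF i] by simp
   then show "y' : {y. (0, y) : N' i}" unfolding N'i[OF i] using y(1) by blast
  qed
  then show "part_I Q N' i = (\<lambda>i\<in>verts Q. b i ` part_I Q N i) i" using i by simp
 qed (auto simp: part_I_def)
 have sI': "is_subrep Q I (\<lambda>i\<in>verts Q. b i ` part_I Q N i)"
  using is_subrep_part_I[OF wf repP GrD(1)] group_action.element_image[OF group_action_G _ N] N' I'
  unfolding orbit_def by fastforce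
 have "iso_class Q (subrep I (part_I Q N)) = iso_class Q (subrep I (part_I Q N'))"
  unfolding I' using iso_class_eq_iff[OF wf is_rep_subrep[OF wf repI sI] is_rep_subrep[OF wf repI sI']]
   image_subrep_iso[OF wf repI sI b] by simp
 then show ?thesis
  unfolding class_pair_def P' using quotient_class_image[OF wf repP sP a] by simp
qed

text \<open>The dimension condition expresses \<open>dim N = dim P\<close>: the quotient has
  dimension \<open>dim P - dim \<pi>(N)\<close> and the part in \<open>I\<close> has dimension
  \<open>dim N - dim \<pi>(N)\<close>. Conversely, the direct sum of \<open>V\<close> and the kernel
  of \<open>P -> R\<close> realizes a given pair.\<close>

lemma class_pair_image: "class_pair Q P I ` Gr = admissible_pairs Q P I"
proof (intro equalityI subsetI)
 fix p assume "p : class_pair Q P I ` Gr"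
 then obtain N where N: "N : Gr" and p: "p = class_pair Q P I N" by blast
 note sN = GrD(1)[OF N]
 note sP = is_subrep_part_P[OF wf sN] and sI = is_subrep_part_I[OF wf repP sN]
 obtain R where R: "R : quotient_class Q P (part_P Q N)" using quotient_class_nonempty[OF wf repP sP] by blast
 obtain f where rR: "is_rep Q R" and f: "f : rep_Hom Q P R"
  and fs: "ALL i:verts Q. f i ` rep_space P i = rep_space R i"
  and fk: "ALL i:verts Q. {x : rep_space P i. f i x = 0} = part_P Q N i"
  by (rule quotient_classE[OF R])
 have d: "dim_vec_of R i = dim_vec_of (subrep I (part_I Q N)) i" if i: "i : verts Q" for i
 proof -
  have "cvec.dim (rep_space P i) = cvec.dim (part_P Q N i) + cvec.dim (rep_space R i)"
   using clinear_on_rank_nullity[OF rep_fin_dim[OF repP i] rep_HomD(2)[OF f i]] fs fk i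
   by (simp del: part_P_apply)
  moreover have "cvec.dim (rep_space P i) = cvec.dim (part_I Q N i) + cvec.dim (part_P Q N i)"
   using cvec_dim_fst_snd[OF Gr_finite_dim[OF N i]] GrD(2)[OF N i] i by simp
  ultimately show ?thesis unfolding dim_vec_of_def by simp
 qed
 have "f : rep_epi Q P R" using f fs unfolding rep_epi_def by blast
 then have "(iso_class Q R, iso_class Q (subrep I (part_I Q N))) : admissible_pairs Q P I"
  unfolding admissible_pairs_def using rR sI d by blast
 then show "p : admissible_pairs Q P I"
  unfolding p class_pair_def quotient_class_eq_iso_class[OF wf repP R] .
next
 fix p assume "p : admissible_pairs Q P I"
 then obtain R V f where p: "p = (iso_class Q R, iso_class Q (subrep I V))" and rR: "is_rep Q R"
  and f: "f : rep_epi Q P R" and V: "is_subrep Q I V"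
  and d: "ALL i:verts Q. dim_vec_of R i = dim_vec_of (subrep I V) i"
  unfolding admissible_pairs_def by blast
 have fH: "f : rep_Hom Q P R" and fs: "!!i. i : verts Q ==> f i ` rep_space P i = rep_space R i"
  using f unfolding rep_epi_def by auto
 define U where "U = (\<lambda>i\<in>verts Q. {x : rep_space P i. f i x = 0})"
 define N where "N = (\<lambda>i\<in>verts Q. U i \<times> V i)"
 have U: "is_subrep Q P U"
 proof (rule is_subrepI)
  fix i assume i: "i : verts Q"
  show "cvec.subspace (U i)"
   using clinear_on_kernel_subspace[OF rep_HomD(2)[OF fH i] rep_subspace[OF repP i]] i by (simp add: U_def)
  show "U i <= rep_space P i" using i by (auto simp: U_def)
 next
  fix a x assume a: "a : arcs Q" and x: "x : U (tail Q a)"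
  have "rep_map R a 0 = 0" by (rule clinear_on_0[OF rep_map_clinear[OF rR a] rep_subspace[OF rR tail_in_verts[OF a]]])
  then show "rep_map P a x : U (head Q a)"
   using x a rep_map_in[OF repP a] rep_HomD(3)[OF fH a] by (simp add: U_def)
 qed (simp add: U_def)
 have Usub: "cvec.subspace (U i)" "U i <= rep_space P i" "fin_dim_subspace (U i)"
  and Vsub: "cvec.subspace (V i)" "V i <= rep_space I i" "fin_dim_subspace (V i)" if i: "i : verts Q" for i
  using is_subrepD(2,3)[OF U i] fin_dim_subspace_subset[OF rep_fin_dim[OF repP i] is_subrepD(2,3)[OF U i]]
   is_subrepD(2,3)[OF V i] fin_dim_subspace_subset[OF rep_fin_dim[OF repI i] is_subrepD(2,3)[OF V i]] by auto
 have sN: "is_subrep Q (rep_sum P I) N"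
 proof (rule is_subrepI)
  fix i assume i: "i : verts Q"
  show "cvec.subspace (N i)" using cvec_subspace_Times[OF Usub(1)[OF i] Vsub(1)[OF i]] i by (simp add: N_def)
  show "N i <= rep_space (rep_sum P I) i" using Usub(2)[OF i] Vsub(2)[OF i] i by (auto simp: N_def)
 next
  fix a z assume "a : arcs Q" "z : N (tail Q a)"
  then show "rep_map (rep_sum P I) a z : N (head Q a)"
   using is_subrepD(4)[OF U] is_subrepD(4)[OF V] by (auto simp: N_def)
 qed (simp add: N_def)
 have "cvec.dim (N i) = cvec.dim (rep_space P i)" if i: "i : verts Q" for i
 proof -
  have "cvec.dim (N i) = cvec.dim (U i) + cvec.dim (V i)"
   using cvec_dim_Times[OF Usub(3)[OF i] Vsub(3)[OF i]] i by (simp add: N_def)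
  also have "... = cvec.dim (U i) + cvec.dim (rep_space R i)" using d i by (simp add: dim_vec_of_def)
  also have "... = cvec.dim (rep_space P i)"
   using clinear_on_rank_nullity[OF rep_fin_dim[OF repP i] rep_HomD(2)[OF fH i]] fs[OF i] i by (simp add: U_def)
  finally show ?thesis .
 qed
 then have N: "N : Gr" using sN unfolding quiver_grass_def dim_vec_of_def by simp
 have "part_P Q N = U"
  using Vsub(1) cvec.subspace_0 is_subrepD(1)[OF U]
  by (intro subrep_eqI[of _ "verts Q"]) (force simp: N_def part_P_def)+
 moreover have "part_I Q N = V"
  using Usub(1) cvec.subspace_0 is_subrepD(1)[OF V]
  by (intro subrep_eqI[of _ "verts Q"]) (force simp: N_def part_I_def)+
 moreover have "R : quotient_class Q P U"
  unfolding quotient_class_def using rR f by (auto simp: U_def)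
 ultimately have "class_pair Q P I N = p"
  unfolding class_pair_def p using quotient_class_eq_iso_class[OF wf repP] by simp
 then show "p : class_pair Q P I ` Gr" using N by blast
qed

lemma orbit_eq_iff:
 assumes N: "N : Gr" and N': "N' : Gr"
 shows "orbit G act N = orbit G act N' \<longleftrightarrow> class_pair Q P I N = class_pair Q P I N'"
proof
 interpret group_action G Gr act by (rule group_action_G)
 assume "orbit G act N = orbit G act N'"
 then have "N : orbit G act N'" using orbit_refl[OF N] by simp
 then show "class_pair Q P I N = class_pair Q P I N'" by (rule orbit_imp_class_pair_eq[OF N'])
next
 interpret group_action G Gr act by (rule group_action_G)
 assume "class_pair Q P I N = class_pair Q P I N'"
 then have o: "N' : orbit G act N" "N : orbit G act N'"
  using class_pair_eq_imp_orbit[OF N N'] class_pair_eq_imp_orbit[OF N' N] by auto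
 have orbE: "x : Gr" if "x : orbit G act M" "M : Gr" for x M
  using that element_image unfolding orbit_def by blast
 show "orbit G act N = orbit G act N'"
  using orbit_trans[OF N N'] orbit_trans[OF N' N] o orbE[OF _ N] orbE[OF _ N'] by blast
qed

lemma orbits_bij_admissible_pairs:
 "EX Ph. bij_betw Ph (orbits G Gr act) (admissible_pairs Q P I) &
  (ALL N:Gr. Ph (orbit G act N) = class_pair Q P I N)"
proof -
 \<comment> \<open>The choice of representative is harmless by \<open>orbit_eq_iff\<close>.\<close>
 define Ph where "Ph X = class_pair Q P I (SOME N. N : Gr & orbit G act N = X)" for X
 have Ph: "Ph (orbit G act N) = class_pair Q P I N" if N: "N : Gr" for N
 proof -
  have "EX N'. N' : Gr & orbit G act N' = orbit G act N" using N by blast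
  from someI_ex[OF this] show ?thesis unfolding Ph_def using orbit_eq_iff[OF _ N] by blast
 qed
 have "inj_on Ph (orbits G Gr act)"
 proof (rule inj_onI)
  fix X Y assume "X : orbits G Gr act" "Y : orbits G Gr act" and e: "Ph X = Ph Y"
  then obtain N N' where N: "N : Gr" "N' : Gr" and XY: "X = orbit G act N" "Y = orbit G act N'"
   unfolding orbits_def by blast
  then show "X = Y" using e Ph orbit_eq_iff[OF N] by simp
 qed
 moreover have "Ph ` orbits G Gr act = class_pair Q P I ` Gr"
 proof -
  have "orbits G Gr act = orbit G act ` Gr" unfolding orbits_def by blast
  then show ?thesis using Ph by (simp add: image_image)
 qed
 ultimately show ?thesis using Ph class_pair_image unfolding bij_betw_def by auto
qed

end

subsection \<open>Simple reflections of dimension vectors\<close>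

text \<open>The simple reflection at \<open>i\<close> for the symmetric Cartan matrix
  \<open>2 - c\<close>.\<close>

definition reflect :: "'v set => ('v => 'v => int) => 'v => ('v => int) => 'v => int" where
 "reflect V c i d = d(i := (SUM j:V. c i j * d j) - d i)"

text \<open>The list is cycled instead of being used up: after reflecting at the first sink of an
  admissible ordering, that vertex belongs at the end.\<close>

fun reflections :: "'v set => ('v => 'v => int) => nat => 'v list => ('v => int) => 'v => int" where
 "reflections V c 0 vs d = d"
| "reflections V c (Suc t) vs d = reflections V c t (rotate1 vs) (reflect V c (hd vs) d)"

lemma reflections_append:
 "reflections V c (length us + t) (us @ ws) d = reflections V c t (ws @ us) (fold (reflect V c) us d)"
 by (induction us arbitrary: ws d) simp_all

text \<open>Full rounds are powers of one Coxeter transformation, the form in which periodicity can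
  be exploited.\<close>

lemma reflections_rounds:
 "reflections V c (k * length vs) vs d = (fold (reflect V c) vs ^^ k) d"
proof (induction k arbitrary: d)
 case (Suc k)
 have "reflections V c (length vs + k * length vs) (vs @ []) d =
   reflections V c (k * length vs) ([] @ vs) (fold (reflect V c) vs d)"
  by (rule reflections_append)
 then show ?case using Suc by (simp add: funpow_swap1 del: funpow.simps) (simp add: funpow_swap1)
qed simp

lemma fold_reflect_notin: "j ~: set us ==> fold (reflect V c) us d j = d j"
 by (induction us arbitrary: d) (auto simp: reflect_def)

text \<open>With \<open>2 - c\<close> as Cartan matrix, \<open>u\<close> is a positive vector with
  strictly positive image; this certifies that the Tits form is positive definite.\<close>

locale dynkin_weights =
 fixes V :: "'v set" and c :: "'v => 'v => int" and u :: "'v => int"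
 assumes finV: "finite V" and csym: "c i j = c j i" and cnonneg: "0 <= c i j" and cdiag: "c i i = 0"
  and upos: "i : V ==> 0 < u i" and udom: "i : V ==> (SUM j:V. c i j * u j) < 2 * u i"
begin

text \<open>Twice the usual Tits form: the double sum meets every edge in both directions.\<close>

definition tits :: "('v => int) => int" where
 "tits d = (SUM i:V. 2 * (d i)^2) - (SUM i:V. SUM j:V. c i j * d i * d j)"

lemma tits_split:
 assumes i: "i : V"
 shows "tits d = 2 * (d i)^2 - 2 * d i * (SUM j:V - {i}. c i j * d j) +
  ((SUM k:V - {i}. 2 * (d k)^2) - (SUM k:V - {i}. SUM j:V - {i}. c k j * d k * d j))"
proof -
 let ?W = "V - {i}"
 have s: "(SUM j:V. f j) = f i + (SUM j:?W. f j)" for f :: "'v => int"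
  using finV i by (simp add: sum.remove)
 have "(SUM k:V. SUM j:V. c k j * d k * d j) =
   (SUM j:?W. c i j * d i * d j) + (SUM k:?W. c k i * d k * d i) + (SUM k:?W. SUM j:?W. c k j * d k * d j)"
  by (simp add: s cdiag sum.distrib)
 also have "(SUM k:?W. c k i * d k * d i) = d i * (SUM j:?W. c i j * d j)"
  using csym by (simp add: sum_distrib_left algebra_simps)
 also have "(SUM j:?W. c i j * d i * d j) = d i * (SUM j:?W. c i j * d j)"
  by (simp add: sum_distrib_left algebra_simps)
 finally show ?thesis unfolding tits_def by (simp add: s algebra_simps)
qed

text \<open>As a polynomial in \<open>t = d i\<close> the form is \<open>2 t^2 - 2 N t\<close> plus
  a constant, which is symmetric under \<open>t -> N - t\<close>.\<close>

lemma tits_reflect: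
 assumes i: "i : V"
 shows "tits (reflect V c i d) = tits d"
proof -
 let ?d = "reflect V c i d" and ?W = "V - {i}"
 define N where "N = (SUM j:?W. c i j * d j)"
 have "(SUM j:V. c i j * d j) = N"
  using finV i cdiag by (simp add: sum.remove N_def)
 then have di: "?d i = N - d i" by (simp add: reflect_def)
 have dj: "?d j = d j" if "j : ?W" for j using that by (simp add: reflect_def)
 have "(SUM j:?W. c i j * ?d j) = N" unfolding N_def using dj by (intro sum.cong) auto
 moreover have "(SUM k:?W. 2 * (?d k)^2) = (SUM k:?W. 2 * (d k)^2)" using dj by (intro sum.cong) auto
 moreover have "(SUM k:?W. SUM j:?W. c k j * ?d k * ?d j) = (SUM k:?W. SUM j:?W. c k j * d k * d j)"
  using dj by (intro sum.cong) auto
 ultimately show ?thesis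
  unfolding tits_split[OF i] di N_def[symmetric] by (simp add: power2_eq_square algebra_simps)
qed

lemma tits_fold_reflect: "set us <= V ==> tits (fold (reflect V c) us d) = tits d"
 by (induction us arbitrary: d) (simp_all add: tits_reflect)

text \<open>Each product is bounded by \<open>x y <= (s x^2 + y^2 / s) / 2\<close> with
  \<open>s = u j / u k\<close>. After summation the row sums of \<open>c\<close> against
  \<open>u\<close> appear, and integrality improves \<open>< 2 * u k\<close> to
  \<open><= 2 * u k - 1\<close>; the gap leaves the sum of all \<open>(d k)^2 / u k\<close> below
  the form.\<close>

lemma tits_bound:
 assumes i: "i : V"
 shows "(d i)^2 <= u i * tits d"
proof -
 let ?x = "%i. real_of_int (d i)" and ?u = "%i. real_of_int (u i)" and ?c = "%i j. real_of_int (c i j)"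
 have amgm: "?c k j * ?x k * ?x j <= ?c k j * ((?u j / ?u k * (?x k)^2 + ?u k / ?u j * (?x j)^2) / 2)"
  if k: "k : V" and j: "j : V" for k j
 proof -
  have p: "?u k > 0" "?u j > 0" using upos k j by auto
  have "0 <= (?u j * ?x k - ?u k * ?x j)^2 / (2 * ?u k * ?u j)" using p by simp
  also have "... = (?u j / ?u k * (?x k)^2 + ?u k / ?u j * (?x j)^2) / 2 - ?x k * ?x j"
   using p by (simp add: field_simps power2_eq_square)
  finally have "?x k * ?x j <= (?u j / ?u k * (?x k)^2 + ?u k / ?u j * (?x j)^2) / 2" by simp
  then have "?c k j * (?x k * ?x j) <= ?c k j * ((?u j / ?u k * (?x k)^2 + ?u k / ?u j * (?x j)^2) / 2)"
   by (rule mult_left_mono) (use cnonneg in simp)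
  then show ?thesis by (simp add: mult.assoc)
 qed
 have "(SUM k:V. SUM j:V. ?c k j * ?x k * ?x j) <=
   (SUM k:V. SUM j:V. ?c k j * ((?u j / ?u k * (?x k)^2 + ?u k / ?u j * (?x j)^2) / 2))"
  by (intro sum_mono amgm)
 also have "... = (SUM k:V. SUM j:V. ?c k j * (?u j / ?u k * (?x k)^2) / 2) +
   (SUM k:V. SUM j:V. ?c k j * (?u k / ?u j * (?x j)^2) / 2)"
  by (simp add: sum.distrib[symmetric] algebra_simps add_divide_distrib)
 also have "(SUM k:V. SUM j:V. ?c k j * (?u k / ?u j * (?x j)^2) / 2) =
   (SUM k:V. SUM j:V. ?c k j * (?u j / ?u k * (?x k)^2) / 2)"
  by (subst sum.swap) (simp add: csym)
 also have "(SUM k:V. SUM j:V. ?c k j * (?u j / ?u k * (?x k)^2) / 2) + ... =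
   (SUM k:V. (?x k)^2 / ?u k * (SUM j:V. ?c k j * ?u j))"
  by (simp add: sum.distrib[symmetric] sum_distrib_left sum_divide_distrib algebra_simps)
 also have "... <= (SUM k:V. (?x k)^2 / ?u k * (2 * ?u k - 1))"
 proof (rule sum_mono, rule mult_left_mono)
  fix k assume k: "k : V"
  have "real_of_int (SUM j:V. c k j * u j) <= real_of_int (2 * u k - 1)"
   using udom[OF k] by (intro of_int_le_iff[THEN iffD2]) simp
  then show "(SUM j:V. ?c k j * ?u j) <= 2 * ?u k - 1" by simp
  show "0 <= (?x k)^2 / ?u k" using upos[OF k] by simp
 qed
 also have "... = (SUM k:V. 2 * (?x k)^2) - (SUM k:V. (?x k)^2 / ?u k)"
  unfolding sum_subtractf[symmetric]
 proof (intro sum.cong refl)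
  fix k assume "k : V"
  then have "?u k ~= 0" using upos[of k] by simp
  then show "(?x k)^2 / ?u k * (2 * ?u k - 1) = 2 * (?x k)^2 - (?x k)^2 / ?u k"
   by (simp add: field_simps)
 qed
 finally have "(SUM k:V. (?x k)^2 / ?u k) <= real_of_int (tits d)"
  unfolding tits_def by simp
 moreover have "(?x i)^2 / ?u i <= (SUM k:V. (?x k)^2 / ?u k)"
  using upos finV by (intro member_le_sum[OF i]) (auto simp: less_imp_le)
 ultimately have "(?x i)^2 / ?u i <= real_of_int (tits d)" by (rule order_trans[rotated])
 then have "(?x i)^2 <= ?u i * real_of_int (tits d)"
  using upos[OF i] by (simp add: field_simps)
 then show ?thesis by (metis of_int_le_iff of_int_mult of_int_power)
qed

text \<open>If no round gave a negative entry, all iterates would be nonnegative vectors of the same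
  Tits form, hence finitely many on \<open>V\<close>, so two of them would agree. The sum over the
  period is fixed by every reflection, and pairing with \<open>u\<close> forces it to vanish. So
  some iterate is 0 on \<open>V\<close>, the Tits form of \<open>d\<close> is 0, and
  \<open>d\<close> is 0.\<close>

lemma fold_reflect_negative:
 assumes vs: "distinct vs" "set vs = V" and d: "EX i:V. d i ~= 0"
 shows "EX k. EX i:V. (fold (reflect V c) vs ^^ k) d i < 0"
proof (rule ccontr)
 assume "~ ?thesis"
 then have nonneg: "0 <= (fold (reflect V c) vs ^^ k) d i" if "i : V" for k i
  using that by (auto simp: not_less)
 define R where "R k = (fold (reflect V c) vs ^^ k) d" for k
 have R_Suc: "R (Suc k) = fold (reflect V c) vs (R k)" for k unfolding R_def by simp
 have R0: "0 <= R k i" if "i : V" for k i using nonneg[OF that] unfolding R_def .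
 have tR: "tits (R k) = tits d" for k
  by (induction k) (simp_all add: R_def tits_fold_reflect vs)
 let ?B = "%i. {0..u i * tits d}"
 have "restrict (R k) V : (\<Pi>\<^sub>E i\<in>V. ?B i)" for k
 proof -
  have "R k i <= u i * tits d" if i: "i : V" for i
  proof -
   have "R k i <= (R k i)^2" using R0[OF i, of k] by (simp add: self_le_power power2_eq_square mult_le_cancel_left1)
   then show ?thesis using tits_bound[OF i, of "R k"] tR by simp
  qed
  then show ?thesis using R0 by auto
 qed
 then have "range (%k. restrict (R k) V) <= (\<Pi>\<^sub>E i\<in>V. ?B i)" by blast
 moreover have "finite (\<Pi>\<^sub>E i\<in>V. ?B i)" using finV by (intro finite_PiE) auto
 ultimately have "~ inj (%k. restrict (R k) V)"
  using finite_imageD finite_subset infinite_UNIV_nat by blast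
 then obtain k l where kl: "k < l" "restrict (R k) V = restrict (R l) V"
  unfolding inj_def by (metis linorder_neqE_nat)
 have Rkl: "R k i = R l i" if "i : V" for i using kl(2) that by (metis restrict_apply')
 define X where "X i = (SUM m:{k..<l}. R m i)" for i
 have X0: "0 <= X i" if "i : V" for i unfolding X_def using R0[OF that] by (intro sum_nonneg) auto
 have XS: "(SUM m:{k..<l}. R (Suc m) i) = X i" if i: "i : V" for i
 proof -
  have "(SUM m:{k..<l}. R (Suc m) i - R m i) = R l i - R k i"
   by (rule sum_Suc_diff') (use kl in simp)
  then show ?thesis using Rkl[OF i] unfolding X_def by (simp add: sum_subtractf)
 qed
 have bal: "2 * X i = (SUM j:V. c i j * X j)" if i: "i : V" for i
 proof -
  obtain us ws where uw: "vs = us @ i # ws" using i vs(2) split_list by metis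
  have dist: "i ~: set us" "i ~: set ws" "set us Int set ws = {}" using vs(1) uw by auto
  \<comment> \<open>In round \<open>m\<close> the vertex \<open>i\<close> sees the new values at the
    vertices before it in \<open>vs\<close> and the old values at the others. Over a full period
    both add up to \<open>X\<close>.\<close>
  have step: "R (Suc m) i + R m i = (SUM j:V. c i j * (if j : set us then R (Suc m) j else R m j))" for m
  proof -
   let ?y = "fold (reflect V c) us (R m)"
   have Rs: "R (Suc m) = fold (reflect V c) ws (reflect V c i ?y)" unfolding R_Suc uw by simp
   have "R (Suc m) i = (SUM j:V. c i j * ?y j) - R m i"
    unfolding Rs using fold_reflect_notin[OF dist(2)] fold_reflect_notin[OF dist(1)]
    by (simp add: reflect_def)
   moreover have "c i j * ?y j = c i j * (if j : set us then R (Suc m) j else R m j)" for j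
   proof (cases "j : set us")
    case True
    then have "j ~: set ws" "j ~= i" using dist by auto
    then have "R (Suc m) j = ?y j" unfolding Rs using fold_reflect_notin by (simp add: fold_reflect_notin reflect_def)
    then show ?thesis using True by simp
   qed (simp add: fold_reflect_notin)
   ultimately show ?thesis by simp
  qed
  have "2 * X i = (SUM m:{k..<l}. R (Suc m) i + R m i)"
   unfolding sum.distrib XS[OF i] by (simp add: X_def)
  also have "... = (SUM j:V. c i j * (SUM m:{k..<l}. if j : set us then R (Suc m) j else R m j))"
   unfolding step sum_distrib_left by (rule sum.swap)
  also have "... = (SUM j:V. c i j * X j)"
  proof (intro sum.cong refl)
   fix j assume "j : V"
   then show "c i j * (SUM m:{k..<l}. if j : set us then R (Suc m) j else R m j) = c i j * X j"
    using XS by (cases "j : set us") (simp_all add: X_def)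
  qed
  finally show ?thesis .
 qed
 \<comment> \<open>The balance equation is paired with \<open>u\<close>, and \<open>c\<close> is
   moved to \<open>u\<close> by symmetry; the gap 1 in \<open>udom\<close> then leaves the sum of
   all \<open>X j\<close> nonpositive.\<close>
 have "(SUM i:V. u i * (2 * X i)) = (SUM i:V. SUM j:V. u i * (c i j * X j))"
  using bal by (simp add: sum_distrib_left)
 also have "... = (SUM j:V. X j * (SUM i:V. c j i * u i))"
  by (subst sum.swap) (simp add: sum_distrib_left csym algebra_simps)
 also have "... <= (SUM j:V. X j * (2 * u j - 1))"
 proof (intro sum_mono mult_left_mono X0)
  fix j assume "j : V"
  then show "(SUM i:V. c j i * u i) <= 2 * u j - 1" using udom[of j] by simp
 qed
 also have "... = (SUM j:V. u j * (2 * X j)) - (SUM j:V. X j)"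
  by (simp add: sum_subtractf[symmetric] algebra_simps)
 finally have "(SUM j:V. X j) <= 0" by simp
 moreover have "0 <= (SUM j:V. X j)" using X0 by (rule sum_nonneg)
 ultimately have "(SUM j:V. X j) = 0" by simp
 then have Xz: "X i = 0" if "i : V" for i using sum_nonneg_eq_0_iff[OF finV X0] that by simp
 have "R k i = 0" if i: "i : V" for i
 proof -
  have "R k i <= X i" unfolding X_def using R0[OF i] kl(1) by (intro member_le_sum) auto
  then show ?thesis using Xz[OF i] R0[OF i, of k] by simp
 qed
 then have "tits d = 0" using tR[of k] unfolding tits_def by simp
 then have "d i = 0" if "i : V" for i using tits_bound[OF that, of d] by simp
 then show False using d by blast
qed

end

subsection \<open>Reflections at a sink\<close>

lemma in_arcs_sum_single:
 assumes Q: "fin_digraph Q" and M: "is_rep Q M" and a: "a : in_arcs Q i"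
 shows "(SUM b:in_arcs Q i. rep_map M b (if b = a then x else 0)) = rep_map M a x"
proof -
 interpret fin_digraph Q by (rule Q)
 have "finite (in_arcs Q i)" using finite_arcs by (simp add: in_arcs_def)
 moreover have "rep_map M b 0 = 0" if "b : in_arcs Q i" for b
 proof -
  have b: "b : arcs Q" using that by (simp add: in_arcs_def)
  show ?thesis by (rule clinear_on_0[OF rep_map_clinear[OF M b] rep_subspace[OF M tail_in_verts[OF b]]])
 qed
 then have "(SUM b:in_arcs Q i. rep_map M b (if b = a then x else 0)) =
   (SUM b:in_arcs Q i. if b = a then rep_map M a x else 0)"
  by (intro sum.cong) auto
 ultimately show ?thesis using a by simp
qed

text \<open>Only arcs pointing to \<open>i\<close> are turned around, which is the full reflection
  when \<open>i\<close> is a sink, as in the applications below.\<close>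

definition refl_quiver :: "('v, 'e) pre_digraph => 'v => ('v, 'e) pre_digraph" where
 "refl_quiver Q i = Q\<lparr>tail := %a. if head Q a = i then i else tail Q a,
  head := %a. if head Q a = i then tail Q a else head Q a\<rparr>"

lemma refl_quiver_simps [simp]:
 "verts (refl_quiver Q i) = verts Q" "arcs (refl_quiver Q i) = arcs Q"
 "tail (refl_quiver Q i) a = (if head Q a = i then i else tail Q a)"
 "head (refl_quiver Q i) a = (if head Q a = i then tail Q a else head Q a)"
 unfolding refl_quiver_def by simp_all

lemma fin_digraph_refl_quiver:
 assumes "fin_digraph Q"
 shows "fin_digraph (refl_quiver Q i)"
proof -
 interpret fin_digraph Q by (rule assms)
 show ?thesis by unfold_locales auto
qed

definition adjacency :: "('v, 'e) pre_digraph => 'v => 'v => int" where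
 "adjacency Q i j = int (card {a : arcs Q. tail Q a = i & head Q a = j | tail Q a = j & head Q a = i})"

lemma adjacency_refl_quiver: "adjacency (refl_quiver Q i) = adjacency Q"
proof (intro ext)
 fix k l
 have "{a : arcs Q. tail (refl_quiver Q i) a = k & head (refl_quiver Q i) a = l |
   tail (refl_quiver Q i) a = l & head (refl_quiver Q i) a = k} =
  {a : arcs Q. tail Q a = k & head Q a = l | tail Q a = l & head Q a = k}"
  by auto
 then show "adjacency (refl_quiver Q i) k l = adjacency Q k l" unfolding adjacency_def by simp
qed

text \<open>An admissible ordering in the sense of reflection functors: its first vertex is a sink.
  The condition in split form survives reflecting there and moving that vertex to the end.\<close>

definition sinks_first :: "('v, 'e) pre_digraph => 'v list => bool" where
 "sinks_first Q vs \<longleftrightarrow> distinct vs & set vs = verts Q &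
  (ALL a:arcs Q. EX us ws. vs = us @ head Q a # ws & tail Q a : set ws)"

lemma sinks_first_hd:
 assumes "sinks_first Q (i # vs)" "a : arcs Q"
 shows "tail Q a ~= i"
proof
 assume t: "tail Q a = i"
 obtain us ws where uw: "i # vs = us @ head Q a # ws" "tail Q a : set ws"
  using assms unfolding sinks_first_def by blast
 have "distinct (i # vs)" using assms(1) unfolding sinks_first_def by blast
 then show False using uw t by (cases us) auto
qed

lemma sinks_first_no_loop:
 assumes "sinks_first Q vs" "a : arcs Q"
 shows "tail Q a ~= head Q a"
proof -
 obtain us ws where uw: "vs = us @ head Q a # ws" "tail Q a : set ws"
  using assms unfolding sinks_first_def by blast
 have "distinct vs" using assms(1) unfolding sinks_first_def by blast
 then show ?thesis using uw by auto
qed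

lemma sinks_first_rotate:
 assumes sf: "sinks_first Q (i # vs)"
 shows "sinks_first (refl_quiver Q i) (vs @ [i])"
 unfolding sinks_first_def
proof (intro conjI ballI)
 show "distinct (vs @ [i])" "set (vs @ [i]) = verts (refl_quiver Q i)"
  using sf unfolding sinks_first_def by auto
 fix a assume "a : arcs (refl_quiver Q i)"
 then have a: "a : arcs Q" by simp
 note ti = sinks_first_hd[OF sf a]
 obtain us ws where uw: "i # vs = us @ head Q a # ws" "tail Q a : set ws"
  using sf a unfolding sinks_first_def by blast
 show "EX us ws. vs @ [i] = us @ head (refl_quiver Q i) a # ws & tail (refl_quiver Q i) a : set ws"
 proof (cases "head Q a = i")
  case True
  have "tail Q a : set vs" using uw ti by (cases us) auto
  then obtain xs ys where "vs = xs @ tail Q a # ys" using split_list by metis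
  then show ?thesis using True by (intro exI[of _ xs] exI[of _ "ys @ [i]"]) simp
 next
  case False
  then obtain us' where "us = i # us'" using uw(1) by (cases us) auto
  then show ?thesis using False uw by (intro exI[of _ us'] exI[of _ "ws @ [i]"]) simp
 qed
qed

lemma sum_adjacency:
 fixes d :: "'v => int"
 assumes Q: "fin_digraph Q" and nl: "!!a. a : arcs Q ==> tail Q a ~= head Q a"
 shows "(SUM j:verts Q. adjacency Q i j * d j) =
  (\<Sum>a | a : arcs Q & tail Q a = i. d (head Q a)) + (\<Sum>a | a : arcs Q & head Q a = i. d (tail Q a))"
proof -
 interpret fin_digraph Q by (rule Q)
 have "adjacency Q i j * d j = (\<Sum>a | a : arcs Q & tail Q a = i & head Q a = j. d j) +
   (\<Sum>a | a : arcs Q & head Q a = i & tail Q a = j. d j)" for j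
 proof -
  have "{a : arcs Q. tail Q a = i & head Q a = j | tail Q a = j & head Q a = i} =
    {a. a : arcs Q & tail Q a = i & head Q a = j} Un {a. a : arcs Q & head Q a = i & tail Q a = j}"
   by auto
  \<comment> \<open>Without loops no arc is counted both as leaving and as entering
    \<open>i\<close>.\<close>
  moreover have "{a. a : arcs Q & tail Q a = i & head Q a = j} Int {a. a : arcs Q & head Q a = i & tail Q a = j} = {}"
   using nl by auto
  ultimately show ?thesis
   unfolding adjacency_def using finite_arcs by (simp add: card_Un_disjoint algebra_simps)
 qed
 then have "(SUM j:verts Q. adjacency Q i j * d j) =
   (SUM j:verts Q. \<Sum>a | a : arcs Q & tail Q a = i & head Q a = j. d j) +
   (SUM j:verts Q. \<Sum>a | a : arcs Q & head Q a = i & tail Q a = j. d j)"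
  by (simp add: sum.distrib)
 also have "(SUM j:verts Q. \<Sum>a | a : arcs Q & tail Q a = i & head Q a = j. d j) =
   (SUM j:verts Q. \<Sum>a | a : {a. a : arcs Q & tail Q a = i} & head Q a = j. d (head Q a))"
  by (intro sum.cong) auto
 also have "... = (\<Sum>a | a : arcs Q & tail Q a = i. d (head Q a))"
  by (rule sum.group) (use finite_arcs in auto)
 also have "(SUM j:verts Q. \<Sum>a | a : arcs Q & head Q a = i & tail Q a = j. d j) =
   (SUM j:verts Q. \<Sum>a | a : {a. a : arcs Q & head Q a = i} & tail Q a = j. d (tail Q a))"
  by (intro sum.cong) auto
 also have "... = (\<Sum>a | a : arcs Q & head Q a = i. d (tail Q a))"
  by (rule sum.group) (use finite_arcs in auto)
 finally show ?thesis .
qed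

definition onto_at :: "('v, 'e) pre_digraph => 'v => ('v, 'e, 'a::complex_vector) rep => bool" where
 "onto_at Q i M \<longleftrightarrow> (ALL z:rep_space M i. EX x:dsum (in_arcs Q i) (%a. rep_space M (tail Q a)).
  z = (SUM a:in_arcs Q i. rep_map M a (x a)))"

text \<open>The reflection functor of Bernstein, Gelfand and Ponomarev, up to the choice of a model:
  the new arcs identify \<open>M' i\<close> with the kernel of the sum map into \<open>M i\<close>.
  It is a relation because that kernel consists of families indexed by arcs and has to be copied
  into the ambient type.\<close>

definition reflects :: "('v, 'e) pre_digraph => 'v => ('v, 'e, 'a::complex_vector) rep =>
  ('v, 'e, 'a) rep => bool" where
 "reflects Q i M M' \<longleftrightarrow> is_rep (refl_quiver Q i) M' &
  (ALL j:verts Q. j ~= i --> rep_space M' j = rep_space M j) &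
  (ALL a:arcs Q. head Q a ~= i --> rep_map M' a = rep_map M a) &
  (ALL y:rep_space M' i. (ALL a:in_arcs Q i. rep_map M' a y = 0) --> y = 0) &
  (ALL y:rep_space M' i. (SUM a:in_arcs Q i. rep_map M a (rep_map M' a y)) = 0) &
  (ALL x. (ALL a:in_arcs Q i. x a : rep_space M (tail Q a)) --> (SUM a:in_arcs Q i. rep_map M a (x a)) = 0 -->
    (EX y:rep_space M' i. ALL a:in_arcs Q i. rep_map M' a y = x a))"

lemma reflectsD:
 assumes "reflects Q i M M'"
 shows "is_rep (refl_quiver Q i) M'"
  "j : verts Q ==> j ~= i ==> rep_space M' j = rep_space M j"
  "a : arcs Q ==> head Q a ~= i ==> rep_map M' a = rep_map M a"
  "y : rep_space M' i ==> (!!a. a : in_arcs Q i ==> rep_map M' a y = 0) ==> y = 0"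
  "y : rep_space M' i ==> (SUM a:in_arcs Q i. rep_map M a (rep_map M' a y)) = 0"
 using assms unfolding reflects_def by simp_all

lemma reflectsE:
 assumes "reflects Q i M M'" "!!a. a : in_arcs Q i ==> x a : rep_space M (tail Q a)"
  "(SUM a:in_arcs Q i. rep_map M a (x a)) = 0"
 obtains y where "y : rep_space M' i" "!!a. a : in_arcs Q i ==> rep_map M' a y = x a"
proof -
 have "ALL x. (ALL a:in_arcs Q i. x a : rep_space M (tail Q a)) --> (SUM a:in_arcs Q i. rep_map M a (x a)) = 0 -->
    (EX y:rep_space M' i. ALL a:in_arcs Q i. rep_map M' a y = x a)"
  using assms(1) unfolding reflects_def by simp
 then show ?thesis using assms(2,3) that by blast
qed

locale sink_quiver = fin_digraph Q for Q :: "('v, 'e) pre_digraph" +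
 fixes i :: 'v
 assumes i: "i : verts Q" and sink: "a : arcs Q ==> tail Q a ~= i"
begin

abbreviation "A == in_arcs Q i"

abbreviation "Q' == refl_quiver Q i"

lemma finA: "finite A" using finite_arcs by (simp add: in_arcs_def)

lemma AD: "a : A ==> a : arcs Q" "a : A ==> head Q a = i" "a : A ==> tail Q a : verts Q" "a : A ==> tail Q a ~= i"
 using sink by (auto simp: in_arcs_def)

lemma wf: "wf_digraph Q" by (rule wf_digraph_axioms)

lemma fd: "fin_digraph Q" by (rule fin_digraph_axioms)

definition msum :: "('v, 'e, 'a::complex_vector) rep => ('e => 'a) => 'a" where
 "msum M x = (SUM a:A. rep_map M a (x a))"

abbreviation tails :: "('v, 'e, 'a::complex_vector) rep => ('e => 'a) set" where
 "tails M == dsum A (%a. rep_space M (tail Q a))"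

lemma tails_fin_dim:
 assumes M: "is_rep Q M"
 shows "fin_dim_subspace (tails M)" "cvec.dim (tails M) = (SUM a:A. cvec.dim (rep_space M (tail Q a)))"
 using dsum_fin_dim[OF finA, of "%a. rep_space M (tail Q a)"] rep_fin_dim[OF M AD(3)] by auto

lemma msum_clinear: "is_rep Q M ==> clinear_on (tails M) (msum M)"
 unfolding msum_def by (rule in_arcs_sum_clinear)

lemma msum_in: "is_rep Q M ==> x : tails M ==> msum M x : rep_space M i"
 unfolding msum_def by (rule in_arcs_sum_in[OF _ i]) (auto simp: dsum_def)

lemma msum_single: "is_rep Q M ==> a : A ==> msum M (%b. if b = a then x else 0) = rep_map M a x"
 unfolding msum_def by (rule in_arcs_sum_single[OF fd])

lemma single_dsum: "(!!b. b : A ==> 0 : V b) ==> a : A ==> x : V a ==> (%b. if b = a then x else 0) : dsum A V"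
 unfolding dsum_def by auto

lemma onto_at_iff: "onto_at Q i M \<longleftrightarrow> rep_space M i <= msum M ` tails M"
 unfolding onto_at_def msum_def by (auto simp: image_def)

text \<open>The kernel of the sum map is copied into \<open>nat => complex\<close>; its dimension is
  the reflected entry because the sum map is onto.\<close>

lemma reflects_exists:
 fixes M :: "('v, 'e, nat => complex) rep"
 assumes M: "is_rep Q M" and onto: "onto_at Q i M"
 obtains M' where "reflects Q i M M'"
  "int (cvec.dim (rep_space M' i)) = (SUM a:A. int (cvec.dim (rep_space M (tail Q a)))) - int (cvec.dim (rep_space M i))"
proof -
 note fT = tails_fin_dim[OF M] and ml = msum_clinear[OF M]
 note sT = fin_dim_subspace_imp_subspace[OF fT(1)]
 define K where "K = {x : tails M. msum M x = 0}"
 have K: "cvec.subspace K" "K <= tails M" "fin_dim_subspace K"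
  using clinear_on_kernel_subspace[OF ml sT] fin_dim_subspace_subset[OF fT(1)] unfolding K_def by auto
 obtain ph :: "('e => nat => complex) => nat => complex" where ph: "clinear_on UNIV ph" "inj_on ph K"
  by (rule clinear_embed[OF K(3)])
 have phK: "clinear_on K ph" using clinear_on_subset[OF ph(1)] by blast
 let ?inv = "inv_into K ph"
 have bij: "bij_betw ph K (ph ` K)" using ph(2) by (simp add: bij_betw_def)
 have inv_lin: "clinear_on (ph ` K) ?inv" by (rule clinear_on_inv_into[OF phK K(1) bij])
 have inv_in: "?inv y : K" if "y : ph ` K" for y using that by (rule inv_into_into)
 define M' where "M' = \<lparr>rep_space = (rep_space M)(i := ph ` K),
  rep_map = (%a. if a : A then (%y. ?inv y a) else rep_map M a)\<rparr>"
 have inv_a: "?inv y a : rep_space M (tail Q a)" if "y : ph ` K" "a : A" for y a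
  using inv_in[OF that(1)] that(2) K(2) unfolding dsum_def by auto
 have rM': "is_rep Q' M'"
 proof (rule is_repI)
  fix j assume "j : verts Q'"
  then show "fin_dim_subspace (rep_space M' j)"
   using rep_fin_dim[OF M] fin_dim_subspace_image[OF K(3) phK] unfolding M'_def by simp
 next
  fix a assume "a : arcs Q'"
  then have a: "a : arcs Q" by simp
  show "clinear_on (rep_space M' (tail Q' a)) (rep_map M' a)"
  proof (cases "head Q a = i")
   case True
   have "clinear_on (ph ` K) (%y. ?inv y a)"
    using inv_lin unfolding clinear_on_def by (simp add: scaleC_fun_def)
   then show ?thesis using True a unfolding M'_def by (simp add: in_arcs_def)
  next
   case False
   then show ?thesis using rep_map_clinear[OF M a] sink[OF a] unfolding M'_def by simp
  qed
  fix x assume x: "x : rep_space M' (tail Q' a)"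
  show "rep_map M' a x : rep_space M' (head Q' a)"
  proof (cases "head Q a = i")
   case True
   then show ?thesis using x a inv_a[of x a] sink[OF a] unfolding M'_def by (simp add: in_arcs_def)
  next
   case False
   then show ?thesis using x rep_map_in[OF M a] sink[OF a] unfolding M'_def by simp
  qed
 qed
 have "reflects Q i M M'"
  unfolding reflects_def
 proof (intro conjI ballI allI impI)
  show "is_rep (refl_quiver Q i) M'" by (rule rM')
 next
  fix y assume y: "y : rep_space M' i" and z: "ALL a:A. rep_map M' a y = 0"
  have yK: "y : ph ` K" using y unfolding M'_def by simp
  have "?inv y = 0"
  proof
   fix a
   show "?inv y a = 0 a"
    using z inv_in[OF yK] unfolding M'_def K_def dsum_def by (cases "a : A") auto
  qed
  then have "y = ph 0" using f_inv_into_f[OF yK] by simp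
  then show "y = 0" using clinear_on_0[OF phK K(1)] by simp
 next
  fix y assume y: "y : rep_space M' i"
  have yK: "y : ph ` K" using y unfolding M'_def by simp
  have "msum M (?inv y) = 0" using inv_in[OF yK] unfolding K_def by simp
  then show "(SUM a:A. rep_map M a (rep_map M' a y)) = 0" unfolding msum_def M'_def by simp
 next
  fix x assume x: "ALL a:A. x a : rep_space M (tail Q a)" and s: "(SUM a:A. rep_map M a (x a)) = 0"
  let ?x = "%a. if a : A then x a else 0"
  have xK: "?x : K" using x s unfolding K_def dsum_def msum_def by simp
  show "EX y:rep_space M' i. ALL a:A. rep_map M' a y = x a"
   using xK inv_into_f_f[OF ph(2) xK] by (intro bexI[of _ "ph ?x"]) (auto simp: M'_def)
 qed (auto simp: M'_def in_arcs_def)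
 moreover have "int (cvec.dim (rep_space M' i)) = (SUM a:A. int (cvec.dim (rep_space M (tail Q a)))) - int (cvec.dim (rep_space M i))"
 proof -
  have "msum M ` tails M = rep_space M i"
   using onto msum_in[OF M] unfolding onto_at_iff by blast
  then have "cvec.dim (tails M) = cvec.dim K + cvec.dim (rep_space M i)"
   using clinear_on_rank_nullity[OF fT(1) ml] unfolding K_def by simp
  moreover have "cvec.dim (rep_space M' i) = cvec.dim K"
   using cvec_dim_inj_image[OF K(3) phK ph(2)] unfolding M'_def by simp
  ultimately show ?thesis using fT(2) by (simp flip: of_nat_sum)
 qed
 ultimately show ?thesis using that by blast
qed

text \<open>If the sum map is onto, \<open>M i\<close> is recovered as the cokernel of
  \<open>M' i\<close> in the sum of the neighbours. An isomorphism \<open>th\<close> of the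
  reflections respects these kernels, so it induces the missing map at \<open>i\<close>.\<close>

lemma reflects_isomorphic:
 fixes M N :: "('v, 'e, 'a::complex_vector) rep"
 assumes M: "is_rep Q M" and N: "is_rep Q N" and oM: "onto_at Q i M" and oN: "onto_at Q i N"
  and rM: "reflects Q i M M'" and rN: "reflects Q i N N'" and iso: "rep_isomorphic Q' M' N'"
 shows "rep_isomorphic Q M N"
proof -
 obtain th where th: "th : rep_iso Q' M' N'" using iso unfolding rep_isomorphic_def by blast
 note thH = rep_iso_Hom[OF th]
 have thbij: "bij_betw (th j) (rep_space M j) (rep_space N j)" if "j : verts Q" "j ~= i" for j
  using rep_iso_bij[OF th, of j] reflectsD(2)[OF rM that] reflectsD(2)[OF rN that] that by simp
 have thlin: "clinear_on (rep_space M j) (th j)" if "j : verts Q" "j ~= i" for j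
  using rep_HomD(2)[OF thH, of j] reflectsD(2)[OF rM that] that by simp
 have thin: "th j x : rep_space N j" if "j : verts Q" "j ~= i" "x : rep_space M j" for j x
  using thbij[OF that(1,2)] that(3) by (rule bij_betw_apply)
 have thnat: "th (tail Q a) (rep_map M' a y) = rep_map N' a (th i y)" if "a : A" "y : rep_space M' i" for a y
  using rep_HomD(3)[OF thH, of a y] AD[OF that(1)] that(2) by simp
 define d where "d x = msum N (%a. th (tail Q a) (x a))" for x
 note fT = tails_fin_dim[OF M] and ml = msum_clinear[OF M]
 note sT = fin_dim_subspace_imp_subspace[OF fT(1)]
 have xin: "x a : rep_space M (tail Q a)" if "x : tails M" "a : A" for x a
  using that unfolding dsum_def by blast
 have d_in: "d x : rep_space N i" if "x : tails M" for x
  unfolding d_def msum_def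
  by (rule in_arcs_sum_in[OF N i]) (use xin[OF that] thin[OF AD(3,4)] in auto)
 have dl: "clinear_on (tails M) d"
  unfolding d_def msum_def
 proof (rule clinear_on_sum_fun)
  fix a assume a: "a : A"
  have 1: "clinear_on (tails M) (%x. x a)" unfolding clinear_on_def by (simp add: scaleC_fun_def)
  have 2: "clinear_on (rep_space M (tail Q a)) (%x. rep_map N a (th (tail Q a) x))"
   by (rule clinear_on_compose[OF thlin[OF AD(3,4)[OF a]] _ rep_map_clinear[OF N AD(1)[OF a]]])
    (use thin[OF AD(3,4)[OF a]] in auto)
  show "clinear_on (tails M) (%x. rep_map N a (th (tail Q a) (x a)))"
   by (rule clinear_on_compose[OF 1 _ 2]) (use xin a in auto)
 qed
 \<comment> \<open>The kernels of the two sum maps are the images of \<open>M' i\<close> and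
   \<open>N' i\<close>, which \<open>th\<close> matches.\<close>
 have d0: "d x = 0 \<longleftrightarrow> msum M x = 0" if x: "x : tails M" for x
 proof
  assume "msum M x = 0"
  then obtain y where y: "y : rep_space M' i" "!!a. a : A ==> rep_map M' a y = x a"
   using reflectsE[OF rM, of x] xin[OF x] unfolding msum_def by blast
  have "d x = (SUM a:A. rep_map N a (rep_map N' a (th i y)))"
   unfolding d_def msum_def using thnat[OF _ y(1)] y(2) by (intro sum.cong) auto
  moreover have "th i y : rep_space N' i" using rep_HomD(1)[OF thH, of i y] i y(1) by simp
  ultimately show "d x = 0" using reflectsD(5)[OF rN] by simp
 next
  assume "d x = 0"
  then obtain y where y: "y : rep_space N' i" "!!a. a : A ==> rep_map N' a y = th (tail Q a) (x a)"
   using reflectsE[OF rN, of "%a. th (tail Q a) (x a)"] xin[OF x] thin[OF AD(3,4)]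
   unfolding d_def msum_def by blast
  obtain z where z: "z : rep_space M' i" "th i z = y"
  proof -
   have "y : th i ` rep_space M' i"
    using rep_iso_bij[OF th, of i] i y(1) unfolding bij_betw_def by simp
   then show ?thesis using that by blast
  qed
  have "rep_map M' a z = x a" if a: "a : A" for a
  proof -
   have "th (tail Q a) (rep_map M' a z) = th (tail Q a) (x a)" using thnat[OF a z(1)] z(2) y(2)[OF a] by simp
   moreover have "rep_map M' a z : rep_space M (tail Q a)"
    using rep_map_in[OF reflectsD(1)[OF rM], of a z] AD[OF a] z(1) reflectsD(2)[OF rM AD(3,4)[OF a]] by simp
   ultimately show ?thesis
    using thbij[OF AD(3,4)[OF a]] xin[OF x a] unfolding bij_betw_def inj_on_def by blast
  qed
  then have "msum M x = (SUM a:A. rep_map M a (rep_map M' a z))" unfolding msum_def by simp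
  then show "msum M x = 0" using reflectsD(5)[OF rM z(1)] by simp
 qed
 obtain D where D: "clinear_on UNIV D" "!!x. x : tails M ==> D (msum M x) = d x"
  by (rule clinear_factor[OF sT ml dl]) (use d0 in auto)
 have Dl: "clinear_on S D" for S using clinear_on_subset[OF D(1)] by blast
 have mM: "EX x:tails M. z = msum M x" if "z : rep_space M i" for z
  using oM that unfolding onto_at_iff by blast
 have Dinj: "inj_on D (rep_space M i)"
  unfolding clinear_on_inj_iff[OF Dl rep_subspace[OF M i]]
 proof (intro ballI impI)
  fix z assume "z : rep_space M i" "D z = 0"
  then obtain x where "x : tails M" "z = msum M x" using mM by blast
  then show "z = 0" using d0 D(2) \<open>D z = 0\<close> by simp
 qed
 have Dimg: "D ` rep_space M i = rep_space N i"
 proof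
  show "D ` rep_space M i <= rep_space N i"
  proof (rule image_subsetI)
   fix z assume "z : rep_space M i"
   then obtain x where "x : tails M" "z = msum M x" using mM by blast
   then show "D z : rep_space N i" using D(2) d_in by simp
  qed
  show "rep_space N i <= D ` rep_space M i"
  proof
   fix z assume "z : rep_space N i"
   then obtain x where x: "x : tails N" "z = msum N x" using oN unfolding onto_at_iff by blast
   define x' where "x' a = (if a : A then inv_into (rep_space M (tail Q a)) (th (tail Q a)) (x a) else 0)" for a
   have xN: "x a : th (tail Q a) ` rep_space M (tail Q a)" if "a : A" for a
    using x(1) that thbij[OF AD(3,4)[OF that]] unfolding dsum_def bij_betw_def by auto
   have x': "x' : tails M" using inv_into_into[OF xN] unfolding x'_def dsum_def by simp
   have "d x' = z" unfolding d_def x(2) msum_def x'_def using f_inv_into_f[OF xN] by simp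
   then have "D (msum M x') = z" using D(2)[OF x'] by simp
   then show "z : D ` rep_space M i" using msum_in[OF M x'] by blast
  qed
 qed
 define ps where "ps j = (if j = i then D else th j)" for j
 have psbij: "bij_betw (ps j) (rep_space M j) (rep_space N j)" if "j : verts Q" for j
  using thbij[OF that] Dinj Dimg unfolding ps_def bij_betw_def by simp
 have H: "(\<lambda>j\<in>verts Q. \<lambda>x\<in>rep_space M j. ps j x) : rep_Hom Q M N"
 proof (rule rep_HomI[OF _ _ _ wf M])
  show "ps j x : rep_space N j" if "j : verts Q" "x : rep_space M j" for j x
   using psbij[OF that(1)] that(2) by (rule bij_betw_apply)
  show "clinear_on (rep_space M j) (ps j)" if "j : verts Q" for j
   using thlin[OF that] Dl unfolding ps_def by simp
  fix a x assume a: "a : arcs Q" and x: "x : rep_space M (tail Q a)"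
  note t = sink[OF a]
  show "ps (head Q a) (rep_map M a x) = rep_map N a (ps (tail Q a) x)"
  proof (cases "head Q a = i")
   case True
   then have aA: "a : A" using a by (simp add: in_arcs_def)
   let ?s = "%b. if b = a then x else 0"
   have s: "?s : tails M"
    by (rule single_dsum) (use aA x cvec.subspace_0[OF rep_subspace[OF M AD(3)]] in auto)
   have "D (rep_map M a x) = d ?s" using D(2)[OF s] msum_single[OF M aA] by simp
   also have "... = msum N (%b. if b = a then th (tail Q a) x else 0)"
    unfolding d_def msum_def
   proof (intro sum.cong refl)
    fix b assume b: "b : A"
    have "th (tail Q b) 0 = 0" by (rule clinear_on_0[OF thlin[OF AD(3,4)[OF b]] rep_subspace[OF M AD(3)[OF b]]])
    then show "rep_map N b (th (tail Q b) (if b = a then x else 0)) = rep_map N b (if b = a then th (tail Q a) x else 0)"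
     by simp
   qed
   also have "... = rep_map N a (th (tail Q a) x)" by (rule msum_single[OF N aA])
   finally show ?thesis using True t unfolding ps_def by simp
  next
   case False
   then show ?thesis
    using rep_HomD(3)[OF thH, of a x] a x t reflectsD(3)[OF rM a False] reflectsD(3)[OF rN a False]
     reflectsD(2)[OF rM tail_in_verts[OF a] t] unfolding ps_def by simp
  qed
 qed
 have "(\<lambda>j\<in>verts Q. \<lambda>x\<in>rep_space M j. ps j x) : rep_iso Q M N"
 proof (rule rep_isoI[OF H])
  fix j assume "j : verts Q"
  then show "bij_betw ((\<lambda>j\<in>verts Q. \<lambda>x\<in>rep_space M j. ps j x) j) (rep_space M j) (rep_space N j)"
   using psbij by (subst bij_betw_cong[where g="ps j"]) auto
 qed
 then show ?thesis unfolding rep_isomorphic_def by blast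
qed

end

lemma dsum_mono: "(!!a. a : A ==> U a <= V a) ==> dsum A U <= dsum A V"
 unfolding dsum_def by blast

lemma indecomposableD:
 assumes "indecomposable_rep Q M" "is_subrep Q M U" "is_subrep Q M W"
  and "!!j. j : verts Q ==> U j Int W j = {0}"
  and "!!j z. j : verts Q ==> z : rep_space M j ==> EX u:U j. EX w:W j. z = u + w"
  and M: "is_rep Q M"
 shows "(ALL j:verts Q. U j = {0}) | (ALL j:verts Q. W j = {0})"
proof -
 have "rep_space M j = {u + w | u w. u : U j & w : W j}" if j: "j : verts Q" for j
 proof
  show "rep_space M j <= {u + w | u w. u : U j & w : W j}" using assms(5)[OF j] by blast
  show "{u + w | u w. u : U j & w : W j} <= rep_space M j"
   using cvec.subspace_add[OF rep_subspace[OF M j]] is_subrepD(3)[OF assms(2) j] is_subrepD(3)[OF assms(3) j]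
   by auto
 qed
 then have ds: "ALL j:verts Q. U j Int W j = {0} & rep_space M j = {u + w | u w. u : U j & w : W j}"
  using assms(4) by (intro ballI conjI)
 have "ALL U W. is_subrep Q M U --> is_subrep Q M W -->
    (ALL i:verts Q. U i Int W i = {0} & rep_space M i = {u + w | u w. u : U i & w : W i}) -->
    (ALL i:verts Q. U i = {0}) | (ALL i:verts Q. W i = {0})"
  using assms(1) unfolding indecomposable_rep_def by (elim conjE)
 from this[rule_format, OF assms(2,3)] ds show ?thesis by simp
qed

lemma indecomposable_is_rep: "indecomposable_rep Q M ==> is_rep Q M"
 unfolding indecomposable_rep_def by (elim conjE)

lemma indecomposable_nonzero: "indecomposable_rep Q M ==> EX j:verts Q. rep_space M j ~= {0}"
 unfolding indecomposable_rep_def by (elim conjE)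

context sink_quiver
begin

text \<open>A complement of the image of the sum map, placed at the sink alone, is a direct summand.
  It is nonzero, so the other summand vanishes, and that one contains all of \<open>M\<close> away
  from \<open>i\<close>.\<close>

lemma indecomposable_not_onto:
 fixes M :: "('v, 'e, 'a::complex_vector) rep"
 assumes ind: "indecomposable_rep Q M" and no: "~ onto_at Q i M" and j: "j : verts Q" "j ~= i"
 shows "rep_space M j = {0}"
proof -
 note M = indecomposable_is_rep[OF ind]
 note fT = tails_fin_dim[OF M] and ml = msum_clinear[OF M]
 let ?H = "msum M ` tails M"
 have H: "cvec.subspace ?H" "?H <= rep_space M i"
  using clinear_on_image_subspace[OF ml fin_dim_subspace_imp_subspace[OF fT(1)]] msum_in[OF M] by auto
 obtain C where C: "cvec.subspace C" "C <= rep_space M i" "?H Int C = {0}"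
  "!!x. x : rep_space M i ==> EX u:?H. EX w:C. x = u + w"
  by (rule fin_dim_subspace_complement[OF rep_fin_dim[OF M i] H]) (rule that)
 define U where "U = (\<lambda>k\<in>verts Q. if k = i then ?H else rep_space M k)"
 define W where "W = (\<lambda>k\<in>verts Q. if k = i then C else {0})"
 have z: "0 : rep_space M k" if "k : verts Q" for k using cvec.subspace_0[OF rep_subspace[OF M that]] .
 have U: "is_subrep Q M U"
 proof (rule is_subrepI)
  fix a x assume a: "a : arcs Q" and x: "x : U (tail Q a)"
  have x': "x : rep_space M (tail Q a)" using x sink[OF a] a unfolding U_def by simp
  show "rep_map M a x : U (head Q a)"
  proof (cases "head Q a = i")
   case True
   then have aA: "a : A" using a by (simp add: in_arcs_def)
   have "(%b. if b = a then x else 0) : tails M"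
    by (rule single_dsum) (use aA x' z AD(3) in auto)
   then have "rep_map M a x : ?H" using msum_single[OF M aA, of x] by (metis image_eqI)
   then show ?thesis using True i unfolding U_def by simp
  next
   case False
   then show ?thesis using rep_map_in[OF M a x'] a unfolding U_def by simp
  qed
 qed (use H rep_subspace[OF M] in \<open>auto simp: U_def\<close>)
 have W: "is_subrep Q M W"
 proof (rule is_subrepI)
  fix a x assume a: "a : arcs Q" and x: "x : W (tail Q a)"
  then have "x = 0" using sink[OF a] unfolding W_def by simp
  then have "rep_map M a x = 0"
   using clinear_on_0[OF rep_map_clinear[OF M a] rep_subspace[OF M tail_in_verts[OF a]]] by simp
  then show "rep_map M a x : W (head Q a)" using a cvec.subspace_0[OF C(1)] unfolding W_def by simp
 qed (use C(1,2) z in \<open>auto simp: W_def\<close>)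
 have "(ALL j:verts Q. U j = {0}) | (ALL j:verts Q. W j = {0})"
 proof (rule indecomposableD[OF ind U W _ _ M])
  show "U k Int W k = {0}" if "k : verts Q" for k using that C(3) z unfolding U_def W_def by auto
  show "EX u:U k. EX w:W k. x = u + w" if "k : verts Q" "x : rep_space M k" for k x
   using that C(4) unfolding U_def W_def by auto
 qed
 moreover have "C ~= {0}"
 proof
  assume "C = {0}"
  then have "rep_space M i <= ?H" using C(4) by force
  then show False using no unfolding onto_at_iff by simp
 qed
 then have "W i ~= {0}" using i unfolding W_def by simp
 ultimately have "U j = {0}" using i j by blast
 then show ?thesis using j unfolding U_def by simp
qed

text \<open>No arc starts at the sink and all other spaces are 0, so every arc acts as 0 and any
  linear isomorphism at \<open>i\<close> is one of representations.\<close>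

lemma concentrated_isomorphic:
 fixes M N :: "('v, 'e, 'a::complex_vector) rep"
 assumes M: "is_rep Q M" and N: "is_rep Q N"
  and z: "!!j. j : verts Q ==> j ~= i ==> rep_space M j = {0}"
  and d: "!!j. j : verts Q ==> cvec.dim (rep_space M j) = cvec.dim (rep_space N j)"
 shows "rep_isomorphic Q M N"
proof -
 have zN: "rep_space N j = {0}" if "j : verts Q" "j ~= i" for j
  using d[OF that(1)] cvec_dim_zero cvec_dim_pos[OF rep_fin_dim[OF N that(1)]]
  unfolding z[OF that] by metis
 obtain f where f: "clinear_on UNIV f" "bij_betw f (rep_space M i) (rep_space N i)"
  by (rule clinear_bij_exists[OF rep_fin_dim[OF M i] rep_fin_dim[OF N i] d[OF i]])
 have f0: "f 0 = 0" using clinear_on_0[OF f(1)] by simp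
 have b: "bij_betw f (rep_space M j) (rep_space N j)" if "j : verts Q" for j
  using f(2) f0 z[OF that] zN[OF that] by (cases "j = i") (auto simp: bij_betw_def)
 have "(\<lambda>j\<in>verts Q. \<lambda>x\<in>rep_space M j. f x) : rep_iso Q M N"
 proof (rule rep_isoI)
  show "(\<lambda>j\<in>verts Q. \<lambda>x\<in>rep_space M j. f x) : rep_Hom Q M N"
  proof (rule rep_HomI[OF _ _ _ wf M])
   show "f x : rep_space N j" if "j : verts Q" "x : rep_space M j" for j x
    using b[OF that(1)] that(2) by (rule bij_betw_apply)
   show "clinear_on (rep_space M j) f" for j using clinear_on_subset[OF f(1)] by blast
   fix a x assume a: "a : arcs Q" and "x : rep_space M (tail Q a)"
   then have "x = 0" using z[OF tail_in_verts[OF a] sink[OF a]] by simp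
   then show "f (rep_map M a x) = rep_map N a (f x)"
    using f0 clinear_on_0[OF rep_map_clinear[OF M a] rep_subspace[OF M tail_in_verts[OF a]]]
     clinear_on_0[OF rep_map_clinear[OF N a] rep_subspace[OF N tail_in_verts[OF a]]] by simp
  qed
  fix j assume "j : verts Q"
  then show "bij_betw ((\<lambda>j\<in>verts Q. \<lambda>x\<in>rep_space M j. f x) j) (rep_space M j) (rep_space N j)"
   using b by (subst bij_betw_cong[where g=f]) auto
 qed
 then show ?thesis unfolding rep_isomorphic_def by blast
qed

text \<open>The passage back from the reflected side: at the sink, what the values at the neighbours
  generate is taken.\<close>

lemma reflects_subrep:
 fixes M :: "('v, 'e, 'a::complex_vector) rep"
 assumes M: "is_rep Q M" and rM: "reflects Q i M M'" and U': "is_subrep Q' M' U'"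
 shows "is_subrep Q M (\<lambda>k\<in>verts Q. if k = i then msum M ` dsum A (%a. U' (tail Q a)) else U' k)"
  (is "is_subrep Q M ?U")
proof -
 note ml = msum_clinear[OF M]
 have U'sub: "cvec.subspace (U' k)" if "k : verts Q" for k using is_subrepD(2)[OF U', of k] that by simp
 have U'in: "U' k <= rep_space M k" if "k : verts Q" "k ~= i" for k
  using is_subrepD(3)[OF U', of k] that reflectsD(2)[OF rM that] by simp
 let ?D = "dsum A (%a. U' (tail Q a))"
 have D: "cvec.subspace ?D"
  using dsum_subspace[of A "%a. U' (tail Q a)"] U'sub[OF AD(3)] by simp
 have DT: "?D <= tails M"
  by (rule dsum_mono) (rule U'in[OF AD(3,4)])
 note D = D DT
 show ?thesis
 proof (rule is_subrepI)
  fix k assume k: "k : verts Q"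
  show "cvec.subspace (?U k)"
   using clinear_on_image_subspace[OF clinear_on_subset[OF ml D(2)] D(1)] U'sub[OF k] k by simp
  show "?U k <= rep_space M k"
   using msum_in[OF M] D(2) U'in[OF k] k by auto
 next
  fix a x assume a: "a : arcs Q" and "x : ?U (tail Q a)"
  then have x: "x : U' (tail Q a)" using sink[OF a] by simp
  show "rep_map M a x : ?U (head Q a)"
  proof (cases "head Q a = i")
   case True
   then have aA: "a : A" using a by (simp add: in_arcs_def)
   have "(%b. if b = a then x else 0) : ?D"
    by (rule single_dsum) (use aA x cvec.subspace_0[OF U'sub[OF AD(3)]] in auto)
   then have "rep_map M a x : msum M ` ?D" using msum_single[OF M aA, of x] by (metis image_eqI)
   then show ?thesis using True i by simp
  next
   case False
   then show ?thesis
    using is_subrepD(4)[OF U', of a x] a x reflectsD(3)[OF rM a False] by simp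
  qed
 qed simp
qed

text \<open>The arcs leaving \<open>i\<close> in \<open>M'\<close> are jointly injective, so
  vanishing at the neighbours propagates to \<open>i\<close>.\<close>

lemma reflects_subrep_zero:
 fixes M :: "('v, 'e, 'a::complex_vector) rep"
 assumes rM: "reflects Q i M M'" and U': "is_subrep Q' M' U'"
  and z: "!!k. k : verts Q ==> k ~= i ==> U' k = {0}" and k: "k : verts Q"
 shows "U' k = {0}"
proof (cases "k = i")
 case True
 have "y = 0" if y: "y : U' i" for y
 proof (rule reflectsD(4)[OF rM])
  show "y : rep_space M' i" using is_subrepD(3)[OF U', of i] i y by auto
  fix a assume a: "a : A"
  have "rep_map M' a y : U' (tail Q a)" using is_subrepD(4)[OF U', of a y] AD[OF a] y by simp
  then show "rep_map M' a y = 0" using z[OF AD(3,4)[OF a]] by simp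
 qed
 then show ?thesis using cvec.subspace_0[OF is_subrepD(2)[OF U', of i]] i True by auto
qed (use z k in simp)

text \<open>A decomposition of \<open>M'\<close> is carried back to \<open>M\<close>, where one part
  has to vanish; then that part vanishes on the reflected side too. The critical point is that the
  two parts still meet trivially at \<open>i\<close>.\<close>

lemma reflects_indecomposable:
 fixes M :: "('v, 'e, 'a::complex_vector) rep"
 assumes ind: "indecomposable_rep Q M" and onto: "onto_at Q i M" and rM: "reflects Q i M M'"
 shows "indecomposable_rep Q' M'"
 unfolding indecomposable_rep_def
proof (intro conjI allI impI)
 note M = indecomposable_is_rep[OF ind]
 note rM' = reflectsD(1)[OF rM] and ml = msum_clinear[OF M]
 note sT = fin_dim_subspace_imp_subspace[OF tails_fin_dim(1)[OF M]]
 show "is_rep Q' M'" by (rule rM')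
 have rep_map_0: "rep_map M a 0 = 0" if "a : arcs Q" for a
  by (rule clinear_on_0[OF rep_map_clinear[OF M that] rep_subspace[OF M tail_in_verts[OF that]]])
 show "EX j:verts Q'. rep_space M' j ~= {0}"
 proof (rule ccontr)
  assume "~ ?thesis"
  then have z: "rep_space M j = {0}" if "j : verts Q" "j ~= i" for j
   using reflectsD(2)[OF rM that] that by simp
  have "msum M x = 0" if "x : tails M" for x
   unfolding msum_def using that z[OF AD(3,4)] rep_map_0[OF AD(1)]
   by (intro sum.neutral) (auto simp: dsum_def)
  then have "rep_space M i <= {0}" using onto unfolding onto_at_iff by auto
  then have "rep_space M i = {0}" using cvec.subspace_0[OF rep_subspace[OF M i]] by auto
  then show False using indecomposable_nonzero[OF ind] z by blast
 qed
 fix U' W' assume U': "is_subrep Q' M' U'" and W': "is_subrep Q' M' W'"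
  and ds: "ALL j:verts Q'. U' j Int W' j = {0} & rep_space M' j = {u + w |u w. u : U' j & w : W' j}"
 have ds1: "U' j Int W' j = {0}" and ds2: "rep_space M' j = {u + w |u w. u : U' j & w : W' j}"
  if "j : verts Q" for j using ds that by simp_all
 let ?DU = "dsum A (%a. U' (tail Q a))" and ?DW = "dsum A (%a. W' (tail Q a))"
 let ?U = "\<lambda>k\<in>verts Q. if k = i then msum M ` ?DU else U' k"
 let ?W = "\<lambda>k\<in>verts Q. if k = i then msum M ` ?DW else W' k"
 note U = reflects_subrep[OF M rM U'] and W = reflects_subrep[OF M rM W']
 have in_M: "U' k <= rep_space M k" "W' k <= rep_space M k" if "k : verts Q" "k ~= i" for k
  using is_subrepD(3)[OF U', of k] is_subrepD(3)[OF W', of k] that reflectsD(2)[OF rM that] by simp_all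
 have DT: "?DU <= tails M" "?DW <= tails M"
  by (rule dsum_mono, rule in_M(1)[OF AD(3,4)], assumption+)
   (rule dsum_mono, rule in_M(2)[OF AD(3,4)], assumption+)
 \<comment> \<open>If \<open>u\<close> and \<open>w\<close> have the same sum, \<open>u - w\<close>
   comes from some \<open>yu + yw\<close> in \<open>M' i\<close>. Then \<open>u\<close> minus the
   image of \<open>yu\<close> equals \<open>w\<close> plus the image of \<open>yw\<close> and lies
   in both parts, so it is 0; thus \<open>u\<close> lies in the kernel of the sum map.\<close>
 have int_i: "msum M ` ?DU Int msum M ` ?DW <= {0}"
 proof
  fix z assume "z : msum M ` ?DU Int msum M ` ?DW"
  then obtain u w where uw: "u : ?DU" "w : ?DW" "z = msum M u" "z = msum M w" by blast
  have uT: "u : tails M" and wT: "w : tails M" using uw DT by auto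
  have "msum M (u - w) = 0" using clinear_on_diff[OF ml sT uT wT] uw by simp
  moreover have "u - w : tails M" by (rule cvec.subspace_diff[OF sT uT wT])
  ultimately obtain y where y: "y : rep_space M' i" "!!a. a : A ==> rep_map M' a y = (u - w) a"
   using reflectsE[OF rM, of "u - w"] unfolding msum_def dsum_def by blast
  obtain yu yw where yy: "yu : U' i" "yw : W' i" "y = yu + yw" using y(1) ds2[OF i] by blast
  have yM: "yu : rep_space M' i" "yw : rep_space M' i"
   using yy is_subrepD(3)[OF U', of i] is_subrepD(3)[OF W', of i] i by auto
  have ua: "u a = rep_map M' a yu" if a: "a : A" for a
  proof -
   have lin: "clinear_on (rep_space M' i) (rep_map M' a)"
    using rep_map_clinear[OF rM', of a] AD[OF a] by simp
   have e: "u a - rep_map M' a yu = w a + rep_map M' a yw"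
    using y(2)[OF a] clinear_on_add[OF lin yM] yy(3) by (simp add: algebra_simps)
   have mu: "rep_map M' a yu : U' (tail Q a)" "rep_map M' a yw : W' (tail Q a)"
    using is_subrepD(4)[OF U', of a yu] is_subrepD(4)[OF W', of a yw] AD[OF a] yy by simp_all
   have "u a - rep_map M' a yu : U' (tail Q a)"
    using cvec.subspace_diff[OF is_subrepD(2)[OF U', of "tail Q a"]] AD(3)[OF a] mu(1) uw(1) a
    unfolding dsum_def by simp
   moreover have "w a + rep_map M' a yw : W' (tail Q a)"
    using cvec.subspace_add[OF is_subrepD(2)[OF W', of "tail Q a"]] AD(3)[OF a] mu(2) uw(2) a
    unfolding dsum_def by simp
   ultimately have "u a - rep_map M' a yu : U' (tail Q a) Int W' (tail Q a)" using e by simp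
   then show ?thesis using ds1[OF AD(3)[OF a]] by simp
  qed
  have "msum M u = (SUM a:A. rep_map M a (rep_map M' a yu))"
   unfolding msum_def using ua by simp
  then show "z : {0}" using reflectsD(5)[OF rM yM(1)] uw(3) by simp
 qed
 have "(ALL j:verts Q. ?U j = {0}) | (ALL j:verts Q. ?W j = {0})"
 proof (rule indecomposableD[OF ind U W _ _ M])
  fix k assume k: "k : verts Q"
  have "0 : ?U k" "0 : ?W k" using cvec.subspace_0[OF is_subrepD(2)[OF U k]] cvec.subspace_0[OF is_subrepD(2)[OF W k]] .
  moreover have "?U k Int ?W k <= {0}" using int_i ds1[OF k] k by auto
  ultimately show "?U k Int ?W k = {0}" by blast
  fix z assume z: "z : rep_space M k"
  show "EX u:?U k. EX w:?W k. z = u + w"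
  proof (cases "k = i")
   case False
   then show ?thesis using z ds2[OF k] reflectsD(2)[OF rM k False] k by auto
  next
   case True
   then obtain x where x: "x : tails M" "z = msum M x" using z onto unfolding onto_at_iff by blast
   have "ALL a:A. EX p. fst p : U' (tail Q a) & snd p : W' (tail Q a) & x a = fst p + snd p"
   proof
    fix a assume a: "a : A"
    have "x a : rep_space M' (tail Q a)" using x(1) a reflectsD(2)[OF rM AD(3,4)[OF a]] unfolding dsum_def by simp
    then obtain u w where "u : U' (tail Q a)" "w : W' (tail Q a)" "x a = u + w" using ds2[OF AD(3)[OF a]] by blast
    then show "EX p. fst p : U' (tail Q a) & snd p : W' (tail Q a) & x a = fst p + snd p"
     by (intro exI[of _ "(u, w)"]) simp
   qed
   from bchoice[OF this] obtain p where p: "ALL a:A. fst (p a) : U' (tail Q a) & snd (p a) : W' (tail Q a) & x a = fst (p a) + snd (p a)"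
    by blast
   define u where "u a = (if a : A then fst (p a) else 0)" for a
   define w where "w a = (if a : A then snd (p a) else 0)" for a
   have uD: "u : ?DU" and wD: "w : ?DW" using p unfolding u_def w_def dsum_def by auto
   have "x = u + w" using p x(1) unfolding u_def w_def dsum_def by (auto simp: fun_eq_iff)
   then have "z = msum M u + msum M w" using clinear_on_add[OF ml] uD wD DT x(2) by auto
   then show ?thesis using uD wD True i by auto
  qed
 qed
 then show "(ALL j:verts Q'. U' j = {0}) | (ALL j:verts Q'. W' j = {0})"
 proof
  assume "ALL j:verts Q. ?U j = {0}"
  then have "U' k = {0}" if "k : verts Q" "k ~= i" for k using that by fastforce
  then show ?thesis using reflects_subrep_zero[OF rM U'] by simp
 next
  assume "ALL j:verts Q. ?W j = {0}"
  then have "W' k = {0}" if "k : verts Q" "k ~= i" for k using that by fastforce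
  then show ?thesis using reflects_subrep_zero[OF rM W'] by simp
 qed
qed

end

text \<open>
 Reflecting at the sinks in turn, the dimension vector becomes non-positive after finitely many
 steps; so at some earlier step the reflected representation was concentrated at the sink.
\<close>

lemma indecomposable_unique:
 fixes M N :: "('v, 'e, nat => complex) rep"
 assumes "fin_digraph Q" "sinks_first Q vs" "indecomposable_rep Q M" "indecomposable_rep Q N"
  and "!!j. j : verts Q ==> cvec.dim (rep_space M j) = cvec.dim (rep_space N j)"
  and "!!j. j : verts Q ==> d j = int (cvec.dim (rep_space M j))"
  and "j : verts Q" "reflections (verts Q) (adjacency Q) t vs d j < 0"
 shows "rep_isomorphic Q M N"
 using assms
proof (induction t arbitrary: Q vs M N d)
 \<comment> \<open>No reflection remains, so the negative entry would be a dimension.\<close>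
 case 0
 then show ?case by simp
next
 case (Suc t)
 note ind = Suc.prems(3,4)
 note rM = indecomposable_is_rep[OF ind(1)] and rN = indecomposable_is_rep[OF ind(2)]
 interpret fin_digraph Q by (rule Suc.prems(1))
 obtain i ws where vs: "vs = i # ws"
  using Suc.prems(2,7) unfolding sinks_first_def by (cases vs) auto
 interpret sink_quiver Q i
 proof unfold_locales
  show "i : verts Q" using Suc.prems(2) vs unfolding sinks_first_def by auto
  show "tail Q a ~= i" if "a : arcs Q" for a
   using sinks_first_hd[of Q i ws] Suc.prems(2) vs that by simp
 qed
 show ?case
 proof (cases "onto_at Q i M & onto_at Q i N")
  case True
  obtain M' where M': "reflects Q i M M'"
   "int (cvec.dim (rep_space M' i)) = (SUM a:A. int (cvec.dim (rep_space M (tail Q a)))) - int (cvec.dim (rep_space M i))"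
   using reflects_exists[OF rM] True by blast
  obtain N' where N': "reflects Q i N N'"
   "int (cvec.dim (rep_space N' i)) = (SUM a:A. int (cvec.dim (rep_space N (tail Q a)))) - int (cvec.dim (rep_space N i))"
   using reflects_exists[OF rN] True by blast
  let ?d = "reflect (verts Q) (adjacency Q) i d"
  have no_tail: "{a. a : arcs Q & tail Q a = i} = {}" using sink by auto
  have "?d k = int (cvec.dim (rep_space M' k))" if k: "k : verts Q" for k
  proof (cases "k = i")
   case True
   have "(SUM j:verts Q. adjacency Q i j * d j) = (SUM a:A. d (tail Q a))"
    using sum_adjacency[OF Suc.prems(1) sinks_first_no_loop[OF Suc.prems(2)], of i d] no_tail
    by (simp add: in_arcs_def)
   also have "... = (SUM a:A. int (cvec.dim (rep_space M (tail Q a))))"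
    using Suc.prems(6) AD(3) by (intro sum.cong) auto
   finally show ?thesis using True M'(2) Suc.prems(6)[OF i] by (simp add: reflect_def)
  next
   case False
   then show ?thesis using Suc.prems(6)[OF k] reflectsD(2)[OF M'(1) k False] by (simp add: reflect_def)
  qed
  moreover have "cvec.dim (rep_space M' k) = cvec.dim (rep_space N' k)" if k: "k : verts Q" for k
  proof (cases "k = i")
   case True
   have "(SUM a:A. int (cvec.dim (rep_space M (tail Q a)))) = (SUM a:A. int (cvec.dim (rep_space N (tail Q a))))"
    using Suc.prems(5) AD(3) by (intro sum.cong) auto
   then show ?thesis using M'(2) N'(2) Suc.prems(5)[OF i] True by simp
  next
   case False
   then show ?thesis
    using Suc.prems(5)[OF k] reflectsD(2)[OF M'(1) k False] reflectsD(2)[OF N'(1) k False] by simp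
  qed
  moreover have "reflections (verts Q) (adjacency Q) t (ws @ [i]) ?d j < 0"
   using Suc.prems(8) vs by simp
  ultimately have "rep_isomorphic Q' M' N'"
   using True Suc.prems(7)
   by (intro Suc.IH[OF fin_digraph_refl_quiver[OF Suc.prems(1)] sinks_first_rotate[OF Suc.prems(2)[unfolded vs]]
     reflects_indecomposable[OF ind(1) _ M'(1)] reflects_indecomposable[OF ind(2) _ N'(1)]])
    (simp_all add: adjacency_refl_quiver)
  then show ?thesis using reflects_isomorphic[OF rM rN _ _ M'(1) N'(1)] True by blast
 next
  \<comment> \<open>One of the two is not onto at the sink, hence concentrated there, and equality
    of dimension vectors concentrates the other as well.\<close>
  case False
  then show ?thesis
  proof (cases "onto_at Q i M")
   case False
   show ?thesis
    by (rule concentrated_isomorphic[OF rM rN indecomposable_not_onto[OF ind(1) False] Suc.prems(5)])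
  next
   case True
   then have no: "~ onto_at Q i N" using False by simp
   have "rep_isomorphic Q N M"
    by (rule concentrated_isomorphic[OF rN rM indecomposable_not_onto[OF ind(2) no] Suc.prems(5)[symmetric]])
   then show ?thesis by (rule rep_isomorphic_sym[OF wf rN rM])
  qed
 qed
qed

subsection \<open>Finiteness of the number of isomorphism classes\<close>

definition decomposes :: "('v, 'e) pre_digraph => ('v, 'e, 'a::complex_vector) rep =>
  ('v => 'a set) => ('v => 'a set) => bool" where
 "decomposes Q M U W \<longleftrightarrow> is_subrep Q M U & is_subrep Q M W &
  (ALL i:verts Q. U i Int W i = {0} & rep_space M i = {u + w | u w. u : U i & w : W i})"

lemma decomposesD:
 assumes "decomposes Q M U W"
 shows "is_subrep Q M U" "is_subrep Q M W" "i : verts Q ==> U i Int W i = {0}"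
  "i : verts Q ==> rep_space M i = {u + w | u w. u : U i & w : W i}"
 using assms unfolding decomposes_def by simp_all

lemma decomposes_isomorphic:
 fixes M :: "('v, 'e, 'a::complex_vector) rep" and N :: "('v, 'e, 'b::complex_vector) rep"
 assumes Q: "wf_digraph Q" and M: "is_rep Q M" and N: "is_rep Q N"
  and dM: "decomposes Q M U W" and dN: "decomposes Q N U' W'"
  and U: "rep_isomorphic Q (subrep M U) (subrep N U')" and W: "rep_isomorphic Q (subrep M W) (subrep N W')"
 shows "rep_isomorphic Q M N"
proof -
 obtain f where f: "f : rep_iso Q (subrep M U) (subrep N U')" using U unfolding rep_isomorphic_def by blast
 obtain g where g: "g : rep_iso Q (subrep M W) (subrep N W')" using W unfolding rep_isomorphic_def by blast
 note fH = rep_iso_Hom[OF f] and gH = rep_iso_Hom[OF g]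
 note sU = is_subrepD[OF decomposesD(1)[OF dM]] and sW = is_subrepD[OF decomposesD(2)[OF dM]]
 note sU' = is_subrepD[OF decomposesD(1)[OF dN]] and sW' = is_subrepD[OF decomposesD(2)[OF dN]]
 have flin: "clinear_on (U i) (f i)" and glin: "clinear_on (W i) (g i)"
  and fbij: "bij_betw (f i) (U i) (U' i)" and gbij: "bij_betw (g i) (W i) (W' i)" if "i : verts Q" for i
  using rep_HomD(2)[OF fH that] rep_HomD(2)[OF gH that] rep_iso_bij[OF f that] rep_iso_bij[OF g that] by auto
 have "ALL i:verts Q. EX h. clinear_on UNIV h & (ALL x:U i. h x = f i x) & (ALL x:W i. h x = g i x)"
 proof
  fix i assume i: "i : verts Q"
  obtain h where "clinear_on UNIV h" "!!x. x : U i ==> h x = f i x" "!!x. x : W i ==> h x = g i x"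
  proof (rule clinear_glue[OF fin_dim_subspace_subset[OF rep_fin_dim[OF M i] sU(2,3)[OF i]]
     fin_dim_subspace_subset[OF rep_fin_dim[OF M i] sW(2,3)[OF i]] flin[OF i] glin[OF i]])
   fix x assume "x : U i" "x : W i"
   then have "x = 0" using decomposesD(3)[OF dM i] by blast
   then show "f i x = g i x"
    using clinear_on_0[OF flin[OF i] sU(2)[OF i]] clinear_on_0[OF glin[OF i] sW(2)[OF i]] by simp
  qed (rule that)
  then show "EX h. clinear_on UNIV h & (ALL x:U i. h x = f i x) & (ALL x:W i. h x = g i x)" by blast
 qed
 from bchoice[OF this] obtain h where h: "ALL i:verts Q. clinear_on UNIV (h i) & (ALL x:U i. h i x = f i x) & (ALL x:W i. h i x = g i x)"
  by blast
 have hl: "clinear_on S (h i)" if "i : verts Q" for i S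
  using h that clinear_on_subset[of UNIV "h i" S] by blast
 have huw: "h i (u + w) = f i u + g i w" if "i : verts Q" "u : U i" "w : W i" for i u w
  using clinear_on_add[OF hl[OF that(1), of UNIV]] h that by simp
 have Mz: "EX u:U i. EX w:W i. z = u + w" if "i : verts Q" "z : rep_space M i" for i z
  using decomposesD(4)[OF dM that(1)] that(2) by blast
 have hbij: "bij_betw (h i) (rep_space M i) (rep_space N i)" if i: "i : verts Q" for i
  unfolding bij_betw_def
 proof
  show "inj_on (h i) (rep_space M i)"
   unfolding clinear_on_inj_iff[OF hl[OF i] rep_subspace[OF M i]]
  proof (intro ballI impI)
   fix z assume z: "z : rep_space M i" "h i z = 0"
   obtain u w where uw: "u : U i" "w : W i" "z = u + w" using Mz[OF i z(1)] by blast
   have in': "f i u : U' i" "g i w : W' i"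
    using bij_betw_apply[OF fbij[OF i]] bij_betw_apply[OF gbij[OF i]] uw by auto
   have e: "f i u = - g i w" using huw[OF i uw(1,2)] z(2) uw(3) by (simp add: eq_neg_iff_add_eq_0)
   have "- g i w : W' i" using cvec.subspace_neg[OF sW'(2)[OF i] in'(2)] .
   then have "f i u : U' i Int W' i" using in'(1) e by simp
   then have "f i u = 0" unfolding decomposesD(3)[OF dN i] by simp
   moreover have "g i w = 0" using e calculation by simp
   ultimately have "u = 0" "w = 0"
    using fbij[OF i] gbij[OF i] uw clinear_on_inj_iff[OF flin[OF i] sU(2)[OF i]]
     clinear_on_inj_iff[OF glin[OF i] sW(2)[OF i]] unfolding bij_betw_def by auto
   then show "z = 0" using uw by simp
  qed
  show "h i ` rep_space M i = rep_space N i"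
  proof
   show "h i ` rep_space M i <= rep_space N i"
   proof (rule image_subsetI)
    fix z assume z: "z : rep_space M i"
    obtain u w where uw: "u : U i" "w : W i" "z = u + w" using Mz[OF i z] by blast
    have "f i u : rep_space N i" "g i w : rep_space N i"
     using bij_betw_apply[OF fbij[OF i]] bij_betw_apply[OF gbij[OF i]] uw sU'(3)[OF i] sW'(3)[OF i] by auto
    then show "h i z : rep_space N i"
     using huw[OF i uw(1,2)] uw(3) cvec.subspace_add[OF rep_subspace[OF N i]] by simp
   qed
   show "rep_space N i <= h i ` rep_space M i"
   proof
    fix z assume "z : rep_space N i"
    then obtain u' w' where uw': "u' : U' i" "w' : W' i" "z = u' + w'" using decomposesD(4)[OF dN i] by blast
    have "u' : f i ` U i" "w' : g i ` W i"
     using bij_betw_imp_surj_on[OF fbij[OF i]] bij_betw_imp_surj_on[OF gbij[OF i]] uw' by simp_all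
    then obtain u w where u: "u : U i" "f i u = u'" and w: "w : W i" "g i w = w'" by (elim imageE) simp
    have "h i (u + w) = z" using huw[OF i u(1) w(1)] u w uw' by simp
    moreover have "u + w : rep_space M i" using decomposesD(4)[OF dM i] u(1) w(1) by blast
    ultimately show "z : h i ` rep_space M i" by blast
   qed
  qed
 qed
 have H: "(\<lambda>i\<in>verts Q. \<lambda>x\<in>rep_space M i. h i x) : rep_Hom Q M N"
 proof (rule rep_HomI[OF _ _ _ Q M])
  show "h i x : rep_space N i" if "i : verts Q" "x : rep_space M i" for i x
   using hbij[OF that(1)] that(2) by (rule bij_betw_apply)
  show "clinear_on (rep_space M i) (h i)" if "i : verts Q" for i using hl[OF that] .
  fix a z assume a: "a : arcs Q" and z: "z : rep_space M (tail Q a)"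
  note t = wf_digraph.tail_in_verts[OF Q a] and hd = wf_digraph.head_in_verts[OF Q a]
  obtain u w where uw: "u : U (tail Q a)" "w : W (tail Q a)" "z = u + w" using Mz[OF t z] by blast
  have uM: "u : rep_space M (tail Q a)" "w : rep_space M (tail Q a)" using uw sU(3)[OF t] sW(3)[OF t] by auto
  have uN: "f (tail Q a) u : rep_space N (tail Q a)" "g (tail Q a) w : rep_space N (tail Q a)"
   using bij_betw_apply[OF fbij[OF t] uw(1)] bij_betw_apply[OF gbij[OF t] uw(2)] sU'(3)[OF t] sW'(3)[OF t] by auto
  have "h (head Q a) (rep_map M a z) = f (head Q a) (rep_map M a u) + g (head Q a) (rep_map M a w)"
   using clinear_on_add[OF rep_map_clinear[OF M a] uM] huw[OF hd sU(4)[OF a uw(1)] sW(4)[OF a uw(2)]] uw(3) by simp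
  also have "... = rep_map N a (f (tail Q a) u) + rep_map N a (g (tail Q a) w)"
   using rep_HomD(3)[OF fH a] rep_HomD(3)[OF gH a] uw by simp
  also have "... = rep_map N a (h (tail Q a) z)"
   using clinear_on_add[OF rep_map_clinear[OF N a] uN] huw[OF t uw(1,2)] uw(3) by simp
  finally show "h (head Q a) (rep_map M a z) = rep_map N a (h (tail Q a) z)" .
 qed
 have "(\<lambda>i\<in>verts Q. \<lambda>x\<in>rep_space M i. h i x) : rep_iso Q M N"
 proof (rule rep_isoI[OF H])
  fix i assume "i : verts Q"
  then show "bij_betw ((\<lambda>i\<in>verts Q. \<lambda>x\<in>rep_space M i. h i x) i) (rep_space M i) (rep_space N i)"
   using hbij by (subst bij_betw_cong[where g="h i"]) auto
 qed
 then show ?thesis unfolding rep_isomorphic_def by blast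
qed

lemma decomposes_dim:
 assumes M: "is_rep Q M" and d: "decomposes Q M U W" and i: "i : verts Q"
 shows "cvec.dim (rep_space M i) = cvec.dim (U i) + cvec.dim (W i)"
proof -
 note sU = is_subrepD(2,3)[OF decomposesD(1)[OF d] i] and sW = is_subrepD(2,3)[OF decomposesD(2)[OF d] i]
 note fU = fin_dim_subspace_subset[OF rep_fin_dim[OF M i] sU] and fW = fin_dim_subspace_subset[OF rep_fin_dim[OF M i] sW]
 let ?p = "%z. fst z + snd z"
 have l: "clinear_on (U i \<times> W i) ?p" by (intro clinear_on_plus clinear_on_fst clinear_on_snd)
 have "inj_on ?p (U i \<times> W i)"
  unfolding clinear_on_inj_iff[OF l cvec_subspace_Times[OF sU(1) sW(1)]]
 proof (intro ballI impI)
  fix z assume z: "z : U i \<times> W i" "fst z + snd z = 0"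
  then have e: "fst z = - snd z" by (simp add: eq_neg_iff_add_eq_0)
  then have "fst z : U i Int W i" using z cvec.subspace_neg[OF sW(1), of "snd z"] by auto
  then have "fst z = 0" using decomposesD(3)[OF d i] by simp
  then show "z = 0" using e by (simp add: prod_eq_iff)
 qed
 moreover have "?p ` (U i \<times> W i) = rep_space M i" unfolding decomposesD(4)[OF d i] by force
 ultimately show ?thesis
  using cvec_dim_inj_image[OF fin_dim_subspace_Times[OF fU fW] l] cvec_dim_Times[OF fU fW] by simp
qed

lemma zero_isomorphic:
 fixes M :: "('v, 'e, 'a::complex_vector) rep" and N :: "('v, 'e, 'b::complex_vector) rep"
 assumes Q: "wf_digraph Q" and M: "is_rep Q M" and N: "is_rep Q N"
  and z: "!!i. i : verts Q ==> rep_space M i = {0}" "!!i. i : verts Q ==> rep_space N i = {0}"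
 shows "rep_isomorphic Q M N"
proof -
 have "(\<lambda>i\<in>verts Q. \<lambda>x\<in>rep_space M i. 0) : rep_iso Q M N"
 proof (rule rep_isoI)
  show "(\<lambda>i\<in>verts Q. \<lambda>x\<in>rep_space M i. 0) : rep_Hom Q M N"
   by (rule rep_HomI[OF _ _ _ Q M])
    (use z clinear_on_0[OF rep_map_clinear[OF N] rep_subspace[OF N]] wf_digraph.tail_in_verts[OF Q] in
     \<open>auto intro: clinear_on_zero\<close>)
 qed (use z in \<open>auto simp: bij_betw_def\<close>)
 then show ?thesis unfolding rep_isomorphic_def by blast
qed

definition iso_classes :: "('v, 'e) pre_digraph => ('v => nat) => ('v, 'e, 'a::complex_vector) rep set set" where
 "iso_classes Q d = {iso_class Q M | M. is_rep Q M & (ALL i:verts Q. cvec.dim (rep_space M i) = d i)}"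

lemma finite_if_all_eq: "(!!x y. x : S ==> y : S ==> x = y) ==> finite S"
 by (metis finite.emptyI finite_insert finite_subset insertI1 subsetI)

text \<open>Induction on the total dimension. Classes are zero, indecomposable (at most one by
  \<open>uniq\<close>) or decomposable. A decomposition into two nonzero parts sends a decomposable
  class to a pair of classes of smaller total dimension, and this is injective because the parts
  determine the sum.\<close>

lemma finite_iso_classes:
 fixes Q :: "('v, 'e) pre_digraph" and d :: "'v => nat"
 assumes Q: "fin_digraph Q"
  and uniq: "!!(M :: ('v, 'e, 'a::complex_vector) rep) (N :: ('v, 'e, 'a) rep). indecomposable_rep Q M ==> indecomposable_rep Q N ==>
   (!!i. i : verts Q ==> cvec.dim (rep_space M i) = cvec.dim (rep_space N i)) ==> rep_isomorphic Q M N"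
 shows "finite (iso_classes Q d :: ('v, 'e, 'a) rep set set)"
proof (induction "SUM i:verts Q. d i" arbitrary: d rule: less_induct)
 case less
 interpret fin_digraph Q by (rule Q)
 note wf = wf_digraph_axioms
 let ?dims = "%(M :: ('v, 'e, 'a) rep). is_rep Q M & (ALL i:verts Q. cvec.dim (rep_space M i) = d i)"
 let ?Z = "{iso_class Q M | M. ?dims M & (ALL i:verts Q. rep_space M i = {0})}"
 let ?I = "{iso_class Q M | M. ?dims M & indecomposable_rep Q M}"
 let ?nz = "%U :: 'v => 'a set. EX i:verts Q. U i ~= {0}"
 let ?D = "{iso_class Q M | M. ?dims M & (EX U W. decomposes Q M U W & ?nz U & ?nz W)}"
 have "finite ?Z"
 proof (rule finite_if_all_eq)
  fix X Y assume X: "X : ?Z" and Y: "Y : ?Z"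
  obtain M where M: "X = iso_class Q M & ?dims M & (ALL i:verts Q. rep_space M i = {0})"
   using X unfolding mem_Collect_eq by (rule exE)
  obtain N where N: "Y = iso_class Q N & ?dims N & (ALL i:verts Q. rep_space N i = {0})"
   using Y unfolding mem_Collect_eq by (rule exE)
  show "X = Y" using M N zero_isomorphic[OF wf, of M N] iso_class_eq_iff[OF wf, of M N] by simp
 qed
 moreover have "finite ?I"
 proof (rule finite_if_all_eq)
  fix X Y assume X: "X : ?I" and Y: "Y : ?I"
  obtain M where M: "X = iso_class Q M & ?dims M & indecomposable_rep Q M"
   using X unfolding mem_Collect_eq by (rule exE)
  obtain N where N: "Y = iso_class Q N & ?dims N & indecomposable_rep Q N"
   using Y unfolding mem_Collect_eq by (rule exE)
  have "rep_isomorphic Q M N" using uniq[of M N] M N by simp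
  then show "X = Y" using M N iso_class_eq_iff[OF wf, of M N] by simp
 qed
 moreover have "finite ?D"
 proof -
  \<comment> \<open>Extensional vectors below \<open>d\<close>, so that the union of classes over
    them is a finite one.\<close>
  let ?E = "{d' : (\<Pi>\<^sub>E i\<in>verts Q. {..d i}). (SUM i:verts Q. d' i) < (SUM i:verts Q. d i)}"
  let ?T = "\<Union>d'\<in>?E. iso_classes Q d' :: ('v, 'e, 'a) rep set set"
  have "finite (\<Pi>\<^sub>E i\<in>verts Q. {..d i})" using finite_verts by (intro finite_PiE) auto
  then have finT: "finite ?T" using less by auto
  have "ALL X:?D. EX p. X = iso_class Q (fst p) & ?dims (fst p) &
    decomposes Q (fst p) (fst (snd p)) (snd (snd p)) & ?nz (fst (snd p)) & ?nz (snd (snd p))"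
  proof
   fix X assume X: "X : ?D"
   obtain M where M: "X = iso_class Q M & ?dims M & (EX U W. decomposes Q M U W & ?nz U & ?nz W)"
    using X unfolding mem_Collect_eq by (rule exE)
   then obtain U W where "decomposes Q M U W & ?nz U & ?nz W" by (elim conjE exE) simp
   with M show "EX p. X = iso_class Q (fst p) & ?dims (fst p) &
    decomposes Q (fst p) (fst (snd p)) (snd (snd p)) & ?nz (fst (snd p)) & ?nz (snd (snd p))"
    by (intro exI[of _ "(M, U, W)"]) simp
  qed
  from bchoice[OF this] obtain p where p: "ALL X:?D. X = iso_class Q (fst (p X)) & ?dims (fst (p X)) &
    decomposes Q (fst (p X)) (fst (snd (p X))) (snd (snd (p X))) & ?nz (fst (snd (p X))) & ?nz (snd (snd (p X)))"
   by (rule exE)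
  define m u w where "m X = fst (p X)" and "u X = fst (snd (p X))" and "w X = snd (snd (p X))" for X
  have P: "X = iso_class Q (m X)" "is_rep Q (m X)" "!!i. i : verts Q ==> cvec.dim (rep_space (m X) i) = d i"
   "decomposes Q (m X) (u X) (w X)" "?nz (u X)" "?nz (w X)" if "X : ?D" for X
   using bspec[OF p that] unfolding m_def u_def w_def by simp_all
  have rU: "is_rep Q (subrep (m X) (u X))" and rW: "is_rep Q (subrep (m X) (w X))" if "X : ?D" for X
   using is_rep_subrep[OF wf P(2)[OF that] decomposesD(1)[OF P(4)[OF that]]]
    is_rep_subrep[OF wf P(2)[OF that] decomposesD(2)[OF P(4)[OF that]]] .
  let ?h = "%X. (iso_class Q (subrep (m X) (u X)), iso_class Q (subrep (m X) (w X)))"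
  have "inj_on ?h ?D"
  proof (rule inj_onI)
   fix X Y assume X: "X : ?D" and Y: "Y : ?D" and e: "?h X = ?h Y"
   have "rep_isomorphic Q (m X) (m Y)"
    by (rule decomposes_isomorphic[OF wf P(2)[OF X] P(2)[OF Y] P(4)[OF X] P(4)[OF Y]])
     (use e iso_class_eq_iff[OF wf rU[OF X] rU[OF Y]] iso_class_eq_iff[OF wf rW[OF X] rW[OF Y]] in auto)
   then have "iso_class Q (m X) = iso_class Q (m Y)" using iso_class_eq_iff[OF wf P(2)[OF X] P(2)[OF Y]] by simp
   then show "X = Y" using P(1)[OF X] P(1)[OF Y] by simp
  qed
  moreover have "?h ` ?D <= ?T \<times> ?T"
  proof (rule image_subsetI)
   fix X assume X: "X : ?D"
   note dim = decomposes_dim[OF P(2)[OF X] P(4)[OF X]]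
   have pos: "0 < (SUM i:verts Q. cvec.dim (S i))"
    if S: "is_rep Q (subrep (m X) S)" "?nz S" for S
   proof -
    obtain i where i: "i : verts Q" "S i ~= {0}" using S(2) by blast
    then have "0 < cvec.dim (S i)" using cvec_dim_pos[OF rep_fin_dim[OF S(1) i(1)]] by simp
    also have "... <= (SUM i:verts Q. cvec.dim (S i))" by (rule member_le_sum[OF i(1)]) auto
    finally show ?thesis .
   qed
   have sum: "(SUM i:verts Q. d i) = (SUM i:verts Q. cvec.dim (u X i)) + (SUM i:verts Q. cvec.dim (w X i))"
    using dim P(3)[OF X] by (simp add: sum.distrib[symmetric])
   have "iso_class Q (subrep (m X) S) : ?T"
    if S: "is_rep Q (subrep (m X) S)" and le: "!!i. i : verts Q ==> cvec.dim (S i) <= d i"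
     and lt: "(SUM i:verts Q. cvec.dim (S i)) < (SUM i:verts Q. d i)" for S
   proof -
    let ?d = "\<lambda>i\<in>verts Q. cvec.dim (S i)"
    have "?d : ?E" using le lt by simp
    moreover have "iso_class Q (subrep (m X) S) : iso_classes Q ?d"
     unfolding iso_classes_def using S by auto
    ultimately show ?thesis by blast
   qed
   from this[OF rU[OF X]] this[OF rW[OF X]] show "?h X : ?T \<times> ?T"
    using dim P(3)[OF X] sum pos[OF rU[OF X] P(5)[OF X]] pos[OF rW[OF X] P(6)[OF X]] by simp
  qed
  ultimately show "finite ?D" using finT by (meson finite_SigmaI inj_on_finite)
 qed
 moreover have "iso_classes Q d <= ?Z Un ?I Un ?D"
 proof
  fix X assume "X : (iso_classes Q d :: ('v, 'e, 'a) rep set set)"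
  then have "EX M. X = iso_class Q M & ?dims M" unfolding iso_classes_def mem_Collect_eq .
  then obtain M where M: "X = iso_class Q M & ?dims M" by (rule exE)
  show "X : ?Z Un ?I Un ?D"
  proof (cases "(ALL i:verts Q. rep_space M i = {0}) | indecomposable_rep Q M")
   case True
   then have "X : ?Z | X : ?I"
    unfolding mem_Collect_eq using M by (elim disjE) (intro disjI1 exI[of _ M], simp, intro disjI2 exI[of _ M], simp)
   then show ?thesis by (elim disjE) (rule UnI1, rule UnI1, assumption, rule UnI1, rule UnI2, assumption)
  next
   case False
   then have "EX U W. decomposes Q M U W & ?nz U & ?nz W"
    using M unfolding indecomposable_rep_def decomposes_def by (simp, elim conjE disjE) simp_all
   then have "X : ?D" unfolding mem_Collect_eq using M by (intro exI[of _ M]) simp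
   then show ?thesis by (rule UnI2)
  qed
 qed
 ultimately show ?case by (meson finite_UnI finite_subset)
qed

text \<open>Uniqueness of indecomposables is established in \<open>nat => complex\<close>; classes
  in another ambient type inject into the classes there by choosing embedded copies.\<close>

lemma finite_iso_classes_bounded:
 fixes Q :: "('v, 'e) pre_digraph" and b :: "'v => nat"
 assumes Q: "fin_digraph Q" and fin: "!!d. finite (iso_classes Q d :: ('v, 'e, nat => complex) rep set set)"
 shows "finite {iso_class Q M | M :: ('v, 'e, 'a::complex_vector) rep.
  is_rep Q M & (ALL i:verts Q. cvec.dim (rep_space M i) <= b i)}" (is "finite ?S")
proof -
 interpret fin_digraph Q by (rule Q)
 note wf = wf_digraph_axioms
 let ?T = "\<Union>d\<in>(\<Pi>\<^sub>E i\<in>verts Q. {..b i}). iso_classes Q d :: ('v, 'e, nat => complex) rep set set"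
 have "finite (\<Pi>\<^sub>E i\<in>verts Q. {..b i})" using finite_verts by (intro finite_PiE) auto
 then have finT: "finite ?T" using fin by auto
 have "ALL X:?S. EX p. X = iso_class Q (fst p) & is_rep Q (fst p) & (ALL i:verts Q. cvec.dim (rep_space (fst p) i) <= b i) &
  is_rep Q (snd p :: ('v, 'e, nat => complex) rep) & rep_isomorphic Q (fst p) (snd p)"
 proof
  fix X assume X: "X : ?S"
  obtain M :: "('v, 'e, 'a) rep" where M': "X = iso_class Q M & is_rep Q M & (ALL i:verts Q. cvec.dim (rep_space M i) <= b i)"
   using X unfolding mem_Collect_eq by (rule exE)
  then have M: "X = iso_class Q M" "is_rep Q M" "ALL i:verts Q. cvec.dim (rep_space M i) <= b i" by simp_all
  obtain M' :: "('v, 'e, nat => complex) rep" and ph where "is_rep Q M'" "ph : rep_iso Q M M'"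
   by (rule rep_embed[OF wf M(2)])
  then show "EX p. X = iso_class Q (fst p) & is_rep Q (fst p) & (ALL i:verts Q. cvec.dim (rep_space (fst p) i) <= b i) &
   is_rep Q (snd p :: ('v, 'e, nat => complex) rep) & rep_isomorphic Q (fst p) (snd p)"
   using M by (intro exI[of _ "(M, M')"]) (auto simp: rep_isomorphic_def)
 qed
 from bchoice[OF this] obtain p where p: "ALL X:?S. X = iso_class Q (fst (p X)) & is_rep Q (fst (p X)) &
  (ALL i:verts Q. cvec.dim (rep_space (fst (p X)) i) <= b i) &
  is_rep Q (snd (p X) :: ('v, 'e, nat => complex) rep) & rep_isomorphic Q (fst (p X)) (snd (p X))"
  by (rule exE)
 define m n where "m X = fst (p X)" and "n X = snd (p X)" for X
 have P: "X = iso_class Q (m X)" "is_rep Q (m X)" "!!i. i : verts Q ==> cvec.dim (rep_space (m X) i) <= b i"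
  "is_rep Q (n X)" "rep_isomorphic Q (m X) (n X)" if "X : ?S" for X
  using bspec[OF p that] unfolding m_def n_def by simp_all
 have "inj_on (%X. iso_class Q (n X)) ?S"
 proof (rule inj_onI)
  fix X Y assume X: "X : ?S" and Y: "Y : ?S" and e: "iso_class Q (n X) = iso_class Q (n Y)"
  have "rep_isomorphic Q (n X) (n Y)" using e iso_class_eq_iff[OF wf P(4)[OF X] P(4)[OF Y]] by simp
  then have "rep_isomorphic Q (m X) (n Y)" by (rule rep_isomorphic_trans[OF wf P(2)[OF X] P(5)[OF X]])
  then have "rep_isomorphic Q (m X) (m Y)"
   by (rule rep_isomorphic_trans[OF wf P(2)[OF X] _ rep_isomorphic_sym[OF wf P(2)[OF Y] P(4)[OF Y] P(5)[OF Y]]])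
  then have "iso_class Q (m X) = iso_class Q (m Y)" using iso_class_eq_iff[OF wf P(2)[OF X] P(2)[OF Y]] by simp
  then show "X = Y" using P(1)[OF X] P(1)[OF Y] by simp
 qed
 moreover have "(%X. iso_class Q (n X)) ` ?S <= ?T"
 proof (rule image_subsetI)
  fix X assume X: "X : ?S"
  let ?d = "\<lambda>i\<in>verts Q. cvec.dim (rep_space (n X) i)"
  have "?d : (\<Pi>\<^sub>E i\<in>verts Q. {..b i})"
   using rep_isomorphic_dim[OF P(2)[OF X] P(5)[OF X]] P(3)[OF X] by simp
  moreover have "iso_class Q (n X) : iso_classes Q ?d"
   unfolding iso_classes_def using P(4)[OF X] by auto
  ultimately show "iso_class Q (n X) : ?T" by blast
 qed
 ultimately show ?thesis using finT by (rule inj_on_finite)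
qed

subsection \<open>Dynkin quivers\<close>

lemma A_edges_iff: "{k, m} : A_edges n \<longleftrightarrow> 1 <= k & k < n & m = k + 1 | 1 <= m & m < n & k = m + 1"
 unfolding A_edges_def by (auto simp: doubleton_eq_iff)

lemma A_edgesE: "e : A_edges n ==> (!!k. e = {k, k + 1} ==> 1 <= k ==> k < n ==> thesis) ==> thesis"
 unfolding A_edges_def by blast

lemma simply_laced_dynkin_cases:
 assumes "simply_laced_dynkin n E"
 obtains "E = A_edges n" | c where "E = insert {c, n} (A_edges (n - 1))" "c < n"
proof -
 consider "E = A_edges n" | "n >= 4" "E = D_edges n" | "n >= 4" "E = E_edges n"
  using assms unfolding simply_laced_dynkin_def by auto
 then show ?thesis
 proof cases
  case 2
  show ?thesis by (rule that(2)[of "n - 2"]) (use 2 in \<open>simp_all add: D_edges_def\<close>)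
 next
  case 3
  show ?thesis by (rule that(2)[of 3]) (use 3 in \<open>simp_all add: E_edges_def\<close>)
 qed (rule that(1))
qed

lemma dynkin_edges_pair:
 assumes "simply_laced_dynkin n E" "e : E"
 obtains k m where "e = {k, m}" "k < m"
 using assms(1)
proof (cases rule: simply_laced_dynkin_cases)
 case 1
 then show ?thesis using assms(2) that by (auto elim!: A_edgesE)
next
 case (2 c)
 then show ?thesis using assms(2) that by (auto elim!: A_edgesE)
qed

text \<open>In the chosen numbering every vertex has at most one smaller neighbour. So the diagram
  grows by attaching leaves, which is what the construction of an admissible ordering uses.\<close>

lemma dynkin_edges_max:
 assumes "simply_laced_dynkin n E" "e : E" "e' : E" "Max e = Max e'"
 shows "e = e'"
proof -
 have A: "e = e'" if "e : A_edges m" "e' : A_edges m" "Max e = Max e'" for e e' m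
  using that by (elim A_edgesE) simp
 have B: "Max e ~= n" if "e : A_edges (n - 1)" for e
  using that by (elim A_edgesE) simp
 show ?thesis
  using assms(1)
 proof (cases rule: simply_laced_dynkin_cases)
  case 1
  then show ?thesis using assms(2-4) A by blast
 next
  case (2 c)
  have "Max {c, n} = n" using 2(2) by simp
  then show ?thesis using assms(2-4) A B 2(1) by (metis insertE)
 qed
qed

lemma sum_A_edges_le:
 fixes w :: "nat => int"
 assumes "!!m. 0 <= w m" "1 <= k"
 shows "(SUM m:{1..n}. if {k, m} : A_edges N then w m else 0) <= w (k - 1) + w (k + 1)"
proof -
 have "(SUM m:{1..n}. if {k, m} : A_edges N then w m else 0) <=
   (SUM m:{1..n}. (if m = k - 1 then w m else 0) + (if m = k + 1 then w m else 0))"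
  using assms(1) by (intro sum_mono) (auto simp: A_edges_iff)
 also have "... = (SUM m:{1..n}. if m = k - 1 then w m else 0) + (SUM m:{1..n}. if m = k + 1 then w m else 0)"
  by (rule sum.distrib)
 also have "... <= w (k - 1) + w (k + 1)"
  using assms(1) by (intro add_mono) simp_all
 finally show ?thesis .
qed

text \<open>
 The weights are the coefficients of twice the sum of the fundamental coweights, up to a factor;
 the Cartan matrix maps them to a constant vector.
\<close>

lemma dynkin_weights_exist:
 assumes "simply_laced_dynkin n E"
 shows "EX w :: nat => int. (ALL k:{1..n}. 0 < w k & (SUM m:{1..n}. if {k, m} : E then w m else 0) < 2 * w k)"
proof -
 consider (A) "n >= 1" "E = A_edges n" | (D) "n >= 4" "E = D_edges n"
  | (E6) "n = 6" "E = E_edges 6" | (E7) "n = 7" "E = E_edges 7" | (E8) "n = 8" "E = E_edges 8"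
  using assms unfolding simply_laced_dynkin_def by auto
 then show ?thesis
 proof cases
  case A
  define w where "w k = (if k <= n then int k * (int n + 1 - int k) else 0)" for k
  have w0: "0 <= w m" for m unfolding w_def by simp
  have "(SUM m:{1..n}. if {k, m} : E then w m else 0) < 2 * w k" if k: "k : {1..n}" for k
  proof -
   have "w (k - 1) + w (k + 1) < 2 * w k"
    using k unfolding w_def by (cases "k = n") (auto simp: of_nat_diff algebra_simps)
   then show ?thesis using sum_A_edges_le[of w k n n] w0 k A(2) by simp
  qed
  moreover have "0 < w k" if "k : {1..n}" for k using that unfolding w_def by simp
  ultimately show ?thesis by blast
 next
  case D
  \<comment> \<open>The coefficients of \<open>2 \<rho>\<close>, doubled to avoid the division in
    the value \<open>n (n - 1) / 2\<close> at the last two vertices.\<close>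
  define w where "w k = (if k <= n - 2 then 2 * int k * (2 * int n - int k - 1)
   else if k <= n then int n * (int n - 1) else 0)" for k
  have w0: "0 <= w m" for m unfolding w_def using D(1) by auto
  have wpos: "0 < w k" if "k : {1..n}" for k using that D(1) unfolding w_def by auto
  have "(SUM m:{1..n}. if {k, m} : E then w m else 0) < 2 * w k" if k: "k : {1..n}" for k
  proof -
   let ?a = "SUM m:{1..n}. if {k, m} : A_edges (n - 1) then w m else 0"
   have "(SUM m:{1..n}. if {k, m} : E then w m else 0) <= 
     (SUM m:{1..n}. (if {k, m} : A_edges (n - 1) then w m else 0) + (if {k, m} = {n - 2, n} then w m else 0))"
    using w0 D(2) by (intro sum_mono) (auto simp: D_edges_def)
   also have "... = ?a + (SUM m:{1..n}. if {k, m} = {n - 2, n} then w m else 0)" by (rule sum.distrib)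
   finally have le: "(SUM m:{1..n}. if {k, m} : E then w m else 0) <=
    ?a + (SUM m:{1..n}. if {k, m} = {n - 2, n} then w m else 0)" .
   consider "k < n - 2" | "k = n - 2" | "k = n - 1" | "k = n" using k by force
   then show ?thesis
   proof cases
    case 1
    then have z: "(SUM m:{1..n}. if {k, m} = {n - 2, n} then w m else 0) = 0"
     by (intro sum.neutral) (auto simp: doubleton_eq_iff)
    have "w (k - 1) + w (k + 1) < 2 * w k"
     using k 1 unfolding w_def by (auto simp: of_nat_diff algebra_simps)
    then show ?thesis using le z sum_A_edges_le[of w k "n - 1" n] w0 k by simp
   next
    case 2
    have "(SUM m:{1..n}. if {k, m} = {n - 2, n} then w m else 0) = (SUM m:{1..n}. if m = n then w m else 0)"
     using 2 D(1) by (intro sum.cong) (auto simp: doubleton_eq_iff)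
    then have z: "(SUM m:{1..n}. if {k, m} = {n - 2, n} then w m else 0) = w n" using D(1) by simp
    have "w (k - 1) + w (k + 1) + w n < 2 * w k"
     using 2 D(1) unfolding w_def by (auto simp: of_nat_diff algebra_simps)
    then show ?thesis using le z sum_A_edges_le[of w k "n - 1" n] w0 k by simp
   next
    case 3
    then have z: "(SUM m:{1..n}. if {k, m} = {n - 2, n} then w m else 0) = 0"
     using D(1) by (intro sum.neutral) (auto simp: doubleton_eq_iff)
    have "?a = (SUM m:{1..n}. if m = n - 2 then w m else 0)"
     using 3 D(1) by (intro sum.cong) (auto simp: A_edges_iff)
    then have "?a = w (n - 2)" using D(1) by simp
    moreover have "w (n - 2) < 2 * w k"
     using 3 D(1) unfolding w_def by (auto simp: of_nat_diff algebra_simps)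
    ultimately show ?thesis using le z by simp
   next
    case 4
    have "?a = 0" using 4 by (intro sum.neutral) (auto simp: A_edges_iff)
    moreover have "(SUM m:{1..n}. if {k, m} = {n - 2, n} then w m else 0) = (SUM m:{1..n}. if m = n - 2 then w m else 0)"
     using 4 D(1) by (intro sum.cong) (auto simp: doubleton_eq_iff)
    then have "(SUM m:{1..n}. if {k, m} = {n - 2, n} then w m else 0) = w (n - 2)" using D(1) by simp
    moreover have "w (n - 2) < 2 * w k"
     using 4 D(1) unfolding w_def by (auto simp: of_nat_diff algebra_simps)
    ultimately show ?thesis using le by simp
   qed
  qed
  then show ?thesis using wpos by blast
 next
  case E6
  have S: "{1..n} = {1, 2, 3, 4, 5, 6 :: nat}" using E6(1) by auto
  \<comment> \<open>Entry 0 of the list is padding, since vertices are numbered from 1; the last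
    entry belongs to the vertex hanging off the third one. The same holds for the other two
    lists.\<close>
  show ?thesis
   unfolding S E6(2) E_edges_def
   by (intro exI[of _ "%k. [0, 16, 30, 42, 30, 16, 22] ! k"])
    (simp add: A_edges_iff doubleton_eq_iff)
 next
  case E7
  have S: "{1..n} = {1, 2, 3, 4, 5, 6, 7 :: nat}" using E7(1) by auto
  show ?thesis
   unfolding S E7(2) E_edges_def
   by (intro exI[of _ "%k. [0, 34, 66, 96, 75, 52, 27, 49] ! k"])
    (simp add: A_edges_iff doubleton_eq_iff)
 next
  case E8
  have S: "{1..n} = {1, 2, 3, 4, 5, 6, 7, 8 :: nat}" using E8(1) by auto
  show ?thesis
   unfolding S E8(2) E_edges_def
   by (intro exI[of _ "%k. [0, 92, 182, 270, 220, 168, 114, 58, 136] ! k"])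
    (simp add: A_edges_iff doubleton_eq_iff)
 qed
qed

locale dynkin_digraph = fin_digraph Q for Q :: "('v, 'e) pre_digraph" +
 fixes n :: nat and E :: "nat set set" and f :: "'v => nat"
 assumes E: "simply_laced_dynkin n E" and f: "bij_betw f (verts Q) {1..n}"
  and g: "bij_betw (%a. {f (tail Q a), f (head Q a)}) (arcs Q) E"
begin

lemma f_eq_iff: "i : verts Q ==> j : verts Q ==> f i = f j \<longleftrightarrow> i = j"
 using f unfolding bij_betw_def inj_on_def by blast

lemma arc_edge: "a : arcs Q ==> {f (tail Q a), f (head Q a)} : E"
 using g unfolding bij_betw_def by blast

lemma no_loops: "a : arcs Q ==> tail Q a ~= head Q a"
proof
 assume a: "a : arcs Q" and "tail Q a = head Q a"
 then have "{f (head Q a)} : E" using arc_edge[OF a] by simp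
 then obtain k m where "{f (head Q a)} = {k, m}" "k < m" by (rule dynkin_edges_pair[OF E])
 then show False by (metis doubleton_eq_iff insert_absorb2 nat_neq_iff)
qed

text \<open>The vertex numbered \<open>m + 1\<close> is joined to at most one smaller vertex. It is
  put in front if an arc from a smaller vertex points to it, and at the end otherwise.\<close>

lemma sinks_first_upto:
 "EX vs. distinct vs & set vs = {v : verts Q. f v <= m} &
  (ALL a:arcs Q. f (tail Q a) <= m --> f (head Q a) <= m -->
    (EX us ws. vs = us @ head Q a # ws & tail Q a : set ws))"
proof (induction m)
 case 0
 have "f v ~= 0" if "v : verts Q" for v using f that unfolding bij_betw_def by force
 then show ?case by (intro exI[of _ "[]"]) auto
next
 case (Suc m)
 then obtain vs where vs: "distinct vs" "set vs = {v : verts Q. f v <= m}"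
  "!!a. a : arcs Q ==> f (tail Q a) <= m ==> f (head Q a) <= m ==>
   EX us ws. vs = us @ head Q a # ws & tail Q a : set ws" by blast
 show ?case
 proof (cases "EX v:verts Q. f v = Suc m")
  case False
  then have "f v <= Suc m \<longleftrightarrow> f v <= m" if "v : verts Q" for v using that by (auto simp: le_Suc_eq)
  then show ?thesis using vs by (intro exI[of _ vs]) auto
 next
  case True
  then obtain v where v: "v : verts Q" "f v = Suc m" by blast
  have le: "w ~= v ==> f w <= m" if "w : verts Q" "f w <= Suc m" for w
   using that v f_eq_iff[OF that(1) v(1)] by (auto simp: le_Suc_eq)
  have set: "{w : verts Q. f w <= Suc m} = insert v (set vs)" using le v vs(2) by auto
  have nv: "v ~: set vs" using v vs(2) by simp
  have in_vs: "w : set vs" if "w : verts Q" "f w <= Suc m" "w ~= v" for w using le[OF that(1,2)] that vs(2) by simp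
  \<comment> \<open>Both arcs give edges with maximum \<open>m + 1\<close>.\<close>
  have uniq: "a = b" if "a : arcs Q" "f (tail Q a) <= Suc m" "f (head Q a) <= Suc m" "v : {tail Q a, head Q a}"
   "b : arcs Q" "f (tail Q b) <= Suc m" "f (head Q b) <= Suc m" "v : {tail Q b, head Q b}" for a b
  proof -
   have "Max {f (tail Q a), f (head Q a)} = Suc m" "Max {f (tail Q b), f (head Q b)} = Suc m"
    using that v by (auto simp: max_def)
   then have "{f (tail Q a), f (head Q a)} = {f (tail Q b), f (head Q b)}"
    using dynkin_edges_max[OF E arc_edge[OF that(1)] arc_edge[OF that(5)]] by simp
   then show ?thesis using g that(1,5) unfolding bij_betw_def inj_on_def by blast
  qed
  show ?thesis
  proof (cases "EX a:arcs Q. f (tail Q a) <= Suc m & head Q a = v")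
   case True
   then obtain b where b: "b : arcs Q" "f (tail Q b) <= Suc m" "head Q b = v" by blast
   show ?thesis
   proof (rule exI[of _ "v # vs"], intro conjI ballI impI)
    fix a assume a: "a : arcs Q" "f (tail Q a) <= Suc m" "f (head Q a) <= Suc m"
    show "EX us ws. v # vs = us @ head Q a # ws & tail Q a : set ws"
    proof (cases "v : {tail Q a, head Q a}")
     case True
     then have "a = b" using uniq[OF a True b(1,2)] b v by simp
     then have "head Q a = v" "tail Q a ~= v" using b no_loops[OF a(1)] by auto
     then show ?thesis using in_vs[of "tail Q a"] a by (intro exI[of _ "[]"] exI[of _ vs]) simp
    next
     case False
     then have "f (tail Q a) <= m" "f (head Q a) <= m" using le a by auto
     from vs(3)[OF a(1) this] obtain us ws where "vs = us @ head Q a # ws" "tail Q a : set ws" by blast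
     then show ?thesis by (intro exI[of _ "v # us"] exI[of _ ws]) simp
    qed
   qed (use set nv vs in auto)
  next
   case False
   show ?thesis
   proof (rule exI[of _ "vs @ [v]"], intro conjI ballI impI)
    fix a assume a: "a : arcs Q" "f (tail Q a) <= Suc m" "f (head Q a) <= Suc m"
    have hv: "head Q a ~= v" using False a by blast
    show "EX us ws. vs @ [v] = us @ head Q a # ws & tail Q a : set ws"
    proof (cases "tail Q a = v")
     case True
     have "head Q a : set vs" using in_vs[OF _ a(3) hv] a by simp
     then obtain us ws where "vs = us @ head Q a # ws" using split_list by metis
     then show ?thesis using True by (intro exI[of _ us] exI[of _ "ws @ [v]"]) simp
    next
     case False
     then have "f (tail Q a) <= m" "f (head Q a) <= m" using le a hv by auto
     from vs(3)[OF a(1) this] obtain us ws where "vs = us @ head Q a # ws" "tail Q a : set ws" by blast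
     then show ?thesis by (intro exI[of _ us] exI[of _ "ws @ [v]"]) simp
    qed
   qed (use set nv vs in auto)
  qed
 qed
qed

lemma sinks_first_exists: "EX vs. sinks_first Q vs"
proof -
 have fn: "f v <= n" if "v : verts Q" for v using f that unfolding bij_betw_def by force
 then have "{v : verts Q. f v <= n} = verts Q" by blast
 then show ?thesis using sinks_first_upto[of n] fn unfolding sinks_first_def by auto
qed

lemma adjacency_eq:
 assumes i: "i : verts Q" and j: "j : verts Q"
 shows "adjacency Q i j = (if {f i, f j} : E then 1 else 0)"
proof -
 let ?S = "{a : arcs Q. tail Q a = i & head Q a = j | tail Q a = j & head Q a = i}"
 have S: "?S = {a : arcs Q. {f (tail Q a), f (head Q a)} = {f i, f j}}"
  using f_eq_iff i j by (auto simp: doubleton_eq_iff)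
 show ?thesis
 proof (cases "{f i, f j} : E")
  case True
  then obtain a where a: "a : arcs Q" "{f (tail Q a), f (head Q a)} = {f i, f j}"
   using g unfolding bij_betw_def by (metis (no_types, lifting) image_iff)
  have "?S = {a}" unfolding S using a g unfolding bij_betw_def inj_on_def by auto
  then show ?thesis using True unfolding adjacency_def by simp
 next
  case False
  have "a ~: ?S" for a unfolding S using arc_edge[of a] False by auto
  then have "?S = {}" by blast
  then show ?thesis using False unfolding adjacency_def by simp
 qed
qed

lemma dynkin_weights_adjacency: "EX u. dynkin_weights (verts Q) (adjacency Q) u"
proof -
 obtain w :: "nat => int" where w: "!!k. k : {1..n} ==> 0 < w k"
  "!!k. k : {1..n} ==> (SUM m:{1..n}. if {k, m} : E then w m else 0) < 2 * w k"
  using dynkin_weights_exist[OF E] by blast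
 have fi: "f i : {1..n}" if "i : verts Q" for i using f that unfolding bij_betw_def by blast
 have "dynkin_weights (verts Q) (adjacency Q) (%i. w (f i))"
 proof
  show "finite (verts Q)" by simp
  show "adjacency Q i j = adjacency Q j i" for i j
   unfolding adjacency_def by (rule arg_cong[of _ _ "%S. int (card S)"]) auto
  show "0 <= adjacency Q i j" for i j unfolding adjacency_def by simp
  show "adjacency Q i i = 0" for i
  proof -
   have "{a : arcs Q. tail Q a = i & head Q a = i | tail Q a = i & head Q a = i} = {}"
    by (auto dest: no_loops[THEN not_sym])
   then show ?thesis unfolding adjacency_def by simp
  qed
  show "0 < w (f i)" if "i : verts Q" for i using w(1) fi[OF that] .
  fix i assume i: "i : verts Q"
  have "(SUM j:verts Q. adjacency Q i j * w (f j)) = (SUM j:verts Q. if {f i, f j} : E then w (f j) else 0)"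
   using adjacency_eq[OF i] by (intro sum.cong) auto
  also have "... = (SUM m:{1..n}. if {f i, m} : E then w m else 0)"
   by (rule sum.reindex_bij_betw[OF f])
  finally show "(SUM j:verts Q. adjacency Q i j * w (f j)) < 2 * w (f i)" using w(2)[OF fi[OF i]] by simp
 qed
 then show ?thesis by blast
qed

end

lemma dynkin_quiver_imp_locale:
 assumes "dynkin_quiver Q"
 obtains n E f where "dynkin_digraph Q n E f"
 using assms unfolding dynkin_quiver_def dynkin_digraph_def dynkin_digraph_axioms_def by blast

lemma sinks_first_sink_rank:
 assumes "sinks_first Q vs"
 obtains r where "sink_rank Q r"
proof
 define r where "r v = length (takeWhile (%w. w ~= v) vs)" for v
 show "sink_rank Q r"
  unfolding sink_rank_def
 proof
  fix a assume "a : arcs Q"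
  then obtain us ws where uw: "vs = us @ head Q a # ws" "tail Q a : set ws"
   using assms unfolding sinks_first_def by blast
  have d: "distinct vs" using assms unfolding sinks_first_def by blast
  have "r (head Q a) = length us" unfolding r_def uw(1) using d uw by (subst takeWhile_append2) auto
  moreover have "r (tail Q a) > length us"
   unfolding r_def uw(1) using d uw by (subst takeWhile_append2) auto
  ultimately show "r (head Q a) < r (tail Q a)" by simp
 qed
qed

lemma dynkin_indecomposable_unique:
 fixes M N :: "('v, 'e, nat => complex) rep"
 assumes Q: "dynkin_quiver Q" and M: "indecomposable_rep Q M" and N: "indecomposable_rep Q N"
  and d: "!!i. i : verts Q ==> cvec.dim (rep_space M i) = cvec.dim (rep_space N i)"
 shows "rep_isomorphic Q M N"
proof -
 obtain n E f where "dynkin_digraph Q n E f" by (rule dynkin_quiver_imp_locale[OF Q])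
 then interpret dynkin_digraph Q n E f .
 obtain vs where vs: "sinks_first Q vs" using sinks_first_exists by blast
 obtain u where "dynkin_weights (verts Q) (adjacency Q) u" using dynkin_weights_adjacency by blast
 then interpret w: dynkin_weights "verts Q" "adjacency Q" u .
 let ?d = "%i. int (cvec.dim (rep_space M i))"
 have dv: "distinct vs" "set vs = verts Q" using vs unfolding sinks_first_def by auto
 obtain j where "j : verts Q" "rep_space M j ~= {0}" using indecomposable_nonzero[OF M] by blast
 then have "EX i:verts Q. ?d i ~= 0"
  using cvec_dim_pos[OF rep_fin_dim[OF indecomposable_is_rep[OF M]]] by auto
 from w.fold_reflect_negative[OF dv this] obtain k i where
  "i : verts Q" "(fold (reflect (verts Q) (adjacency Q)) vs ^^ k) ?d i < 0" by blast
 then show ?thesis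
  using indecomposable_unique[OF fin_digraph_axioms vs M N d, of ?d i "k * length vs"]
  by (simp add: reflections_rounds)
qed

subsection \<open>Indecomposable summands over the equioriented quiver of type A\<close>

locale linear_quiver = fin_digraph Q for Q :: "('v, 'e) pre_digraph" +
 fixes n :: nat and pos :: "'v => nat"
 assumes pos: "bij_betw pos (verts Q) {1..n}"
  and pos_arcs: "bij_betw (%a. (pos (tail Q a), pos (head Q a))) (arcs Q) {(k, k + 1) | k. 1 <= k & k < n}"
begin

lemma wf: "wf_digraph Q" by (rule wf_digraph_axioms)

lemma pos_eq_iff: "i : verts Q ==> j : verts Q ==> pos i = pos j \<longleftrightarrow> i = j"
 using pos unfolding bij_betw_def inj_on_def by blast

lemma pos_range: "i : verts Q ==> 1 <= pos i & pos i <= n"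
 using bij_betw_apply[OF pos] by fastforce

lemma pos_head: "a : arcs Q ==> pos (head Q a) = pos (tail Q a) + 1"
 using bij_betw_apply[OF pos_arcs, of a] by auto

lemma vertex_at: "1 <= k ==> k <= n ==> EX i:verts Q. pos i = k"
 using bij_betw_imp_surj_on[OF pos] by (metis (mono_tags, lifting) atLeastAtMost_iff imageE)

lemma arc_between:
 assumes i: "i : verts Q" and j: "j : verts Q" and ij: "pos j = pos i + 1"
 obtains a where "a : arcs Q" "tail Q a = i" "head Q a = j"
proof -
 have "(pos i, pos j) : {(k, k + 1) | k. 1 <= k & k < n}"
  using pos_range[OF i] pos_range[OF j] ij by auto
 then obtain a where a: "a : arcs Q" "pos (tail Q a) = pos i" "pos (head Q a) = pos j"
  unfolding bij_betw_imp_surj_on[OF pos_arcs, symmetric] by auto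
 then show ?thesis using that[of a] pos_eq_iff i j by simp
qed

lemma arc_unique:
 assumes "a : arcs Q" "b : arcs Q" "tail Q a = tail Q b | head Q a = head Q b"
 shows "a = b"
proof -
 have "pos (tail Q a) = pos (tail Q b)" "pos (head Q a) = pos (head Q b)"
  using assms pos_head[OF assms(1)] pos_head[OF assms(2)] by auto
 then show ?thesis
  using bij_betw_imp_inj_on[OF pos_arcs] assms(1,2) unfolding inj_on_def by auto
qed

lemma vertex_induct [consumes 1, case_names step]:
 assumes "i : verts Q"
  and "!!i. i : verts Q ==> (!!a. a : in_arcs Q i ==> P (tail Q a)) ==> P i"
 shows "P i"
 using assms(1)
proof (induction "pos i" arbitrary: i rule: less_induct)
 case less
 show ?case
  by (rule assms(2)[OF less(2)], rule less(1)) (auto simp: in_arcs_def pos_head)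
qed

text \<open>Outside its support a string carries \<open>b i = 0\<close>, and the arc leaving the
  support maps the last basis vector to this 0. The zero values let strings be handled as total
  functions.\<close>

definition string_at :: "('v, 'e, 'a::complex_vector) rep => ('v => 'a set) => ('v => 'a) => bool" where
 "string_at M S b \<longleftrightarrow> (ALL i:verts Q. S i = cvec.span {b i}) &
  (ALL a:arcs Q. b (tail Q a) ~= 0 --> rep_map M a (b (tail Q a)) = b (head Q a))"

text \<open>The complement is \<open>V + C\<close> with \<open>C\<close> a complement of
  \<open>U + V\<close>.\<close>

lemma complement_containing:
 assumes S: "fin_dim_subspace S" and U: "cvec.subspace U" "U <= S" and V: "cvec.subspace V" "V <= S"
  and UV: "U Int V <= {0}"
 obtains W where "cvec.subspace W" "W <= S" "V <= W" "U Int W = {0}"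
  "!!z. z : S ==> EX u:U. EX w:W. z = u + w"
proof -
 note sS = fin_dim_subspace_imp_subspace[OF S]
 let ?T = "{x + y | x y. x : U & y : V}"
 have T: "cvec.subspace ?T" "?T <= S"
  using cvec.subspace_sums[OF U(1) V(1)] cvec.subspace_add[OF sS] U(2) V(2) by auto
 obtain C where C: "cvec.subspace C" "C <= S" "?T Int C = {0}" "!!x. x : S ==> EX u:?T. EX w:C. x = u + w"
  by (rule fin_dim_subspace_complement[OF S T]) (rule that)
 let ?W = "{x + y | x y. x : V & y : C}"
 show ?thesis
 proof (rule that)
  show "cvec.subspace ?W" by (rule cvec.subspace_sums[OF V(1) C(1)])
  show "?W <= S" using cvec.subspace_add[OF sS] V(2) C(2) by auto
  show "V <= ?W" using cvec.subspace_0[OF C(1)] by (blast intro: add.right_neutral[symmetric])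
  have z0: "0 : U" "0 : ?W"
   using cvec.subspace_0[OF U(1)] cvec.subspace_0[OF cvec.subspace_sums[OF V(1) C(1)]] by auto
  have "x = 0" if x: "x : U" "x : ?W" for x
  proof -
   obtain v c where vc: "x = v + c" "v : V" "c : C" using x(2) by blast
   have "c = x + (- v)" using vc by simp
   moreover have "- v : V" using cvec.subspace_neg[OF V(1) vc(2)] .
   ultimately have "c : ?T" using x(1) by blast
   then have "c = 0" using C(3) vc(3) by blast
   then show "x = 0" using vc x UV by auto
  qed
  then show "U Int ?W = {0}" using z0 by blast
  fix z assume "z : S"
  then obtain t w where t: "t : ?T" and w: "w : C" "z = t + w" using C(4) by blast
  obtain u v where uv: "t = u + v" "u : U" "v : V" using t by blast
  have "z = u + (v + w)" using uv w by (simp add: add.assoc)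
  then show "EX u:U. EX w:?W. z = u + w" using uv w by blast
 qed
qed

lemma span_singleton: "x : cvec.span {b} \<longleftrightarrow> (EX c. x = c *\<^sub>C b)"
 using cvec.span_singleton[of b] by auto

lemma string_span_subrep:
 assumes M: "is_rep Q M" and b: "!!i. i : verts Q ==> b i : rep_space M i"
  and ba: "!!a. a : arcs Q ==> b (tail Q a) ~= 0 ==> rep_map M a (b (tail Q a)) = b (head Q a)"
 shows "is_subrep Q M (\<lambda>i\<in>verts Q. cvec.span {b i})"
proof (rule is_subrepI)
 fix i assume i: "i : verts Q"
 show "(\<lambda>i\<in>verts Q. cvec.span {b i}) i <= rep_space M i"
  using cvec.span_minimal[OF _ rep_subspace[OF M i], of "{b i}"] b[OF i] i by simp
next
 fix a x assume a: "a : arcs Q" and "x : (\<lambda>i\<in>verts Q. cvec.span {b i}) (tail Q a)"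
 then obtain c where c: "x = c *\<^sub>C b (tail Q a)" by (auto simp: span_singleton)
 note t = tail_in_verts[OF a] and h = head_in_verts[OF a]
 have "rep_map M a x = c *\<^sub>C rep_map M a (b (tail Q a))"
  unfolding c by (rule clinear_on_scale[OF rep_map_clinear[OF M a] b[OF t]])
 moreover have "rep_map M a (b (tail Q a)) : cvec.span {b (head Q a)}"
 proof (cases "b (tail Q a) = 0")
  case True
  then show ?thesis
   using clinear_on_0[OF rep_map_clinear[OF M a] rep_subspace[OF M t]] cvec.span_zero by simp
 next
  case False
  then show ?thesis using ba[OF a] cvec.span_base[of "b (head Q a)" "{b (head Q a)}"] by simp
 qed
 ultimately show "rep_map M a x : (\<lambda>i\<in>verts Q. cvec.span {b i}) (head Q a)"
  using h cvec.span_scale by simp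
qed auto

text \<open>A nonzero vector at the first vertex of the support has nonzero images up to
  \<open>n\<close>, and their span is a direct summand: complements are chosen from left to right,
  each containing the image of the preceding one. Injectivity keeps that image away from the span,
  and indecomposability kills the complement.\<close>

lemma string_of_injective:
 fixes M :: "('v, 'e, 'a::complex_vector) rep"
 assumes ind: "indecomposable_rep Q M"
  and inj: "!!a. a : arcs Q ==> inj_on (rep_map M a) (rep_space M (tail Q a))"
 obtains b p where "string_at M (rep_space M) b" "1 <= p" "p <= n"
  "!!i. i : verts Q ==> b i ~= 0 \<longleftrightarrow> p <= pos i"
proof -
 note M = indecomposable_is_rep[OF ind]
 have z: "0 : rep_space M i" if "i : verts Q" for i using cvec.subspace_0[OF rep_subspace[OF M that]] .
 have mlin: "clinear_on (rep_space M (tail Q a)) (rep_map M a)" if "a : arcs Q" for a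
  using rep_map_clinear[OF M that] .
 have m0: "rep_map M a x = 0 \<longleftrightarrow> x = 0" if "a : arcs Q" "x : rep_space M (tail Q a)" for a x
  using inj[OF that(1)] clinear_on_inj_iff[OF mlin[OF that(1)] rep_subspace[OF M tail_in_verts[OF that(1)]]]
   clinear_on_0[OF mlin[OF that(1)] rep_subspace[OF M tail_in_verts[OF that(1)]]] that(2) by blast
 let ?N = "%k. EX i:verts Q. pos i = k & rep_space M i ~= {0}"
 define p where "p = (LEAST k. ?N k)"
 have exN: "EX k. ?N k" using indecomposable_nonzero[OF ind] by blast
 have pN: "?N p" unfolding p_def by (rule LeastI_ex[OF exN])
 have below: "rep_space M i = {0}" if "i : verts Q" "pos i < p" for i
  using not_less_Least[of "pos i" ?N] that unfolding p_def by blast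
 obtain v where v: "v : verts Q" "pos v = p" "rep_space M v ~= {0}" using pN by blast
 obtain x where x: "x : rep_space M v" "x ~= 0" using v(3) z[OF v(1)] by blast
 define G where "G i b \<longleftrightarrow> b i : rep_space M i & (b i ~= 0 \<longleftrightarrow> p <= pos i) &
  (ALL a:in_arcs Q i. b (tail Q a) ~= 0 --> rep_map M a (b (tail Q a)) = b i)" for i and b :: "'v => 'a"
 obtain b where b: "!!i. i : verts Q ==> G i b"
 proof (rule rank_choice[of "verts Q" pos G])
  fix i and b b' :: "'v => 'a"
  assume "i : verts Q" "b i = b' i" and lo: "!!j. j : verts Q ==> pos j < pos i ==> b j = b' j" and "G i b"
  moreover have "b (tail Q a) = b' (tail Q a)" if "a : in_arcs Q i" for a
   using that pos_head by (intro lo) (auto simp: in_arcs_def)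
  ultimately show "G i b'" unfolding G_def by simp
 next
  fix i and b :: "'v => 'a"
  assume i: "i : verts Q" and lo: "!!j. j : verts Q ==> pos j < pos i ==> G j b"
  have A: "a : arcs Q" "head Q a = i" "tail Q a ~= i" "G (tail Q a) b" "pos i = pos (tail Q a) + 1" if "a : in_arcs Q i" for a
   using that pos_head[of a] lo[of "tail Q a"] by (auto simp: in_arcs_def)
  consider "pos i < p" | "pos i = p" | "p < pos i" by linarith
  then show "EX y. G i (b(i := y))"
  proof cases
   case 1
   have "G i (b(i := 0))"
    unfolding G_def using z[OF i] 1 A(3,4,5) unfolding G_def by fastforce
   then show ?thesis by blast
  next
   case 2
   then have "i = v" using pos_eq_iff[OF i v(1)] v(2) by simp
   then have "G i (b(i := x))"
    unfolding G_def using x 2 A(3,4,5) unfolding G_def by fastforce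
   then show ?thesis by blast
  next
   case 3
   then obtain t where t: "t : verts Q" "pos i = pos t + 1" "p <= pos t"
   proof -
    have "1 <= pos i - 1" "pos i - 1 <= n" "pos i = (pos i - 1) + 1"
     using 3 pos_range[OF i] pos_range[OF v(1)] v(2) by auto
    then show ?thesis using vertex_at[of "pos i - 1"] that 3 by force
   qed
   obtain a where a: "a : arcs Q" "tail Q a = t" "head Q a = i" by (rule arc_between[OF t(1) i t(2)])
   have aA: "a : in_arcs Q i" using a by (simp add: in_arcs_def)
   have bt: "b t : rep_space M t" "b t ~= 0" using A(4)[OF aA] a(2) t(3) unfolding G_def by auto
   have un: "c = a" if "c : in_arcs Q i" for c using arc_unique[OF A(1)[OF that] a(1)] A(2)[OF that] a(3) by simp
   let ?y = "rep_map M a (b t)"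
   have ti: "t ~= i" using A(3)[OF aA] a(2) by simp
   have y: "?y : rep_space M i" "?y ~= 0"
    using rep_map_in[OF M a(1), of "b t"] m0[OF a(1), of "b t"] bt a(2,3) by simp_all
   have "rep_map M c ((b(i := ?y)) (tail Q c)) = ?y" if "c : in_arcs Q i" for c
    unfolding un[OF that] a(2) using ti by simp
   then have "G i (b(i := ?y))"
    unfolding G_def using y 3 by simp
   then show ?thesis by blast
  qed
 qed (auto intro: that)
 have ba: "rep_map M a (b (tail Q a)) = b (head Q a)" if "a : arcs Q" "b (tail Q a) ~= 0" for a
  using b[OF head_in_verts[OF that(1)]] that unfolding G_def in_arcs_def by blast
 have bi: "b i : rep_space M i" "b i ~= 0 \<longleftrightarrow> p <= pos i" if "i : verts Q" for i
  using b[OF that] unfolding G_def by auto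
 let ?U = "\<lambda>i\<in>verts Q. cvec.span {b i}"
 have U: "is_subrep Q M ?U" by (rule string_span_subrep[OF M bi(1) ba])
 have Ui: "cvec.subspace (cvec.span {b i})" "cvec.span {b i} <= rep_space M i" if "i : verts Q" for i
  using is_subrepD(2,3)[OF U that] that by simp_all
 define H where "H i W \<longleftrightarrow> cvec.subspace (W i) & W i <= rep_space M i & cvec.span {b i} Int W i = {0} &
  (ALL z:rep_space M i. EX u:cvec.span {b i}. EX w:W i. z = u + w) &
  (ALL a:in_arcs Q i. rep_map M a ` W (tail Q a) <= W i)" for i and W :: "'v => 'a set"
 obtain W where W: "!!i. i : verts Q ==> H i W"
 proof (rule rank_choice[of "verts Q" pos H])
  fix i and W W' :: "'v => 'a set"
  assume "i : verts Q" "W i = W' i" and lo: "!!j. j : verts Q ==> pos j < pos i ==> W j = W' j" and "H i W"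
  moreover have "W (tail Q a) = W' (tail Q a)" if "a : in_arcs Q i" for a
   using that pos_head by (intro lo) (auto simp: in_arcs_def)
  ultimately show "H i W'" unfolding H_def by simp
 next
  fix i and W :: "'v => 'a set"
  assume i: "i : verts Q" and lo: "!!j. j : verts Q ==> pos j < pos i ==> H j W"
  have A: "a : arcs Q" "head Q a = i" "tail Q a ~= i" "H (tail Q a) W" "pos i = pos (tail Q a) + 1" if "a : in_arcs Q i" for a
   using that pos_head[of a] lo[of "tail Q a"] by (auto simp: in_arcs_def)
  \<comment> \<open>\<open>V\<close> is the image of the preceding complement, and 0 at the first
    vertex.\<close>
  have "EX V. cvec.subspace V & V <= rep_space M i & cvec.span {b i} Int V <= {0} &
    (ALL a:in_arcs Q i. rep_map M a ` W (tail Q a) <= V)"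
  proof (cases "in_arcs Q i = {}")
   case True
   then show ?thesis using z[OF i] by (intro exI[of _ "{0}"]) auto
  next
   case False
   then obtain a where a: "a : in_arcs Q i" by blast
   have un: "c = a" if "c : in_arcs Q i" for c
    using arc_unique[OF A(1)[OF that] A(1)[OF a]] A(2)[OF that] A(2)[OF a] by simp
   have Wt: "cvec.subspace (W (tail Q a))" "W (tail Q a) <= rep_space M (tail Q a)"
    "cvec.span {b (tail Q a)} Int W (tail Q a) = {0}" using A(4)[OF a] unfolding H_def by simp_all
   note t = tail_in_verts[OF A(1)[OF a]]
   let ?V = "rep_map M a ` W (tail Q a)"
   have V: "cvec.subspace ?V" "?V <= rep_space M i"
    using clinear_on_image_subspace[OF clinear_on_subset[OF mlin[OF A(1)[OF a]] Wt(2)] Wt(1)]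
     rep_map_in[OF M A(1)[OF a]] Wt(2) A(2)[OF a] by auto
   have "y = 0" if y: "y : cvec.span {b i}" "y : ?V" for y
   proof -
    obtain w where w: "w : W (tail Q a)" "y = rep_map M a w" using y(2) by blast
    obtain c where c: "y = c *\<^sub>C b i" using y(1) by (auto simp: span_singleton)
    note wM = subsetD[OF Wt(2) w(1)]
    show "y = 0"
    proof (cases "b (tail Q a) = 0")
     case True
     then have "pos (tail Q a) < p" using bi(2)[OF t] by simp
     then have "w = 0" using below[OF t] wM by simp
     then show ?thesis using w m0[OF A(1)[OF a] wM] by simp
    next
     case False
     let ?cb = "c *\<^sub>C b (tail Q a)"
     have cbM: "?cb : rep_space M (tail Q a)" using cvec.subspace_scale[OF rep_subspace[OF M t] bi(1)[OF t]] .
     have "rep_map M a ?cb = rep_map M a w"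
      using clinear_on_scale[OF mlin[OF A(1)[OF a]] bi(1)[OF t]] ba[OF A(1)[OF a] False] A(2)[OF a] c w by simp
     then have "w = ?cb" using inj[OF A(1)[OF a]] cbM wM unfolding inj_on_def by metis
     then have "w : cvec.span {b (tail Q a)} Int W (tail Q a)" using w(1) by (auto simp: span_singleton)
     then have "w = 0" unfolding Wt(3) by simp
     then show ?thesis using w m0[OF A(1)[OF a] wM] by simp
    qed
   qed
   then show ?thesis using V un by (intro exI[of _ ?V]) auto
  qed
  then obtain V where V: "cvec.subspace V" "V <= rep_space M i" "cvec.span {b i} Int V <= {0}"
    "!!a. a : in_arcs Q i ==> rep_map M a ` W (tail Q a) <= V" by blast
  obtain X where X: "cvec.subspace X" "X <= rep_space M i" "V <= X" "cvec.span {b i} Int X = {0}"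
   "!!z. z : rep_space M i ==> EX u:cvec.span {b i}. EX w:X. z = u + w"
   by (rule complement_containing[OF rep_fin_dim[OF M i] Ui[OF i] V(1-3)]) (rule that)
  have "rep_map M a ` W (tail Q a) <= X" if "a : in_arcs Q i" for a using V(4)[OF that] X(3) by (rule order_trans)
  then have "H i (W(i := X))" unfolding H_def using X A(3) by auto
  then show "EX y. H i (W(i := y))" by blast
 qed (auto intro: that)
 have Wi: "cvec.subspace (W i)" "W i <= rep_space M i" "cvec.span {b i} Int W i = {0}"
  "ALL z:rep_space M i. EX u:cvec.span {b i}. EX w:W i. z = u + w"
  "ALL a:in_arcs Q i. rep_map M a ` W (tail Q a) <= W i" if "i : verts Q" for i
  using W[OF that] unfolding H_def by simp_all
 have W': "is_subrep Q M (restrict W (verts Q))"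
  by (rule is_subrepI) (use Wi in \<open>auto simp: in_arcs_def image_subset_iff\<close>)
 have "(ALL j:verts Q. ?U j = {0}) | (ALL j:verts Q. restrict W (verts Q) j = {0})"
  by (rule indecomposableD[OF ind U W' _ _ M]) (use Wi(3,4) in simp_all)
 moreover have "b v : ?U v" using v(1) cvec.span_base[of "b v" "{b v}"] by simp
 then have "?U v ~= {0}" using bi(2)[OF v(1)] v by force
 ultimately have W0: "W i = {0}" if "i : verts Q" for i using v(1) that by auto
 have "rep_space M i = cvec.span {b i}" if i: "i : verts Q" for i
  using Wi(4)[OF i] W0[OF i] Ui(2)[OF i] by auto
 then have "string_at M (rep_space M) b" unfolding string_at_def using ba by simp
 then show ?thesis using that[of b p] bi(2) pos_range[OF v(1)] v(2) by simp
qed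

text \<open>The mirror image: from a nonzero vector at the last vertex of the support, preimages are
  chosen to the left. The complement at a vertex is the preimage of the next one; from the last
  vertex on any complement works, because the next space is 0.\<close>

lemma string_of_surjective:
 fixes M :: "('v, 'e, 'a::complex_vector) rep"
 assumes ind: "indecomposable_rep Q M"
  and surj: "!!a. a : arcs Q ==> rep_map M a ` rep_space M (tail Q a) = rep_space M (head Q a)"
 obtains b q where "string_at M (rep_space M) b" "1 <= q" "q <= n"
  "!!i. i : verts Q ==> b i ~= 0 \<longleftrightarrow> pos i <= q"
proof -
 note M = indecomposable_is_rep[OF ind]
 have z: "0 : rep_space M i" if "i : verts Q" for i using cvec.subspace_0[OF rep_subspace[OF M that]] .
 have mlin: "clinear_on (rep_space M (tail Q a)) (rep_map M a)" if "a : arcs Q" for a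
  using rep_map_clinear[OF M that] .
 have m00: "rep_map M a 0 = 0" if "a : arcs Q" for a
  using clinear_on_0[OF mlin[OF that] rep_subspace[OF M tail_in_verts[OF that]]] .
 let ?N = "%k. EX i:verts Q. pos i = k & rep_space M i ~= {0}"
 define q where "q = (GREATEST k. ?N k)"
 have bd: "k <= n" if "?N k" for k using that pos_range by blast
 obtain k where k: "?N k" using indecomposable_nonzero[OF ind] by blast
 have qN: "?N q" unfolding q_def by (rule GreatestI_nat[where P="?N", OF k bd])
 have above: "rep_space M i = {0}" if "i : verts Q" "q < pos i" for i
 proof (rule ccontr)
  assume "rep_space M i ~= {0}"
  then have "?N (pos i)" using that(1) by blast
  then have "pos i <= q" unfolding q_def by (rule Greatest_le_nat[where P="?N", OF _ bd])
  then show False using that(2) by simp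
 qed
 obtain v where v: "v : verts Q" "pos v = q" "rep_space M v ~= {0}" using qN by blast
 obtain x where x: "x : rep_space M v" "x ~= 0" using v(3) z[OF v(1)] by blast
 \<comment> \<open>Reversed positions, because the choices run from right to left.\<close>
 define rk where "rk i = n - pos i" for i
 have rk: "rk (head Q a) < rk (tail Q a)" if "a : arcs Q" for a
  using pos_head[OF that] pos_range[OF head_in_verts[OF that]] unfolding rk_def by simp
 define G where "G i b \<longleftrightarrow> b i : rep_space M i & (b i ~= 0 \<longleftrightarrow> pos i <= q) &
  (ALL a:out_arcs Q i. b i ~= 0 --> rep_map M a (b i) = b (head Q a))" for i and b :: "'v => 'a"
 obtain b where b: "!!i. i : verts Q ==> G i b"
 proof (rule rank_choice[of "verts Q" rk G])
  fix i and b b' :: "'v => 'a"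
  assume "i : verts Q" "b i = b' i" and lo: "!!j. j : verts Q ==> rk j < rk i ==> b j = b' j" and "G i b"
  moreover have "b (head Q a) = b' (head Q a)" if "a : out_arcs Q i" for a
   using that rk by (intro lo) (auto simp: out_arcs_def)
  ultimately show "G i b'" unfolding G_def by simp
 next
  fix i and b :: "'v => 'a"
  assume i: "i : verts Q" and lo: "!!j. j : verts Q ==> rk j < rk i ==> G j b"
  have A: "a : arcs Q" "tail Q a = i" "head Q a ~= i" "G (head Q a) b" "pos (head Q a) = pos i + 1" if "a : out_arcs Q i" for a
   using that pos_head[of a] rk[of a] lo[of "head Q a"] by (auto simp: out_arcs_def)
  consider "q < pos i" | "pos i = q" | "pos i < q" by linarith
  then show "EX y. G i (b(i := y))"
  proof cases
   case 1
   have "G i (b(i := 0))" unfolding G_def using z[OF i] 1 by simp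
   then show ?thesis by blast
  next
   case 2
   then have iv: "i = v" using pos_eq_iff[OF i v(1)] v(2) by simp
   have "rep_map M a x = b (head Q a)" if a: "a : out_arcs Q i" for a
   proof -
    have "rep_space M (head Q a) = {0}" using above[OF head_in_verts[OF A(1)[OF a]]] A(5)[OF a] 2 by simp
    then show ?thesis
     using rep_map_in[OF M A(1)[OF a]] A(2,4)[OF a] x(1) iv unfolding G_def by auto
   qed
   then have "G i (b(i := x))" unfolding G_def using x 2 iv A(3) by auto
   then show ?thesis by blast
  next
   case 3
   then obtain h where h: "h : verts Q" "pos h = pos i + 1" "pos h <= q"
    using vertex_at[of "pos i + 1"] pos_range[OF v(1)] v(2) by auto
   obtain a where a: "a : arcs Q" "tail Q a = i" "head Q a = h" by (rule arc_between[OF i h(1,2)])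
   have aA: "a : out_arcs Q i" using a by (simp add: out_arcs_def)
   have bh: "b h : rep_space M h" "b h ~= 0" using A(4)[OF aA] a(3) h(3) unfolding G_def by auto
   obtain y where y: "y : rep_space M i" "rep_map M a y = b h"
    using surj[OF a(1)] bh(1) a by (metis imageE)
   have y0: "y ~= 0" using y(2) m00[OF a(1)] bh(2) by auto
   have un: "c = a" if "c : out_arcs Q i" for c using arc_unique[OF A(1)[OF that] a(1)] A(2)[OF that] a(2) by simp
   have hi: "h ~= i" using A(3)[OF aA] a(3) by simp
   have "rep_map M c y = (b(i := y)) (head Q c)" if "c : out_arcs Q i" for c
    unfolding un[OF that] a(3) using hi y(2) by simp
   then have "G i (b(i := y))" unfolding G_def using y(1) y0 3 by simp
   then show ?thesis by blast
  qed
 qed (auto intro: that)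
 have ba: "rep_map M a (b (tail Q a)) = b (head Q a)" if "a : arcs Q" "b (tail Q a) ~= 0" for a
  using b[OF tail_in_verts[OF that(1)]] that unfolding G_def out_arcs_def by blast
 have bi: "b i : rep_space M i" "b i ~= 0 \<longleftrightarrow> pos i <= q" if "i : verts Q" for i
  using b[OF that] unfolding G_def by auto
 let ?U = "\<lambda>i\<in>verts Q. cvec.span {b i}"
 have U: "is_subrep Q M ?U" by (rule string_span_subrep[OF M bi(1) ba])
 have Ui: "cvec.subspace (cvec.span {b i})" "cvec.span {b i} <= rep_space M i" if "i : verts Q" for i
  using is_subrepD(2,3)[OF U that] that by simp_all
 define H where "H i W \<longleftrightarrow> cvec.subspace (W i) & W i <= rep_space M i & cvec.span {b i} Int W i = {0} &
  (ALL z:rep_space M i. EX u:cvec.span {b i}. EX w:W i. z = u + w) &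
  (ALL a:out_arcs Q i. rep_map M a ` W i <= W (head Q a))" for i and W :: "'v => 'a set"
 obtain W where W: "!!i. i : verts Q ==> H i W"
 proof (rule rank_choice[of "verts Q" rk H])
  fix i and W W' :: "'v => 'a set"
  assume "i : verts Q" "W i = W' i" and lo: "!!j. j : verts Q ==> rk j < rk i ==> W j = W' j" and "H i W"
  moreover have "W (head Q a) = W' (head Q a)" if "a : out_arcs Q i" for a
   using that rk by (intro lo) (auto simp: out_arcs_def)
  ultimately show "H i W'" unfolding H_def by simp
 next
  fix i and W :: "'v => 'a set"
  assume i: "i : verts Q" and lo: "!!j. j : verts Q ==> rk j < rk i ==> H j W"
  have A: "a : arcs Q" "tail Q a = i" "head Q a ~= i" "H (head Q a) W" "pos (head Q a) = pos i + 1" if "a : out_arcs Q i" for a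
   using that pos_head[of a] rk[of a] lo[of "head Q a"] by (auto simp: out_arcs_def)
  have Hh: "cvec.subspace (W (head Q a))" "cvec.span {b (head Q a)} Int W (head Q a) = {0}"
   "ALL z:rep_space M (head Q a). EX u:cvec.span {b (head Q a)}. EX w:W (head Q a). z = u + w"
   if "a : out_arcs Q i" for a using A(4)[OF that] unfolding H_def by simp_all
  show "EX y. H i (W(i := y))"
  proof (cases "pos i < q")
   case False
   obtain X where X: "cvec.subspace X" "X <= rep_space M i" "cvec.span {b i} Int X = {0}"
    "!!z. z : rep_space M i ==> EX u:cvec.span {b i}. EX w:X. z = u + w"
    by (rule fin_dim_subspace_complement[OF rep_fin_dim[OF M i] Ui[OF i]]) (rule that)
   have "rep_map M a ` X <= W (head Q a)" if a: "a : out_arcs Q i" for a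
   proof -
    have "rep_space M (head Q a) = {0}" using above[OF head_in_verts[OF A(1)[OF a]]] A(5)[OF a] False by simp
    then have "rep_map M a y = 0" if "y : X" for y
     using rep_map_in[OF M A(1)[OF a]] A(2)[OF a] X(2) that by auto
    then show ?thesis using cvec.subspace_0[OF Hh(1)[OF a]] by auto
   qed
   then have "H i (W(i := X))" unfolding H_def using X A(3) by auto
   then show ?thesis by blast
  next
   case True
   then obtain h where h: "h : verts Q" "pos h = pos i + 1" "pos h <= q"
    using vertex_at[of "pos i + 1"] pos_range[OF v(1)] v(2) by auto
   obtain a where a: "a : arcs Q" "tail Q a = i" "head Q a = h" by (rule arc_between[OF i h(1,2)])
   have aA: "a : out_arcs Q i" using a by (simp add: out_arcs_def)
   have un: "c = a" if "c : out_arcs Q i" for c using arc_unique[OF A(1)[OF that] a(1)] A(2)[OF that] a(2) by simp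
   have b0: "b i ~= 0" "b h ~= 0" using bi(2)[OF i] bi(2)[OF h(1)] True h(3) by simp_all
   have fb: "rep_map M a (b i) = b h" using ba[OF a(1)] a b0 by simp
   have ml: "clinear_on (rep_space M i) (rep_map M a)" using mlin[OF a(1)] a by simp
   let ?X = "{y : rep_space M i. rep_map M a y : W h}"
   have Wh: "cvec.subspace (W h)" "cvec.span {b h} Int W h = {0}"
    "ALL z:rep_space M h. EX u:cvec.span {b h}. EX w:W h. z = u + w" using Hh[OF aA] a(3) by simp_all
   have X: "cvec.subspace ?X" by (rule clinear_on_vimage_subspace[OF ml rep_subspace[OF M i] Wh(1)])
   have "y = 0" if y: "y : cvec.span {b i}" "y : ?X" for y
   proof -
    obtain c where c: "y = c *\<^sub>C b i" using y(1) by (auto simp: span_singleton)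
    have "rep_map M a y = c *\<^sub>C b h" using clinear_on_scale[OF ml bi(1)[OF i]] fb c by simp
    then have "c *\<^sub>C b h : cvec.span {b h} Int W h" using y(2) by (auto simp: span_singleton)
    then have "c *\<^sub>C b h = 0" unfolding Wh(2) by simp
    then show "y = 0" using c b0 by simp
   qed
   then have int: "cvec.span {b i} Int ?X = {0}" using cvec.subspace_0[OF X] cvec.span_zero by blast
   have sum: "EX u:cvec.span {b i}. EX w:?X. y = u + w" if y: "y : rep_space M i" for y
   proof -
    have "rep_map M a y : rep_space M h" using rep_map_in[OF M a(1)] a y by simp
    then obtain u w where uw: "u : cvec.span {b h}" "w : W h" "rep_map M a y = u + w" using Wh(3) by blast
    obtain c where c: "u = c *\<^sub>C b h" using uw(1) by (auto simp: span_singleton)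
    have cb: "c *\<^sub>C b i : rep_space M i" by (rule cvec.subspace_scale[OF rep_subspace[OF M i] bi(1)[OF i]])
    have "rep_map M a (y - c *\<^sub>C b i) = w"
     using clinear_on_diff[OF ml rep_subspace[OF M i] y cb] clinear_on_scale[OF ml bi(1)[OF i]] fb uw c by simp
    then have "y - c *\<^sub>C b i : ?X" using cvec.subspace_diff[OF rep_subspace[OF M i] y cb] uw(2) by simp
    moreover have "c *\<^sub>C b i : cvec.span {b i}" by (auto simp: span_singleton)
    moreover have "y = c *\<^sub>C b i + (y - c *\<^sub>C b i)" by simp
    ultimately show ?thesis by blast
   qed
   have im: "rep_map M c ` ?X <= W (head Q c)" if "c : out_arcs Q i" for c using un[OF that] a(3) by auto
   have "H i (W(i := ?X))" unfolding H_def using X int sum im A(3) by auto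
   then show ?thesis by blast
  qed
 qed (auto intro: that)
 have Wi: "cvec.subspace (W i)" "W i <= rep_space M i" "cvec.span {b i} Int W i = {0}"
  "ALL z:rep_space M i. EX u:cvec.span {b i}. EX w:W i. z = u + w"
  "ALL a:out_arcs Q i. rep_map M a ` W i <= W (head Q a)" if "i : verts Q" for i
  using W[OF that] unfolding H_def by simp_all
 have W': "is_subrep Q M (restrict W (verts Q))"
 proof (rule is_subrepI)
  fix a x assume a: "a : arcs Q" and x: "x : restrict W (verts Q) (tail Q a)"
  have "a : out_arcs Q (tail Q a)" using a by (simp add: out_arcs_def)
  then have "rep_map M a ` W (tail Q a) <= W (head Q a)" using Wi(5)[OF tail_in_verts[OF a]] by blast
  then show "rep_map M a x : restrict W (verts Q) (head Q a)" using a x by auto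
 qed (use Wi in auto)
 have "(ALL j:verts Q. ?U j = {0}) | (ALL j:verts Q. restrict W (verts Q) j = {0})"
  by (rule indecomposableD[OF ind U W' _ _ M]) (use Wi(3,4) in simp_all)
 moreover have "b v : ?U v" using v(1) cvec.span_base[of "b v" "{b v}"] by simp
 then have "?U v ~= {0}" using bi(2)[OF v(1)] v by force
 ultimately have W0: "W i = {0}" if "i : verts Q" for i using v(1) that by auto
 have "rep_space M i = cvec.span {b i}" if i: "i : verts Q" for i
  using Wi(4)[OF i] W0[OF i] Ui(2)[OF i] by auto
 then have "string_at M (rep_space M) b" unfolding string_at_def using ba by simp
 then show ?thesis using that[of b q] bi(2) pos_range[OF v(1)] v(2) by simp
qed

end

subsection \<open>Representations with a basis of strings\<close>

lemma family_independent:
 assumes A: "finite A" and z: "!!c. (SUM k:A. c k *\<^sub>C v k) = 0 ==> ALL k:A. c k = 0"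
 shows "inj_on v A" "cvec.independent (v ` A)"
proof -
 show inj: "inj_on v A"
 proof (rule inj_onI, rule ccontr)
  fix k l assume kl: "k : A" "l : A" "v k = v l" "k ~= l"
  let ?c = "%j. (if j = k then 1 else 0) - (if j = l then 1 else 0 :: complex)"
  have "(SUM j:A. ?c j *\<^sub>C v j) = (SUM j:A. (if j = k then v k else 0) - (if j = l then v l else 0))"
   using kl by (intro sum.cong) auto
  also have "... = 0" using A kl by (simp add: sum_subtractf)
  finally show False using z[of ?c] kl by auto
 qed
 show "cvec.independent (v ` A)"
 proof (rule cvec.independent_if_scalars_zero)
  fix f x assume s: "(SUM x:v ` A. f x *\<^sub>C x) = 0" and x: "x : v ` A"
  have "(SUM k:A. f (v k) *\<^sub>C v k) = 0" using s by (simp add: sum.reindex[OF inj])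
  then show "f x = 0" using z[of "%k. f (v k)"] x by blast
 qed (use A in simp)
qed

text \<open>
 The assumptions on starts and ends say that adding to a basis string multiples of strings of smaller
 rank \<open>rh\<close> commutes with the arcs.
\<close>

locale string_basis = linear_quiver Q n pos for Q :: "('v, 'e) pre_digraph" and n pos +
 fixes M :: "('v, 'e, 'm::complex_vector) rep" and B :: "'k set" and rh :: "'k => nat" and e :: "'k => 'v => 'm"
 assumes repM: "is_rep Q M" and finB: "finite B" and rh: "inj_on rh B"
  and e_in: "kp : B ==> i : verts Q ==> e kp i : rep_space M i"
  and indep: "i : verts Q ==> (SUM kp:B. c kp *\<^sub>C e kp i) = 0 ==> kp : B ==> e kp i ~= 0 ==> c kp = 0"
  and spans: "i : verts Q ==> x : rep_space M i ==> EX c. x = (SUM kp:B. c kp *\<^sub>C e kp i)"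
  and e_map: "a : arcs Q ==> kp : B ==> e kp (tail Q a) ~= 0 ==> rep_map M a (e kp (tail Q a)) = e kp (head Q a)"
  and ends: "a : arcs Q ==> kp : B ==> mu : B ==> rh mu < rh kp ==> e kp (tail Q a) ~= 0 ==>
   e kp (head Q a) = 0 ==> e mu (tail Q a) ~= 0 ==> e mu (head Q a) = 0"
  and starts: "a : arcs Q ==> kp : B ==> mu : B ==> rh mu < rh kp ==> e kp (tail Q a) ~= 0 ==>
   e kp (head Q a) ~= 0 ==> e mu (head Q a) ~= 0 ==> e mu (tail Q a) ~= 0"
  and convex: "kp : B ==> i : verts Q ==> j : verts Q ==> l : verts Q ==> e kp i ~= 0 ==> e kp l ~= 0 ==>
   pos i <= pos j ==> pos j <= pos l ==> e kp j ~= 0"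
begin

definition Bi :: "'v => 'k set" where "Bi i = {kp : B. e kp i ~= 0}"

lemma Bi_fin: "finite (Bi i)" using finB unfolding Bi_def by simp

lemma BiD: "kp : Bi i ==> kp : B" "kp : Bi i ==> e kp i ~= 0"
 unfolding Bi_def by auto

lemma sum_Bi: "(SUM kp:B. c kp *\<^sub>C e kp i) = (SUM kp:Bi i. c kp *\<^sub>C e kp i)"
 using finB unfolding Bi_def by (intro sum.mono_neutral_right) auto

text \<open>Normalised by 0 off \<open>Bi i\<close>; otherwise the coefficients of the vanishing
  \<open>e kp i\<close> would be arbitrary.\<close>

definition cf :: "'v => 'm => 'k => complex" where
 "cf i x = (SOME c. x = (SUM kp:Bi i. c kp *\<^sub>C e kp i) & (ALL kp. kp ~: Bi i --> c kp = 0))"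

lemma cf_spec:
 assumes i: "i : verts Q" and x: "x : rep_space M i"
 shows "x = (SUM kp:Bi i. cf i x kp *\<^sub>C e kp i)" "kp ~: Bi i ==> cf i x kp = 0"
proof -
 obtain c where c: "x = (SUM kp:Bi i. c kp *\<^sub>C e kp i)" using spans[OF i x] sum_Bi by metis
 let ?c = "%kp. if kp : Bi i then c kp else 0"
 have "x = (SUM kp:Bi i. ?c kp *\<^sub>C e kp i) & (ALL kp. kp ~: Bi i --> ?c kp = 0)"
  unfolding c by (auto intro: sum.cong)
 then have "EX c. x = (SUM kp:Bi i. c kp *\<^sub>C e kp i) & (ALL kp. kp ~: Bi i --> c kp = 0)" by (rule exI[of _ ?c])
 from someI_ex[OF this] show "x = (SUM kp:Bi i. cf i x kp *\<^sub>C e kp i)" "kp ~: Bi i ==> cf i x kp = 0"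
  unfolding cf_def by auto
qed

lemma comb_in: "i : verts Q ==> A <= B ==> (SUM kp:A. c kp *\<^sub>C e kp i) : rep_space M i"
 by (intro cvec.subspace_sum[OF rep_subspace[OF repM]] cvec.subspace_scale[OF rep_subspace[OF repM]] e_in) auto

lemma cf_comb:
 assumes i: "i : verts Q" and A: "A <= Bi i"
 shows "cf i (SUM kp:A. c kp *\<^sub>C e kp i) mu = (if mu : A then c mu else 0)"
proof -
 let ?x = "SUM kp:A. c kp *\<^sub>C e kp i"
 have AB: "A <= B" using A BiD(1) by blast
 have x: "?x : rep_space M i" by (rule comb_in[OF i AB])
 let ?c = "%kp. if kp : A then c kp else 0"
 have "?x = (SUM kp:Bi i. ?c kp *\<^sub>C e kp i)"
  using A Bi_fin by (intro sum.mono_neutral_cong_left) auto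
 then have "(SUM kp:Bi i. (cf i ?x kp - ?c kp) *\<^sub>C e kp i) = 0"
  using cf_spec(1)[OF i x] by (simp add: cvec.scale_left_diff_distrib sum_subtractf)
 then have "(SUM kp:B. (cf i ?x kp - ?c kp) *\<^sub>C e kp i) = 0" unfolding sum_Bi .
 from indep[OF i this] have "cf i ?x mu = ?c mu" if "mu : Bi i" using that BiD by force
 moreover have "cf i ?x mu = 0" "mu ~: A" if "mu ~: Bi i" using cf_spec(2)[OF i x that] that A by auto
 ultimately show ?thesis by (cases "mu : Bi i") auto
qed

lemma cf_e: "i : verts Q ==> kp : Bi i ==> cf i (e kp i) mu = (if mu = kp then 1 else 0)"
 using cf_comb[of i "{kp}" "%_. 1" mu] by (simp add: scaleC_one)

lemma cf_add:
 assumes i: "i : verts Q" and x: "x : rep_space M i" and y: "y : rep_space M i"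
 shows "cf i (x + y) mu = cf i x mu + cf i y mu"
proof -
 have "x + y = (SUM kp:Bi i. (cf i x kp + cf i y kp) *\<^sub>C e kp i)"
  using cf_spec(1)[OF i x] cf_spec(1)[OF i y] by (simp add: cvec.scale_left_distrib sum.distrib)
 then show ?thesis
  using cf_comb[OF i order_refl, of "%kp. cf i x kp + cf i y kp" mu] cf_spec(2)[OF i x] cf_spec(2)[OF i y] by simp
qed

lemma cf_scale:
 assumes i: "i : verts Q" and x: "x : rep_space M i"
 shows "cf i (c *\<^sub>C x) mu = c * cf i x mu"
proof -
 have "c *\<^sub>C x = (SUM kp:Bi i. (c * cf i x kp) *\<^sub>C e kp i)"
  by (subst cf_spec(1)[OF i x]) (simp add: cvec.scale_sum_right)
 then show ?thesis
  using cf_comb[OF i order_refl, of "%kp. c * cf i x kp" mu] cf_spec(2)[OF i x] by simp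
qed

lemma cf_clinear: "i : verts Q ==> clinear_on (rep_space M i) (%x. cf i x mu)"
 by (intro clinear_onI) (auto simp: cf_add cf_scale scaleC_complex_def)

lemma cf_sum:
 assumes i: "i : verts Q" and x: "!!k. k : K ==> x k : rep_space M i"
 shows "cf i (SUM k:K. c k *\<^sub>C x k) mu = (SUM k:K. c k * cf i (x k) mu)"
proof -
 have "cf i (SUM k:K. c k *\<^sub>C x k) mu = (SUM k:K. cf i (c k *\<^sub>C x k) mu)"
  using x by (intro clinear_on_sum[OF cf_clinear[OF i] rep_subspace[OF repM i]] cvec.subspace_scale[OF rep_subspace[OF repM i]])
 also have "... = (SUM k:K. c k * cf i (x k) mu)" using cf_scale[OF i x] by (intro sum.cong) auto
 finally show ?thesis .
qed

lemma cf_zero: "i : verts Q ==> cf i 0 mu = 0"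
 using cf_scale[of i 0 0 mu] cvec.subspace_0[OF rep_subspace[OF repM]] by simp

lemma cf_eqI:
 assumes i: "i : verts Q" and x: "x : rep_space M i" and y: "y : rep_space M i"
  and "!!kp. kp : Bi i ==> cf i x kp = cf i y kp"
 shows "x = y"
proof -
 have "x = (SUM kp:Bi i. cf i x kp *\<^sub>C e kp i)" by (rule cf_spec(1)[OF i x])
 also have "... = (SUM kp:Bi i. cf i y kp *\<^sub>C e kp i)" using assms(4) by (intro sum.cong) auto
 also have "... = y" by (rule cf_spec(1)[OF i y, symmetric])
 finally show ?thesis .
qed

lemma map_comb:
 assumes a: "a : arcs Q" and A: "A <= Bi (tail Q a)"
 shows "rep_map M a (SUM kp:A. c kp *\<^sub>C e kp (tail Q a)) = (SUM kp:A. c kp *\<^sub>C e kp (head Q a))"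
proof -
 note t = tail_in_verts[OF a]
 have AD: "kp : B" "e kp (tail Q a) ~= 0" if "kp : A" for kp using that A BiD by auto
 have "rep_map M a (SUM kp:A. c kp *\<^sub>C e kp (tail Q a)) = (SUM kp:A. rep_map M a (c kp *\<^sub>C e kp (tail Q a)))"
  using AD(1) t by (intro clinear_on_sum[OF rep_map_clinear[OF repM a] rep_subspace[OF repM t]]
   cvec.subspace_scale[OF rep_subspace[OF repM t]] e_in)
 also have "... = (SUM kp:A. c kp *\<^sub>C e kp (head Q a))"
  using clinear_on_scale[OF rep_map_clinear[OF repM a] e_in[OF AD(1) t]] e_map[OF a AD] by (intro sum.cong) auto
 finally show ?thesis .
qed

text \<open>Arcs carry basis vectors to basis vectors with the same index or to 0, so coordinates
  are copied, and dropped where strings end. A string beginning at the head has coordinate 0 on both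
  sides by the normalisation.\<close>

lemma cf_map:
 assumes a: "a : arcs Q" and x: "x : rep_space M (tail Q a)"
 shows "cf (head Q a) (rep_map M a x) mu = (if mu : Bi (head Q a) then cf (tail Q a) x mu else 0)"
proof -
 note t = tail_in_verts[OF a] and h = head_in_verts[OF a]
 have "rep_map M a x = rep_map M a (SUM kp:Bi (tail Q a). cf (tail Q a) x kp *\<^sub>C e kp (tail Q a))"
  using cf_spec(1)[OF t x] by simp
 also have "... = (SUM kp:Bi (tail Q a). cf (tail Q a) x kp *\<^sub>C e kp (head Q a))" by (rule map_comb[OF a order_refl])
 also have "... = (SUM kp:Bi (tail Q a) Int Bi (head Q a). cf (tail Q a) x kp *\<^sub>C e kp (head Q a))"
  using Bi_fin by (intro sum.mono_neutral_right) (auto simp: Bi_def)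
 finally show ?thesis
  using cf_comb[OF h, of "Bi (tail Q a) Int Bi (head Q a)" "cf (tail Q a) x" mu] cf_spec(2)[OF t x, of mu] by auto
qed

section \<open>Unitriangular automorphisms\<close>

definition below :: "'k => 'v => 'k set" where "below kp i = {mu : Bi i. rh mu < rh kp}"

lemma below_sub: "below kp i <= Bi i" "finite (below kp i)"
 using Bi_fin unfolding below_def by auto

definition unip_vec :: "('k => 'k => complex) => 'v => 'k => 'm" where
 "unip_vec x i kp = e kp i + (SUM mu:below kp i. x kp mu *\<^sub>C e mu i)"

definition unip :: "('k => 'k => complex) => 'v => 'm => 'm" where
 "unip x = (\<lambda>i\<in>verts Q. \<lambda>y\<in>rep_space M i. SUM kp:Bi i. cf i y kp *\<^sub>C unip_vec x i kp)"

lemma unip_vec_in: "i : verts Q ==> kp : B ==> unip_vec x i kp : rep_space M i"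
 unfolding unip_vec_def
 by (intro cvec.subspace_add[OF rep_subspace[OF repM]] e_in comb_in) (auto simp: below_def Bi_def)

lemma cf_unip_vec:
 assumes i: "i : verts Q" and kp: "kp : Bi i"
 shows "cf i (unip_vec x i kp) mu = (if mu = kp then 1 else if mu : below kp i then x kp mu else 0)"
proof -
 have "kp ~: below kp i" unfolding below_def by simp
 moreover have "(SUM mu:below kp i. x kp mu *\<^sub>C e mu i) : rep_space M i"
  using below_sub BiD(1) by (intro comb_in[OF i]) blast
 ultimately show ?thesis
  unfolding unip_vec_def
  using cf_add[OF i e_in[OF BiD(1)[OF kp] i]] cf_e[OF i kp] cf_comb[OF i below_sub(1), of "x kp" kp mu] by simp
qed

lemma unip_apply_e:
 assumes i: "i : verts Q" and kp: "kp : Bi i"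
 shows "unip x i (e kp i) = unip_vec x i kp"
proof -
 have "unip x i (e kp i) = (SUM mu:Bi i. (if mu = kp then 1 else 0) *\<^sub>C unip_vec x i mu)"
  unfolding unip_def using i e_in[OF BiD(1)[OF kp] i] cf_e[OF i kp] by simp
 also have "... = (SUM mu:Bi i. if mu = kp then unip_vec x i mu else 0)"
  by (intro sum.cong) (auto simp: scaleC_one)
 also have "... = unip_vec x i kp" using kp Bi_fin by simp
 finally show ?thesis .
qed

text \<open>The two order conditions enter here. By \<open>starts\<close>, every string below
  \<open>kp\<close> at the head is already present at the tail, so no term is missing. By
  \<open>ends\<close>, when \<open>kp\<close> ends, all strings below it that are present end as
  well, so the image is 0.\<close>

lemma map_unip_vec:
 assumes a: "a : arcs Q" and kp: "kp : Bi (tail Q a)"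
 shows "rep_map M a (unip_vec x (tail Q a) kp) = (if kp : Bi (head Q a) then unip_vec x (head Q a) kp else 0)"
proof -
 note t = tail_in_verts[OF a] and h = head_in_verts[OF a]
 let ?t = "tail Q a" and ?h = "head Q a"
 have s: "(SUM mu:below kp ?t. x kp mu *\<^sub>C e mu ?t) : rep_space M ?t"
  using below_sub BiD(1) by (intro comb_in[OF t]) blast
 have eq: "rep_map M a (unip_vec x ?t kp) = e kp ?h + (SUM mu:below kp ?t. x kp mu *\<^sub>C e mu ?h)"
  unfolding unip_vec_def
  using clinear_on_add[OF rep_map_clinear[OF repM a] e_in[OF BiD(1)[OF kp] t] s]
   e_map[OF a BiD[OF kp]] map_comb[OF a below_sub(1)] by simp
 show ?thesis
 proof (cases "kp : Bi ?h")
  case True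
  have "below kp ?h <= below kp ?t"
   using starts[OF a BiD(1)[OF kp] _ _ BiD(2)[OF kp] BiD(2)[OF True]] unfolding below_def Bi_def by auto
  then have "(SUM mu:below kp ?t. x kp mu *\<^sub>C e mu ?h) = (SUM mu:below kp ?h. x kp mu *\<^sub>C e mu ?h)"
   using below_sub(2) by (intro sum.mono_neutral_right) (auto simp: below_def Bi_def)
  then show ?thesis using eq True unfolding unip_vec_def by simp
 next
  case False
  then have k0: "e kp ?h = 0" using BiD(1)[OF kp] unfolding Bi_def by simp
  have "(SUM mu:below kp ?t. x kp mu *\<^sub>C e mu ?h) = 0"
   using ends[OF a BiD(1)[OF kp] _ _ BiD(2)[OF kp] k0] by (intro sum.neutral) (auto simp: below_def Bi_def)
  then show ?thesis using eq k0 False by simp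
 qed
qed

lemma unip_in: "i : verts Q ==> y : rep_space M i ==> unip x i y : rep_space M i"
 unfolding unip_def using unip_vec_in BiD(1)
 by (auto intro!: cvec.subspace_sum[OF rep_subspace[OF repM]] cvec.subspace_scale[OF rep_subspace[OF repM]])

text \<open>Only strings above \<open>mu\<close> could alter the coordinate at \<open>mu\<close>,
  and for the top coordinate of \<open>y\<close> these contribute nothing; this gives
  injectivity.\<close>

lemma cf_unip:
 assumes i: "i : verts Q" and y: "y : rep_space M i" and mu: "mu : Bi i"
  and top: "!!kp. kp : Bi i ==> rh mu < rh kp ==> cf i y kp = 0"
 shows "cf i (unip x i y) mu = cf i y mu"
proof -
 have "cf i (unip x i y) mu = (SUM kp:Bi i. cf i y kp * cf i (unip_vec x i kp) mu)"
  unfolding unip_def using i y cf_sum[OF i unip_vec_in[OF i BiD(1)]] by simp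
 also have "... = (SUM kp:Bi i. if kp = mu then cf i y kp else 0)"
 proof (intro sum.cong refl)
  fix kp assume kp: "kp : Bi i"
  show "cf i y kp * cf i (unip_vec x i kp) mu = (if kp = mu then cf i y kp else 0)"
   using top[OF kp] cf_unip_vec[OF i kp, of x mu] by (auto simp: below_def)
 qed
 also have "... = cf i y mu" using mu Bi_fin by simp
 finally show ?thesis .
qed

lemma exists_top:
 assumes "finite A" "A ~= {}"
 obtains mu where "mu : A" "!!kp. kp : A ==> rh kp <= rh mu"
proof -
 have "Max (rh ` A) : rh ` A" using assms by simp
 then obtain mu where "mu : A" "rh mu = Max (rh ` A)" by auto
 then show ?thesis using that assms by simp
qed

lemma unip_iso: "unip x : rep_iso Q M M"
proof -
 have lin: "clinear_on (rep_space M i) (%y. SUM kp:Bi i. cf i y kp *\<^sub>C unip_vec x i kp)" if "i : verts Q" for i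
 proof (rule clinear_on_sum_fun)
  fix kp
  show "clinear_on (rep_space M i) (%y. cf i y kp *\<^sub>C unip_vec x i kp)"
   using that by (intro clinear_onI) (simp_all add: cf_add cf_scale cvec.scale_left_distrib)
 qed
 have H: "unip x : rep_Hom Q M M"
  unfolding unip_def
 proof (rule rep_HomI[OF _ lin _ wf repM])
  fix i y assume "i : verts Q" "y : rep_space M i"
  then show "(SUM kp:Bi i. cf i y kp *\<^sub>C unip_vec x i kp) : rep_space M i"
   using unip_in[of i y x] unfolding unip_def by simp
 next
  fix a y assume a: "a : arcs Q" and y: "y : rep_space M (tail Q a)"
  let ?t = "tail Q a" and ?h = "head Q a"
  note t = tail_in_verts[OF a] and h = head_in_verts[OF a]
  have "(SUM kp:Bi ?h. cf ?h (rep_map M a y) kp *\<^sub>C unip_vec x ?h kp) =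
    (SUM kp:Bi ?h. cf ?t y kp *\<^sub>C unip_vec x ?h kp)"
   using cf_map[OF a y] by (intro sum.cong) auto
  also have "... = (SUM kp:Bi ?t Int Bi ?h. cf ?t y kp *\<^sub>C unip_vec x ?h kp)"
   using cf_spec(2)[OF t y] Bi_fin by (intro sum.mono_neutral_right) auto
  also have "... = (SUM kp:Bi ?t. cf ?t y kp *\<^sub>C rep_map M a (unip_vec x ?t kp))"
   using map_unip_vec[OF a] Bi_fin by (intro sum.mono_neutral_cong_left) auto
  also have "... = (SUM kp:Bi ?t. rep_map M a (cf ?t y kp *\<^sub>C unip_vec x ?t kp))"
   using clinear_on_scale[OF rep_map_clinear[OF repM a] unip_vec_in[OF t BiD(1)]] by (intro sum.cong) auto
  also have "... = rep_map M a (SUM kp:Bi ?t. cf ?t y kp *\<^sub>C unip_vec x ?t kp)"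
   using unip_vec_in[OF t BiD(1)] cvec.subspace_scale[OF rep_subspace[OF repM t]]
   by (intro clinear_on_sum[OF rep_map_clinear[OF repM a] rep_subspace[OF repM t], symmetric]) auto
  finally show "(SUM kp:Bi ?h. cf ?h (rep_map M a y) kp *\<^sub>C unip_vec x ?h kp) =
   rep_map M a (SUM kp:Bi ?t. cf ?t y kp *\<^sub>C unip_vec x ?t kp)" .
 qed
 show ?thesis
 proof (rule rep_isoI[OF H])
  fix i assume i: "i : verts Q"
  have "inj_on (unip x i) (rep_space M i)"
   unfolding clinear_on_inj_iff[OF rep_HomD(2)[OF H i] rep_subspace[OF repM i]]
  proof (intro ballI impI, rule ccontr)
   fix y assume y: "y : rep_space M i" "unip x i y = 0" "y ~= 0"
   let ?S = "{kp : Bi i. cf i y kp ~= 0}"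
   have "?S ~= {}"
   proof
    assume "?S = {}"
    then have "cf i y kp = cf i 0 kp" if "kp : Bi i" for kp using that cf_zero[OF i] by auto
    then show False using y cf_eqI[OF i y(1) cvec.subspace_0[OF rep_subspace[OF repM i]]] by blast
   qed
   moreover have "finite ?S" using Bi_fin[of i] by simp
   ultimately obtain mu where mu: "mu : ?S" "!!kp. kp : ?S ==> rh kp <= rh mu"
    using exists_top[of ?S] by blast
   have "cf i (unip x i y) mu = cf i y mu"
    using mu by (intro cf_unip[OF i y(1)]) force+
   then show False using mu(1) y(2) cf_zero[OF i] by simp
  qed
  then show "bij_betw (unip x i) (rep_space M i) (rep_space M i)"
   using unip_in[OF i] by (intro clinear_on_inj_imp_bij[OF rep_fin_dim[OF repM i] rep_fin_dim[OF repM i] rep_HomD(2)[OF H i]]) auto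
 qed
qed

section \<open>Leading terms, pivots and coordinate subrepresentations\<close>

definition leads :: "'v => 'k => 'm => bool" where
 "leads i kp x \<longleftrightarrow> x : rep_space M i & cf i x kp ~= 0 & (ALL mu:Bi i. rh kp < rh mu --> cf i x mu = 0)"

lemma triangular_zero:
 assumes i: "i : verts Q" and A: "A <= Bi i" and v: "!!kp. kp : A ==> leads i kp (v kp)"
  and s: "(SUM kp:A. c kp *\<^sub>C v kp) = 0"
 shows "ALL kp:A. c kp = 0"
proof (rule ccontr)
 assume "~ ?thesis"
 then have ne: "{kp : A. c kp ~= 0} ~= {}" by blast
 have fA: "finite A" using A Bi_fin finite_subset by blast
 then have fin: "finite {kp : A. c kp ~= 0}" by simp
 obtain mu where mu: "mu : {kp : A. c kp ~= 0}" "!!kp. kp : {kp : A. c kp ~= 0} ==> rh kp <= rh mu"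
  by (rule exists_top[OF fin ne]) (rule that)
 have "0 = (SUM kp:A. c kp * cf i (v kp) mu)"
  using s cf_sum[OF i, of A v c mu] v cf_zero[OF i] unfolding leads_def by simp
 also have "... = (SUM kp:A. if kp = mu then c mu * cf i (v mu) mu else 0)"
 proof (intro sum.cong refl)
  fix kp assume kp: "kp : A"
  show "c kp * cf i (v kp) mu = (if kp = mu then c mu * cf i (v mu) mu else 0)"
  proof (cases "kp = mu | c kp = 0")
   case False
   then have "rh kp <= rh mu" using mu(2) kp by blast
   moreover have "rh kp ~= rh mu"
    using inj_onD[OF rh, of kp mu] False kp mu(1) A BiD(1) by blast
   ultimately have "cf i (v kp) mu = 0" using v[OF kp] mu(1) A unfolding leads_def by auto
   then show ?thesis using False by simp
  qed auto
 qed
 also have "... = c mu * cf i (v mu) mu" using mu(1) fA by simp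
 finally show False using mu(1) v unfolding leads_def by auto
qed

lemma triangular_independent:
 assumes i: "i : verts Q" and A: "A <= Bi i" and v: "!!kp. kp : A ==> leads i kp (v kp)"
 shows "inj_on v A" "cvec.independent (v ` A)" "cvec.dim (cvec.span (v ` A)) = card A"
proof -
 have fA: "finite A" using A Bi_fin finite_subset by blast
 show inj: "inj_on v A" and ind: "cvec.independent (v ` A)"
  using family_independent[OF fA, of v] triangular_zero[OF i A v] by blast+
 show "cvec.dim (cvec.span (v ` A)) = card A"
  using cvec.dim_span_eq_card_independent[OF ind] card_image[OF inj] by simp
qed

definition pivots :: "('v => 'm set) => 'v => 'k set" where
 "pivots N i = {kp : Bi i. EX x:N i. cf i x kp = 1 & (ALL mu:Bi i. rh kp < rh mu --> cf i x mu = 0)}"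

text \<open>Elimination by induction on a strict bound \<open>k\<close> for the ranks in the
  support: if the top rank is attained at \<open>mu\<close>, scaling shows that \<open>mu\<close> is
  a pivot, and subtracting a multiple of \<open>v mu\<close> lowers the bound.\<close>

lemma pivots_span:
 assumes i: "i : verts Q" and N: "cvec.subspace (N i)" "N i <= rep_space M i"
  and v: "!!kp. kp : pivots N i ==> leads i kp (v kp)" "!!kp. kp : pivots N i ==> v kp : N i"
 shows "N i = cvec.span (v ` pivots N i)"
proof
 let ?S = "cvec.span (v ` pivots N i)"
 show "?S <= N i" using v(2) by (intro cvec.span_minimal[OF _ N(1)]) auto
 have *: "y : ?S" if "y : N i" "ALL mu:Bi i. cf i y mu ~= 0 --> rh mu < k" for y k
  using that
 proof (induction k arbitrary: y)
  case 0
  then have "cf i y kp = cf i 0 kp" if "kp : Bi i" for kp using that cf_zero[OF i] by auto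
  then have "y = 0" using cf_eqI[OF i] 0(1) N(2) cvec.subspace_0[OF rep_subspace[OF repM i]] by blast
  then show ?case by (simp add: cvec.span_zero)
 next
  case (Suc k)
  show ?case
  proof (cases "EX mu:Bi i. cf i y mu ~= 0 & rh mu = k")
   case False
   then have "ALL mu:Bi i. cf i y mu ~= 0 --> rh mu < k" using Suc.prems(2) by (auto simp: less_Suc_eq)
   then show ?thesis using Suc.IH Suc.prems(1) by blast
  next
   case True
   then obtain mu where mu: "mu : Bi i" "cf i y mu ~= 0" "rh mu = k" by blast
   have yM: "y : rep_space M i" using Suc.prems(1) N(2) by blast
   have hi: "cf i y nu = 0" if "nu : Bi i" "rh mu < rh nu" for nu using Suc.prems(2) that mu(3) by force
   let ?y = "(1 / cf i y mu) *\<^sub>C y"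
   have "?y : N i" using cvec.subspace_scale[OF N(1) Suc.prems(1)] .
   moreover have "cf i ?y mu = 1" using cf_scale[OF i yM] mu(2) by simp
   moreover have "ALL nu:Bi i. rh mu < rh nu --> cf i ?y nu = 0" using cf_scale[OF i yM] hi by simp
   ultimately have piv: "mu : pivots N i" unfolding pivots_def using mu(1) by blast
   have lv: "v mu : rep_space M i" "cf i (v mu) mu ~= 0" "!!nu. nu : Bi i ==> rh mu < rh nu ==> cf i (v mu) nu = 0"
    using v(1)[OF piv] unfolding leads_def by auto
   let ?c = "- (cf i y mu / cf i (v mu) mu)"
   let ?z = "y + ?c *\<^sub>C v mu"
   have cM: "?c *\<^sub>C v mu : rep_space M i" using cvec.subspace_scale[OF rep_subspace[OF repM i] lv(1)] .
   have cfz: "cf i ?z nu = cf i y nu + ?c * cf i (v mu) nu" for nu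
    using cf_add[OF i yM cM] cf_scale[OF i lv(1), of ?c] by simp
   have "?z : N i" using cvec.subspace_add[OF N(1) Suc.prems(1) cvec.subspace_scale[OF N(1) v(2)[OF piv]]] .
   moreover have "rh nu < k" if nu: "nu : Bi i" "cf i ?z nu ~= 0" for nu
   proof (rule ccontr)
    assume "~ rh nu < k"
    then consider "rh nu = k" | "rh mu < rh nu" using mu(3) by force
    then show False
    proof cases
     case 1
     then have "nu = mu" using inj_onD[OF rh, of nu mu] mu nu(1) BiD(1) by simp
     then show False using nu(2) cfz[of mu] lv(2) by simp
    next
     case 2
     then show False using nu cfz[of nu] hi lv(3) by simp
    qed
   qed
   ultimately have "?z : ?S" using Suc.IH[of ?z] by blast
   moreover have "?c *\<^sub>C v mu : ?S" using piv by (intro cvec.span_scale cvec.span_base) auto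
   ultimately have "?z - ?c *\<^sub>C v mu : ?S" by (rule cvec.span_diff)
   then show ?thesis by simp
  qed
 qed
 show "N i <= ?S"
 proof
  fix y assume y: "y : N i"
  have "rh mu < Suc (Max (rh ` B))" if "mu : Bi i" for mu using that finB BiD(1) by (simp add: le_imp_less_Suc)
  then show "y : ?S" using *[OF y] by blast
 qed
qed

text \<open>The second condition says that the spans of the chosen basis vectors are stable under
  the arcs.\<close>

definition coord_family :: "('v => 'k set) => bool" where
 "coord_family A \<longleftrightarrow> (ALL i:verts Q. A i <= Bi i) &
  (ALL a:arcs Q. A (tail Q a) Int Bi (head Q a) <= A (head Q a))"

definition coord :: "('v => 'k set) => 'v => 'm set" where
 "coord A = (\<lambda>i\<in>verts Q. cvec.span ((%kp. e kp i) ` A i))"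

lemma coord_familyD:
 assumes "coord_family A"
 shows "i : verts Q ==> A i <= Bi i" "a : arcs Q ==> kp : A (tail Q a) ==> kp : Bi (head Q a) ==> kp : A (head Q a)"
 using assms unfolding coord_family_def by blast+

lemma leads_e: "i : verts Q ==> kp : Bi i ==> leads i kp (e kp i)"
 unfolding leads_def using cf_e e_in BiD(1) by auto

lemma leads_unip_vec: "i : verts Q ==> kp : Bi i ==> leads i kp (unip_vec x i kp)"
 unfolding leads_def using cf_unip_vec[of i kp x] unip_vec_in[of i kp x] BiD(1) by (auto simp: below_def)

lemma coord_mem_iff:
 fixes A :: "'v => 'k set"
 assumes i: "i : verts Q" and A: "A i <= Bi i"
 shows "y : coord A i \<longleftrightarrow> y : rep_space M i & (ALL mu. mu ~: A i --> cf i y mu = 0)"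
proof
 have AB: "A i <= B" using A BiD(1) by blast
 have fA: "finite (A i)" using A Bi_fin finite_subset by blast
 have inj: "inj_on (%kp. e kp i) (A i)"
  by (rule triangular_independent(1)[OF i A leads_e[OF i]]) (use A in auto)
 assume "y : coord A i"
 then obtain f where "y = (SUM v:(%kp. e kp i) ` A i. f v *\<^sub>C v)"
  using i fA cvec.span_finite[of "(%kp. e kp i) ` A i"] unfolding coord_def by auto
 then have y: "y = (SUM kp:A i. f (e kp i) *\<^sub>C e kp i)" by (simp add: sum.reindex[OF inj])
 then show "y : rep_space M i & (ALL mu. mu ~: A i --> cf i y mu = 0)"
  using comb_in[OF i AB] cf_comb[OF i A] by simp
next
 assume y: "y : rep_space M i & (ALL mu. mu ~: A i --> cf i y mu = 0)"
 then have "y = (SUM kp:Bi i. cf i y kp *\<^sub>C e kp i)" using cf_spec(1)[OF i] by blast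
 also have "... = (SUM kp:A i. cf i y kp *\<^sub>C e kp i)"
  using y A Bi_fin by (intro sum.mono_neutral_right) auto
 also have "... : coord A i"
  unfolding coord_def using i
  by (simp, intro cvec.span_sum cvec.span_scale cvec.span_base) blast
 finally show "y : coord A i" .
qed

lemma coord_subrep:
 assumes A: "coord_family A"
 shows "is_subrep Q M (coord A)"
proof (rule is_subrepI)
 show "coord A : extensional (verts Q)" unfolding coord_def by simp
 show "cvec.subspace (coord A i)" if "i : verts Q" for i using that unfolding coord_def by simp
 show "coord A i <= rep_space M i" if "i : verts Q" for i
  using coord_mem_iff[where A=A, OF that coord_familyD(1)[OF A that]] by blast
 fix a x assume a: "a : arcs Q" and x: "x : coord A (tail Q a)"
 note t = tail_in_verts[OF a] and h = head_in_verts[OF a]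
 have x': "x : rep_space M (tail Q a)" "!!mu. mu ~: A (tail Q a) ==> cf (tail Q a) x mu = 0"
  using x coord_mem_iff[where A=A, OF t coord_familyD(1)[OF A t]] by auto
 show "rep_map M a x : coord A (head Q a)"
  unfolding coord_mem_iff[where A=A, OF h coord_familyD(1)[OF A h]]
  using rep_map_in[OF repM a x'(1)] cf_map[OF a x'(1)] x'(2) coord_familyD(2)[OF A a] by auto
qed

lemma coord_dim:
 assumes A: "coord_family A" and i: "i : verts Q"
 shows "cvec.dim (coord A i) = card (A i)"
 using triangular_independent(3)[OF i coord_familyD(1)[OF A i], of "%kp. e kp i"] leads_e[OF i]
  coord_familyD(1)[OF A i] i unfolding coord_def by auto

lemma unip_coord:
 assumes A: "coord_family A" and i: "i : verts Q"
 shows "unip x i ` coord A i = cvec.span (unip_vec x i ` A i)"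
proof -
 note AB = coord_familyD(1)[OF A i]
 have "cvec.span ((%kp. e kp i) ` A i) <= rep_space M i" using is_subrepD(3)[OF coord_subrep[OF A] i] i unfolding coord_def by simp
 then have "clinear_on (cvec.span ((%kp. e kp i) ` A i)) (unip x i)"
  by (rule clinear_on_subset[OF rep_HomD(2)[OF rep_iso_Hom[OF unip_iso] i]])
 then have "unip x i ` coord A i = cvec.span (unip x i ` (%kp. e kp i) ` A i)"
  using clinear_on_image_span i unfolding coord_def by simp
 also have "unip x i ` (%kp. e kp i) ` A i = unip_vec x i ` A i"
  unfolding image_image using unip_apply_e[OF i] AB by (intro image_cong) auto
 finally show ?thesis .
qed

text \<open>The support of a string is an interval, so it can be followed arc by arc, and each arc
  sends the modified basis vector to the next one.\<close>

lemma unip_vec_propagates: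
 assumes N: "is_subrep Q M N" and kp: "kp : B" and s: "s : verts Q" "unip_vec x s kp : N s" "e kp s ~= 0"
  and i: "i : verts Q" "pos s <= pos i" "e kp i ~= 0"
 shows "unip_vec x i kp : N i"
 using i
proof (induction i rule: vertex_induct)
 case (step i)
 show ?case
 proof (cases "pos s = pos i")
  case True
  then show ?thesis using pos_eq_iff[OF s(1) step(1)] s(2) by simp
 next
  case False
  then have "1 <= pos i - 1" "pos i - 1 <= n" "pos i = (pos i - 1) + 1"
   using step(3) pos_range[OF s(1)] pos_range[OF step(1)] by auto
  then obtain t where t: "t : verts Q" "pos i = pos t + 1" using vertex_at[of "pos i - 1"] by force
  obtain a where a: "a : arcs Q" "tail Q a = t" "head Q a = i" by (rule arc_between[OF t(1) step(1) t(2)])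
  have et: "e kp t ~= 0"
   using convex[OF kp s(1) t(1) step(1) s(3) step(4)] False step(3) t(2) by simp
  have "unip_vec x t kp : N t"
   using step(2)[of a] a et False step(3) t(2) by (simp add: in_arcs_def)
  then have "rep_map M a (unip_vec x t kp) : N i" using is_subrepD(4)[OF N a(1)] a by simp
  then show ?thesis
   using map_unip_vec[OF a(1), of kp x] a kp et step(4) unfolding Bi_def by simp
 qed
qed

text \<open>Once chosen, a string stays chosen until it ends; so for a given family of pivots the
  free data belonging to \<open>kp\<close> sit at this first vertex.\<close>

definition start :: "('v => 'k set) => 'k => 'v" where
 "start A kp = (SOME s. s : verts Q & kp : A s & (ALL i:verts Q. kp : A i --> pos s <= pos i))"

lemma start:
 assumes "i : verts Q" "kp : A i"
 shows "start A kp : verts Q" "kp : A (start A kp)" "pos (start A kp) <= pos i"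
proof -
 let ?P = "%s. s : verts Q & kp : A s"
 have "EX s. ?P s & (ALL j. ?P j --> pos s <= pos j)"
  using ex_has_least_nat[of ?P i pos] assms by blast
 then have "EX s. s : verts Q & kp : A s & (ALL i:verts Q. kp : A i --> pos s <= pos i)" by blast
 from someI_ex[OF this] show "start A kp : verts Q" "kp : A (start A kp)" "pos (start A kp) <= pos i"
  using assms unfolding start_def by auto
qed

text \<open>Membership at the first vertex of each chosen string propagates along it, and then
  equality follows by dimension.\<close>

lemma unip_coord_eqI:
 assumes N: "is_subrep Q M N" and A: "coord_family A" and d: "!!i. i : verts Q ==> cvec.dim (N i) = card (A i)"
  and v: "!!i kp. i : verts Q ==> kp : A i ==> unip_vec x (start A kp) kp : N (start A kp)"
  and i: "i : verts Q"
 shows "N i = unip x i ` coord A i"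
proof -
 note AB = coord_familyD(1)[OF A]
 have "unip_vec x i kp : N i" if kp: "kp : A i" for kp
 proof (rule unip_vec_propagates[where s="start A kp", OF N])
  note st = start[where A=A, OF i kp]
  show "kp : B" "e kp i ~= 0" using AB[OF i] kp BiD by auto
  show "e kp (start A kp) ~= 0" using AB[OF st(1)] st(2) BiD(2) by blast
  show "unip_vec x (start A kp) kp : N (start A kp)" by (rule v[OF i kp])
 qed (use start[where A=A, OF i kp] i in auto)
 then have sub: "cvec.span (unip_vec x i ` A i) <= N i"
  by (intro cvec.span_minimal is_subrepD(2)[OF N i]) auto
 have dim: "cvec.dim (cvec.span (unip_vec x i ` A i)) = card (A i)"
  by (rule triangular_independent(3)[OF i AB[OF i] leads_unip_vec[OF i]]) (use AB[OF i] in auto)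
 have "cvec.span (unip_vec x i ` A i) = N i"
  by (rule cvec_dim_eq_imp_eq[OF fin_dim_subspace_subset[OF rep_fin_dim[OF repM i] is_subrepD(2,3)[OF N i]] _ sub])
   (use dim d[OF i] in auto)
 then show ?thesis using unip_coord[OF A i] by simp
qed

text \<open>Arcs copy coordinates, so the image of a vector with leading index \<open>kp\<close> has
  the same leading index whenever the string continues; strings new at the head contribute
  coordinate 0.\<close>

lemma pivots_coord_family:
 assumes N: "is_subrep Q M N"
 shows "coord_family (pivots N)"
 unfolding coord_family_def
proof (intro conjI ballI subsetI)
 fix i kp assume "kp : pivots N i"
 then show "kp : Bi i" unfolding pivots_def by simp
next
 fix a kp assume a: "a : arcs Q" and kp: "kp : pivots N (tail Q a) Int Bi (head Q a)"
 note t = tail_in_verts[OF a]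
 obtain x where x: "x : N (tail Q a)" "cf (tail Q a) x kp = 1"
  "ALL mu:Bi (tail Q a). rh kp < rh mu --> cf (tail Q a) x mu = 0" using kp unfolding pivots_def by blast
 have xM: "x : rep_space M (tail Q a)" using x(1) is_subrepD(3)[OF N t] by blast
 have "rep_map M a x : N (head Q a)" by (rule is_subrepD(4)[OF N a x(1)])
 moreover have "cf (head Q a) (rep_map M a x) kp = 1" using cf_map[OF a xM] kp x(2) by simp
 moreover have "cf (head Q a) (rep_map M a x) mu = 0" if "mu : Bi (head Q a)" "rh kp < rh mu" for mu
  using cf_map[OF a xM, of mu] that x(3) cf_spec(2)[OF t xM, of mu] by (cases "mu : Bi (tail Q a)") auto
 ultimately show "kp : pivots N (head Q a)" using kp unfolding pivots_def by blast
qed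

lemma pivots_card:
 assumes N: "is_subrep Q M N" and i: "i : verts Q"
 shows "cvec.dim (N i) = card (pivots N i)"
proof -
 have "ALL kp:pivots N i. EX x. x : N i & leads i kp x"
 proof
  fix kp assume "kp : pivots N i"
  then obtain x where x: "x : N i" "cf i x kp = 1" "ALL mu:Bi i. rh kp < rh mu --> cf i x mu = 0"
   unfolding pivots_def by blast
  have "x : rep_space M i" using x(1) is_subrepD(3)[OF N i] by blast
  then show "EX x. x : N i & leads i kp x" unfolding leads_def using x by (intro exI[of _ x]) simp
 qed
 from bchoice[OF this] obtain v where v: "ALL kp:pivots N i. v kp : N i & leads i kp (v kp)" by blast
 have "N i = cvec.span (v ` pivots N i)"
  by (rule pivots_span[where v=v and N=N, OF i is_subrepD(2,3)[OF N i]]) (use v in auto)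
 moreover have "cvec.dim (cvec.span (v ` pivots N i)) = card (pivots N i)"
  by (rule triangular_independent(3)[OF i]) (use v in \<open>auto simp: pivots_def\<close>)
 ultimately show ?thesis by simp
qed

text \<open>One matrix \<open>x\<close> works at all vertices, because each of its rows is read off
  where the pivot first appears and is then carried along by the arcs.\<close>

lemma subrep_eq_unip_coord:
 assumes N: "is_subrep Q M N"
 obtains x where "!!i. i : verts Q ==> N i = unip x i ` coord (pivots N) i"
proof -
 let ?A = "pivots N"
 note A = pivots_coord_family[OF N]
 have "ALL kp:{kp. EX i:verts Q. kp : ?A i}. EX v. v : N (start ?A kp) & cf (start ?A kp) v kp = 1 &
  (ALL mu:Bi (start ?A kp). rh kp < rh mu --> cf (start ?A kp) v mu = 0)"
 proof
  fix kp assume "kp : {kp. EX i:verts Q. kp : ?A i}"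
  then obtain i where "i : verts Q" "kp : ?A i" by blast
  then have "kp : ?A (start ?A kp)" by (rule start(2)[where A="?A"])
  then show "EX v. v : N (start ?A kp) & cf (start ?A kp) v kp = 1 &
   (ALL mu:Bi (start ?A kp). rh kp < rh mu --> cf (start ?A kp) v mu = 0)" unfolding pivots_def by blast
 qed
 from bchoice[OF this] obtain v where v0: "ALL kp:{kp. EX i:verts Q. kp : ?A i}. v kp : N (start ?A kp) &
  cf (start ?A kp) (v kp) kp = 1 & (ALL mu:Bi (start ?A kp). rh kp < rh mu --> cf (start ?A kp) (v kp) mu = 0)"
  by (rule exE)
 \<comment> \<open>The pivot entry of \<open>v kp\<close> is 1 and the entries above it vanish, so
   \<open>v kp\<close> is recovered as \<open>unip_vec\<close>.\<close>
 define x where "x kp mu = cf (start ?A kp) (v kp) mu" for kp mu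
 have "unip_vec x (start ?A kp) kp : N (start ?A kp)" if i: "i : verts Q" and kp: "kp : ?A i" for i kp
 proof -
  let ?s = "start ?A kp"
  note st = start[where A="?A", OF i kp]
  have v: "v kp : N ?s" "cf ?s (v kp) kp = 1" "!!mu. mu : Bi ?s ==> rh kp < rh mu ==> cf ?s (v kp) mu = 0"
   using v0 i kp by auto
  have vM: "v kp : rep_space M ?s" using v(1) is_subrepD(3)[OF N st(1)] by blast
  have kB: "kp : Bi ?s" using st(2) unfolding pivots_def by simp
  have "unip_vec x ?s kp = v kp"
  proof (rule cf_eqI[OF st(1) unip_vec_in[OF st(1) BiD(1)[OF kB]] vM])
   fix mu assume mu: "mu : Bi ?s"
   have "rh mu = rh kp ==> mu = kp" using inj_onD[OF rh, of mu kp] BiD(1)[OF mu] BiD(1)[OF kB] by simp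
   then have "rh mu < rh kp | mu = kp | rh kp < rh mu" by linarith
   then show "cf ?s (unip_vec x ?s kp) mu = cf ?s (v kp) mu"
    using cf_unip_vec[OF st(1) kB, of x mu] v(2) v(3)[OF mu] mu unfolding below_def x_def by auto
  qed
  then show ?thesis using v(1) by simp
 qed
 then show ?thesis
  using that[of x] unip_coord_eqI[OF N A pivots_card[OF N]] by blast
qed

end

subsection \<open>Recognizing cells\<close>

lemma poly_algebra_sum:
 "(!!k. k : K ==> f k : poly_algebra L) ==> (%x. SUM k:K. f k x) : poly_algebra L"
 by (induction K rule: infinite_finite_induct) (auto intro: poly_algebra.intros)

lemma poly_algebra_prod:
 "(!!k. k : K ==> f k : poly_algebra L) ==> (%x. PROD k:K. f k x) : poly_algebra L"
 by (induction K rule: infinite_finite_induct) (auto intro: poly_algebra.intros)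

lemma poly_algebra_power: "f : poly_algebra L ==> (%x. f x ^ k) : poly_algebra L"
 by (induction k) (auto intro: poly_algebra.intros)

lemma topspace_zariski: "topspace (zariski_topology X L) = X"
proof
 have "openin (zariski_topology X L) X"
  unfolding openin_zariski_topology
  by (rule exI[of _ "{%x. 1}"]) (auto intro: poly_algebra.const)
 then show "X <= topspace (zariski_topology X L)" by (rule openin_subset)
 show "topspace (zariski_topology X L) <= X"
  using openin_topspace[of "zariski_topology X L"] unfolding openin_zariski_topology by blast
qed

text \<open>
 \<open>Z\<close> is given by the equations \<open>E\<close> in the chart \<open>D ~= 0\<close>, on which the coordinates \<open>ps\<close> and the
 functions in \<open>E\<close> are quotients of polynomials by \<open>D\<close>; \<open>fr\<close> is a polynomial section over \<open>Z\<close>.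
\<close>

locale affine_chart =
 fixes X :: "'x set" and L :: "('x => complex) set" and pr :: "'x => 'y" and Gr Z :: "'y set" and m :: nat
  and fr :: "(nat => complex) => 'x" and ps :: "'y => nat => complex" and D :: "'x => complex"
  and E :: "('y => complex) set"
 assumes D: "D : poly_algebra L"
  and D_sat: "u : X ==> u' : X ==> pr u = pr u' ==> D u ~= 0 ==> D u' ~= 0"
  and fr_X: "y : {..<m} \<rightarrow>\<^sub>E UNIV ==> fr y : X"
  and fr_L: "l : L ==> (%y. l (fr y)) : poly_algebra {%x. x j | j. j < m}"
  and ps_ext: "ps N : {..<m} \<rightarrow>\<^sub>E UNIV"
  and ps_poly: "j < m ==> EX P:poly_algebra L. ALL u:X. D u ~= 0 --> ps (pr u) j * D u = P u"
  and fr_D: "y : {..<m} \<rightarrow>\<^sub>E UNIV ==> D (fr y) ~= 0"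
  and ps_fr: "y : {..<m} \<rightarrow>\<^sub>E UNIV ==> ps (pr (fr y)) = y"
  and E_poly: "h : E ==> EX P:poly_algebra L. ALL u:X. D u ~= 0 --> h (pr u) * D u = P u"
  and Z_image: "Z = (%y. pr (fr y)) ` ({..<m} \<rightarrow>\<^sub>E UNIV)"
  and Z_eq: "Z = {N : Gr. (EX u:X. pr u = N & D u ~= 0) & (ALL h:E. h N = 0)}"
begin

abbreviation "AA == {..<m} \<rightarrow>\<^sub>E (UNIV :: complex set)"

abbreviation "L' == {%x :: nat => complex. x j | j. j < m}"

abbreviation "T == zariski_topology X L"

abbreviation "quot == quotient_topology T pr"

abbreviation "GP == fquotient (zariski_space X L) pr"

definition ph :: "(nat => complex) => 'y" where "ph y = pr (fr y)"

definition Op :: "'y set" where "Op = {N. EX u:X. pr u = N & D u ~= 0}"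

text \<open>\<open>D\<close> is a function of frames only and does not descend to the quotient, so
  denominators are cleared on frames. Powers are allowed, which makes the class closed under sums
  and products.\<close>

definition cleared :: "('y => complex) => bool" where
 "cleared g \<longleftrightarrow> (EX P:poly_algebra L. EX k. ALL u:X. D u ~= 0 --> g (pr u) * D u ^ k = P u)"

lemma Op_iff: "u : X ==> pr u : Op \<longleftrightarrow> D u ~= 0"
 unfolding Op_def using D_sat by blast

lemma ftop_GP [simp]: "ftop GP = quot" "ftop (zariski_space X L) = T"
 unfolding fquotient_def zariski_space_def by simp_all

lemma open_quot_iff: "openin quot U \<longleftrightarrow> U <= pr ` X & openin T {u : X. pr u : U}"
 unfolding openin_quotient_topology topspace_zariski ..

text \<open>Openness is tested on frames. The extra factor \<open>D u\<close> makes the defining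
  polynomials vanish off the chart.\<close>

lemma open_cleared:
 assumes S: "!!g. g : S ==> cleared g"
 shows "openin quot {N : Op. EX g:S. g N ~= 0}"
proof -
 let ?V = "{N : Op. EX g:S. g N ~= 0}"
 let ?C = "{P : poly_algebra L. EX g:S. EX k. ALL u:X. D u ~= 0 --> g (pr u) * D u ^ k = P u}"
 let ?F = "(%P u. D u * P u) ` ?C"
 have "{u : X. pr u : ?V} = {u : X. EX p:?F. p u ~= 0}"
 proof (intro equalityI subsetI)
  fix u assume "u : {u : X. pr u : ?V}"
  then obtain g where u: "u : X" "D u ~= 0" and g: "g : S" "g (pr u) ~= 0" using Op_iff by blast
  obtain P k where P: "P : poly_algebra L" "ALL u:X. D u ~= 0 --> g (pr u) * D u ^ k = P u"
   using S[OF g(1)] unfolding cleared_def by blast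
  have "g (pr u) * D u ^ k = P u" using P(2) u by blast
  then have "D u * P u ~= 0" using u g(2) by auto
  moreover have "P : ?C" using P g(1) by (intro CollectI conjI bexI[of _ g] exI[of _ k]) auto
  ultimately show "u : {u : X. EX p:?F. p u ~= 0}" using u(1) by auto
 next
  fix u assume "u : {u : X. EX p:?F. p u ~= 0}"
  then obtain P where u: "u : X" and P: "P : ?C" "D u * P u ~= 0" by auto
  then obtain g k where g: "g : S" "ALL u:X. D u ~= 0 --> g (pr u) * D u ^ k = P u" by auto
  have Du: "D u ~= 0" "P u ~= 0" using P(2) by auto
  then have "g (pr u) * D u ^ k = P u" using g(2) u by blast
  then have "g (pr u) ~= 0" using Du by auto
  then show "u : {u : X. pr u : ?V}" using Op_iff[OF u] Du(1) u g(1) by auto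
 qed
 moreover have "?F <= poly_algebra L" using D by (auto intro: poly_algebra.mult)
 ultimately have "openin T {u : X. pr u : ?V}" unfolding openin_zariski_topology by blast
 then show ?thesis unfolding open_quot_iff Op_def by blast
qed

lemma cleared_const: "cleared (%_. c)"
 unfolding cleared_def by (rule bexI[of _ "%_. c"], rule exI[of _ 0]) (auto intro: poly_algebra.const)

lemma cleared_add:
 assumes "cleared f" "cleared g"
 shows "cleared (%N. f N + g N)"
proof -
 obtain P k where P: "P : poly_algebra L" "ALL u:X. D u ~= 0 --> f (pr u) * D u ^ k = P u"
  using assms(1) unfolding cleared_def by blast
 obtain R l where R: "R : poly_algebra L" "ALL u:X. D u ~= 0 --> g (pr u) * D u ^ l = R u"
  using assms(2) unfolding cleared_def by blast
 show ?thesis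
  unfolding cleared_def
 proof (intro bexI exI ballI impI)
  show "(%u. P u * D u ^ l + R u * D u ^ k) : poly_algebra L"
   by (intro poly_algebra.add poly_algebra.mult P R poly_algebra_power D)
  fix u assume u: "u : X" "D u ~= 0"
  have "P u = f (pr u) * D u ^ k" "R u = g (pr u) * D u ^ l" using P(2) R(2) u by simp_all
  then show "(f (pr u) + g (pr u)) * D u ^ (k + l) = P u * D u ^ l + R u * D u ^ k"
   by (simp add: power_add algebra_simps)
 qed
qed

lemma cleared_mult:
 assumes "cleared f" "cleared g"
 shows "cleared (%N. f N * g N)"
proof -
 obtain P k where P: "P : poly_algebra L" "ALL u:X. D u ~= 0 --> f (pr u) * D u ^ k = P u"
  using assms(1) unfolding cleared_def by blast
 obtain R l where R: "R : poly_algebra L" "ALL u:X. D u ~= 0 --> g (pr u) * D u ^ l = R u"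
  using assms(2) unfolding cleared_def by blast
 show ?thesis
  unfolding cleared_def
 proof (intro bexI exI ballI impI)
  show "(%u. P u * R u) : poly_algebra L" by (intro poly_algebra.mult P R)
  fix u assume u: "u : X" "D u ~= 0"
  have "P u = f (pr u) * D u ^ k" "R u = g (pr u) * D u ^ l" using P(2) R(2) u by simp_all
  then show "f (pr u) * g (pr u) * D u ^ (k + l) = P u * R u" by (simp add: power_add algebra_simps)
 qed
qed

lemma cleared_ps: "p : poly_algebra L' ==> cleared (%N. p (ps N))"
proof (induction rule: poly_algebra.induct)
 case (gen l)
 then obtain j where j: "l = (%x. x j)" "j < m" by blast
 obtain P where "P : poly_algebra L" "ALL u:X. D u ~= 0 --> ps (pr u) j * D u = P u" using ps_poly[OF j(2)] by blast
 then show ?case unfolding cleared_def j(1) by (intro bexI[of _ P] exI[of _ 1]) simp_all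
qed (auto intro: cleared_const cleared_add cleared_mult)

lemma cleared_E: "h : E ==> cleared h"
 using E_poly[of h] unfolding cleared_def by (metis power_one_right)

lemma pullback: "p : poly_algebra L ==> (%y. p (fr y)) : poly_algebra L'"
 by (induction rule: poly_algebra.induct) (auto intro: poly_algebra.intros fr_L)

lemma open_fr:
 assumes "openin T W"
 shows "openin (zariski_topology AA L') {y : AA. fr y : W}"
proof -
 obtain F where F: "F <= poly_algebra L" "W = {u : X. EX p:F. p u ~= 0}"
  using assms unfolding openin_zariski_topology by blast
 have "(%p y. p (fr y)) ` F <= poly_algebra L'" using F(1) pullback by blast
 moreover have "{y : AA. fr y : W} = {y : AA. EX p:(%p y. p (fr y)) ` F. p y ~= 0}"
  using F(2) fr_X by auto
 ultimately show ?thesis unfolding openin_zariski_topology by blast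
qed

lemma open_ph:
 assumes "openin quot U"
 shows "openin (zariski_topology AA L') {y : AA. ph y : U}"
proof -
 have "{y : AA. ph y : U} = {y : AA. fr y : {u : X. pr u : U}}" using fr_X unfolding ph_def by blast
 then show ?thesis using open_fr[of "{u : X. pr u : U}"] assms unfolding open_quot_iff by simp
qed

lemma ph_in: "y : AA ==> ph y : Z" "y : AA ==> ph y : Op"
 using Z_image fr_X fr_D unfolding ph_def Op_def by auto

lemma psph: "y : AA ==> ps (ph y) = y"
 unfolding ph_def by (rule ps_fr)

lemma phps: "N : Z ==> ph (ps N) = N"
 using Z_image psph unfolding ph_def by auto

lemma Z_sub: "Z <= Gr" "Z <= Op" "Op <= pr ` X"
 using Z_eq unfolding Op_def by blast+

lemma quot_topspace: "topspace quot = pr ` X"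
proof
 show "topspace quot <= pr ` X" using openin_topspace[of quot] unfolding open_quot_iff by blast
 have "{u : X. pr u : pr ` X} = X" by blast
 then have "openin quot (pr ` X)" unfolding open_quot_iff using openin_topspace[of T, unfolded topspace_zariski] by simp
 then show "pr ` X <= topspace quot" by (rule openin_subset)
qed

lemma open_ps:
 assumes "openin (zariski_topology AA L') W"
 obtains V where "openin quot V" "V <= Op" "V Int Z = {N : Z. ps N : W}"
proof -
 obtain F where F: "F <= poly_algebra L'" "W = {y : AA. EX p:F. p y ~= 0}"
  using assms unfolding openin_zariski_topology by blast
 let ?V = "{N : Op. EX g:(%p N. p (ps N)) ` F. g N ~= 0}"
 have "openin quot ?V" by (rule open_cleared) (use F(1) cleared_ps in blast)
 moreover have "?V Int Z = {N : Z. ps N : W}" unfolding F(2) using ps_ext Z_sub(2) by fastforce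
 ultimately show ?thesis using that[of ?V] by blast
qed

abbreviation "GV == fsubspace GP Gr"

abbreviation "CZ == fsubspace GV Z"

lemma ftop_GV: "ftop GV = subtopology quot Gr"
 unfolding fsubspace_def by simp

lemma ftop_CZ: "ftop CZ = subtopology quot Z"
 unfolding fsubspace_def using Z_sub(1) by (simp add: subtopology_subtopology Int_absorb1)

lemma topspace_CZ: "topspace (ftop CZ) = Z"
 unfolding ftop_CZ topspace_subtopology quot_topspace using Z_sub by blast

lemma ftop_affine: "ftop (affine_space m) = zariski_topology AA L'"
 unfolding affine_space_def zariski_space_def by simp

lemma continuous_ph: "continuous_map (ftop (affine_space m)) (ftop CZ) ph"
 unfolding continuous_map topspace_CZ ftop_affine topspace_zariski
proof (intro conjI allI impI)
 show "ph ` AA <= Z" using ph_in by blast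
 fix U assume "openin (ftop CZ) U"
 then obtain V where V: "openin quot V" "U = V Int Z" unfolding ftop_CZ openin_subtopology by blast
 have "{y : AA. ph y : U} = {y : AA. ph y : V}" using V(2) ph_in by blast
 then show "openin (zariski_topology AA L') {y : AA. ph y : U}" using open_ph[OF V(1)] by simp
qed

lemma continuous_ps: "continuous_map (ftop CZ) (ftop (affine_space m)) ps"
 unfolding continuous_map topspace_CZ ftop_affine topspace_zariski
proof (intro conjI allI impI)
 show "ps ` Z <= AA" using ps_ext by blast
 fix W assume "openin (zariski_topology AA L') W"
 then obtain V where V: "openin quot V" "V <= Op" "V Int Z = {N : Z. ps N : W}" by (rule open_ps)
 then show "openin (ftop CZ) {N : Z. ps N : W}"
  unfolding ftop_CZ openin_subtopology by (intro exI[of _ V] conjI) simp_all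
qed

lemma homeomorphic_maps_phps: "homeomorphic_maps (ftop (affine_space m)) (ftop CZ) ph ps"
 unfolding homeomorphic_maps_def topspace_CZ
 using continuous_ph continuous_ps psph phps by (simp add: ftop_affine topspace_zariski)

lemma homeomorphic_ph: "homeomorphic_map (ftop (affine_space m)) (ftop CZ) ph"
 using homeomorphic_maps_phps homeomorphic_map_maps by blast

lemma fregular_GP: "fregular GP U g \<longleftrightarrow> openin quot U & fregular (zariski_space X L) {u : X. pr u : U} (%u. g (pr u))"
 unfolding fquotient_def by (simp add: zariski_space_def topspace_zariski comp_def)

lemma fregular_zariski: "fregular (zariski_space Y K) U f \<longleftrightarrow> openin (zariski_topology Y K) U &
    (ALL x:U. EX W p q. x : W & W <= U & openin (zariski_topology Y K) W &
     p : poly_algebra K & q : poly_algebra K & (ALL y:W. q y ~= 0 & f y = p y / q y))"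
 unfolding zariski_space_def by simp

lemma fregular_sub: "fregular (fsubspace Y S) W f \<longleftrightarrow> openin (subtopology (ftop Y) S) W &
    (ALL x:W. EX U g. x : U & openin (ftop Y) U & fregular Y U g & (ALL y:U Int W. f y = g y))"
 unfolding fsubspace_def by simp

lemma fregular_affine: "fregular (affine_space m) U f \<longleftrightarrow> fregular (zariski_space AA L') U f"
 unfolding affine_space_def ..

text \<open>Unwinding the two induced structures and the quotient gives a fraction of polynomials on
  frames near \<open>fr y\<close>; composition with the polynomial section \<open>fr\<close> turns
  it into a fraction in the coordinates.\<close>

lemma regular_pullback:
 assumes U: "openin (zariski_topology AA L') U" and reg: "fregular CZ (ph ` U) f"
 shows "fregular (affine_space m) U (f o ph)"
 unfolding fregular_affine fregular_zariski
proof (intro conjI ballI)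
 show "openin (zariski_topology AA L') U" by (rule U)
 have UA: "U <= AA" using openin_subset[OF U] topspace_zariski by metis
 fix y assume y: "y : U"
 then have "ph y : ph ` U" by blast
 then obtain U1 g1 where U1: "ph y : U1" "openin (ftop GV) U1" "fregular GV U1 g1" "ALL N:U1 Int ph ` U. f N = g1 N"
  using reg unfolding fregular_sub[of GV] by blast
 obtain U2 g2 where U2: "ph y : U2" "openin (ftop GP) U2" "fregular GP U2 g2" "ALL N:U2 Int U1. g1 N = g2 N"
  using U1(1,3) unfolding fregular_sub[of GP] by blast
 obtain U1' where U1': "openin quot U1'" "U1 = U1' Int Gr"
  using U1(2) unfolding ftop_GV openin_subtopology by blast
 have "fr y : {u : X. pr u : U2}" using U2(1) y UA fr_X unfolding ph_def by blast
 then obtain W p q where W: "fr y : W" "W <= {u : X. pr u : U2}" "openin T W"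
  "p : poly_algebra L" "q : poly_algebra L" "ALL u:W. q u ~= 0 & g2 (pr u) = p u / q u"
  using U2(3) unfolding fregular_GP fregular_zariski by blast
 let ?W = "U Int ({z : AA. fr z : W} Int {z : AA. ph z : U1'})"
 show "EX W p q. y : W & W <= U & openin (zariski_topology AA L') W &
   p : poly_algebra L' & q : poly_algebra L' & (ALL z:W. q z ~= 0 & (f o ph) z = p z / q z)"
 proof (rule exI[of _ ?W], rule exI[of _ "%z. p (fr z)"], rule exI[of _ "%z. q (fr z)"], intro conjI ballI)
  show "y : ?W" using y UA W(1) U1(1) U1'(2) by blast
  show "openin (zariski_topology AA L') ?W" by (intro openin_Int U open_fr W(3) open_ph U1'(1))
  fix z assume z: "z : ?W"
  then have zW: "fr z : W" by blast
  then show "q (fr z) ~= 0" using W(6) by blast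
  have "ph z : U1" using z U1'(2) ph_in(1) Z_sub(1) by blast
  moreover have "ph z : U2" using zW W(2) unfolding ph_def by blast
  ultimately have "f (ph z) = g2 (ph z)" using U1(4) U2(4) z by simp
  then show "(f o ph) z = p (fr z) / q (fr z)" using W(6) zW unfolding ph_def by simp
 qed (use pullback W(4,5) in auto)
qed

text \<open>A local fraction \<open>p / q\<close> in the coordinates becomes
  \<open>p (ps N) / q (ps N)\<close> on an open set of the ambient quotient, where it extends
  \<open>f\<close>; on frames both parts become polynomials after multiplication by powers of
  \<open>D\<close>.\<close>

lemma regular_extend:
 assumes U: "openin (zariski_topology AA L') U" and reg: "fregular (affine_space m) U (f o ph)"
 shows "fregular CZ (ph ` U) f"
 unfolding fregular_sub[of GV]
proof (intro conjI ballI)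
 have UA: "U <= AA" using openin_subset[OF U] topspace_zariski by metis
 have "openin (ftop CZ) (ph ` U)"
  using homeomorphic_map_openness_eq[OF homeomorphic_ph] U UA unfolding ftop_affine topspace_zariski by blast
 then show "openin (subtopology (ftop GV) Z) (ph ` U)"
  unfolding ftop_CZ ftop_GV using Z_sub(1) by (simp add: subtopology_subtopology Int_absorb1)
 fix N assume "N : ph ` U"
 then obtain y where y: "y : U" "N = ph y" by blast
 obtain W p q where W: "y : W" "W <= U" "openin (zariski_topology AA L') W"
  "p : poly_algebra L'" "q : poly_algebra L'" "ALL z:W. q z ~= 0 & (f o ph) z = p z / q z"
  using reg y(1) unfolding fregular_affine fregular_zariski by blast
 obtain V where V: "openin quot V" "V <= Op" "V Int Z = {N : Z. ps N : W}" by (rule open_ps[OF W(3)])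
 let ?q = "%N. q (ps N)" and ?p = "%N. p (ps N)"
 let ?V = "V Int {N : Op. EX g:{?q}. g N ~= 0}"
 have oV: "openin quot ?V" by (intro openin_Int V(1) open_cleared) (use cleared_ps[OF W(5)] in blast)
 let ?g = "%N. ?p N / ?q N"
 have yA: "y : AA" using y(1) UA by blast
 have NZ: "N : Z" using ph_in(1)[OF yA] y(2) by simp
 have psN: "ps N = y" using psph[OF yA] y(2) by simp
 have "N : V Int Z" unfolding V(3) using NZ psN W(1) by simp
 moreover have "q (ps N) ~= 0" using W(1,6) psN by simp
 ultimately have NV: "N : ?V" using V(2) by (intro IntI CollectI conjI bexI[of _ ?q]) auto
 have rGP: "fregular GP ?V ?g"
  unfolding fregular_GP fregular_zariski
 proof (intro conjI ballI)
  show "openin quot ?V" by (rule oV)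
  then show oT: "openin T {u : X. pr u : ?V}" unfolding open_quot_iff by blast
  obtain P k where P: "P : poly_algebra L" "ALL u:X. D u ~= 0 --> ?p (pr u) * D u ^ k = P u"
   using cleared_ps[OF W(4)] unfolding cleared_def by blast
  obtain R l where R: "R : poly_algebra L" "ALL u:X. D u ~= 0 --> ?q (pr u) * D u ^ l = R u"
   using cleared_ps[OF W(5)] unfolding cleared_def by blast
  fix u assume u: "u : {u : X. pr u : ?V}"
  \<comment> \<open>The exponents \<open>k\<close> and \<open>l\<close> may differ, so each
    polynomial is multiplied by the power of \<open>D\<close> belonging to the other.\<close>
  show "EX W p q. u : W & W <= {u : X. pr u : ?V} & openin T W &
    p : poly_algebra L & q : poly_algebra L & (ALL u:W. q u ~= 0 & ?g (pr u) = p u / q u)"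
  proof (rule exI[of _ "{u : X. pr u : ?V}"], rule exI[of _ "%u. P u * D u ^ l"],
    rule exI[of _ "%u. R u * D u ^ k"], intro conjI ballI)
   show "(%u. P u * D u ^ l) : poly_algebra L" "(%u. R u * D u ^ k) : poly_algebra L"
    by (intro poly_algebra.mult P(1) R(1) poly_algebra_power D)+
   fix v assume v: "v : {u : X. pr u : ?V}"
   then have v': "v : X" "D v ~= 0" "?q (pr v) ~= 0" using Op_iff[of v] by auto
   have PR: "P v = ?p (pr v) * D v ^ k" "R v = ?q (pr v) * D v ^ l" using P(2) R(2) v' by simp_all
   show "R v * D v ^ k ~= 0" using PR v' by simp
   show "?g (pr v) = P v * D v ^ l / (R v * D v ^ k)" unfolding PR using v' by (simp add: field_simps)
  qed (use u oT in auto)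
 qed
 have oG: "openin (ftop GV) (?V Int Gr)" unfolding ftop_GV openin_subtopology using oV by blast
 have rGV: "fregular GV (?V Int Gr) ?g"
  unfolding fregular_sub[of GP]
 proof (intro conjI ballI)
  show "openin (subtopology (ftop GP) Gr) (?V Int Gr)" using oG unfolding ftop_GV by simp
  fix N' assume "N' : ?V Int Gr"
  then show "EX U g. N' : U & openin (ftop GP) U & fregular GP U g & (ALL y:U Int (?V Int Gr). ?g y = g y)"
   using oV rGP by (intro exI[of _ ?V] exI[of _ ?g]) auto
 qed
 have agree: "f N' = ?g N'" if N': "N' : (?V Int Gr) Int ph ` U" for N'
 proof -
  obtain z where z: "z : U" "N' = ph z" using N' by blast
  have zA: "z : AA" using z(1) UA by blast
  have "N' : V Int Z" using IntD1[OF IntD1[OF IntD1[OF N']]] z(2) ph_in(1)[OF zA] by simp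
  then have "ps N' : W" using V(3) by blast
  then have "z : W" using psph[OF zA] z(2) by simp
  then show ?thesis using W(6) psph[OF zA] z(2) by simp
 qed
 show "EX U1 g. N : U1 & openin (ftop GV) U1 & fregular GV U1 g & (ALL y:U1 Int ph ` U. f y = g y)"
  using NV NZ Z_sub(1) oG rGV agree by (intro exI[of _ "?V Int Gr"] exI[of _ ?g]) auto
qed

theorem is_cell_chart: "is_cell GV Z"
 unfolding is_cell_def
proof
 have "openin (ftop GV) (Op Int Gr)"
 proof -
  have "openin quot {N : Op. EX g:{%_. 1 :: complex}. g N ~= 0}" by (rule open_cleared) (auto intro: cleared_const)
  then show ?thesis unfolding ftop_GV openin_subtopology by auto
 qed
 moreover have "closedin (ftop GV) (topspace (ftop GV) - {N : Op. EX g:E. g N ~= 0} Int Gr)"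
 proof (rule closedin_diff)
  show "openin (ftop GV) ({N : Op. EX g:E. g N ~= 0} Int Gr)"
   unfolding ftop_GV openin_subtopology using open_cleared[of E] cleared_E by blast
 qed simp
 moreover have "Z = (Op Int Gr) Int (topspace (ftop GV) - {N : Op. EX g:E. g N ~= 0} Int Gr)"
  unfolding ftop_GV topspace_subtopology quot_topspace using Z_eq Z_sub(3) unfolding Op_def by blast
 ultimately show "is_subvariety GV Z" unfolding is_subvariety_def by blast
 have "fspace_isomorphic (affine_space m) CZ"
  unfolding fspace_isomorphic_def
  using homeomorphic_ph regular_pullback regular_extend unfolding ftop_affine by blast
 then show "EX m. fspace_isomorphic (affine_space m) (fsubspace GV Z)" by blast
qed

end

subsection \<open>Cells of triangular groups\<close>

lemma poly_algebra_det:
 assumes "!!r c. r < n ==> c < n ==> (%x. f x r c) : poly_algebra L"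
 shows "(%x. Determinant.det (Matrix.mat n n (%(r, c). f x r c))) : poly_algebra L"
proof -
 have "Determinant.det (Matrix.mat n n (%(r, c). f x r c)) =
   (SUM p:{p. p permutes {0..<n}}. signof p * (PROD i:{0..<n}. f x i (p i)))" for x
 proof (subst det_def'[of _ n], simp, intro sum.cong refl arg_cong2[of _ _ _ _ "(*)"] prod.cong)
  fix p i assume "p : {p. p permutes {0..<n}}" "i : {0..<n}"
  then have "p i < n" using permutes_in_image[of p "{0..<n}" i] by simp
  then show "Matrix.mat n n (%(r, c). f x r c) $$ (i, p i) = f x i (p i)" using \<open>i : {0..<n}\<close> by simp
 qed
 moreover have "p i < n" if "p : {p. p permutes {0..<n}}" "i : {0..<n}" for p i
  using that permutes_in_image[of p "{0..<n}" i] by simp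
 ultimately show ?thesis
  using assms by (auto intro!: poly_algebra_sum poly_algebra.mult poly_algebra_prod poly_algebra.const)
qed

lemma poly_algebra_adj_mat:
 assumes f: "!!r c. r < n ==> c < n ==> (%x. f x r c) : poly_algebra L" and rc: "r < n" "c < n"
 shows "(%x. adj_mat (Matrix.mat n n (%(r, c). f x r c)) $$ (r, c)) : poly_algebra L"
proof -
 let ?s = "%k j. if j < k then j else Suc j"
 have "mat_delete (Matrix.mat n n (%(r, c). f x r c)) c r = Matrix.mat (n - 1) (n - 1) (%(i, j). f x (?s c i) (?s r j))" for x
  unfolding mat_delete_def by (intro eq_matI) auto
 then have "(%x. adj_mat (Matrix.mat n n (%(r, c). f x r c)) $$ (r, c)) =
   (%x. (-1) ^ (c + r) * Determinant.det (Matrix.mat (n - 1) (n - 1) (%(i, j). f x (?s c i) (?s r j))))"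
  using rc by (simp add: adj_mat_def cofactor_def)
 also have "... : poly_algebra L"
  by (intro poly_algebra.mult poly_algebra.const poly_algebra_det f) auto
 finally show ?thesis .
qed

lemma index_mult_mat_sum:
 "A : carrier_mat n n ==> C : carrier_mat n n ==> s < n ==> r < n ==>
  (A * C) $$ (s, r) = (\<Sum>k<n. A $$ (s, k) * C $$ (k, r))"
 by (auto simp: scalar_prod_def atLeast0LessThan intro!: sum.cong)

context string_basis
begin

text \<open>The order \<open>rh\<close> does not enter: for a subspace of dimension
  \<open>card A\<close>, having such a vector for every \<open>kp\<close> in \<open>A\<close> means
  lying in the standard chart of the Grassmannian around the coordinate subspace of
  \<open>A\<close>.\<close>

definition reduced :: "'v => 'k set => 'k => 'm => bool" where
 "reduced i A kp w \<longleftrightarrow> w : rep_space M i & (ALL nu:A. cf i w nu = (if nu = kp then 1 else 0))"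

text \<open>Back substitution: the normalised leading vector is corrected by the reduced vectors of
  the lower pivots, which leaves all coordinates above \<open>kp\<close> equal to 0.\<close>

lemma triangular_reduced:
 assumes i: "i : verts Q" and A: "A <= Bi i" and N: "cvec.subspace N"
  and v: "!!kp. kp : A ==> leads i kp (v kp)" "!!kp. kp : A ==> v kp : N"
 shows "kp : A ==> EX w:N. reduced i A kp w & (ALL mu. rh kp < rh mu --> cf i w mu = 0)"
proof (induction "rh kp" arbitrary: kp rule: less_induct)
 case less
 let ?A = "{nu : A. rh nu < rh kp}"
 have "ALL nu:?A. EX w. w : N & reduced i A nu w & (ALL mu. rh nu < rh mu --> cf i w mu = 0)"
  using less(1) by auto
 from bchoice[OF this] obtain w where w: "ALL nu:?A. w nu : N & reduced i A nu (w nu) & (ALL mu. rh nu < rh mu --> cf i (w nu) mu = 0)"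
  by (rule exE)
 have wM: "!!nu. nu : ?A ==> w nu : rep_space M i" using w unfolding reduced_def by blast
 note vk = v(1)[OF less(2), unfolded leads_def]
 let ?c = "1 / cf i (v kp) kp"
 let ?s = "SUM nu:?A. (- (?c * cf i (v kp) nu)) *\<^sub>C w nu"
 let ?w = "?c *\<^sub>C v kp + ?s"
 have fA: "finite ?A" using finite_subset[OF A Bi_fin] by simp
 have sM: "?s : rep_space M i"
  using wM by (intro cvec.subspace_sum[OF rep_subspace[OF repM i]] cvec.subspace_scale[OF rep_subspace[OF repM i]])
 have vM: "v kp : rep_space M i" "?c *\<^sub>C v kp : rep_space M i" using vk cvec.subspace_scale[OF rep_subspace[OF repM i]] by auto
 have cfw: "cf i ?w mu = ?c * cf i (v kp) mu + (SUM nu:?A. - (?c * cf i (v kp) nu) * cf i (w nu) mu)" for mu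
  unfolding cf_add[OF i vM(2) sM] cf_scale[OF i vM(1)] by (subst cf_sum[OF i wM]) auto
 have neq: "rh nu ~= rh kp" if "nu : A" "nu ~= kp" for nu
  using that less(2) A BiD(1) inj_onD[OF rh, of nu kp] by blast
 have top0: "cf i (v kp) mu = 0" if "rh kp < rh mu" for mu
  using vk that cf_spec(2)[OF i vM(1)] by (cases "mu : Bi i") auto
 have low: "(SUM nu:?A. - (?c * cf i (v kp) nu) * cf i (w nu) mu) = 0" if "rh kp <= rh mu" for mu
  using w that by (intro sum.neutral) auto
 have "?w : N"
  using w v(2)[OF less(2)] by (intro cvec.subspace_add[OF N] cvec.subspace_sum[OF N] cvec.subspace_scale[OF N]) auto
 moreover have "cf i ?w nu = (if nu = kp then 1 else 0)" if nu: "nu : A" for nu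
 proof (cases "rh nu < rh kp")
  case True
  have "(SUM nu':?A. - (?c * cf i (v kp) nu') * cf i (w nu') nu) = (SUM nu':?A. if nu' = nu then - (?c * cf i (v kp) nu) else 0)"
   using w nu unfolding reduced_def by (intro sum.cong) auto
  also have "... = - (?c * cf i (v kp) nu)" using fA nu True by simp
  finally show ?thesis using cfw[of nu] True by auto
 next
  case False
  then show ?thesis using cfw[of nu] low[of nu] top0[of nu] neq[OF nu] vk by (cases "nu = kp") auto
 qed
 moreover have "cf i ?w mu = 0" if "rh kp < rh mu" for mu using cfw[of mu] low[of mu] top0[OF that] that by simp
 moreover have "?w : rep_space M i" using cvec.subspace_add[OF rep_subspace[OF repM i] vM(2) sM] .
 ultimately show ?case unfolding reduced_def by blast
qed

text \<open>The reduced vectors are dual to the pivot coordinates, hence independent, and by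
  dimension they form a basis. This is what makes reduced vectors unique.\<close>

lemma reduced_basis:
 assumes i: "i : verts Q" and A: "A <= Bi i" and N: "cvec.subspace N" "N <= rep_space M i" "cvec.dim N = card A"
  and w: "!!kp. kp : A ==> w kp : N & reduced i A kp (w kp)"
  and y: "y : N" "!!kp. kp : A ==> cf i y kp = 0"
 shows "y = 0"
proof -
 have fA: "finite A" using A Bi_fin finite_subset by blast
 have wM: "!!kp. kp : A ==> w kp : rep_space M i" using w N(2) by blast
 have cfs: "cf i (SUM kp:A. c kp *\<^sub>C w kp) nu = c nu" if "nu : A" for c nu
 proof -
  have "cf i (SUM kp:A. c kp *\<^sub>C w kp) nu = (SUM kp:A. if kp = nu then c nu else 0)"
   using w that unfolding reduced_def by (subst cf_sum[OF i wM]) (auto intro!: sum.cong)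
  then show ?thesis using fA that by simp
 qed
 have z: "ALL kp:A. c kp = 0" if "(SUM kp:A. c kp *\<^sub>C w kp) = 0" for c
  using cfs[of _ c] that cf_zero[OF i] by auto
 have ind: "inj_on w A" "cvec.independent (w ` A)" using family_independent[OF fA, of w] z by blast+
 have "cvec.span (w ` A) = N"
 proof (rule cvec_dim_eq_imp_eq[OF fin_dim_subspace_subset[OF rep_fin_dim[OF repM i] N(1,2)]])
  show "cvec.span (w ` A) <= N" using w by (intro cvec.span_minimal N(1)) auto
  show "cvec.dim N <= cvec.dim (cvec.span (w ` A))"
   using cvec.dim_span_eq_card_independent[OF ind(2)] card_image[OF ind(1)] N(3) by simp
 qed simp
 then have "y : range (%u. SUM v:w ` A. u v *\<^sub>C v)" using y(1) cvec.span_finite[of "w ` A"] fA by auto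
 then obtain u where "y = (SUM v:w ` A. u v *\<^sub>C v)" by blast
 then have u: "y = (SUM kp:A. u (w kp) *\<^sub>C w kp)" by (simp add: sum.reindex[OF ind(1)])
 then have "u (w kp) = 0" if "kp : A" for kp using cfs[OF that, of "%kp. u (w kp)"] y(2)[OF that] by simp
 then show ?thesis unfolding u by (intro sum.neutral) auto
qed

end

locale string_cell = string_basis Q n pos M B rh e
 for Q :: "('v, 'e) pre_digraph" and n pos and M :: "('v, 'e, 'm::complex_vector) rep" and B :: "'k set" and rh e +
 fixes A :: "'v => 'k set" and d :: "'v => nat"
 assumes A: "coord_family A" and d: "i : verts Q ==> card (A i) = d i"
begin

lemma AB: "i : verts Q ==> A i <= Bi i" using coord_familyD(1)[OF A] .

lemma finA: "i : verts Q ==> finite (A i)" using finite_subset[OF AB Bi_fin] .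

definition al :: "'v => nat => 'k" where "al i = (SOME f. bij_betw f {..<d i} (A i))"

lemma al: "i : verts Q ==> bij_betw (al i) {..<d i} (A i)"
proof -
 assume i: "i : verts Q"
 then obtain f where "bij_betw f {..<d i} (A i)" using ex_bij_betw_nat_finite[OF finA[OF i]] d[OF i] by (auto simp: atLeast0LessThan)
 then show ?thesis unfolding al_def by (rule someI[of "%f. bij_betw f {..<d i} (A i)"])
qed

lemma al_in: "i : verts Q ==> r < d i ==> al i r : A i"
 using bij_betw_apply[OF al] by simp

lemma al_eq: "i : verts Q ==> r < d i ==> s < d i ==> al i r = al i s \<longleftrightarrow> r = s"
 using bij_betw_imp_inj_on[OF al] unfolding inj_on_def by auto

lemma al_surj: assumes "i : verts Q" "kp : A i" obtains r where "r < d i" "al i r = kp"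
proof -
 have "kp : al i ` {..<d i}" using assms(2) bij_betw_imp_surj_on[OF al[OF assms(1)]] by simp
 then show ?thesis using that by auto
qed

abbreviation "X == frames Q M d"

abbreviation "L == frame_coordinates Q M d"

abbreviation "Gr == quiver_grass Q M d"

definition hasred :: "'v => 'm set => bool" where "hasred i N \<longleftrightarrow> (ALL kp:A i. EX w:N. reduced i (A i) kp w)"

text \<open>
 The entries of the reduced echelon form with pivots \<open>A i\<close>; meaningful only if \<open>hasred i (N i)\<close>.
\<close>

definition xi :: "'v => 'k => 'k => ('v => 'm set) => complex" where
 "xi i kp mu N = cf i (SOME w. w : N i & reduced i (A i) kp w) mu"

text \<open>Two reduced vectors for the same pivot differ by a vector whose pivot coordinates all
  vanish.\<close>

lemma xi_eq:
 assumes i: "i : verts Q" and N: "cvec.subspace (N i)" "N i <= rep_space M i" "cvec.dim (N i) = d i"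
  and h: "hasred i (N i)" and kp: "kp : A i" and w: "w : N i" "reduced i (A i) kp w"
 shows "xi i kp mu N = cf i w mu"
proof -
 let ?w = "SOME w. w : N i & reduced i (A i) kp w"
 have w': "?w : N i & reduced i (A i) kp ?w" by (rule someI[of _ w]) (use w in simp)
 obtain r where r: "ALL kp:A i. r kp : N i & reduced i (A i) kp (r kp)"
  using h unfolding hasred_def Bex_def by (rule bchoice[THEN exE])
 have M: "?w : rep_space M i" "w : rep_space M i" "- 1 *\<^sub>C w : rep_space M i"
  using w w' N(2) cvec.subspace_scale[OF rep_subspace[OF repM i], of w "-1"] by auto
 have "?w + - 1 *\<^sub>C w = 0"
 proof (rule reduced_basis[OF i AB[OF i] N(1,2), of r])
  show "?w + - 1 *\<^sub>C w : N i" using w w' by (intro cvec.subspace_add[OF N(1)] cvec.subspace_scale[OF N(1)]) auto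
  show "cf i (?w + - 1 *\<^sub>C w) nu = 0" if "nu : A i" for nu
   unfolding cf_add[OF i M(1,3)] cf_scale[OF i M(2)] using w(2) w' that unfolding reduced_def by simp
 qed (use r N(3) d[OF i] in auto)
 then have "?w = w" by (simp add: cvec.scale_minus_left scaleC_one)
 then show ?thesis unfolding xi_def by simp
qed

section \<open>Frames, pivot minors and Cramer's rule\<close>

lemma frames_iff: "u : X \<longleftrightarrow> u : (\<Pi>\<^sub>E i\<in>verts Q. {..<d i} \<rightarrow>\<^sub>E rep_space M i) &
  (ALL i:verts Q. inj_on (u i) {..<d i} & cvec.independent (u i ` {..<d i}))"
 unfolding frames_def by simp

lemma framesD:
 assumes u: "u : X" and i: "i : verts Q"
 shows "k < d i ==> u i k : rep_space M i" "inj_on (u i) {..<d i}" "cvec.independent (u i ` {..<d i})"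
  "cvec.subspace (frame_span Q d u i)" "frame_span Q d u i <= rep_space M i" "cvec.dim (frame_span Q d u i) = d i"
proof -
 show a: "!!k. k < d i ==> u i k : rep_space M i" using u i unfolding frames_iff by (auto simp: PiE_iff)
 show b: "inj_on (u i) {..<d i}" "cvec.independent (u i ` {..<d i})" using u i unfolding frames_iff by auto
 show "cvec.subspace (frame_span Q d u i)" using i unfolding frame_span_def by simp
 show "frame_span Q d u i <= rep_space M i"
  using i a cvec.span_minimal[OF _ rep_subspace[OF repM i], of "u i ` {..<d i}"] unfolding frame_span_def by auto
 show "cvec.dim (frame_span Q d u i) = d i"
  using i cvec.dim_span_eq_card_independent[OF b(2)] card_image[OF b(1)] unfolding frame_span_def by simp
qed

lemma frame_span_mem: "i : verts Q ==> (\<Sum>k<d i. c k *\<^sub>C u i k) : frame_span Q d u i"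
 unfolding frame_span_def by (simp, intro cvec.span_sum cvec.span_scale cvec.span_base) auto

lemma frame_span_memE:
 assumes u: "u : X" and i: "i : verts Q" and y: "y : frame_span Q d u i"
 obtains c where "y = (\<Sum>k<d i. c k *\<^sub>C u i k)"
proof -
 have "y : range (%f. SUM v:u i ` {..<d i}. f v *\<^sub>C v)"
  using y i cvec.span_finite[of "u i ` {..<d i}"] unfolding frame_span_def by simp
 then obtain f where "y = (SUM v:u i ` {..<d i}. f v *\<^sub>C v)" by blast
 then show ?thesis using that[of "%k. f (u i k)"] by (simp add: sum.reindex[OF framesD(2)[OF u i]])
qed

lemma frame_exists:
 assumes N: "N : Gr" obtains u where "u : X" "frame_span Q d u = N"
proof -
 have N': "is_subrep Q M N" "!!i. i : verts Q ==> cvec.dim (N i) = d i" using N unfolding quiver_grass_def by auto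
 have "ALL i:verts Q. EX f. bij_betw f {..<d i} (f ` {..<d i}) & cvec.independent (f ` {..<d i}) & cvec.span (f ` {..<d i}) = N i"
 proof
  fix i assume i: "i : verts Q"
  obtain C where C: "finite C" "cvec.independent C" "C <= N i" "cvec.span C = N i" "card C = cvec.dim (N i)"
   by (rule fin_dim_subspace_basis[OF fin_dim_subspace_subset[OF rep_fin_dim[OF repM i] is_subrepD(2,3)[OF N'(1) i]]])
  obtain f where "bij_betw f {..<d i} C" using ex_bij_betw_nat_finite[OF C(1)] C(5) N'(2)[OF i] by (auto simp: atLeast0LessThan)
  then show "EX f. bij_betw f {..<d i} (f ` {..<d i}) & cvec.independent (f ` {..<d i}) & cvec.span (f ` {..<d i}) = N i"
   using C(2,4) bij_betw_imp_surj_on by (intro exI[of _ f]) auto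
 qed
 from bchoice[OF this] obtain f where f: "ALL i:verts Q. bij_betw (f i) {..<d i} (f i ` {..<d i}) &
  cvec.independent (f i ` {..<d i}) & cvec.span (f i ` {..<d i}) = N i" by (rule exE)
 let ?u = "\<lambda>i\<in>verts Q. \<lambda>k\<in>{..<d i}. f i k"
 have im: "?u i ` {..<d i} = f i ` {..<d i}" if "i : verts Q" for i using that by auto
 have "f i k : rep_space M i" if "i : verts Q" "k < d i" for i k
  using that f is_subrepD(3)[OF N'(1) that(1)] cvec.span_base[of "f i k" "f i ` {..<d i}"] by auto
 moreover have "inj_on (?u i) {..<d i}" if "i : verts Q" for i
  using f that unfolding bij_betw_def by (auto simp: inj_on_def)
 ultimately have "?u : X" unfolding frames_iff using im f by (auto simp: PiE_iff)
 moreover have "frame_span Q d ?u = N"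
  using is_subrepD(1)[OF N'(1)] im f unfolding frame_span_def by (intro extensionalityI[of _ "verts Q"]) auto
 ultimately show ?thesis by (rule that)
qed

text \<open>Rows are the pivots and columns the frame vectors; the determinant is the Pluecker
  coordinate at \<open>A i\<close>.\<close>

definition XM :: "('v => nat => 'm) => 'v => complex Matrix.mat" where
 "XM u i = Matrix.mat (d i) (d i) (%(r, c). cf i (u i c) (al i r))"

text \<open>A product over the vertices, so that one denominator serves all coordinates and
  equations.\<close>

definition D :: "('v => nat => 'm) => complex" where
 "D u = (PROD i:verts Q. Determinant.det (XM u i))"

lemma cf_poly: "i : verts Q ==> k < d i ==> (%u. cf i (u i k) mu) : poly_algebra L"
 unfolding frame_coordinates_def by (intro poly_algebra.gen CollectI exI[of _ "%x. cf i x mu"] exI[of _ i] exI[of _ k] conjI refl cf_clinear)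

lemma det_poly: "i : verts Q ==> (%u. Determinant.det (XM u i)) : poly_algebra L"
 unfolding XM_def by (intro poly_algebra_det cf_poly)

text \<open>Cramer's rule: column \<open>r\<close> of the inverse of \<open>XM u i\<close> expresses
  the reduced vector in the frame, and the adjugate shows that its entries times the determinant are
  polynomial.\<close>

lemma reduced_of_det:
 assumes u: "u : X" and i: "i : verts Q" and D: "Determinant.det (XM u i) ~= 0" and r: "r < d i"
 defines "w == (\<Sum>k<d i. (adj_mat (XM u i) $$ (k, r) / Determinant.det (XM u i)) *\<^sub>C u i k)"
 shows "w : frame_span Q d u i" "reduced i (A i) (al i r) w"
  "cf i w mu * Determinant.det (XM u i) = (\<Sum>k<d i. adj_mat (XM u i) $$ (k, r) * cf i (u i k) mu)"
proof -
 let ?D = "Determinant.det (XM u i)" and ?J = "adj_mat (XM u i)"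
 have C: "XM u i : carrier_mat (d i) (d i)" unfolding XM_def by simp
 note J = adj_mat[OF C]
 show mem: "w : frame_span Q d u i" unfolding w_def by (rule frame_span_mem[OF i])
 have cfw: "cf i w mu = (\<Sum>k<d i. ?J $$ (k, r) / ?D * cf i (u i k) mu)" for mu
  unfolding w_def by (rule cf_sum[OF i]) (use framesD(1)[OF u i] in simp)
 then show "cf i w mu * ?D = (\<Sum>k<d i. ?J $$ (k, r) * cf i (u i k) mu)" using D by (simp add: sum_distrib_right)
 have "cf i w (al i s) = (if s = r then 1 else 0)" if s: "s < d i" for s
 proof -
  have "(XM u i * ?J) $$ (s, r) = (\<Sum>k<d i. cf i (u i k) (al i s) * ?J $$ (k, r))"
   unfolding index_mult_mat_sum[OF C J(1) s r] using s by (intro sum.cong) (auto simp: XM_def)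
  then have "(\<Sum>k<d i. ?J $$ (k, r) * cf i (u i k) (al i s)) = ?D * (if s = r then 1 else 0)"
   unfolding J(2) using r s by (simp add: mult.commute)
  then show ?thesis unfolding cfw using D by (simp add: sum_divide_distrib[symmetric])
 qed
 then have "cf i w nu = (if nu = al i r then 1 else 0)" if "nu : A i" for nu
  using that r i al_surj[OF i that] al_eq[OF i] by metis
 then show "reduced i (A i) (al i r) w" using mem framesD(5)[OF u i] unfolding reduced_def by blast
qed

text \<open>Conversely, the coefficients of reduced vectors in the frame form a right inverse of the
  matrix. Hence nonvanishing of the minor depends only on the span.\<close>

lemma det_iff_hasred:
 assumes u: "u : X" and i: "i : verts Q"
 shows "Determinant.det (XM u i) ~= 0 \<longleftrightarrow> hasred i (frame_span Q d u i)"
proof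
 assume D: "Determinant.det (XM u i) ~= 0"
 show "hasred i (frame_span Q d u i)"
  unfolding hasred_def
 proof
  fix kp assume "kp : A i"
  then obtain r where "r < d i" "al i r = kp" using al_surj[OF i] by blast
  then show "EX w:frame_span Q d u i. reduced i (A i) kp w" using reduced_of_det(1,2)[OF u i D] by blast
 qed
next
 assume h: "hasred i (frame_span Q d u i)"
 have "ALL r:{..<d i}. EX c. reduced i (A i) (al i r) (\<Sum>k<d i. c k *\<^sub>C u i k)"
 proof
  fix r assume "r : {..<d i}"
  then obtain w where w: "w : frame_span Q d u i" "reduced i (A i) (al i r) w" using h al_in[OF i] unfolding hasred_def by blast
  obtain c where "w = (\<Sum>k<d i. c k *\<^sub>C u i k)" by (rule frame_span_memE[OF u i w(1)])
  then show "EX c. reduced i (A i) (al i r) (\<Sum>k<d i. c k *\<^sub>C u i k)" using w(2) by blast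
 qed
 from bchoice[OF this] obtain c where c: "ALL r:{..<d i}. reduced i (A i) (al i r) (\<Sum>k<d i. c r k *\<^sub>C u i k)" by (rule exE)
 let ?C = "Matrix.mat (d i) (d i) (%(k, r). c r k)"
 have C: "XM u i : carrier_mat (d i) (d i)" unfolding XM_def by simp
 have "XM u i * ?C = 1\<^sub>m (d i)"
 proof (rule eq_matI)
  fix s r assume "s < dim_row (1\<^sub>m (d i) :: complex Matrix.mat)" "r < dim_col (1\<^sub>m (d i) :: complex Matrix.mat)"
  then have sr: "s < d i" "r < d i" by auto
  have "(XM u i * ?C) $$ (s, r) = (\<Sum>k<d i. c r k * cf i (u i k) (al i s))"
   using sr by (subst index_mult_mat_sum[OF C _ sr]) (auto simp: XM_def intro!: sum.cong)
  also have "... = cf i (\<Sum>k<d i. c r k *\<^sub>C u i k) (al i s)"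
   by (rule cf_sum[OF i, symmetric]) (use framesD(1)[OF u i] in simp)
  also have "... = (if al i s = al i r then 1 else 0)" using c sr al_in[OF i sr(1)] unfolding reduced_def by auto
  also have "... = 1\<^sub>m (d i) $$ (s, r)" using sr al_eq[OF i sr] by simp
  finally show "(XM u i * ?C) $$ (s, r) = 1\<^sub>m (d i) $$ (s, r)" .
 qed (simp_all add: XM_def)
 then have "Determinant.det (XM u i) * Determinant.det ?C = 1"
  using det_mult[OF C, of ?C] by simp
 then show "Determinant.det (XM u i) ~= 0" by auto
qed

lemma D_iff: "u : X ==> D u ~= 0 \<longleftrightarrow> (ALL i:verts Q. hasred i (frame_span Q d u i))"
 unfolding D_def using det_iff_hasred by simp

lemma D_poly: "D : poly_algebra L"
 unfolding D_def by (intro poly_algebra_prod det_poly)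

text \<open>The numerator is that of Cramer's rule at \<open>i\<close>, times the minors at the
  other vertices to match the common denominator.\<close>

lemma xi_poly:
 assumes i: "i : verts Q" and kp: "kp : A i"
 shows "EX P:poly_algebra L. ALL u:X. D u ~= 0 --> xi i kp mu (frame_span Q d u) * D u = P u"
proof -
 obtain r where r: "r < d i" "al i r = kp" using al_surj[OF i kp] by blast
 let ?P = "%u. (\<Sum>k<d i. adj_mat (XM u i) $$ (k, r) * cf i (u i k) mu) * (PROD j:verts Q - {i}. Determinant.det (XM u j))"
 have "(%u. adj_mat (XM u i) $$ (k, r)) : poly_algebra L" if "k < d i" for k
  unfolding XM_def using that r(1) i by (intro poly_algebra_adj_mat cf_poly)
 then have P: "?P : poly_algebra L"
  using i by (intro poly_algebra.mult poly_algebra_sum poly_algebra_prod det_poly cf_poly) auto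
 have eq: "xi i kp mu (frame_span Q d u) * D u = ?P u" if u: "u : X" and Du: "D u ~= 0" for u
 proof -
  have h: "hasred i (frame_span Q d u i)" using D_iff[OF u] Du i by blast
  then have det: "Determinant.det (XM u i) ~= 0" using det_iff_hasred[OF u i] by blast
  note R = reduced_of_det[OF u i det r(1)]
  have "D u = Determinant.det (XM u i) * (PROD j:verts Q - {i}. Determinant.det (XM u j))"
   unfolding D_def using i by (simp add: prod.remove[of _ i])
  then show ?thesis
   using xi_eq[where N="frame_span Q d u", OF i framesD(4,5,6)[OF u i] h kp R(1) R(2)[unfolded r(2)]] R(3)[of mu]
   by (simp add: mult.assoc)
 qed
 show ?thesis
 proof (rule bexI[OF _ P], intro ballI impI)
  fix u assume "u : X" "D u ~= 0"
  then show "xi i kp mu (frame_span Q d u) * D u = ?P u" by (rule eq)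
 qed
qed

end

section \<open>Coordinates and equations of a cell\<close>

context string_cell
begin

text \<open>The free entries: strings below the pivot that are present but not pivots themselves,
  taken only where the pivot first appears, since the arcs repeat the entry afterwards. Their number
  is the dimension of the cell.\<close>

definition "Par = {(kp, mu). (EX i:verts Q. kp : A i) & mu : Bi (start A kp) & mu ~: A (start A kp) & rh mu < rh kp}"

lemma ParD:
 assumes "(kp, mu) : Par"
 shows "start A kp : verts Q" "kp : A (start A kp)" "mu : Bi (start A kp)" "mu ~: A (start A kp)" "rh mu < rh kp"
 using assms start[where A=A] unfolding Par_def by auto

lemma Par_fin: "finite Par"
proof (rule finite_subset)
 show "Par <= B \<times> B"
 proof
  fix p assume p: "p : Par"
  then obtain kp mu where km: "p = (kp, mu)" by (cases p)
  then show "p : B \<times> B" using ParD[of kp mu] p AB[of "start A kp"] BiD(1) by auto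
 qed
qed (use finB in simp)

definition "m = card Par"

definition "pi0 = (SOME f. bij_betw f {..<m} Par)"

lemma pi0: "bij_betw pi0 {..<m} Par"
proof -
 obtain f where "bij_betw f {..<m} Par" using ex_bij_betw_nat_finite[OF Par_fin] unfolding m_def by (auto simp: atLeast0LessThan)
 then show ?thesis unfolding pi0_def by (rule someI[of "%f. bij_betw f {..<m} Par"])
qed

definition par :: "(nat => complex) => 'k => 'k => complex" where
 "par y kp mu = (if (kp, mu) : Par then y (inv_into {..<m} pi0 (kp, mu)) else 0)"

definition translate :: "('k => 'k => complex) => 'v => 'm set" where
 "translate x = (\<lambda>i\<in>verts Q. unip x i ` coord A i)"

text \<open>A frame depending polynomially on \<open>y\<close>. Each vector is reduced where its
  pivot first appears; further on, new pivots may occur among the lower strings, and then it is only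
  a leading vector.\<close>

definition fr :: "(nat => complex) => 'v => nat => 'm" where
 "fr y = (\<lambda>i\<in>verts Q. \<lambda>k\<in>{..<d i}. unip_vec (par y) i (al i k))"

definition ps :: "('v => 'm set) => nat => complex" where
 "ps N = (\<lambda>j\<in>{..<m}. xi (start A (fst (pi0 j))) (fst (pi0 j)) (snd (pi0 j)) N)"

text \<open>Echelon form as equations in the chart: entries above the pivots vanish at every vertex.
  Compatibility with the arcs is already contained in \<open>Gr\<close>.\<close>

definition cell :: "('v => 'm set) set" where
 "cell = {N : Gr. (ALL i:verts Q. hasred i (N i)) & (ALL i:verts Q. ALL kp:A i. ALL mu:Bi i. rh kp < rh mu --> xi i kp mu N = 0)}"

lemma GrD: "N : Gr ==> is_subrep Q M N" "N : Gr ==> i : verts Q ==> cvec.dim (N i) = d i"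
 unfolding quiver_grass_def by auto

lemma grass_translate: "translate x : Gr"
proof -
 have "cvec.dim (coord A i) = d i" if "i : verts Q" for i using coord_dim[OF A that] d[OF that] by simp
 then have "coord A : Gr" using coord_subrep[OF A] unfolding quiver_grass_def by simp
 then show ?thesis unfolding translate_def by (rule grass_image[OF wf repM unip_iso])
qed

lemma translate_span: "i : verts Q ==> translate x i = cvec.span (unip_vec x i ` A i)"
 unfolding translate_def using unip_coord[OF A] by simp

lemma fr_X: "fr y : X"
proof -
 have im: "fr y i ` {..<d i} = unip_vec (par y) i ` A i" if i: "i : verts Q" for i
 proof -
  have "fr y i ` {..<d i} = unip_vec (par y) i ` al i ` {..<d i}" using i unfolding fr_def by (auto simp: image_image)
  then show ?thesis using bij_betw_imp_surj_on[OF al[OF i]] by simp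
 qed
 have T: "inj_on (unip_vec (par y) i) (A i)" "cvec.independent (unip_vec (par y) i ` A i)" if i: "i : verts Q" for i
  using triangular_independent(1,2)[where v="unip_vec (par y) i", OF i AB[OF i] leads_unip_vec[OF i subsetD[OF AB[OF i]]]] by simp_all
 have "inj_on (fr y i) {..<d i}" if i: "i : verts Q" for i
  using comp_inj_on[OF bij_betw_imp_inj_on[OF al[OF i]], of "unip_vec (par y) i"] T(1)[OF i] bij_betw_imp_surj_on[OF al[OF i]] i
  unfolding fr_def by (simp add: inj_on_def)
 moreover have "fr y : (\<Pi>\<^sub>E i\<in>verts Q. {..<d i} \<rightarrow>\<^sub>E rep_space M i)"
  using unip_vec_in[OF _ BiD(1)[OF subsetD[OF AB al_in]]] unfolding fr_def by (auto simp: PiE_iff)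
 ultimately show ?thesis unfolding frames_iff using T(2) im by simp
qed

lemma frame_span_fr: "frame_span Q d (fr y) = translate (par y)"
proof (rule extensionalityI[of _ "verts Q"])
 fix i assume i: "i : verts Q"
 have "fr y i ` {..<d i} = unip_vec (par y) i ` al i ` {..<d i}" using i unfolding fr_def by (auto simp: image_image)
 then show "frame_span Q d (fr y) i = translate (par y) i"
  unfolding translate_span[OF i] using i bij_betw_imp_surj_on[OF al[OF i]] unfolding frame_span_def by simp
qed (simp_all add: frame_span_def translate_def)

text \<open>Leading vectors can be reduced without creating entries above the pivots.\<close>

lemma leading_in_cell:
 assumes N: "N : Gr"
  and v: "!!i kp. i : verts Q ==> kp : A i ==> leads i kp (v i kp) & v i kp : N i"
 shows "N : cell"
proof -
 have red: "EX w:N i. reduced i (A i) kp w & (ALL mu. rh kp < rh mu --> cf i w mu = 0)" if i: "i : verts Q" and "kp : A i" for i kp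
  by (rule triangular_reduced[OF i AB[OF i] is_subrepD(2)[OF GrD(1)[OF N] i], of "v i"]) (use v that in auto)
 then have h: "hasred i (N i)" if "i : verts Q" for i using that unfolding hasred_def by blast
 have "xi i kp mu N = 0" if i: "i : verts Q" and k: "kp : A i" and lt: "rh kp < rh mu" for i kp mu
 proof -
  obtain w where w: "w : N i" "reduced i (A i) kp w" "ALL mu. rh kp < rh mu --> cf i w mu = 0" using red[OF i k] by blast
  show ?thesis
   using xi_eq[where N=N, OF i is_subrepD(2,3)[OF GrD(1)[OF N] i] GrD(2)[OF N i] h[OF i] k w(1,2)] w(3) lt by simp
 qed
 then show ?thesis unfolding cell_def using N h by simp
qed

lemma translate_cell: "translate x : cell"
proof (rule leading_in_cell[where v="unip_vec x", OF grass_translate])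
 fix i kp assume i: "i : verts Q" and k: "kp : A i"
 then show "leads i kp (unip_vec x i kp) & unip_vec x i kp : translate x i"
  using leads_unip_vec[OF i subsetD[OF AB[OF i]]] unfolding translate_span[OF i] by (auto intro: cvec.span_base)
qed

lemma reduced_unip_vec:
 assumes s: "s : verts Q" and k: "kp : A s" and x: "!!mu. mu : A s ==> x kp mu = 0"
 shows "reduced s (A s) kp (unip_vec x s kp)"
 using k cf_unip_vec[OF s, of kp x] x unip_vec_in[OF s BiD(1)] AB[OF s] unfolding reduced_def by auto

text \<open>Where a pivot first appears, the reduced vector of \<open>N\<close> is a modified basis
  vector: its entries are 0 at other pivots, 0 above by the equations, and coordinates of
  \<open>ps N\<close> elsewhere. \<open>unip_coord_eqI\<close> extends this to all vertices.\<close>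

lemma cell_translate:
 assumes N: "N : cell"
 shows "N = translate (par (ps N))"
proof -
 have G: "N : Gr" and h: "!!i. i : verts Q ==> hasred i (N i)"
  and z: "!!i kp mu. i : verts Q ==> kp : A i ==> mu : Bi i ==> rh kp < rh mu ==> xi i kp mu N = 0"
  using N unfolding cell_def by auto
 note S = GrD(1)[OF G]
 let ?x = "par (ps N)"
 have x: "?x kp mu = xi (start A kp) kp mu N" if p: "(kp, mu) : Par" for kp mu
 proof -
  have "pi0 (inv_into {..<m} pi0 (kp, mu)) = (kp, mu)" "inv_into {..<m} pi0 (kp, mu) < m"
   using bij_betw_inv_into_right[OF pi0 p] bij_betw_apply[OF bij_betw_inv_into[OF pi0] p] by auto
  then show ?thesis using p unfolding par_def ps_def by simp
 qed
 have "unip_vec ?x (start A kp) kp : N (start A kp)" if "i : verts Q" "kp : A i" for i kp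
 proof -
  let ?s = "start A kp"
  note st = start[where A=A, OF that]
  note sub = is_subrepD(2,3)[OF S st(1)]
  have kB: "kp : Bi ?s" using AB[OF st(1)] st(2) by blast
  obtain w where w: "w : N ?s" "reduced ?s (A ?s) kp w" using h[OF st(1)] st(2) unfolding hasred_def by blast
  have xiw: "xi ?s kp mu N = cf ?s w mu" for mu
   by (rule xi_eq[where N=N, OF st(1) sub GrD(2)[OF G st(1)] h[OF st(1)] st(2) w])
  have "unip_vec ?x ?s kp = w"
  proof (rule cf_eqI[OF st(1) unip_vec_in[OF st(1) BiD(1)[OF kB]]])
   show "w : rep_space M ?s" using w(2) unfolding reduced_def by blast
   fix mu assume mu: "mu : Bi ?s"
   have cu: "cf ?s (unip_vec ?x ?s kp) mu = (if mu = kp then 1 else if mu : below kp ?s then ?x kp mu else 0)"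
    by (rule cf_unip_vec[OF st(1) kB])
   show "cf ?s (unip_vec ?x ?s kp) mu = cf ?s w mu"
   proof (cases "mu : A ?s")
    case True
    then have "?x kp mu = 0" using ParD(4) unfolding par_def by auto
    then show ?thesis using cu w(2) True unfolding reduced_def by simp
   next
    case False
    then have ne: "mu ~= kp" using st(2) by blast
    then have "rh mu ~= rh kp" using inj_onD[OF rh, of mu kp] BiD(1)[OF mu] BiD(1)[OF kB] by blast
    then consider "rh mu < rh kp" | "rh kp < rh mu" by linarith
    then show ?thesis
    proof cases
     case 1
     then have "(kp, mu) : Par" using that mu False unfolding Par_def by auto
     then show ?thesis using cu ne 1 mu x xiw unfolding below_def by simp
    next
     case 2
     then show ?thesis using cu ne z[OF st(1,2) mu 2] xiw unfolding below_def by simp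
    qed
   qed
  qed
  then show ?thesis using w(1) by simp
 qed
 then have "N i = unip ?x i ` coord A i" if "i : verts Q" for i
  by (rule unip_coord_eqI[OF S A _ _ that, rotated]) (use GrD(2)[OF G] d in auto)
 then show ?thesis using is_subrepD(1)[OF S] unfolding translate_def by (intro extensionalityI[of _ "verts Q"]) auto
qed

text \<open>Where \<open>kp\<close> first appears, the parameters vanish at all pivots present
  there, so the modified basis vector is already reduced and its entries are the values of
  \<open>xi\<close>.\<close>

lemma ps_translate:
 assumes y: "y : {..<m} \<rightarrow>\<^sub>E UNIV"
 shows "ps (translate (par y)) = y"
proof (rule extensionalityI[of _ "{..<m}"])
 show "ps (translate (par y)) : extensional {..<m}" "y : extensional {..<m}" using y unfolding ps_def by (auto simp: PiE_iff)
 fix j assume j: "j : {..<m}"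
 obtain kp mu where p: "pi0 j = (kp, mu)" by fastforce
 then have P: "(kp, mu) : Par" using bij_betw_apply[OF pi0 j] by simp
 let ?s = "start A kp" and ?N = "translate (par y)"
 note PD = ParD[OF P]
 have G: "?N : Gr" by (rule grass_translate)
 have h: "hasred ?s (?N ?s)" using translate_cell[of "par y"] PD(1) unfolding cell_def by blast
 have w: "unip_vec (par y) ?s kp : ?N ?s" unfolding translate_span[OF PD(1)] using PD(2) by (intro cvec.span_base) auto
 have r: "reduced ?s (A ?s) kp (unip_vec (par y) ?s kp)"
  by (rule reduced_unip_vec[OF PD(1,2)]) (auto simp: par_def dest: ParD(4))
 have kB: "kp : Bi ?s" using AB[OF PD(1)] PD(2) by blast
 have "xi ?s kp mu ?N = cf ?s (unip_vec (par y) ?s kp) mu"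
  by (rule xi_eq[where N="?N", OF PD(1) is_subrepD(2,3)[OF GrD(1)[OF G] PD(1)] GrD(2)[OF G PD(1)] h PD(2) w r])
 also have "... = par y kp mu"
  using cf_unip_vec[OF PD(1) kB, of "par y" mu] PD unfolding below_def by auto
 also have "... = y j" using P bij_betw_inv_into_left[OF pi0 j] p unfolding par_def by simp
 finally show "ps ?N j = y j" using j p unfolding ps_def by simp
qed

lemma fr_poly:
 assumes l: "l : L"
 shows "(%y. l (fr y)) : poly_algebra {%x. x j | j. j < m}"
proof -
 obtain f i k where l: "l = (%u. f (u i k))" and i: "i : verts Q" and k: "k < d i" and f: "clinear_on (rep_space M i) f"
  using l unfolding frame_coordinates_def by blast
 let ?k = "al i k"
 have kB: "?k : B" using al_in[OF i k] AB[OF i] BiD(1) by blast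
 note sub = rep_subspace[OF repM i]
 have bB: "below ?k i <= B" using below_sub(1) BiD(1) by blast
 have xe: "x *\<^sub>C e mu i : rep_space M i" if "mu : below ?k i" for x mu
  using that bB i by (intro cvec.subspace_scale[OF sub] e_in) auto
 have "l (fr y) = f (e ?k i) + (SUM mu:below ?k i. par y ?k mu * f (e mu i))" for y
 proof -
  have "l (fr y) = f (e ?k i) + f (SUM mu:below ?k i. par y ?k mu *\<^sub>C e mu i)"
   unfolding l fr_def unip_vec_def using i k
   by (simp add: clinear_on_add[OF f e_in[OF kB i] comb_in[OF i bB]])
  also have "f (SUM mu:below ?k i. par y ?k mu *\<^sub>C e mu i) = (SUM mu:below ?k i. f (par y ?k mu *\<^sub>C e mu i))"
   by (rule clinear_on_sum[OF f sub]) (rule xe)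
  also have "... = (SUM mu:below ?k i. par y ?k mu * f (e mu i))"
   using clinear_on_scale[OF f e_in[OF _ i]] bB by (intro sum.cong) (auto simp: scaleC_complex_def)
  finally show ?thesis .
 qed
 moreover have "(%y. par y kp mu) : poly_algebra {%x. x j | j. j < m}" for kp mu
 proof (cases "(kp, mu) : Par")
  case True
  then have "inv_into {..<m} pi0 (kp, mu) < m" using bij_betw_apply[OF bij_betw_inv_into[OF pi0] True] by simp
  then show ?thesis using True unfolding par_def by (simp, intro poly_algebra.gen) blast
 qed (simp add: par_def poly_algebra.const)
 ultimately show ?thesis by (simp add: poly_algebra.add poly_algebra.const poly_algebra_sum poly_algebra.mult)
qed

theorem is_cell_cell: "is_cell (quiver_grass_variety Q M d) cell"
proof -
 let ?E = "(%(i, kp, mu). xi i kp mu) ` {(i, kp, mu). i : verts Q & kp : A i & mu : Bi i & rh kp < rh mu}"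
 have "affine_chart X L (frame_span Q d) Gr cell m fr ps D ?E"
 proof
  show "D : poly_algebra L" by (rule D_poly)
  show "D u' ~= 0" if "u : X" "u' : X" "frame_span Q d u = frame_span Q d u'" "D u ~= 0" for u u'
   using that D_iff by metis
  show "fr y : X" for y by (rule fr_X)
  show "(%y. l (fr y)) : poly_algebra {%x. x j | j. j < m}" if "l : L" for l by (rule fr_poly[OF that])
  show "ps N : {..<m} \<rightarrow>\<^sub>E UNIV" for N unfolding ps_def by simp
  show "EX P:poly_algebra L. ALL u:X. D u ~= 0 --> ps (frame_span Q d u) j * D u = P u" if j: "j < m" for j
  proof -
   have "(fst (pi0 j), snd (pi0 j)) : Par" using bij_betw_apply[OF pi0, of j] j by simp
   note P = ParD(1,2)[OF this]
   show ?thesis using xi_poly[OF P, of "snd (pi0 j)"] j unfolding ps_def by simp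
  qed
  show "D (fr y) ~= 0" for y
   unfolding D_iff[OF fr_X] frame_span_fr using translate_cell[of "par y"] unfolding cell_def by blast
  show "ps (frame_span Q d (fr y)) = y" if "y : {..<m} \<rightarrow>\<^sub>E UNIV" for y
   unfolding frame_span_fr by (rule ps_translate[OF that])
  show "EX P:poly_algebra L. ALL u:X. D u ~= 0 --> h (frame_span Q d u) * D u = P u" if "h : ?E" for h
   using that xi_poly by force
  show "cell = (%y. frame_span Q d (fr y)) ` ({..<m} \<rightarrow>\<^sub>E UNIV)"
   unfolding frame_span_fr
  proof (intro equalityI subsetI)
   fix N assume "N : cell"
   then have "N = translate (par (ps N))" by (rule cell_translate)
   moreover have "ps N : {..<m} \<rightarrow>\<^sub>E UNIV" unfolding ps_def by simp
   ultimately show "N : (%y. translate (par y)) ` ({..<m} \<rightarrow>\<^sub>E UNIV)" by (rule image_eqI)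
  qed (use translate_cell in auto)
  show "cell = {N : Gr. (EX u:X. frame_span Q d u = N & D u ~= 0) & (ALL h:?E. h N = 0)}"
  proof -
   have "(EX u:X. frame_span Q d u = N & D u ~= 0) \<longleftrightarrow> (ALL i:verts Q. hasred i (N i))" if "N : Gr" for N
    using frame_exists[OF that] D_iff by metis
   then show ?thesis unfolding cell_def by (intro Collect_cong) auto
  qed
 qed
 then show ?thesis unfolding quiver_grass_variety_def grass_product_def by (rule affine_chart.is_cell_chart)
qed

text \<open>The unitriangular elements already fill the cell, and triangularity keeps the image of
  each basis vector leading at its own index, so no element of \<open>H\<close> leaves it.\<close>

lemma triangular_orbit_eq_cell:
 assumes H: "!!g. g : H ==> g : rep_iso Q M M" "!!x. unip x : H"
  and T: "!!g i kp. g : H ==> i : verts Q ==> kp : Bi i ==> leads i kp (g i (e kp i))"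
 shows "(%g. \<lambda>i\<in>verts Q. g i ` coord A i) ` H = cell"
proof (intro equalityI subsetI)
 fix N assume "N : cell"
 then have "N = translate (par (ps N))" by (rule cell_translate)
 then show "N : (%g. \<lambda>i\<in>verts Q. g i ` coord A i) ` H" using H(2) unfolding translate_def by blast
next
 fix N assume "N : (%g. \<lambda>i\<in>verts Q. g i ` coord A i) ` H"
 then obtain g where g: "g : H" "N = (\<lambda>i\<in>verts Q. g i ` coord A i)" by blast
 have "coord A : Gr" using coord_subrep[OF A] coord_dim[OF A] d unfolding quiver_grass_def by simp
 then have "N : Gr" unfolding g(2) by (rule grass_image[OF wf repM H(1)[OF g(1)]])
 then show "N : cell"
 proof (rule leading_in_cell[where v="%i kp. g i (e kp i)"])
  fix i kp assume i: "i : verts Q" and k: "kp : A i"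
  have "e kp i : coord A i" unfolding coord_def using i k by (simp add: cvec.span_base)
  then show "leads i kp (g i (e kp i)) & g i (e kp i) : N i" using T[OF g(1) i] AB[OF i] k i unfolding g(2) by auto
 qed
qed

text \<open>Separates the orbits of distinct fixed points: a reduced vector of
  \<open>coord A'\<close> has coordinate 1 at its pivot, which must then lie in
  \<open>A'\<close>.\<close>

lemma coord_in_cell_imp_eq:
 assumes A': "coord_family A'" and N: "coord A' : cell" and i: "i : verts Q"
 shows "A' i = A i"
proof -
 have h: "hasred i (coord A' i)" and dim: "cvec.dim (coord A' i) = d i" using N GrD(2)[OF _ i] i unfolding cell_def by auto
 have "A i <= A' i"
 proof
  fix kp assume k: "kp : A i"
  then obtain w where "w : coord A' i" "reduced i (A i) kp w" using h unfolding hasred_def by blast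
  then show "kp : A' i"
   using coord_mem_iff[where A=A', OF i coord_familyD(1)[OF A' i]] k unfolding reduced_def by force
 qed
 moreover have "card (A i) = card (A' i)" "finite (A' i)"
  using coord_dim[OF A' i] dim d[OF i] finite_subset[OF coord_familyD(1)[OF A' i] Bi_fin] by auto
 ultimately show ?thesis using card_subset_eq by metis
qed

end

section \<open>Torus fixed points\<close>

lemma two_powi_inj: "(2::complex) powi a = 2 powi b ==> a = b"
proof -
 assume "(2::complex) powi a = 2 powi b"
 then have "norm ((2::complex) powi a) = norm ((2::complex) powi b)" by simp
 then have "(2::real) powi a = 2 powi b" by (simp only: norm_power_int norm_numeral)
 then show "a = b"
  using power_int_strict_increasing[of a b "2::real"] power_int_strict_increasing[of b a "2::real"] by (cases a b rule: linorder_cases) simp_all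
qed

context string_basis
begin

lemma torus_act_eq:
 assumes S: "!!kp i. kp : B ==> i : verts Q ==> S kp i = cvec.span {e kp i}"
  and i: "i : verts Q" and N: "N i <= rep_space M i"
 shows "torus_act Q B S w t N i = (%y. SUM kp:B. (t powi w kp * cf i y kp) *\<^sub>C e kp i) ` N i"
proof -
 have "(EX x. z = (SUM kp:B. (t powi w kp) *\<^sub>C x kp) & (ALL kp:B. x kp : S kp i) & (SUM kp:B. x kp) : N i) \<longleftrightarrow>
  z : (%y. SUM kp:B. (t powi w kp * cf i y kp) *\<^sub>C e kp i) ` N i" for z
 proof
  assume "EX x. z = (SUM kp:B. (t powi w kp) *\<^sub>C x kp) & (ALL kp:B. x kp : S kp i) & (SUM kp:B. x kp) : N i"
  then obtain x where x: "z = (SUM kp:B. (t powi w kp) *\<^sub>C x kp)" "ALL kp:B. x kp : S kp i" "(SUM kp:B. x kp) : N i" by blast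
  have "ALL kp:B. EX c. x kp = c *\<^sub>C e kp i" using x(2) S i by (simp add: span_singleton)
  from bchoice[OF this] obtain c where c: "ALL kp:B. x kp = c kp *\<^sub>C e kp i" by (rule exE)
  have "(SUM kp:B. x kp) = (SUM kp:Bi i. c kp *\<^sub>C e kp i)" using c sum_Bi[of c i] by simp
  then have cc: "cf i (SUM kp:B. x kp) kp = c kp" if "kp : Bi i" for kp using cf_comb[OF i order_refl, of c kp] that by simp
  have "z = (SUM kp:B. (t powi w kp * cf i (SUM kp:B. x kp) kp) *\<^sub>C e kp i)"
   unfolding x(1)
  proof (rule sum.cong)
   fix kp assume k: "kp : B"
   show "(t powi w kp) *\<^sub>C x kp = (t powi w kp * cf i (SUM kp:B. x kp) kp) *\<^sub>C e kp i"
    using c k cc[of kp] by (cases "e kp i = 0") (auto simp: Bi_def)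
  qed simp
  then show "z : (%y. SUM kp:B. (t powi w kp * cf i y kp) *\<^sub>C e kp i) ` N i" using x(3) by (rule image_eqI)
 next
  assume "z : (%y. SUM kp:B. (t powi w kp * cf i y kp) *\<^sub>C e kp i) ` N i"
  then obtain y where y: "y : N i" "z = (SUM kp:B. (t powi w kp * cf i y kp) *\<^sub>C e kp i)" by blast
  have "y = (SUM kp:B. cf i y kp *\<^sub>C e kp i)" using cf_spec(1)[OF i] y(1) N sum_Bi[of "cf i y" i] by auto
  then show "EX x. z = (SUM kp:B. (t powi w kp) *\<^sub>C x kp) & (ALL kp:B. x kp : S kp i) & (SUM kp:B. x kp) : N i"
   using y S i by (intro exI[of _ "%kp. cf i y kp *\<^sub>C e kp i"]) (auto simp: span_singleton)
 qed
 then show ?thesis using i unfolding torus_act_def by simp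
qed

lemma cf_scaled: "i : verts Q ==> cf i (SUM kp:B. c kp *\<^sub>C e kp i) mu = (if mu : Bi i then c mu else 0)"
 unfolding sum_Bi by (rule cf_comb) simp_all

text \<open>For a fixed point the single element \<open>t = 2\<close> is enough: its powers are
  distinct, so \<open>N\<close> is stable under a diagonal map with distinct eigenvalues and is
  spanned by basis vectors.\<close>

lemma torus_fixed_eq:
 assumes S: "!!kp i. kp : B ==> i : verts Q ==> S kp i = cvec.span {e kp i}" and w: "inj_on w B"
 shows "torus_fixed Q B S w (quiver_grass Q M d) = {coord A | A. coord_family A & (ALL i:verts Q. card (A i) = d i)}"
proof (intro equalityI subsetI)
 fix N assume N: "N : torus_fixed Q B S w (quiver_grass Q M d)"
 have sub: "is_subrep Q M N" and dim: "!!i. i : verts Q ==> cvec.dim (N i) = d i"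
  using N unfolding torus_fixed_def quiver_grass_def by auto
 have "torus_act Q B S w 2 N = N" using N unfolding torus_fixed_def by simp
 then have stab: "(SUM kp:B. (2 powi w kp * cf i y kp) *\<^sub>C e kp i) : N i" if "i : verts Q" "y : N i" for i y
  using torus_act_eq[where S=S and N=N, OF S that(1) is_subrepD(3)[OF sub that(1)], of w 2] that(2) by auto
 have key: "cf i y kp ~= 0 ==> e kp i : N i" if i: "i : verts Q" and "y : N i" for i y kp
  using that(2)
 proof (induction "card {kp. cf i y kp ~= 0}" arbitrary: y rule: less_induct)
  case less
  have yM: "y : rep_space M i" using less(3) is_subrepD(3)[OF sub i] by blast
  have Bik: "{kp. cf i y kp ~= 0} <= Bi i" using cf_spec(2)[OF i yM] by blast
  then have k: "kp : Bi i" and fin: "finite {kp. cf i y kp ~= 0}" using less(2) finite_subset[OF _ Bi_fin] by auto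
  show ?case
  proof (cases "EX mu. cf i y mu ~= 0 & mu ~= kp")
   case True
   then obtain mu where mu: "cf i y mu ~= 0" "mu ~= kp" by blast
   \<comment> \<open>Subtracting the eigenvalue at \<open>mu\<close> from the diagonal map removes
     \<open>mu\<close> from the support and keeps \<open>kp\<close>, because the weights
     differ.\<close>
   let ?z = "(SUM kp:B. (2 powi w kp * cf i y kp) *\<^sub>C e kp i) + (- (2 powi w mu)) *\<^sub>C y"
   have zN: "?z : N i"
    by (intro cvec.subspace_add[OF is_subrepD(2)[OF sub i]] cvec.subspace_scale[OF is_subrepD(2)[OF sub i]] stab i less(3))
   have cz: "cf i ?z nu = (2 powi w nu - 2 powi w mu) * cf i y nu" for nu
    unfolding cf_add[OF i comb_in[OF i order_refl] cvec.subspace_scale[OF rep_subspace[OF repM i] yM]] cf_scale[OF i yM] cf_scaled[OF i]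
    using cf_spec(2)[OF i yM, of nu] by (auto simp: algebra_simps)
   have "{kp. cf i ?z kp ~= 0} \<subset> {kp. cf i y kp ~= 0}" unfolding cz using mu(1) by auto
   then have lt: "card {kp. cf i ?z kp ~= 0} < card {kp. cf i y kp ~= 0}" by (rule psubset_card_mono[OF fin])
   have "w kp ~= w mu" using inj_onD[OF w, of kp mu] mu Bik k BiD(1) by blast
   then have "(2::complex) powi w kp ~= 2 powi w mu" using two_powi_inj by blast
   then have "cf i ?z kp ~= 0" unfolding cz using less(2) by simp
   then show ?thesis using less(1)[OF lt _ zN] by blast
  next
   case False
   have "y = (SUM nu:Bi i. cf i y nu *\<^sub>C e nu i)" by (rule cf_spec(1)[OF i yM])
   also have "... = (SUM nu:{kp}. cf i y nu *\<^sub>C e nu i)"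
    using False k Bi_fin by (intro sum.mono_neutral_right) auto
   finally have "y = cf i y kp *\<^sub>C e kp i" by simp
   from arg_cong[OF this, of "%y'. (1 / cf i y kp) *\<^sub>C y'"]
   have "e kp i = (1 / cf i y kp) *\<^sub>C y" using less(2) by simp
   then show ?thesis using cvec.subspace_scale[OF is_subrepD(2)[OF sub i] less(3)] by simp
  qed
 qed
 define A where "A i = {kp : Bi i. e kp i : N i}" for i
 have A: "coord_family A"
  unfolding coord_family_def
 proof (intro conjI ballI subsetI)
  fix a kp assume a: "a : arcs Q" and kp: "kp : A (tail Q a) Int Bi (head Q a)"
  then have "kp : B" "e kp (tail Q a) ~= 0" "e kp (tail Q a) : N (tail Q a)" unfolding A_def Bi_def by auto
  then have "e kp (head Q a) : N (head Q a)" using is_subrepD(4)[OF sub a, of "e kp (tail Q a)"] e_map[OF a] by simp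
  then show "kp : A (head Q a)" using kp unfolding A_def by blast
 qed (auto simp: A_def)
 have eq: "N i = coord A i" if i: "i : verts Q" for i
 proof (intro equalityI subsetI)
  fix y assume y: "y : N i"
  then have yM: "y : rep_space M i" using is_subrepD(3)[OF sub i] by blast
  show "y : coord A i"
   unfolding coord_mem_iff[where A=A, OF i coord_familyD(1)[OF A i]]
   using key[OF i y] cf_spec(2)[OF i yM] yM unfolding A_def by blast
 next
  fix y assume "y : coord A i"
  moreover have "cvec.span ((%kp. e kp i) ` A i) <= N i"
   by (rule cvec.span_minimal[OF _ is_subrepD(2)[OF sub i]]) (auto simp: A_def)
  ultimately show "y : N i" using i unfolding coord_def by auto
 qed
 have "N = coord A" using is_subrepD(1)[OF sub] eq by (intro extensionalityI[of _ "verts Q"]) (auto simp: coord_def)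
 moreover have "card (A i) = d i" if "i : verts Q" for i using coord_dim[OF A that] dim[OF that] eq[OF that] by simp
 ultimately show "N : {coord A | A. coord_family A & (ALL i:verts Q. card (A i) = d i)}" using A by blast
next
 fix N assume "N : {coord A | A. coord_family A & (ALL i:verts Q. card (A i) = d i)}"
 then obtain A where N: "N = coord A" and A: "coord_family A" and d: "!!i. i : verts Q ==> card (A i) = d i" by blast
 have "torus_act Q B S w t (coord A) = coord A" if t: "t ~= 0" for t
 proof (rule extensionalityI[of _ "verts Q"])
  fix i assume i: "i : verts Q"
  note mem = coord_mem_iff[where A=A, OF i coord_familyD(1)[OF A i]]
  let ?s = "%t y. SUM kp:B. (t powi w kp * cf i y kp) *\<^sub>C e kp i"
  have sA: "?s t y : coord A i" if "y : coord A i" for t y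
   using that comb_in[OF i order_refl] unfolding mem cf_scaled[OF i] by auto
  have inv: "?s t (?s (inverse t) y) = y" if y: "y : coord A i" for y
  proof (rule cf_eqI[OF i comb_in[OF i order_refl]])
   show "y : rep_space M i" using y mem by blast
   show "cf i (?s t (?s (inverse t) y)) kp = cf i y kp" if "kp : Bi i" for kp
    unfolding cf_scaled[OF i] using that t by (simp add: power_int_inverse)
  qed
  have "?s t ` coord A i = coord A i"
  proof (intro equalityI subsetI)
   fix y assume y: "y : coord A i"
   show "y : ?s t ` coord A i" by (rule image_eqI[where x="?s (inverse t) y"]) (simp_all only: inv[OF y] sA[OF y])
  qed (use sA in auto)
  then show "torus_act Q B S w t (coord A) i = coord A i"
   using torus_act_eq[where S=S and N="coord A", OF S i] is_subrepD(3)[OF coord_subrep[OF A] i] by simp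
 qed (simp_all add: torus_act_def coord_def)
 moreover have "coord A : quiver_grass Q M d" using coord_subrep[OF A] coord_dim[OF A] d unfolding quiver_grass_def by simp
 ultimately show "N : torus_fixed Q B S w (quiver_grass Q M d)" unfolding N torus_fixed_def by blast
qed

end

section \<open>Strings as direct summands of \<open>P\<close> and \<open>I\<close>\<close>

context linear_quiver
begin

lemma string_decomposition:
 assumes M: "is_rep Q M" and dec: "indec_decomposition Q M K S" and b: "!!k. k : K ==> string_at M (S k) (b k)"
  and i: "i : verts Q"
 shows "k : K ==> b k i : rep_space M i"
  and "x : rep_space M i ==> EX c. x = (SUM k:K. c k *\<^sub>C b k i)"
  and "(SUM k:K. c k *\<^sub>C b k i) = 0 ==> k : K ==> b k i ~= 0 ==> c k = 0"
proof -
 have D: "is_subrep Q M (S k)" if "k : K" for k using dec that unfolding indec_decomposition_def by simp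
 have U: "EX! y. y : (\<Pi>\<^sub>E k\<in>K. S k i) & x = (SUM k:K. y k)" if "x : rep_space M i" for x
  using dec that i unfolding indec_decomposition_def by simp
 have S: "S k i = cvec.span {b k i}" if "k : K" for k using b[OF that] i unfolding string_at_def by simp
 show "b k i : rep_space M i" if "k : K" for k
  using is_subrepD(3)[OF D[OF that] i] S[OF that] cvec.span_base[of "b k i" "{b k i}"] by auto
 show "EX c. x = (SUM k:K. c k *\<^sub>C b k i)" if x: "x : rep_space M i" for x
 proof -
  obtain y where y: "y : (\<Pi>\<^sub>E k\<in>K. S k i)" "x = (SUM k:K. y k)" using U[OF x] by blast
  have "ALL k:K. EX c. y k = c *\<^sub>C b k i" using y(1) S by (auto simp: PiE_iff span_singleton)
  from bchoice[OF this] obtain c where c: "ALL k:K. y k = c k *\<^sub>C b k i" by (rule exE)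
  then show ?thesis unfolding y(2) by (intro exI[of _ c] sum.cong) auto
 qed
 show "c k = 0" if z: "(SUM k:K. c k *\<^sub>C b k i) = 0" and k: "k : K" "b k i ~= 0" for c k
 proof -
  let ?y = "\<lambda>k\<in>K. c k *\<^sub>C b k i" and ?z = "\<lambda>k\<in>K. 0"
  have "?y : (\<Pi>\<^sub>E k\<in>K. S k i) & 0 = (SUM k:K. ?y k)" using z S by (auto simp: span_singleton)
  moreover have "?z : (\<Pi>\<^sub>E k\<in>K. S k i) & 0 = (SUM k:K. ?z k)" using S by (auto simp: cvec.span_zero)
  ultimately have "?y = ?z" using U[OF cvec.subspace_0[OF rep_subspace[OF M i]]] by blast
  from fun_cong[OF this, of k] have "c k *\<^sub>C b k i = 0" using k(1) by simp
  then show ?thesis using k(2) by simp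
 qed
qed

text \<open>A string is determined up to isomorphism by its support: sending basis vectors to basis
  vectors commutes with the arcs.\<close>

lemma strings_isomorphic:
 assumes M: "is_rep Q M" and U: "is_subrep Q M U" "is_subrep Q M U'" and b: "string_at M U b" "string_at M U' b'"
  and supp: "!!i. i : verts Q ==> b i ~= 0 \<longleftrightarrow> b' i ~= 0"
 shows "rep_isomorphic Q (subrep M U) (subrep M U')"
proof -
 have sp: "U i = cvec.span {b i}" "U' i = cvec.span {b' i}" if "i : verts Q" for i using b that unfolding string_at_def by auto
 have bm: "rep_map M a (b (tail Q a)) = b (head Q a) & rep_map M a (b' (tail Q a)) = b' (head Q a)"
  if "a : arcs Q" "b (tail Q a) ~= 0" for a
  using b supp[OF tail_in_verts] that unfolding string_at_def by auto
 have "EX g. clinear_on UNIV g & g (b i) = b' i" if "i : verts Q" for i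
 proof (cases "b i = 0")
  case True
  then show ?thesis using supp[OF that] by (intro exI[of _ "%_. 0"]) (simp add: clinear_on_def)
 next
  case False
  then have "cvec.independent {b i}" by simp
  then obtain g where "clinear_on UNIV g" "!!x. x : {b i} ==> g x = b' i"
   by (rule clinear_on_exists_on_basis[where f="%_. b' i"]) (rule that)
  then show ?thesis by blast
 qed
 then obtain g where g: "!!i. i : verts Q ==> clinear_on UNIV (g i) & g i (b i) = b' i" by metis
 have gs: "g i (c *\<^sub>C b i) = c *\<^sub>C b' i" if "i : verts Q" for i c
  using clinear_on_scale[of UNIV "g i" "b i" c] g[OF that] by simp
 let ?f = "\<lambda>i\<in>verts Q. \<lambda>x\<in>rep_space (subrep M U) i. g i x"
 have "?f : rep_iso Q (subrep M U) (subrep M U')"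
 proof (rule rep_isoI)
  show "?f : rep_Hom Q (subrep M U) (subrep M U')"
  proof (rule rep_HomI[OF _ _ _ wf is_rep_subrep[OF wf M U(1)]])
   show "g i x : rep_space (subrep M U') i" if "i : verts Q" "x : rep_space (subrep M U) i" for i x
    using that gs sp by (auto simp: span_singleton)
   show "clinear_on (rep_space (subrep M U) i) (g i)" if "i : verts Q" for i
    using clinear_on_subset g[OF that] by blast
   fix a x assume a: "a : arcs Q" and x: "x : rep_space (subrep M U) (tail Q a)"
   note t = tail_in_verts[OF a] and h = head_in_verts[OF a]
   obtain c where c: "x = c *\<^sub>C b (tail Q a)" using x sp(1)[OF t] by (auto simp: span_singleton)
   have bM: "b (tail Q a) : rep_space M (tail Q a)" "b' (tail Q a) : rep_space M (tail Q a)"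
    by (rule subsetD[OF is_subrepD(3)[OF U(1) t]], simp add: sp[OF t] cvec.span_base)
     (rule subsetD[OF is_subrepD(3)[OF U(2) t]], simp add: sp[OF t] cvec.span_base)
   note s = clinear_on_scale[OF rep_map_clinear[OF M a]]
   show "g (head Q a) (rep_map (subrep M U) a x) = rep_map (subrep M U') a (g (tail Q a) x)"
   proof (cases "b (tail Q a) = 0")
    case True
    then have "b' (tail Q a) = 0" using supp[OF t] by blast
    then show ?thesis using True c gs[OF t] gs[OF h, of 0] clinear_on_0[OF rep_map_clinear[OF M a] rep_subspace[OF M t]] by simp
   next
    case False
    then show ?thesis using c gs[OF t] gs[OF h] s[OF bM(1)] s[OF bM(2)] bm[OF a] by simp
   qed
  qed
  fix i assume i: "i : verts Q"
  have "inj_on (g i) (cvec.span {b i})"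
   using gs[OF i] supp[OF i] by (intro inj_onI) (auto simp: span_singleton)
  moreover have "g i ` cvec.span {b i} = cvec.span {b' i}"
   using clinear_on_image_span[of "{b i}" "g i", OF clinear_on_subset[of UNIV]] g[OF i] by simp
  ultimately show "bij_betw (?f i) (rep_space (subrep M U) i) (rep_space (subrep M U') i)"
   using i sp[OF i] by (auto simp: bij_betw_def inj_on_def)
 qed
 then show ?thesis unfolding rep_isomorphic_def by blast
qed

end

text \<open>Strings of \<open>P\<close> run from \<open>p k\<close> to \<open>n\<close>, those of
  \<open>I\<close> from 1 to \<open>q l\<close>. The key \<open>n + p k\<close> exceeds every
  \<open>q l\<close>, which puts the strings of \<open>I\<close> first; \<open>rh\<close> refines
  the key to a linear order.\<close>

locale string_sum = linear_quiver Q n pos + block_action Q P I r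
 for Q :: "('v, 'e) pre_digraph" and n pos and P :: "('v, 'e, 'a::complex_vector) rep" and I :: "('v, 'e, 'b::complex_vector) rep" and r +
 fixes K :: "nat set" and S and L :: "nat set" and T b p c q and rh :: "nat + nat => nat"
 assumes decP: "indec_decomposition Q P K S" and decI: "indec_decomposition Q I L T"
  and b: "k : K ==> string_at P (S k) (b k)" and p: "k : K ==> i : verts Q ==> b k i ~= 0 \<longleftrightarrow> p k <= pos i"
  and c: "l : L ==> string_at I (T l) (c l)" and q: "l : L ==> i : verts Q ==> c l i ~= 0 \<longleftrightarrow> pos i <= q l"
  and pn: "k : K ==> 1 <= p k & p k <= n" and qn: "l : L ==> 1 <= q l & q l <= n"
  and rh_inj: "inj_on rh (K <+> L)"
  and rh_key: "mu : K <+> L ==> kp : K <+> L ==> rh mu < rh kp ==>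
   case_sum (%k. n + p k) q mu <= case_sum (%k. n + p k) q kp"
begin

definition e :: "nat + nat => 'v => 'a \<times> 'b" where "e = case_sum (%k i. (b k i, 0)) (%l i. (0, c l i))"

lemma e_simps [simp]: "e (Inl k) i = (b k i, 0)" "e (Inr l) i = (0, c l i)"
 unfolding e_def by simp_all

lemma finKL: "finite K" "finite L" using decP decI unfolding indec_decomposition_def by simp_all

lemma sumB: "(SUM kp:K <+> L. x kp *\<^sub>C e kp i) = (SUM k:K. x (Inl k) *\<^sub>C b k i, SUM l:L. x (Inr l) *\<^sub>C c l i)"
 using finKL by (simp add: sum.Plus comp_def prod_eq_iff fst_sum snd_sum scaleC_prod_def)

lemmas decompP = string_decomposition[OF repP decP b]

lemmas decompI = string_decomposition[OF repI decI c]

lemma e_nonzero: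
 "kp : K <+> L ==> i : verts Q ==> e kp i ~= 0 \<longleftrightarrow> (case kp of Inl k => p k <= pos i | Inr l => pos i <= q l)"
 using p q by (cases kp) (auto simp: zero_prod_def)

sublocale string_basis Q n pos "rep_sum P I" "K <+> L" rh e
proof
 show "is_rep Q (rep_sum P I)" by (rule repS)
 show "finite (K <+> L)" using finKL by simp
 show "inj_on rh (K <+> L)" by (rule rh_inj)
next
 fix kp i assume "kp : K <+> L" "i : verts Q"
 then show "e kp i : rep_space (rep_sum P I) i"
  using decompP(1) decompI(1) cvec.subspace_0[OF rep_subspace[OF repP]] cvec.subspace_0[OF rep_subspace[OF repI]]
  by (cases kp) auto
next
 fix i x kp assume i: "i : verts Q" and s: "(SUM kp:K <+> L. x kp *\<^sub>C e kp i) = 0" and k: "kp : K <+> L" "e kp i ~= 0"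
 have "(SUM k:K. x (Inl k) *\<^sub>C b k i) = 0" "(SUM l:L. x (Inr l) *\<^sub>C c l i) = 0"
  using s unfolding sumB by (simp_all add: zero_prod_def)
 then show "x kp = 0"
  using decompP(3)[OF _ i, of "%k. x (Inl k)"] decompI(3)[OF _ i, of "%l. x (Inr l)"] k
  by (cases kp) (auto simp: zero_prod_def)
next
 fix i z assume i: "i : verts Q" and z: "z : rep_space (rep_sum P I) i"
 then have "fst z : rep_space P i" "snd z : rep_space I i" by auto
 then obtain x y where "fst z = (SUM k:K. x k *\<^sub>C b k i)" "snd z = (SUM l:L. y l *\<^sub>C c l i)"
  using decompP(2)[OF _ i] decompI(2)[OF _ i] by meson
 then show "EX c. z = (SUM kp:K <+> L. c kp *\<^sub>C e kp i)"
  unfolding sumB by (intro exI[of _ "case_sum x y"]) (simp add: prod_eq_iff)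
next
 fix a kp assume a: "a : arcs Q" and k: "kp : K <+> L" "e kp (tail Q a) ~= 0"
 have z: "rep_map P a 0 = 0" "rep_map I a 0 = 0"
  using clinear_on_0[OF rep_map_clinear[OF _ a] rep_subspace[OF _ tail_in_verts[OF a]]] repP repI by blast+
 show "rep_map (rep_sum P I) a (e kp (tail Q a)) = e kp (head Q a)"
  using k b c a z unfolding string_at_def by (cases kp) (auto simp: zero_prod_def)
next
 fix a kp mu assume a: "a : arcs Q" and km: "kp : K <+> L" "mu : K <+> L" "rh mu < rh kp"
 note t = tail_in_verts[OF a] and h = head_in_verts[OF a]
 note key = rh_key[OF km(2,1,3)] and nz = e_nonzero[OF _ t] e_nonzero[OF _ h]
 \<comment> \<open>Only strings of \<open>I\<close> end before \<open>n\<close>, and a lower one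
   ends no later.\<close>
 show "e mu (head Q a) = 0" if "e kp (tail Q a) ~= 0" "e kp (head Q a) = 0" "e mu (tail Q a) ~= 0"
  using that nz[OF km(1)] nz[OF km(2)] key pos_head[OF a] km(1,2) qn pn
  by (cases kp; cases mu) force+
 \<comment> \<open>A lower string of \<open>P\<close> starts no later, and strings of
   \<open>I\<close> start at the first vertex.\<close>
 show "e mu (tail Q a) ~= 0" if "e kp (tail Q a) ~= 0" "e kp (head Q a) ~= 0" "e mu (head Q a) ~= 0"
  using that nz[OF km(1)] nz[OF km(2)] key pos_head[OF a] km(1,2) qn pn
  by (cases kp; cases mu) force+
next
 fix kp i j l assume k: "kp : K <+> L" and ij: "i : verts Q" "j : verts Q" "l : verts Q"
  and "e kp i ~= 0" "e kp l ~= 0" "pos i <= pos j" "pos j <= pos l"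
 then show "e kp j ~= 0"
  using e_nonzero[OF k ij(1)] e_nonzero[OF k ij(2)] e_nonzero[OF k ij(3)] by (cases kp) auto
qed

lemma fst_image_zero:
 assumes g: "g : block_subgroup Q P I" and i: "i : verts Q" and l: "l : L"
 shows "fst (g i (e (Inr l) i)) = 0"
 using g i decompI(1)[OF _ i l] unfolding block_subgroup_iff[OF wf repP repI] by simp

lemma cf_Inl: 
 assumes i: "i : verts Q" and z: "z : rep_space (rep_sum P I) i" "fst z = 0"
 shows "cf i z (Inl k) = 0"
proof -
 obtain y where y: "snd z = (SUM l:L. y l *\<^sub>C c l i)" using decompI(2)[OF _ i] z(1) by (metis mem_Times_iff rep_sum_simps(1))
 have "z = (SUM kp:K <+> L. case_sum (%_. 0) y kp *\<^sub>C e kp i)" unfolding sumB using y z(2) by (simp add: prod_eq_iff)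
 then show ?thesis using cf_scaled[OF i, of "case_sum (%_. 0) y" "Inl k"] by simp
qed

text \<open>Below a string of \<open>I\<close> there are only strings of \<open>I\<close>, so
  vectors of \<open>0 \<times> I\<close> acquire no component in \<open>P\<close>.\<close>

lemma unip_block: "unip x : block_subgroup Q P I"
 unfolding block_subgroup_iff[OF wf repP repI]
proof (intro conjI ballI unip_iso)
 fix i y assume i: "i : verts Q" and y: "y : rep_space I i"
 have z: "(0, y) : rep_space (rep_sum P I) i" using y cvec.subspace_0[OF rep_subspace[OF repP i]] by simp
 have f0: "fst (cf i (0, y) kp *\<^sub>C unip_vec x i kp) = 0" if k: "kp : Bi i" for kp
 proof (cases kp)
  case (Inl k)
  then show ?thesis using cf_Inl[OF i z] by simp
 next
  case (Inr l)
  have "fst (e mu i) = 0" if mu: "mu : below kp i" for mu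
  proof (cases mu)
   case (Inl k')
   then show ?thesis using mu rh_key[of mu kp] k Inr qn pn[of k'] unfolding below_def Bi_def by force
  qed simp
  then show ?thesis using Inr unfolding unip_vec_def by (simp add: scaleC_prod_def fst_sum)
 qed
 show "fst (unip x i (0, y)) = 0" using i z f0 unfolding unip_def by (simp add: fst_sum)
qed

text \<open>Naturality of \<open>g\<close> in coordinates: a matrix entry keeps its value along an
  arc as long as both strings go on.\<close>

lemma cf_arc:
 assumes g: "g : rep_Hom Q (rep_sum P I) (rep_sum P I)" and a: "a : arcs Q" and k: "kp : Bi (tail Q a)"
 shows "(if mu : Bi (head Q a) then cf (tail Q a) (g (tail Q a) (e kp (tail Q a))) mu else 0) =
  cf (head Q a) (g (head Q a) (e kp (head Q a))) mu"
proof -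
 note t = tail_in_verts[OF a] and e = e_in[OF BiD(1)[OF k] tail_in_verts[OF a]]
 show ?thesis
  using cf_map[OF a rep_HomD(1)[OF g t e], of mu] rep_HomD(3)[OF g a e] e_map[OF a BiD[OF k]] by simp
qed

text \<open>An entry is followed along the arcs until one string is missing. Between strings of
  \<open>I\<close> one moves right, past the end of the shorter source, while the target goes on;
  between strings of \<open>P\<close> one moves left, before the start of the target, while the
  source is present. Distinct endpoints exclude ties, and the block form excludes entries from
  \<open>I\<close> to \<open>P\<close>.\<close>

lemma triangular:
 assumes g: "g : block_subgroup Q P I" and inj: "inj_on p K" "inj_on q L"
  and i: "i : verts Q" and k: "kp : Bi i" and m: "mu : Bi i" and lt: "rh kp < rh mu"
 shows "cf i (g i (e kp i)) mu = 0"
proof -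
 have gH: "g : rep_Hom Q (rep_sum P I) (rep_sum P I)" using g rep_iso_Hom unfolding block_subgroup_iff[OF wf repP repI] by blast
 note kB = BiD(1)[OF k] and mB = BiD(1)[OF m]
 have key: "case_sum (%k. n + p k) q kp <= case_sum (%k. n + p k) q mu" by (rule rh_key[OF kB mB lt])
 have ne: "kp ~= mu" using lt by auto
 have zero: "cf j (g j 0) mu = 0" if j: "j : verts Q" for j
  using clinear_on_0[OF rep_HomD(2)[OF gH j] rep_subspace[OF repS j]] cf_zero[OF j] by simp
 show ?thesis
 proof (cases kp)
  case kp: (Inr l)
  have l: "l : L" using kB kp by auto
  show ?thesis
  proof (cases mu)
   case (Inl k')
   then show ?thesis using cf_Inl[OF i rep_HomD(1)[OF gH i e_in[OF kB i]]] fst_image_zero[OF g i l] kp by simp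
  next
   case mu: (Inr l')
   have l': "l' : L" using mB mu by auto
   have lt: "q l < q l'" using key ne inj(2) l l' unfolding kp mu inj_on_def by (auto simp: le_less)
   have B: "Inr l'' : Bi j \<longleftrightarrow> pos j <= q l''" if "j : verts Q" "l'' : L" for j l''
    using e_nonzero[of "Inr l''" j] that unfolding Bi_def by auto
   \<comment> \<open>Induction on the distance \<open>d\<close> from the vertex to the end of the
     string \<open>l\<close>.\<close>
   have "ALL i:verts Q. pos i <= q l --> d = q l - pos i --> cf i (g i (e kp i)) mu = 0" for d
   proof (induction d)
    case 0
    show ?case
    proof (intro ballI impI)
     fix i assume i: "i : verts Q" "pos i <= q l" "0 = q l - pos i"
     have "1 <= q l + 1" "q l + 1 <= n" using lt qn[OF l'] by auto
     then obtain j where j: "j : verts Q" "pos j = q l + 1" using vertex_at by blast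
     obtain a where a: "a : arcs Q" "tail Q a = i" "head Q a = j" by (rule arc_between[OF i(1) j(1)]) (use i j in auto)
     have "e kp j = 0" using e_nonzero[OF kB j(1)] kp j(2) by auto
     then show "cf i (g i (e kp i)) mu = 0"
      using cf_arc[OF gH a(1), of kp mu] B i j l l' lt zero[OF j(1)] kp mu a by simp
    qed
   next
    case (Suc d)
    show ?case
    proof (intro ballI impI)
     fix i assume i: "i : verts Q" "pos i <= q l" "Suc d = q l - pos i"
     have "1 <= pos i + 1" "pos i + 1 <= n" using i(3) qn[OF l] by auto
     then obtain j where j: "j : verts Q" "pos j = pos i + 1" using vertex_at by blast
     obtain a where a: "a : arcs Q" "tail Q a = i" "head Q a = j" by (rule arc_between[OF i(1) j])
     have "cf j (g j (e kp j)) mu = 0" using Suc i j by auto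
     then show "cf i (g i (e kp i)) mu = 0"
      using cf_arc[OF gH a(1), of kp mu] B i j l l' lt kp mu a by simp
    qed
   qed
   then show ?thesis using i k B[OF i l] kp by auto
  qed
 next
  case kp: (Inl k1)
  have k1: "k1 : K" using kB kp by auto
  obtain k2 where mu: "mu = Inl k2" using key qn mB pn[OF k1] unfolding kp by (cases mu) force+
  have k2: "k2 : K" using mB mu by auto
  have lt: "p k1 < p k2" using key ne inj(1) k1 k2 unfolding kp mu inj_on_def by (auto simp: le_less)
  have B: "Inl k : Bi j \<longleftrightarrow> p k <= pos j" if "j : verts Q" "k : K" for j k
   using e_nonzero[of "Inl k" j] that unfolding Bi_def by auto
  have "p k2 <= pos i --> cf i (g i (e kp i)) mu = 0"
   using i
  proof (induction i rule: vertex_induct)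
   case (step i)
   show ?case
   proof
    assume le: "p k2 <= pos i"
    have "1 <= pos i - 1" "pos i - 1 <= n" "pos i = pos i - 1 + 1" using le lt pn[OF k1] pos_range[OF step(1)] by auto
    then obtain t where t: "t : verts Q" "pos i = pos t + 1" using vertex_at[of "pos i - 1"] by force
    obtain a where a: "a : arcs Q" "tail Q a = t" "head Q a = i" by (rule arc_between[OF t(1) step(1) t(2)])
    have "cf t (g t (e kp t)) mu = 0"
    proof (cases "p k2 <= pos t")
     case True
     then show ?thesis using step(2)[of a] a by (simp add: in_arcs_def)
    next
     case False
     have "e kp t : rep_space (rep_sum P I) t" by (rule e_in[OF kB t(1)])
     then show ?thesis using cf_spec(2)[OF t(1) rep_HomD(1)[OF gH t(1)]] B[OF t(1) k2] mu False by simp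
    qed
    then show "cf i (g i (e kp i)) mu = 0"
     using cf_arc[OF gH a(1), of kp mu] B k1 t step(1) k2 lt le kp mu a by auto
   qed
  qed
  then show ?thesis using i m B[OF i k2] mu by auto
 qed
qed

text \<open>The inverse of \<open>g\<close> is triangular too, so the product of the two diagonal
  entries at \<open>kp\<close> is 1 and both are nonzero.\<close>

lemma leads_image:
 assumes g: "g : block_subgroup Q P I" and inj: "inj_on p K" "inj_on q L" and i: "i : verts Q" and k: "kp : Bi i"
 shows "leads i kp (g i (e kp i))"
proof -
 let ?M = "rep_sum P I"
 note iff = block_subgroup_iff[OF wf repP repI]
 have gi: "g : rep_iso Q ?M ?M" using g unfolding iff by blast
 note gH = rep_iso_Hom[OF gi] and ek = e_in[OF BiD(1)[OF k] i]
 let ?h = "rep_inv Q ?M ?M g"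
 have h: "?h : block_subgroup Q P I"
  using subgroup.m_inv_closed[OF subgroup_block_subgroup[OF wf repP repI] g] inv_Aut_group[OF wf repS gi] by simp
 have hH: "?h : rep_Hom Q ?M ?M" using h rep_iso_Hom unfolding iff by blast
 note ge = rep_HomD(1)[OF gH i ek]
 have "?h i (g i (e kp i)) = e kp i" by (rule rep_inv_apply(1)[OF gi i ek])
 then have "1 = cf i (?h i (SUM mu:Bi i. cf i (g i (e kp i)) mu *\<^sub>C e mu i)) kp"
  using cf_spec(1)[OF i ge] cf_e[OF i k, of kp] by simp
 also have "... = cf i (SUM mu:Bi i. cf i (g i (e kp i)) mu *\<^sub>C ?h i (e mu i)) kp"
 proof -
  have "?h i (SUM mu:Bi i. cf i (g i (e kp i)) mu *\<^sub>C e mu i) = (SUM mu:Bi i. ?h i (cf i (g i (e kp i)) mu *\<^sub>C e mu i))"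
   by (rule clinear_on_sum[OF rep_HomD(2)[OF hH i] rep_subspace[OF repM i] cvec.subspace_scale[OF rep_subspace[OF repM i] e_in[OF BiD(1) i]]])
  also have "... = (SUM mu:Bi i. cf i (g i (e kp i)) mu *\<^sub>C ?h i (e mu i))"
   by (intro sum.cong refl clinear_on_scale[OF rep_HomD(2)[OF hH i] e_in[OF BiD(1) i]])
  finally show ?thesis by simp
 qed
 also have "... = (SUM mu:Bi i. cf i (g i (e kp i)) mu * cf i (?h i (e mu i)) kp)"
  by (rule cf_sum[OF i rep_HomD(1)[OF hH i e_in[OF BiD(1) i]]])
 also have "... = (SUM mu:{kp}. cf i (g i (e kp i)) mu * cf i (?h i (e mu i)) kp)"
 proof (rule sum.mono_neutral_right[OF Bi_fin])
  show "ALL mu:Bi i - {kp}. cf i (g i (e kp i)) mu * cf i (?h i (e mu i)) kp = 0"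
  proof
   fix mu assume m: "mu : Bi i - {kp}"
   then have "rh mu ~= rh kp" using inj_onD[OF rh_inj, of mu kp] BiD(1) k by blast
   then consider "rh kp < rh mu" | "rh mu < rh kp" by linarith
   then show "cf i (g i (e kp i)) mu * cf i (?h i (e mu i)) kp = 0"
    using triangular[OF g inj i k] triangular[OF h inj i _ k] m by cases auto
  qed
 qed (use k in simp)
 finally have "cf i (g i (e kp i)) kp ~= 0" by auto
 then show ?thesis unfolding leads_def using ge triangular[OF g inj i k] by blast
qed

end

context string_sum
begin

lemma summands_span: "kp : K <+> L ==> i : verts Q ==> sum_summands Q S T kp i = cvec.span {e kp i}"
proof -
 assume k: "kp : K <+> L" and i: "i : verts Q"
 have "S k i = cvec.span {b k i}" if "k : K" for k using b[OF that] i unfolding string_at_def by simp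
 moreover have "T l i = cvec.span {c l i}" if "l : L" for l using c[OF that] i unfolding string_at_def by simp
 ultimately show ?thesis
  using k i unfolding sum_summands_def
  by (cases kp) (auto simp: span_singleton scaleC_prod_def)
qed

text \<open>Strings of \<open>P\<close> with the same start, or of \<open>I\<close> with the same
  end, have the same support and so are isomorphic.\<close>

lemma multiplicity_free_inj:
 assumes "multiplicity_free Q P K S" "multiplicity_free Q I L T"
 shows "inj_on p K" "inj_on q L"
proof -
 have D: "is_subrep Q P (S k)" if "k : K" for k using decP that unfolding indec_decomposition_def by simp
 have E: "is_subrep Q I (T l)" if "l : L" for l using decI that unfolding indec_decomposition_def by simp
 show "inj_on p K"
 proof (rule inj_onI)
  fix k k' assume k: "k : K" "k' : K" "p k = p k'"
  then have "rep_isomorphic Q (subrep P (S k)) (subrep P (S k'))"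
   using p by (intro strings_isomorphic[OF repP D D b b]) simp_all
  then show "k = k'" using assms(1) k unfolding multiplicity_free_def by blast
 qed
 show "inj_on q L"
 proof (rule inj_onI)
  fix l l' assume l: "l : L" "l' : L" "q l = q l'"
  then have "rep_isomorphic Q (subrep I (T l)) (subrep I (T l'))"
   using q by (intro strings_isomorphic[OF repI E E c c]) simp_all
  then show "l = l'" using assms(2) l unfolding multiplicity_free_def by blast
 qed
qed

abbreviation "dims A == coord_family A & (ALL i:verts Q. card (A i) = dim_vec_of P i)"

lemma coord_Gr: "dims A ==> coord A : Gr"
 using coord_subrep coord_dim unfolding quiver_grass_def by simp

lemma orbit_coord: "dims A ==> orbit G act (coord A) = (%g. \<lambda>i\<in>verts Q. g i ` coord A i) ` block_subgroup Q P I"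
 using coord_Gr[of A] unfolding orbit_def grass_act_def by auto

text \<open>Every orbit meets \<open>Fix\<close> by elimination with unitriangular elements, which
  lie in the group in any case. Absence of multiplicities makes the whole group triangular; orbits
  are then cells, and a cell contains only one coordinate subrepresentation.\<close>

lemma fixed_orbits:
 assumes w: "inj_on w (K <+> L)"
 defines "Fix == torus_fixed Q (K <+> L) (sum_summands Q S T) w Gr"
 shows "orbit G act ` Fix = orbits G Gr act"
  and "multiplicity_free Q P K S ==> multiplicity_free Q I L T ==>
   (ALL X:orbits G Gr act. is_cell (quiver_grass_variety Q (rep_sum P I) (dim_vec_of P)) X) &
   bij_betw (orbit G act) Fix (orbits G Gr act)"
proof -
 have Fix: "Fix = {coord A | A. dims A}"
  unfolding Fix_def by (rule torus_fixed_eq[OF summands_span w])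
 show orb: "orbit G act ` Fix = orbits G Gr act"
 proof (intro equalityI subsetI)
  fix X assume "X : orbit G act ` Fix"
  then show "X : orbits G Gr act" using coord_Gr unfolding Fix orbits_def by blast
 next
  fix X assume "X : orbits G Gr act"
  then obtain N where N: "N : Gr" and X: "X = orbit G act N" unfolding orbits_def by blast
  note sub = GrD(1)[OF N]
  let ?A = "pivots N"
  have "card (?A i) = dim_vec_of P i" if "i : verts Q" for i
   using pivots_card[OF sub that] N that unfolding quiver_grass_def by simp
  then have A: "dims ?A" using pivots_coord_family[OF sub] by simp
  obtain x where x: "!!i. i : verts Q ==> N i = unip x i ` coord ?A i" by (rule subrep_eq_unip_coord[OF sub]) (rule that)
  have "N = (\<lambda>i\<in>verts Q. unip x i ` coord ?A i)"
   using x is_subrepD(1)[OF sub] by (intro extensionalityI[of _ "verts Q"]) auto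
  then have "N : orbit G act (coord ?A)" unfolding orbit_coord[OF A] using unip_block by (rule image_eqI)
  then have "class_pair Q P I N = class_pair Q P I (coord ?A)" by (rule orbit_imp_class_pair_eq[OF coord_Gr[OF A]])
  then have "X = orbit G act (coord ?A)" using orbit_eq_iff[OF N coord_Gr[OF A]] X by simp
  moreover have "coord ?A : Fix" using A unfolding Fix by blast
  ultimately show "X : orbit G act ` Fix" by (rule image_eqI)
 qed
 assume "multiplicity_free Q P K S" "multiplicity_free Q I L T"
 note inj = multiplicity_free_inj[OF this]
 have cell: "string_cell Q n pos (rep_sum P I) (K <+> L) rh e A (dim_vec_of P)" if "dims A" for A
  using that by unfold_locales auto
 have orbit_cell: "orbit G act (coord A) = string_cell.cell Q (rep_sum P I) (K <+> L) rh e A (dim_vec_of P)" if A: "dims A" for A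
  unfolding orbit_coord[OF A]
  by (rule string_cell.triangular_orbit_eq_cell[OF cell[OF A]])
   (use block_subgroup_iff[OF wf repP repI] unip_block leads_image[OF _ inj] in auto)
 show "(ALL X:orbits G Gr act. is_cell (quiver_grass_variety Q (rep_sum P I) (dim_vec_of P)) X) &
   bij_betw (orbit G act) Fix (orbits G Gr act)"
 proof (intro conjI ballI)
  fix X assume "X : orbits G Gr act"
  then obtain A where A: "dims A" "X = orbit G act (coord A)" unfolding orb[symmetric] Fix by blast
  show "is_cell (quiver_grass_variety Q (rep_sum P I) (dim_vec_of P)) X"
   unfolding A(2) orbit_cell[OF A(1)] by (rule string_cell.is_cell_cell[OF cell[OF A(1)]])
 next
  have "inj_on (orbit G act) Fix"
  proof (rule inj_onI)
   fix N N' assume "N : Fix" "N' : Fix" and eq: "orbit G act N = orbit G act N'"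
   then obtain A A' where A: "dims A" "N = coord A" and A': "dims A'" "N' = coord A'" unfolding Fix by blast
   interpret group_action G Gr act by (rule group_action_G)
   have "coord A' : string_cell.cell Q (rep_sum P I) (K <+> L) rh e A (dim_vec_of P)"
    using orbit_refl[OF coord_Gr[OF A'(1)]] eq A(2) A'(2) orbit_cell[OF A(1)] by simp
   then have "A' i = A i" if "i : verts Q" for i
    using string_cell.coord_in_cell_imp_eq[OF cell[OF A(1)]] A'(1) that by blast
   then show "N = N'" unfolding A(2) A'(2) coord_def by (intro restrict_ext) simp
  qed
  then show "bij_betw (orbit G act) Fix (orbits G Gr act)" using orb unfolding bij_betw_def by blast
 qed
qed

end

text \<open>The key times the size of \<open>B\<close> plus a number below that size: lexicographic
  order with an arbitrary tie-break.\<close>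

lemma refine_to_injective:
 fixes key :: "'a => nat"
 assumes "finite B"
 shows "EX rh :: 'a => nat. inj_on rh B & (ALL mu:B. ALL kp:B. rh mu < rh kp --> key mu <= key kp)"
proof -
 obtain g where g: "bij_betw g B {0..<card B}" using ex_bij_betw_finite_nat[OF assms] by blast
 let ?r = "%x. key x * card B + g x"
 have gl: "g x < card B" if "x : B" for x using bij_betw_apply[OF g that] by simp
 show ?thesis
 proof (intro exI[of _ ?r] conjI ballI impI)
  show "inj_on ?r B"
  proof (rule inj_onI)
   fix x y assume xy: "x : B" "y : B" "?r x = ?r y"
   have "g x = ?r x mod card B" using gl[OF xy(1)] by simp
   also have "... = g y" unfolding xy(3) using gl[OF xy(2)] by simp
   finally show "x = y" using bij_betw_imp_inj_on[OF g] xy unfolding inj_on_def by blast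
  qed
  fix x y assume xy: "x : B" "y : B" "?r x < ?r y"
  show "key x <= key y"
  proof (rule ccontr)
   assume "~ key x <= key y"
   then have "(key y + 1) * card B <= key x * card B" by (intro mult_le_mono1) simp
   then show False using xy(3) gl[OF xy(2)] by simp
  qed
 qed
qed

locale linear_block = linear_quiver Q n pos + block_action Q P I r
 for Q :: "('v, 'e) pre_digraph" and n pos and P :: "('v, 'e, 'a::complex_vector) rep" and I :: "('v, 'e, 'b::complex_vector) rep" and r
begin

text \<open>At most one arc enters a vertex, so joint injectivity is injectivity of each map, and it
  passes to subrepresentations.\<close>

lemma projective_string:
 assumes dec: "indec_decomposition Q P K S" and k: "k : K"
 shows "EX b p. string_at P (S k) b & 1 <= p & p <= n & (ALL i:verts Q. b i ~= 0 \<longleftrightarrow> p <= pos i)"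
proof -
 have sub: "is_subrep Q P (S k)" and ind: "indecomposable_rep Q (subrep P (S k))"
  using dec k unfolding indec_decomposition_def by auto
 have "inj_on (rep_map (subrep P (S k)) a) (rep_space (subrep P (S k)) (tail Q a))" if a: "a : arcs Q" for a
 proof -
  note t = tail_in_verts[OF a] and h = head_in_verts[OF a]
  have "x = 0" if x: "x : rep_space P (tail Q a)" "rep_map P a x = 0" for x
  proof -
   have "in_arcs Q (head Q a) = {a}" using arc_unique[OF _ a] a by (auto simp: in_arcs_def)
   then show ?thesis using in_arcs_injectiveD[OF injP h, of "%_. x" a] x by simp
  qed
  then show ?thesis
   using clinear_on_inj_iff[OF clinear_on_subset[OF rep_map_clinear[OF repP a] is_subrepD(3)[OF sub t]] is_subrepD(2)[OF sub t]]
    is_subrepD(3)[OF sub t] by auto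
 qed
 from string_of_injective[OF ind this] obtain b p where "string_at (subrep P (S k)) (rep_space (subrep P (S k))) b" "1 <= p" "p <= n"
  "!!i. i : verts Q ==> b i ~= 0 \<longleftrightarrow> p <= pos i" by blast
 then show ?thesis unfolding string_at_def by (intro exI[of _ b] exI[of _ p]) auto
qed

text \<open>Surjectivity does not pass to arbitrary subrepresentations; for a summand it follows by
  decomposing a preimage of \<open>y\<close> and comparing the two resulting decompositions of
  \<open>y\<close>.\<close>

lemma injective_string:
 assumes dec: "indec_decomposition Q I L T" and l: "l : L"
 shows "EX c q. string_at I (T l) c & 1 <= q & q <= n & (ALL i:verts Q. c i ~= 0 \<longleftrightarrow> pos i <= q)"
proof -
 have sub: "is_subrep Q I (T l)" if "l : L" for l using dec that unfolding indec_decomposition_def by auto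
 have ind: "indecomposable_rep Q (subrep I (T l))" and fin: "finite L"
  using dec l unfolding indec_decomposition_def by auto
 have U: "EX! y. y : (\<Pi>\<^sub>E l\<in>L. T l i) & x = (SUM l:L. y l)" if "i : verts Q" "x : rep_space I i" for i x
  using dec that unfolding indec_decomposition_def by simp
 have "rep_map I a ` T l (tail Q a) = T l (head Q a)" if a: "a : arcs Q" for a
 proof (intro equalityI subsetI)
  note t = tail_in_verts[OF a] and h = head_in_verts[OF a]
  fix y assume y: "y : T l (head Q a)"
  have yI: "y : rep_space I (head Q a)" using is_subrepD(3)[OF sub[OF l] h] y by blast
  have oa: "out_arcs Q (tail Q a) = {a}" using arc_unique[OF _ a] a by (auto simp: out_arcs_def)
  have "EX x:rep_space I (tail Q a). ALL a':out_arcs Q (tail Q a). rep_map I a' x = y"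
   using surjI[unfolded out_arcs_surjective_def, rule_format, OF t, of "%_. y"] oa yI by simp
  then obtain x where x: "x : rep_space I (tail Q a)" "rep_map I a x = y" using oa by blast
  obtain z where z: "z : (\<Pi>\<^sub>E l\<in>L. T l (tail Q a))" "x = (SUM l:L. z l)" using U[OF t x(1)] by blast
  have zT: "z l : T l (tail Q a)" if "l : L" for l using z(1) that by (auto simp: PiE_iff)
  have "y = (SUM l:L. rep_map I a (z l))"
   unfolding x(2)[symmetric] z(2)
   by (rule clinear_on_sum[OF rep_map_clinear[OF repI a] rep_subspace[OF repI t]]) (use zT is_subrepD(3)[OF sub t] in blast)
  then have "(\<lambda>l\<in>L. rep_map I a (z l)) : (\<Pi>\<^sub>E l\<in>L. T l (head Q a)) & y = (SUM l':L. (\<lambda>l\<in>L. rep_map I a (z l)) l')"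
   using is_subrepD(4)[OF sub a zT] by auto
  moreover have "(\<lambda>l'\<in>L. if l' = l then y else 0) : (\<Pi>\<^sub>E l\<in>L. T l (head Q a)) & y = (SUM l':L. (\<lambda>l'\<in>L. if l' = l then y else 0) l')"
   using fin l y cvec.subspace_0[OF is_subrepD(2)[OF sub h]] by auto
  ultimately have "(\<lambda>l\<in>L. rep_map I a (z l)) = (\<lambda>l'\<in>L. if l' = l then y else 0)" using U[OF h yI] by blast
  from fun_cong[OF this, of l] have "rep_map I a (z l) = y" using l by simp
  then show "y : rep_map I a ` T l (tail Q a)" using zT[OF l] by blast
 qed (use is_subrepD(4)[OF sub[OF l] a] in blast)
 then have "rep_map (subrep I (T l)) a ` rep_space (subrep I (T l)) (tail Q a) = rep_space (subrep I (T l)) (head Q a)" if "a : arcs Q" for a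
  using that by simp
 from string_of_surjective[OF ind this] obtain c q where "string_at (subrep I (T l)) (rep_space (subrep I (T l))) c" "1 <= q" "q <= n"
  "!!i. i : verts Q ==> c i ~= 0 \<longleftrightarrow> pos i <= q" by blast
 then show ?thesis unfolding string_at_def by (intro exI[of _ c] exI[of _ q]) auto
qed

lemma string_sum_exists:
 fixes K L :: "nat set"
 assumes P: "indec_decomposition Q P K S" and I: "indec_decomposition Q I L T"
 shows "EX b p c q rh. string_sum Q n pos P I r K S L T b p c q rh"
proof -
 have "ALL k:K. EX bp. string_at P (S k) (fst bp) & 1 <= snd bp & snd bp <= n & (ALL i:verts Q. fst bp i ~= 0 \<longleftrightarrow> snd bp <= pos i)"
  using projective_string[OF P] by simp
 from bchoice[OF this] obtain bp where bp: "ALL k:K. string_at P (S k) (fst (bp k)) & 1 <= snd (bp k) & snd (bp k) <= n &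
  (ALL i:verts Q. fst (bp k) i ~= 0 \<longleftrightarrow> snd (bp k) <= pos i)" by (rule exE)
 have "ALL l:L. EX cq. string_at I (T l) (fst cq) & 1 <= snd cq & snd cq <= n & (ALL i:verts Q. fst cq i ~= 0 \<longleftrightarrow> pos i <= snd cq)"
  using injective_string[OF I] by simp
 from bchoice[OF this] obtain cq where cq: "ALL l:L. string_at I (T l) (fst (cq l)) & 1 <= snd (cq l) & snd (cq l) <= n &
  (ALL i:verts Q. fst (cq l) i ~= 0 \<longleftrightarrow> pos i <= snd (cq l))" by (rule exE)
 let ?key = "case_sum (%k. n + snd (bp k)) (%l. snd (cq l))"
 have "finite (K <+> L)" using P I unfolding indec_decomposition_def by simp
 then obtain rh :: "nat + nat => nat" where rh: "inj_on rh (K <+> L)" "ALL mu:K <+> L. ALL kp:K <+> L. rh mu < rh kp --> ?key mu <= ?key kp"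
  using refine_to_injective[of _ ?key] by blast
 have "string_sum Q n pos P I r K S L T (%k. fst (bp k)) (%k. snd (bp k)) (%l. fst (cq l)) (%l. snd (cq l)) rh"
  by unfold_locales (use P I bp cq rh in auto)
 then show ?thesis by blast
qed

end

text \<open>Dimensions of quotients of \<open>P\<close> and of subrepresentations of
  \<open>I\<close> are bounded, so both components range over finite sets of classes.\<close>

lemma finite_admissible_pairs:
 fixes P :: "('v, 'e, 'a::complex_vector) rep" and I :: "('v, 'e, 'b::complex_vector) rep"
 assumes Q: "dynkin_quiver Q" and P: "is_rep Q P" and I: "is_rep Q I"
 shows "finite (admissible_pairs Q P I)"
proof -
 have fd: "fin_digraph Q" using Q unfolding dynkin_quiver_def by blast
 interpret fin_digraph Q by (rule fd)
 have fin: "finite (iso_classes Q d :: ('v, 'e, nat => complex) rep set set)" for d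
  by (rule finite_iso_classes[OF fd dynkin_indecomposable_unique[OF Q]])
 let ?A = "{iso_class Q M | M :: ('v, 'e, 'a) rep. is_rep Q M & (ALL i:verts Q. cvec.dim (rep_space M i) <= cvec.dim (rep_space P i))}"
 let ?B = "{iso_class Q M | M :: ('v, 'e, 'b) rep. is_rep Q M & (ALL i:verts Q. cvec.dim (rep_space M i) <= cvec.dim (rep_space I i))}"
 have "admissible_pairs Q P I <= ?A \<times> ?B"
 proof
  fix x assume "x : admissible_pairs Q P I"
  then obtain R V where x: "x = (iso_class Q R, iso_class Q (subrep I V))" and R: "is_rep Q R" "rep_epi Q P R ~= {}" and V: "is_subrep Q I V"
   unfolding admissible_pairs_def by blast
  obtain f where f: "f : rep_Hom Q P R" "!!i. i : verts Q ==> f i ` rep_space P i = rep_space R i"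
   using R(2) unfolding rep_epi_def by blast
  have "cvec.dim (rep_space R i) <= cvec.dim (rep_space P i)" if i: "i : verts Q" for i
   using clinear_on_rank_nullity[OF rep_fin_dim[OF P i] rep_HomD(2)[OF f(1) i]] f(2)[OF i] by simp
  then have "iso_class Q R : ?A" using R(1) by blast
  moreover have "cvec.dim (V i) <= cvec.dim (rep_space I i)" if i: "i : verts Q" for i
   by (rule cvec_dim_mono[OF rep_fin_dim[OF I i] is_subrepD(2,3)[OF V i]])
  then have "iso_class Q (subrep I V) : ?B" using is_rep_subrep[OF wf_digraph_axioms I V] by (intro CollectI exI[of _ "subrep I V"]) auto
  ultimately show "x : ?A \<times> ?B" unfolding x by blast
 qed
 moreover have "finite ?A" by (rule finite_iso_classes_bounded[OF fd fin])
 moreover have "finite ?B" by (rule finite_iso_classes_bounded[OF fd fin])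
 ultimately show ?thesis using finite_subset by blast
qed

theorem theorem1p3:
  fixes Q :: "('v, 'e) pre_digraph"
    and P :: "('v, 'e, 'a::complex_vector) rep"
    and I :: "('v, 'e, 'b::complex_vector) rep"
  assumes "dynkin_quiver Q"
    and "projective_rep Q P"
    and "injective_rep Q I"
  shows "let G = block_group Q P I;
             Gr = quiver_grass Q (rep_sum P I) (dim_vec_of P);
             Gr_var = quiver_grass_variety Q (rep_sum P I) (dim_vec_of P);
             act = grass_act Q Gr
         in
           subgroup (block_subgroup Q P I) (Aut_group Q (rep_sum P I)) \<and>
           group_action G Gr act \<and>
           finite (orbits G Gr act) \<and>
           (\<exists>\<Phi>. bij_betw \<Phi> (orbits G Gr act) (admissible_pairs Q P I) \<and>
              (\<forall>N\<in>Gr. \<Phi> (orbit G act N) = class_pair Q P I N)) \<and>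
           (equioriented_A Q \<longrightarrow>
              (\<forall>(K :: nat set) S (L :: nat set) T (w :: nat + nat \<Rightarrow> int).
                 indec_decomposition Q P K S \<longrightarrow> indec_decomposition Q I L T \<longrightarrow>
                 inj_on w (K <+> L) \<longrightarrow>
                   (let Fix = torus_fixed Q (K <+> L) (sum_summands Q S T) w Gr
                    in orbit G act ` Fix = orbits G Gr act \<and>
                       (multiplicity_free Q P K S \<longrightarrow> multiplicity_free Q I L T \<longrightarrow>
                          (\<forall>X\<in>orbits G Gr act. is_cell Gr_var X) \<and>
                          bij_betw (orbit G act) Fix (orbits G Gr act)))))"
proof -
 obtain m E f where "dynkin_digraph Q m E f" by (rule dynkin_quiver_imp_locale[OF assms(1)])
 then interpret D: dynkin_digraph Q m E f .
 obtain vs where "sinks_first Q vs" using D.sinks_first_exists by blast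
 then obtain r where r: "sink_rank Q r" by (rule sinks_first_sink_rank)
 interpret block_action Q P I r by unfold_locales (rule r assms)+
 have bij: "EX Ph. bij_betw Ph (orbits G Gr act) (admissible_pairs Q P I) &
   (ALL N:Gr. Ph (orbit G act N) = class_pair Q P I N)" by (rule orbits_bij_admissible_pairs)
 then have fin: "finite (orbits G Gr act)"
  using finite_admissible_pairs[OF assms(1) repP repI] bij_betw_finite by blast
 have A: "orbit G act ` Fix = orbits G Gr act &
   (multiplicity_free Q P K S --> multiplicity_free Q I L T -->
    (ALL X:orbits G Gr act. is_cell (quiver_grass_variety Q (rep_sum P I) (dim_vec_of P)) X) &
    bij_betw (orbit G act) Fix (orbits G Gr act))"
  if eq: "equioriented_A Q" and dec: "indec_decomposition Q P K S" "indec_decomposition Q I L T" and w: "inj_on w (K <+> L)"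
   and Fix: "Fix = torus_fixed Q (K <+> L) (sum_summands Q S T) w Gr"
  for K L :: "nat set" and S T and w :: "nat + nat => int" and Fix
 proof -
  obtain n and pos :: "'v => nat" where pos: "bij_betw pos (verts Q) {1..n}"
   "bij_betw (%a. (pos (tail Q a), pos (head Q a))) (arcs Q) {(k, k + 1) | k. 1 <= k & k < n}"
   using eq unfolding equioriented_A_def by blast
  interpret linear_block Q n pos P I r by unfold_locales (rule pos)+
  obtain b p c q rh where "string_sum Q n pos P I r K S L T b p c q rh" using string_sum_exists[OF dec] by blast
  then interpret s: string_sum Q n pos P I r K S L T b p c q rh .
  show ?thesis using s.fixed_orbits[OF w] unfolding Fix by blast
 qed
 show ?thesis
  unfolding Let_def
  by (rule conjI[OF subgroup_block_subgroup[OF wf repP repI] conjI[OF group_action_G conjI[OF fin conjI[OF bij]]]],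
   intro impI allI, rule A[OF _ _ _ _ refl], assumption+)
qed

end
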